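(* Fix $\varepsilon\in(0,1)$, $r_0\in(0,\tfrac23)$ and $\alpha\in[0,1)$. There is a number $a_0=a_0(r_0)>0$ such that for each $(\lambda,\mu)\in(0,a_0]^2$ the free boundary problem $(\mathrm P_{\varepsilon,\lambda,\mu})$ admits a solution $(u,v,\varphi)$ with $$u,v\in C^{2+\alpha}([-1,1]),\qquad \varphi\in W_2^2(\Omega_{u,v})\cap C(\overline{\Omega_{u,v}})\cap C^{2+\alpha}(\Omega_{u,v}\cup\Gamma_u\cup\Gamma_v),$$ such that $u$, $v$ and, for each fixed $z$, the function $x\mapsto\varphi(x,z)$ are even; $u$ and $-v$ are convex; $|\partial_x^2u(x)|\le r_0$ and $|\partial_x^2 v(x)|\le r_0$ for all $x\in[-1,1]$. Moreover, there is $\kappa_0\in(0,\tfrac13)$, independent of $\varepsilon$ (depending only on $r_0$), such that for all $x\in[-1,1]$ $$0\ge u(x)\ge -\tfrac13+\kappa_0\quad\text{and}\quad -\tfrac13-2\kappa_0\ge v(x)\ge -1,$$ and $\|u\|_{W^2_\infty(-1,1)}\le 3$, $\|v\|_{W^2_\infty(-1,1)}\le 3$.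
   Context: For functions $u,v\in W^2_\infty(-1,1)$ with $v<u$ on $[-1,1]$, let $\Omega_{u,v}=\{(x,z)\in(-1,1)\times\mathbb R:\ v(x)<z<u(x)\}$, $\Gamma_u=\{(x,u(x)):x\in(-1,1)\}$ and $\Gamma_v=\{(x,v(x)):x\in(-1,1)\}$. For $\varepsilon>0$ write $\nabla_\varepsilon=(\varepsilon\partial_x,\partial_z)$ and $\Delta_\varepsilon=\varepsilon^2\partial_x^2+\partial_z^2$. For parameters $\varepsilon,\lambda,\mu>0$, the problem $(\mathrm P_{\varepsilon,\lambda,\mu})$ consists in finding $(u,v,\varphi)$ with $u,v\in W^2_\infty(-1,1)$, $v<u$, and $\varphi$ on $\overline{\Omega_{u,v}}$ such that $\Delta_\varepsilon\varphi=0$ in $\Omega_{u,v}$; $\varphi(x,z)=\frac{z-v(x)}{u(x)-v(x)}$ on $\partial\Omega_{u,v}$; $\partial_x^2u(x)=\lambda\,|\nabla_\varepsilon\varphi(x,u(x))|^2$ for $x\in(-1,1)$; $\partial_x^2v(x)=-\mu\,|\nabla_\varepsilon\varphi(x,v(x))|^2$ for $x\in(-1,1)$; $u(\pm1)=0$; $v(\pm1)=-1$. *)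

theory Defs
  imports "HOL-Analysis.Analysis"
begin

definition Omega :: "(real \<Rightarrow> real) \<Rightarrow> (real \<Rightarrow> real) \<Rightarrow> (real \<times> real) set" where
  "Omega u v = {(x,z). -1 < x \<and> x < 1 \<and> v x < z \<and> z < u x}"

definition Gamma :: "(real \<Rightarrow> real) \<Rightarrow> (real \<times> real) set" where
  "Gamma w = {(x, w x) | x. -1 < x \<and> x < 1}"

definition pdir :: "bool \<Rightarrow> (real \<times> real \<Rightarrow> real) \<Rightarrow> real \<times> real \<Rightarrow> real" where
  "pdir d f = (\<lambda>p. if d then deriv (\<lambda>t. f (t, snd p)) (fst p)
                         else deriv (\<lambda>t. f (fst p, t)) (snd p))"

fun pd :: "bool list \<Rightarrow> (real \<times> real \<Rightarrow> real) \<Rightarrow> real \<times> real \<Rightarrow> real" where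
  "pd [] f = f"
| "pd (d # ds) f = pdir d (pd ds f)"

definition C2_on :: "(real \<times> real) set \<Rightarrow> (real \<times> real \<Rightarrow> real) \<Rightarrow> bool" where
  "C2_on U f \<longleftrightarrow> (\<forall>ds. length ds \<le> 1 \<longrightarrow> (\<forall>p\<in>U. pd ds f differentiable (at p)))
                 \<and> (\<forall>ds. length ds \<le> 2 \<longrightarrow> continuous_on U (pd ds f))"

definition smooth_fun :: "(real \<times> real \<Rightarrow> real) \<Rightarrow> bool" where
  "smooth_fun f \<longleftrightarrow> (\<forall>ds p. pd ds f differentiable (at p))"

definition test_fun :: "(real \<times> real) set \<Rightarrow> (real \<times> real \<Rightarrow> real) \<Rightarrow> bool" where
  "test_fun U \<psi> \<longleftrightarrow> smooth_fun \<psi> \<and> compact (closure {p. \<psi> p \<noteq> 0})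
                     \<and> closure {p. \<psi> p \<noteq> 0} \<subseteq> U"

definition weak_pd :: "(real \<times> real) set \<Rightarrow> bool list \<Rightarrow> (real \<times> real \<Rightarrow> real) \<Rightarrow> (real \<times> real \<Rightarrow> real) \<Rightarrow> bool" where
  "weak_pd U ds f g \<longleftrightarrow> (\<forall>\<psi>. test_fun U \<psi> \<longrightarrow>
      set_integrable lborel U (\<lambda>p. f p * pd ds \<psi> p) \<and>
      set_integrable lborel U (\<lambda>p. g p * \<psi> p) \<and>
      (LINT p:U|lborel. f p * pd ds \<psi> p) = (-1) ^ length ds * (LINT p:U|lborel. g p * \<psi> p))"

definition L2_on :: "(real \<times> real) set \<Rightarrow> (real \<times> real \<Rightarrow> real) \<Rightarrow> bool" where
  "L2_on U f \<longleftrightarrow> set_borel_measurable lborel U f \<and> set_integrable lborel U (\<lambda>p. (f p)\<^sup>2)"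

definition W22 :: "(real \<times> real) set \<Rightarrow> (real \<times> real \<Rightarrow> real) \<Rightarrow> bool" where
  "W22 U f \<longleftrightarrow> L2_on U f \<and> (\<forall>ds. length ds \<le> 2 \<longrightarrow> (\<exists>g. L2_on U g \<and> weak_pd U ds f g))"

text \<open>C^{2+\<alpha>}(S) for U open, U \<subseteq> S \<subseteq> closure U: f is C^2 in U, all derivatives up
  to order 2 extend continuously to S, and second derivatives are \<alpha>-Hoelder on compact
  subsets of S (local Hoelder regularity up to the boundary part S - U).\<close>
definition C2alpha_upto :: "real \<Rightarrow> (real \<times> real) set \<Rightarrow> (real \<times> real) set \<Rightarrow> (real \<times> real \<Rightarrow> real) \<Rightarrow> bool" where
  "C2alpha_upto \<alpha> U S f \<longleftrightarrow> C2_on U f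
     \<and> (\<forall>ds. length ds \<le> 2 \<longrightarrow> (\<exists>g. continuous_on S g \<and> (\<forall>p\<in>U. g p = pd ds f p)))
     \<and> (\<forall>K. compact K \<and> K \<subseteq> S \<longrightarrow> (\<exists>C. \<forall>ds. length ds = 2 \<longrightarrow>
          (\<forall>p\<in>K \<inter> U. \<forall>q\<in>K \<inter> U. \<bar>pd ds f p - pd ds f q\<bar> \<le> C * dist p q powr \<alpha>)))"

definition bpdir :: "bool \<Rightarrow> (real \<times> real) set \<Rightarrow> (real \<times> real \<Rightarrow> real) \<Rightarrow> real \<times> real \<Rightarrow> real" where
  "bpdir d U f p = Lim (at p within U) (pdir d f)"

definition D1 :: "(real \<Rightarrow> real) \<Rightarrow> real \<Rightarrow> real" where
  "D1 u x = vector_derivative u (at x within {-1..1})"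

definition D2 :: "(real \<Rightarrow> real) \<Rightarrow> real \<Rightarrow> real" where
  "D2 u x = D1 (D1 u) x"

definition C2alpha_I :: "real \<Rightarrow> (real \<Rightarrow> real) \<Rightarrow> bool" where
  "C2alpha_I \<alpha> u \<longleftrightarrow>
     (\<forall>x\<in>{-1..1}. u differentiable (at x within {-1..1}) \<and> D1 u differentiable (at x within {-1..1}))
     \<and> continuous_on {-1..1} (D2 u)
     \<and> (\<exists>C. \<forall>x\<in>{-1..1}. \<forall>y\<in>{-1..1}. \<bar>D2 u x - D2 u y\<bar> \<le> C * \<bar>x - y\<bar> powr \<alpha>)"

text \<open>W^2_\<infinity>(-1,1) norm (sum convention), for C^2 functions where the weak derivatives are
  the classical ones and the essential supremum is the supremum.\<close>
definition W2inf_norm :: "(real \<Rightarrow> real) \<Rightarrow> real" where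
  "W2inf_norm u = (SUP x\<in>{-1<..<1}. \<bar>u x\<bar>) + (SUP x\<in>{-1<..<1}. \<bar>D1 u x\<bar>)
                  + (SUP x\<in>{-1<..<1}. \<bar>D2 u x\<bar>)"

text \<open>The free boundary problem (P_{\<epsilon>,\<lambda>,\<mu>}), for u,v of class C^2 on [-1,1] and
  \<phi> of class C^2 in \<Omega> with gradient extending to \<Gamma>_u, \<Gamma>_v.\<close>
definition solves_P :: "real \<Rightarrow> real \<Rightarrow> real \<Rightarrow> (real \<Rightarrow> real) \<Rightarrow> (real \<Rightarrow> real) \<Rightarrow> (real \<times> real \<Rightarrow> real) \<Rightarrow> bool" where
  "solves_P \<epsilon> lam mu u v \<phi> \<longleftrightarrow>
     (\<forall>x\<in>{-1..1}. v x < u x)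
     \<and> (\<forall>p\<in>Omega u v. \<epsilon>\<^sup>2 * pd [True, True] \<phi> p + pd [False, False] \<phi> p = 0)
     \<and> (\<forall>p\<in>frontier (Omega u v). \<phi> p = (snd p - v (fst p)) / (u (fst p) - v (fst p)))
     \<and> (\<forall>x\<in>{-1<..<1}. D2 u x = lam * ((\<epsilon> * bpdir True (Omega u v) \<phi> (x, u x))\<^sup>2
                                          + (bpdir False (Omega u v) \<phi> (x, u x))\<^sup>2))
     \<and> (\<forall>x\<in>{-1<..<1}. D2 v x = - mu * ((\<epsilon> * bpdir True (Omega u v) \<phi> (x, v x))\<^sup>2
                                          + (bpdir False (Omega u v) \<phi> (x, v x))\<^sup>2))
     \<and> u (-1) = 0 \<and> u 1 = 0 \<and> v (-1) = -1 \<and> v 1 = -1"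

end

theory Submission
 imports Defs "HOL-Complex_Analysis.Complex_Analysis"
begin

text \<open>
 Put L = 1/eps. After the substitution X = x/eps the potential is the real part of a holomorphic
 function h on the cell between two graphs over (-L, L). For profiles whose second derivative is
 bounded by K = eps^2 r0 one has K L^2 = r0 < 2/3, so the gap between the graphs stays above 1/3,
 and explicit quadratic barriers bound |h'|^2 by 270 on both graphs, uniformly in eps. Hence for
 lam, mu at most r0/270 the truncated condition U'' = min K (eps^2 lam |h'|^2) is equivalent to the
 original one. The truncated problem is solved by Brouwer's theorem for finitely many curvature
 parameters, followed by a limit.

 Regularity comes from the maximum principle. Comparing difference quotients along the tangent at
 a boundary point with Re (zeta powr beta) gives |h''| <= C d powr (beta - 1), where d is the
 distance to the graph, up to the corners. This makes h' Hoelder continuous up to the graphs and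
 h'' square integrable. Since the curvature is then Hoelder continuous, comparison with
 Re (zeta - zeta powr (3/2)) bounds h'' locally up to the graphs, and a second round of difference
 quotients bounds the third derivative by C d powr (beta - 1).
\<close>


section \<open>Maximum principle and gradient bounds\<close>

text \<open>A potential is described by inequalities that measure how fast it approaches its
  boundary data. By the maximum principle they determine its real part and give stability: moving
  both graphs by at most delta changes it by at most 27/2 * delta. For existence, the Riemann map
  carries the datum to the disc, where real parts of entire functions approximate it. The truncation
  confines the unknown curvatures to a fixed cube and keeps every intermediate cell wide enough for
  the uniform bounds. The curvatures are driven by gradients sampled slightly inside the cell,
  because interior derivatives depend continuously on the profiles; Hoelder bounds for h' with
  constants common to all cells turn the samples into boundary traces in the limit. The corners are
  the obstacle to regularity. Convexity of the graphs makes the angles there at most right angles,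
  so that harmonic barriers of every order below 2 are available. Evenness and the reflection that
  turns the cell upside down reduce all boundary estimates to the right half of the upper
  graph.\<close>

definition laplacian_at :: "(complex => real) => complex => real => bool" where
 "laplacian_at g w l \<longleftrightarrow> (\<exists>a b g1 g2.
   (\<forall>\<^sub>F t in nhds 0. ((\<lambda>t. g (w + of_real t)) has_real_derivative g1 t) (at t)) &
   (g1 has_real_derivative a) (at 0) &
   (\<forall>\<^sub>F t in nhds 0. ((\<lambda>t. g (w + \<i> * of_real t)) has_real_derivative g2 t) (at t)) &
   (g2 has_real_derivative b) (at 0) & l = a + b)"

lemma laplacian_at_add:
 assumes "laplacian_at f w k" "laplacian_at g w l"
 shows "laplacian_at (\<lambda>w. f w + g w) w (k + l)"
proof -
 from assms(1) obtain a b f1 f2 where f: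
  "\<forall>\<^sub>F t in nhds 0. ((\<lambda>t. f (w + of_real t)) has_real_derivative f1 t) (at t)"
  "(f1 has_real_derivative a) (at 0)"
  "\<forall>\<^sub>F t in nhds 0. ((\<lambda>t. f (w + \<i> * of_real t)) has_real_derivative f2 t) (at t)"
  "(f2 has_real_derivative b) (at 0)" "k = a + b"
  unfolding laplacian_at_def by blast
 from assms(2) obtain c d g1 g2 where g:
  "\<forall>\<^sub>F t in nhds 0. ((\<lambda>t. g (w + of_real t)) has_real_derivative g1 t) (at t)"
  "(g1 has_real_derivative c) (at 0)"
  "\<forall>\<^sub>F t in nhds 0. ((\<lambda>t. g (w + \<i> * of_real t)) has_real_derivative g2 t) (at t)"
  "(g2 has_real_derivative d) (at 0)" "l = c + d"
  unfolding laplacian_at_def by blast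
 have "\<forall>\<^sub>F t in nhds 0. ((\<lambda>t. f (w + of_real t) + g (w + of_real t)) has_real_derivative f1 t + g1 t) (at t)"
  using f(1) g(1) by eventually_elim (auto intro!: derivative_intros)
 moreover have "\<forall>\<^sub>F t in nhds 0. ((\<lambda>t. f (w + \<i> * of_real t) + g (w + \<i> * of_real t)) has_real_derivative f2 t + g2 t) (at t)"
  using f(3) g(3) by eventually_elim (auto intro!: derivative_intros)
 moreover have "((\<lambda>t. f1 t + g1 t) has_real_derivative a + c) (at 0)"
  "((\<lambda>t. f2 t + g2 t) has_real_derivative b + d) (at 0)"
  using f g by (auto intro!: derivative_intros)
 moreover have "k + l = (a + c) + (b + d)" using f g by simp
 ultimately show ?thesis unfolding laplacian_at_def by (intro exI conjI)
qed

lemma laplacian_at_cmult: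
 assumes "laplacian_at f w k"
 shows "laplacian_at (\<lambda>w. c * f w) w (c * k)"
proof -
 from assms(1) obtain a b f1 f2 where f:
  "\<forall>\<^sub>F t in nhds 0. ((\<lambda>t. f (w + of_real t)) has_real_derivative f1 t) (at t)"
  "(f1 has_real_derivative a) (at 0)"
  "\<forall>\<^sub>F t in nhds 0. ((\<lambda>t. f (w + \<i> * of_real t)) has_real_derivative f2 t) (at t)"
  "(f2 has_real_derivative b) (at 0)" "k = a + b"
  unfolding laplacian_at_def by blast
 have "\<forall>\<^sub>F t in nhds 0. ((\<lambda>t. c * f (w + of_real t)) has_real_derivative c * f1 t) (at t)"
  using f(1) by eventually_elim (auto intro!: derivative_eq_intros)
 moreover have "\<forall>\<^sub>F t in nhds 0. ((\<lambda>t. c * f (w + \<i> * of_real t)) has_real_derivative c * f2 t) (at t)"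
  using f(3) by eventually_elim (auto intro!: derivative_eq_intros)
 moreover have "((\<lambda>t. c * f1 t) has_real_derivative c * a) (at 0)"
  "((\<lambda>t. c * f2 t) has_real_derivative c * b) (at 0)"
  using f by (auto intro!: derivative_eq_intros)
 moreover have "c * k = c * a + c * b" using f by (simp add: algebra_simps)
 ultimately show ?thesis unfolding laplacian_at_def by (intro exI conjI)
qed

lemma has_real_derivative_Re_line:
 assumes "(f has_field_derivative D) (at (w + c * of_real t))"
 shows "((\<lambda>t. Re (f (w + c * of_real t))) has_real_derivative Re (c * D)) (at t)"
proof -
 have "((\<lambda>t. w + c * of_real t) has_vector_derivative c) (at t)"
  by (auto intro!: derivative_eq_intros)
 then have "((f \<circ> (\<lambda>t. w + c * of_real t)) has_vector_derivative c * D) (at t)"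
  by (rule field_vector_diff_chain_at) (use assms in auto)
 from bounded_linear.has_vector_derivative[OF bounded_linear_Re this] show ?thesis
  by (simp add: o_def has_real_derivative_iff_has_vector_derivative)
qed

text \<open>The second derivative of Re f in the direction c is Re (c^2 f''), and the directions 1
  and \<i> have squares 1 and -1.\<close>

lemma laplacian_at_Re:
 assumes "f holomorphic_on S" "open S" "w \<in> S"
 shows "laplacian_at (\<lambda>w. Re (f w)) w 0"
proof -
 have ev: "\<forall>\<^sub>F t in nhds 0. w + c * of_real t \<in> S" for c
 proof -
  have "((\<lambda>t. w + c * of_real t) \<longlongrightarrow> w + c * of_real 0) (nhds 0)"
   by (intro tendsto_intros filterlim_ident)
  then show ?thesis using assms(2,3) by (auto simp: tendsto_def)
 qed
 have d1: "(f has_field_derivative deriv f x) (at x)" if "x \<in> S" for x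
  using assms that by (simp add: holomorphic_derivI)
 have d2: "(deriv f has_field_derivative deriv (deriv f) w) (at w)"
  using assms by (intro holomorphic_derivI[of _ S]) (auto intro: holomorphic_deriv)
 have "\<forall>\<^sub>F t in nhds 0. ((\<lambda>t. Re (f (w + c * of_real t))) has_real_derivative Re (c * deriv f (w + c * of_real t))) (at t)" for c
  using ev[of c] by eventually_elim (rule has_real_derivative_Re_line, rule d1)
 note E = this[of 1] this[of \<i>]
 have "((\<lambda>x. c * deriv f x) has_field_derivative (c * deriv (deriv f) w)) (at (w + c * of_real 0))" for c
  using DERIV_cmult[OF d2, of c] by simp
 from has_real_derivative_Re_line[OF this] 
 have F: "((\<lambda>t. Re (c * deriv f (w + c * of_real t))) has_real_derivative Re (c * (c * deriv (deriv f) w))) (at 0)" for c .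
 have "0 = Re (1 * (1 * deriv (deriv f) w)) + Re (\<i> * (\<i> * deriv (deriv f) w))" by simp
 with E F[of 1] F[of \<i>] show ?thesis unfolding laplacian_at_def mult_1
  by (intro exI conjI)
qed

text \<open>The first derivative vanishes at 0, so a positive second derivative would make it
  positive just to the right, and f would exceed f 0 there.\<close>

lemma second_derivative_nonpos_at_max:
 fixes f :: "real => real"
 assumes "\<forall>\<^sub>F t in nhds 0. (f has_real_derivative g t) (at t)"
  and "(g has_real_derivative a) (at 0)"
  and "\<forall>\<^sub>F t in nhds 0. f t <= f 0"
 shows "a <= 0"
proof (rule ccontr)
 assume "\<not> a <= 0"
 then have a: "a > 0" by simp
 from assms(1,3) have "\<forall>\<^sub>F t in nhds 0. (f has_real_derivative g t) (at t) & f t <= f 0"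
  by eventually_elim auto
 then obtain d where d: "d > 0" "\<And>t. dist t 0 < d ==> (f has_real_derivative g t) (at t) & f t <= f 0"
  unfolding eventually_nhds_metric by blast
 have "g 0 = 0"
  by (rule DERIV_local_max[of f "g 0" 0 d]) (use d in auto)
 from DERIV_pos_inc_right[OF assms(2) a] obtain e where e: "e > 0" "\<And>h. h > 0 ==> h < e ==> g 0 < g h"
  by auto
 define t where "t = min d e / 2"
 have t: "t > 0" "t < d" "t < e" using d e by (auto simp: t_def)
 obtain z where z: "0 < z" "z < t" "f t - f 0 = (t - 0) * g z"
  using MVT2[of 0 t f g] t d by force
 have "g z > 0" using e z t \<open>g 0 = 0\<close> by force
 then have "f t - f 0 > 0" using z t by simp
 with d(2)[of t] t show False by auto
qed

text \<open>Boundary values enter only through majorants \<open>m\<close>, one for each frontier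
  point, continuous at that point and nonpositive there. A superlevel set at a positive value is
  therefore closed: a limit point on the frontier would force \<open>m\<close> to be positive. So a
  maximum is attained inside, where both pure second derivatives are nonpositive.\<close>

theorem maximum_principle_strict:
 fixes g :: "complex => real"
 assumes S: "open S" "bounded S" and cont: "continuous_on S g"
  and lap: "\<And>w. w \<in> S ==> \<exists>l>0. laplacian_at g w l"
  and bd: "\<And>x. x \<in> frontier S ==> \<exists>m. isCont m x & m x <= (0::real) & (\<forall>w\<in>S. g w <= m w)"
  and w: "w \<in> S"
 shows "g w <= 0"
proof (rule ccontr)
 assume "\<not> g w <= 0"
 then have pos: "g w > 0" by simp
 define C where "C = {x \<in> S. g x >= g w}"
 have "closed C"
 proof (subst closed_sequential_limits, safe)
  fix X l assume X: "\<forall>n. X n \<in> C" "X \<longlonglongrightarrow> l"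
  have XS: "X n \<in> S" "g (X n) >= g w" for n using X(1) by (auto simp: C_def)
  show "l \<in> C"
  proof (cases "l \<in> S")
   case True
   then have "isCont g l" using cont S by (simp add: continuous_on_eq_continuous_at)
   then have "(\<lambda>n. g (X n)) \<longlonglongrightarrow> g l" using X(2) by (simp add: isCont_tendsto_compose)
   then have "g l >= g w" using XS(2) by (intro LIMSEQ_le_const) auto
   then show ?thesis using True by (simp add: C_def)
  next
   case False
   have "l \<in> closure S" using XS X(2) closure_sequential by blast
   then have "l \<in> frontier S" using False S by (simp add: frontier_def interior_open)
   then obtain m where m: "isCont m l" "m l <= 0" "\<And>w. w \<in> S ==> g w <= m w" using bd by blast
   have "(\<lambda>n. m (X n)) \<longlonglongrightarrow> m l" using X(2) m(1) by (simp add: isCont_tendsto_compose)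
   moreover have "m (X n) >= g w" for n using XS[of n] m(3)[of "X n"] by linarith
   ultimately have "m l >= g w" by (intro LIMSEQ_le_const) auto
   with m(2) pos show ?thesis by simp
  qed
 qed
 moreover have "bounded C" using S(2) by (rule bounded_subset) (auto simp: C_def)
 ultimately have "compact C" by (simp add: compact_eq_bounded_closed)
 moreover have "C \<noteq> {}" using w by (auto simp: C_def)
 moreover have "continuous_on C g" using cont by (rule continuous_on_subset) (auto simp: C_def)
 ultimately obtain x where x: "x \<in> C" "\<And>y. y \<in> C ==> g y <= g x"
  using continuous_attains_sup by metis
 have xS: "x \<in> S" using x by (simp add: C_def)
 have mx: "g y <= g x" if "y \<in> S" for y
 proof (cases "y \<in> C")
  case False then show ?thesis using that x(1) by (auto simp: C_def)
 qed (use x in auto)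
 obtain l where l: "l > 0" "laplacian_at g x l" using lap[OF xS] by blast
 then obtain a b g1 g2 where f:
  "\<forall>\<^sub>F t in nhds 0. ((\<lambda>t. g (x + of_real t)) has_real_derivative g1 t) (at t)"
  "(g1 has_real_derivative a) (at 0)"
  "\<forall>\<^sub>F t in nhds 0. ((\<lambda>t. g (x + \<i> * of_real t)) has_real_derivative g2 t) (at t)"
  "(g2 has_real_derivative b) (at 0)" "l = a + b"
  unfolding laplacian_at_def by blast
 have ev: "\<forall>\<^sub>F t in nhds 0. g (x + c * of_real t) <= g (x + c * of_real 0)" for c
 proof -
  have "((\<lambda>t. x + c * of_real t) \<longlongrightarrow> x + c * of_real 0) (nhds 0)"
   by (intro tendsto_intros filterlim_ident)
  then have "\<forall>\<^sub>F t in nhds 0. x + c * of_real t \<in> S" using S xS by (auto simp: tendsto_def)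
  then show ?thesis by eventually_elim (use mx in simp)
 qed
 have "a <= 0" by (rule second_derivative_nonpos_at_max[OF f(1,2)]) (use ev[of 1] in simp)
 moreover have "b <= 0" by (rule second_derivative_nonpos_at_max[OF f(3,4)]) (use ev[of \<i>] in simp)
 ultimately show False using l f by simp
qed

lemma laplacian_at_Re_square: "laplacian_at (\<lambda>w. (Re w)\<^sup>2) w 2"
 unfolding laplacian_at_def
proof (intro exI conjI)
 show "\<forall>\<^sub>F t in nhds 0. ((\<lambda>t. (Re (w + complex_of_real t))\<^sup>2) has_real_derivative 2 * (Re w + t)) (at t)"
  by (auto intro!: always_eventually derivative_eq_intros)
 show "((\<lambda>t. 2 * (Re w + t)) has_real_derivative 2) (at 0)" by (auto intro!: derivative_eq_intros)
 show "\<forall>\<^sub>F t in nhds 0. ((\<lambda>t. (Re (w + \<i> * complex_of_real t))\<^sup>2) has_real_derivative (\<lambda>_. 0) t) (at t)"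
  by (auto intro!: always_eventually derivative_eq_intros)
 show "((\<lambda>_. 0) has_real_derivative 0) (at 0)" by simp
qed simp

text \<open>The perturbation \<open>e * ((Re w)\<^sup>2 - B\<^sup>2)\<close> is nonpositive on the
  set and has Laplacian \<open>2 * e\<close>; e tends to 0 at the end.\<close>

theorem maximum_principle:
 fixes g :: "complex => real"
 assumes S: "open S" "bounded S" and cont: "continuous_on S g"
  and lap: "\<And>w. w \<in> S ==> \<exists>l\<ge>0. laplacian_at g w l"
  and bd: "\<And>x. x \<in> frontier S ==> \<exists>m. isCont m x & m x <= (0::real) & (\<forall>w\<in>S. g w <= m w)"
  and w: "w \<in> S"
 shows "g w <= 0"
proof -
 obtain B where B: "\<And>x. x \<in> S ==> cmod x <= B" using S(2) by (auto simp: bounded_iff)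
 have B2: "(Re x)\<^sup>2 <= B\<^sup>2" if "x \<in> S" for x
  using B[OF that] abs_Re_le_cmod[of x] by (intro abs_le_square_iff[THEN iffD1]) auto
 have main: "g w + e * ((Re w)\<^sup>2 - B\<^sup>2) <= 0" if e: "e > 0" for e
 proof (rule maximum_principle_strict[OF S, where g = "\<lambda>w. g w + e * ((Re w)\<^sup>2 - B\<^sup>2)"])
  show "continuous_on S (\<lambda>w. g w + e * ((Re w)\<^sup>2 - B\<^sup>2))" by (intro continuous_intros cont)
  fix x assume x: "x \<in> S"
  obtain l where l: "l >= 0" "laplacian_at g x l" using lap[OF x] by blast
  have "laplacian_at (\<lambda>w. (\<lambda>_. Re (-(of_real (B\<^sup>2)))) w + (Re w)\<^sup>2) x (0 + 2)"
   by (rule laplacian_at_add[OF laplacian_at_Re[of _ UNIV] laplacian_at_Re_square]) auto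
  from laplacian_at_add[OF l(2) laplacian_at_cmult[OF this, of e]]
  have "laplacian_at (\<lambda>w. g w + e * ((Re w)\<^sup>2 - B\<^sup>2)) x (l + e * 2)" by (simp add: algebra_simps)
  then show "\<exists>l>0. laplacian_at (\<lambda>w. g w + e * ((Re w)\<^sup>2 - B\<^sup>2)) x l"
   using l e by (intro exI[of _ "l + e * 2"]) auto
 next
  fix x assume x: "x \<in> frontier S"
  obtain m where m: "isCont m x" "m x <= 0" "\<And>w. w \<in> S ==> g w <= m w" using bd[OF x] by blast
  have "g w + e * ((Re w)\<^sup>2 - B\<^sup>2) <= m w" if "w \<in> S" for w
   using m(3)[OF that] B2[OF that] e by (smt (verit) mult_nonneg_nonpos)
  then show "\<exists>m. isCont m x & m x <= 0 & (\<forall>w\<in>S. g w + e * ((Re w)\<^sup>2 - B\<^sup>2) <= m w)"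
   using m by blast
 qed (rule w)
 have "(\<lambda>n. g w + (1 / real (Suc n)) * ((Re w)\<^sup>2 - B\<^sup>2)) \<longlonglongrightarrow> g w + 0 * ((Re w)\<^sup>2 - B\<^sup>2)"
  by (intro tendsto_intros LIMSEQ_Suc[OF lim_1_over_n])
 then have "g w + 0 * ((Re w)\<^sup>2 - B\<^sup>2) <= 0"
  by (rule LIMSEQ_le_const2) (intro exI allI impI main, simp)
 then show ?thesis by simp
qed

corollary maximum_principle_Re:
 assumes S: "open S" "bounded S" and f: "f holomorphic_on S"
  and bd: "\<And>x. x \<in> frontier S ==> \<exists>m. isCont m x & m x <= (0::real) & (\<forall>w\<in>S. Re (f w) <= m w)"
  and w: "w \<in> S"
 shows "Re (f w) <= 0"
proof (rule maximum_principle[OF S _ _ bd w])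
 show "continuous_on S (\<lambda>w. Re (f w))"
  using f by (intro continuous_intros) (rule holomorphic_on_imp_continuous_on)
qed (use laplacian_at_Re[OF f S(1)] in auto)


text \<open>The function exp ((f - c) / N) has modulus between 1/e and e. Cauchy's inequality bounds
  its derivative by e / s, and dividing by the modulus costs another factor e. The 8 is an upper
  bound for e^2.\<close>

lemma norm_deriv_le_Re_bound:
 assumes f: "f holomorphic_on ball w r" and r: "r > 0" and M: "\<And>x. x \<in> ball w r ==> \<bar>Re (f x) - c\<bar> <= M"
 shows "cmod (deriv f w) <= 8 * M / r"
proof -
 have M0: "M >= 0" using M[of w] r by fastforce
 \<comment> \<open>Strictness in \<open>N > M\<close> makes N positive even if M = 0, and
   \<open>s < r\<close> puts the closed disc into the domain. The limit values M and r are reached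
   at the end.\<close>
 have step: "cmod (deriv f w) <= 8 * N / s" if N: "N > M" and s: "0 < s" "s < r" for N s
 proof -
  have Npos: "N > 0" using M0 N by simp
  define g where "g = (\<lambda>x. exp ((f x - of_real c) / of_real N))"
  have sub: "cball w s \<subseteq> ball w r" using s by auto
  have holg: "g holomorphic_on ball w r" unfolding g_def using Npos by (intro holomorphic_intros f) auto
  have nb: "cmod (g x) <= exp 1" "cmod (g x) >= exp (-1)" if "x \<in> ball w r" for x
  proof -
   have "cmod (g x) = exp ((Re (f x) - c) / N)" by (simp add: g_def norm_exp_eq_Re)
   moreover have "(Re (f x) - c) / N <= 1" "-1 <= (Re (f x) - c) / N"
    using M[OF that] N Npos by (auto simp: field_simps)
   ultimately show "cmod (g x) <= exp 1" "cmod (g x) >= exp (-1)" by (auto simp: abs_le_iff)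
  qed
  have "cmod ((deriv ^^ 1) g w) <= fact 1 * exp 1 / s ^ 1"
  proof (rule Cauchy_inequality)
   show "g holomorphic_on ball w s" using holg by (rule holomorphic_on_subset) (use s in auto)
   show "continuous_on (cball w s) g"
    using holg sub by (meson continuous_on_subset holomorphic_on_imp_continuous_on)
   fix x assume "cmod (w - x) = s"
   then show "cmod (g x) <= exp 1" using s by (intro nb) (auto simp: dist_norm)
  qed (use s in auto)
  then have A: "cmod (deriv g w) <= exp 1 / s" by simp
  have "(f has_field_derivative deriv f w) (at w)"
   using f r by (intro holomorphic_derivI[of _ "ball w r"]) auto
  then have "(g has_field_derivative (g w * (deriv f w / of_real N))) (at w)"
   unfolding g_def using Npos by (auto intro!: derivative_eq_intros)
  then have "deriv g w = g w * (deriv f w / of_real N)" by (rule DERIV_imp_deriv)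
  then have "cmod (deriv g w) = cmod (g w) * (cmod (deriv f w) / N)" using Npos by (simp add: norm_mult norm_divide)
  moreover have "cmod (g w) * (cmod (deriv f w) / N) >= exp (-1) * (cmod (deriv f w) / N)"
   using nb(2)[of w] r Npos by (intro mult_right_mono) auto
  ultimately have "exp (-1) * (cmod (deriv f w) / N) <= exp 1 / s" using A by simp
  then have "exp 1 * (exp (-1) * (cmod (deriv f w) / N)) <= exp 1 * (exp 1 / s)"
   by (intro mult_left_mono) auto
  also have "exp 1 * (exp (-1) * (cmod (deriv f w) / N)) = cmod (deriv f w) / N"
   unfolding mult.assoc[symmetric] mult_exp_exp by simp
  also have "exp 1 * (exp 1 / s) = (exp 1)\<^sup>2 / s" by (simp add: power2_eq_square)
  finally have "cmod (deriv f w) / N <= (exp 1)\<^sup>2 / s" .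
  also have "\<dots> <= 8 / s"
  proof -
   have "exp (1::real) < 28/10" using e_less_272 by simp
   then have "(exp (1::real))\<^sup>2 <= (28/10)\<^sup>2" by (intro power_mono) auto
   then show ?thesis using s by (intro divide_right_mono) (auto simp: power2_eq_square)
  qed
  finally show ?thesis using Npos s by (simp add: field_simps)
 qed
 define X where "X = (\<lambda>n. 8 * (M + 1 / real (Suc n)) / (r - r / 2 * (1 / real (Suc n))))"
 have "X \<longlonglongrightarrow> 8 * (M + 0) / (r - r / 2 * 0)" unfolding X_def
  using r by (intro tendsto_intros LIMSEQ_Suc[OF lim_1_over_n]) auto
 moreover have "cmod (deriv f w) <= X n" for n
  unfolding X_def
 proof (rule step)
  define y where "y = 1 / real (Suc n)"
  have y: "y > 0" "y <= 1" by (auto simp: y_def)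
  have "r / 2 * y > 0" using r y by simp
  moreover have "r / 2 * y <= r / 2 * 1" using r y by (intro mult_left_mono) auto
  ultimately show "M < M + 1 / real (Suc n)" "0 < r - r / 2 * (1 / real (Suc n))" "r - r / 2 * (1 / real (Suc n)) < r"
   unfolding y_def[symmetric] using r y by linarith+
 qed
 ultimately have "cmod (deriv f w) <= 8 * (M + 0) / (r - r / 2 * 0)"
  by (intro LIMSEQ_le_const) auto
 then show ?thesis by simp
qed

text \<open>Two applications with half the radius: |f'| is at most 16 * M / r on the smaller ball,
  and 8 * (16 * M / r) / (r / 2) is the claim.\<close>

lemma norm_deriv_deriv_le_Re_bound:
 assumes f: "f holomorphic_on ball w r" and r: "r > 0" and M: "\<And>x. x \<in> ball w r ==> \<bar>Re (f x) - c\<bar> <= M"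
 shows "cmod (deriv (deriv f) w) <= 256 * M / r\<^sup>2"
proof -
 have "cmod (deriv (deriv f) w) <= 8 * (16 * M / r) / (r / 2)"
 proof (rule norm_deriv_le_Re_bound[where c = 0])
  show "deriv f holomorphic_on ball w (r / 2)"
   using holomorphic_deriv[OF f open_ball] by (rule holomorphic_on_subset) (use r in auto)
  fix x assume x: "x \<in> ball w (r / 2)"
  have sub: "ball x (r / 2) \<subseteq> ball w r"
  proof
   fix y assume "y \<in> ball x (r / 2)"
   then show "y \<in> ball w r" using x dist_triangle[of w y x] by auto
  qed
  have "cmod (deriv f x) <= 8 * M / (r / 2)"
   by (rule norm_deriv_le_Re_bound[where c = c])
    (use f r M sub in \<open>auto intro: holomorphic_on_subset\<close>)
  then show "\<bar>Re (deriv f x) - 0\<bar> <= 16 * M / r"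
   using abs_Re_le_cmod[of "deriv f x"] by simp
 qed (use r in auto)
 then show ?thesis by (simp add: power2_eq_square field_simps)
qed

section \<open>Cells\<close>

text \<open>An even convex graph with curvature between 0 and K, in weak form. The slope
  \<open>p\<close> is carried along explicitly, and all conditions refer to the whole line, so that
  the ends of [-L, L] are ordinary points.\<close>

definition profile :: "real => real => (real => real) => (real => real) => bool" where
 "profile L K U p \<longleftrightarrow> (\<forall>x. p (-x) = - p x) & (\<forall>x y. x <= y --> p x <= p y & p y - p x <= K * (y - x))
   & (\<forall>x. (U has_real_derivative p x) (at x)) & U L = 0"

text \<open>The lower graph is written as -1 - W. Both boundaries are then profiles of the same
  kind, and the reflection taking w to cnj w - \<i> exchanges their roles.\<close>

definition cellD :: "real => (real => real) => (real => real) => complex set" where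
 "cellD L U W = {w. \<bar>Re w\<bar> < L & - 1 - W (Re w) < Im w & Im w < U (Re w)}"

text \<open>Together with L >= 1 the bound on K * L^2 also yields slopes of at most 2/3 over [-L, L]
  and K <= 2/3. The latter is what makes the quadratic barriers superharmonic.\<close>

locale cell_top =
 fixes L K :: real and U p :: "real => real"
 assumes L: "1 <= L" and K: "0 <= K" and KL: "K * L\<^sup>2 <= 2/3" and prof: "profile L K U p"
begin

lemma p_odd: "p (-x) = - p x" and p_mono: "x <= y ==> p x <= p y"
 and p_lip: "x <= y ==> p y - p x <= K * (y - x)"
 and U_deriv: "(U has_real_derivative p x) (at x)" and U_L: "U L = 0"
 using prof by (auto simp: profile_def)

lemma p_0: "p 0 = 0" using p_odd[of 0] by simp

lemma K_le: "K * L <= 2/3" "K <= 2/3"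
proof -
 have "K * L * 1 <= K * L * L" using K L by (intro mult_left_mono) auto
 then show "K * L <= 2/3" using KL by (simp add: power2_eq_square algebra_simps)
 moreover have "K * 1 <= K * L" using K L by (intro mult_left_mono) auto
 ultimately show "K <= 2/3" by simp
qed

lemma p_lip_abs: "\<bar>p x - p y\<bar> <= K * \<bar>x - y\<bar>"
 using p_lip[of x y] p_lip[of y x] p_mono[of x y] p_mono[of y x] by (cases "x <= y") auto

lemma p_bound: "\<bar>p x\<bar> <= K * \<bar>x\<bar>"
 using p_lip_abs[of x 0] p_0 by simp

lemma p_bound': "\<bar>x\<bar> <= L ==> \<bar>p x\<bar> <= 2/3"
 using p_bound[of x] mult_left_mono[of "\<bar>x\<bar>" L K] K K_le by linarith

lemma U_cont: "isCont U x" using U_deriv DERIV_isCont by blast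
lemma U_cont_on: "continuous_on S U" using U_cont by (simp add: continuous_at_imp_continuous_on)
lemma U_ge_tangent: "U x + p x * (y - x) <= U y"
proof (cases x y rule: linorder_cases)
 case less
 then obtain z where "x < z" "z < y" "U y - U x = (y - x) * p z" using MVT2[of x y U p] U_deriv by blast
 moreover have "(y - x) * p x <= (y - x) * p z" using p_mono[of x z] calculation less by (intro mult_left_mono) auto
 ultimately show ?thesis by (simp add: algebra_simps)
next
 case greater
 then obtain z where "y < z" "z < x" "U x - U y = (x - y) * p z" using MVT2[of y x U p] U_deriv by blast
 moreover have "(x - y) * p z <= (x - y) * p x" using p_mono[of z x] calculation greater by (intro mult_left_mono) auto
 ultimately show ?thesis by (simp add: algebra_simps)
qed simp

lemma U_le_parabola: "U y <= U x + p x * (y - x) + K / 2 * (y - x)\<^sup>2"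
proof -
 define f where "f = (\<lambda>y. U x + p x * (y - x) + K / 2 * (y - x)\<^sup>2 - U y)"
 have d: "(f has_real_derivative p x + K * (y - x) - p y) (at y)" for y
  unfolding f_def by (auto intro!: derivative_eq_intros U_deriv)
 have "f y >= f x"
 proof (cases x y rule: linorder_cases)
  case less
  then obtain z where "x < z" "z < y" "f y - f x = (y - x) * (p x + K * (z - x) - p z)"
   using MVT2[of x y f "\<lambda>y. p x + K * (y - x) - p y"] d by blast
  moreover have "p x + K * (z - x) - p z >= 0" using p_lip[of x z] calculation by simp
  ultimately show ?thesis using less by (smt (verit) mult_nonneg_nonneg)
 next
  case greater
  then obtain z where "y < z" "z < x" "f x - f y = (x - y) * (p x + K * (z - x) - p z)"
   using MVT2[of y x f "\<lambda>y. p x + K * (y - x) - p y"] d by blast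
  moreover have "p x + K * (z - x) - p z <= 0" using p_lip[of z x] calculation by (simp add: algebra_simps)
  ultimately show ?thesis using greater by (smt (verit) mult_nonneg_nonpos)
 qed simp
 then show ?thesis by (simp add: f_def)
qed

lemma U_even: "U (-x) = U x"
proof -
 have "((\<lambda>x. U x - U (-x)) has_real_derivative 0) (at x)" for x
  by (auto intro!: derivative_eq_intros U_deriv DERIV_chain2[OF U_deriv] simp: p_odd)
 then have "U x - U (-x) = U 0 - U (-0)" using DERIV_isconst_all by blast
 then show ?thesis by simp
qed

lemma U_nonpos: "\<bar>x\<bar> <= L ==> U x <= 0"
proof -
 assume x: "\<bar>x\<bar> <= L"
 have "U \<bar>x\<bar> + p \<bar>x\<bar> * (L - \<bar>x\<bar>) <= U L" by (rule U_ge_tangent)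
 moreover have "p \<bar>x\<bar> >= 0" using p_mono[of 0 "\<bar>x\<bar>"] p_0 by simp
 ultimately have "U \<bar>x\<bar> <= 0" using x U_L by (smt (verit) mult_nonneg_nonneg)
 then show ?thesis using U_even[of x] by (simp add: abs_if split: if_splits)
qed

lemma U_lower: "\<bar>x\<bar> <= L ==> - (K / 2) * (L\<^sup>2 - x\<^sup>2) <= U x"
proof -
 assume x: "\<bar>x\<bar> <= L"
 have "U L <= U \<bar>x\<bar> + p \<bar>x\<bar> * (L - \<bar>x\<bar>) + K / 2 * (L - \<bar>x\<bar>)\<^sup>2" by (rule U_le_parabola)
 moreover have "p \<bar>x\<bar> * (L - \<bar>x\<bar>) <= K * \<bar>x\<bar> * (L - \<bar>x\<bar>)"
  using p_bound[of "\<bar>x\<bar>"] x by (intro mult_right_mono) auto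
 ultimately have "U \<bar>x\<bar> >= - (K * \<bar>x\<bar> * (L - \<bar>x\<bar>)) - K / 2 * (L - \<bar>x\<bar>)\<^sup>2" using U_L by simp
 also have "- (K * \<bar>x\<bar> * (L - \<bar>x\<bar>)) - K / 2 * (L - \<bar>x\<bar>)\<^sup>2 = - (K / 2) * (L\<^sup>2 - \<bar>x\<bar>\<^sup>2)"
  by (simp add: power2_eq_square algebra_simps)
 finally show ?thesis using U_even[of x] by (simp add: abs_if split: if_splits)
qed

lemma U_ge: "\<bar>x\<bar> <= L ==> U x >= -1/3"
proof -
 assume x: "\<bar>x\<bar> <= L"
 have "(K / 2) * (L\<^sup>2 - x\<^sup>2) <= (K / 2) * L\<^sup>2" using K by (intro mult_left_mono) auto
 then show ?thesis using U_lower[OF x] KL by simp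
qed

lemma U_lip: "\<bar>x\<bar> <= L ==> \<bar>y\<bar> <= L ==> U y - U x <= 2/3 * \<bar>y - x\<bar>"
proof -
 assume *: "\<bar>x\<bar> <= L" "\<bar>y\<bar> <= L"
 have "U y + p y * (x - y) <= U x" by (rule U_ge_tangent)
 then have "U y - U x <= p y * (y - x)" by (simp add: algebra_simps)
 also have "\<dots> <= \<bar>p y\<bar> * \<bar>y - x\<bar>" by (metis abs_ge_self abs_mult)
 also have "\<dots> <= 2/3 * \<bar>y - x\<bar>" using p_bound'[of y] * by (intro mult_right_mono) auto
 finally show ?thesis .
qed

end

locale cell = cell_top L K U p + bot: cell_top L K W q for L K U p W q
begin

abbreviation D where "D \<equiv> cellD L U W"

lemma gap: "\<bar>x\<bar> <= L ==> U x + 1 + W x >= 1/3"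
 using U_ge[of x] bot.U_ge[of x] by simp

lemma swap: "cell L K W q U p" by unfold_locales

lemma open_D: "open D"
proof -
 have "open ({w. \<bar>Re w\<bar> < L} \<inter> {w. - 1 - W (Re w) < Im w} \<inter> {w. Im w < U (Re w)})"
  by (intro open_Int open_Collect_less continuous_intros
   continuous_on_compose2[OF U_cont_on[of UNIV]] continuous_on_compose2[OF bot.U_cont_on[of UNIV]]) auto
 also have "\<dots> = D" by (auto simp: cellD_def)
 finally show ?thesis .
qed

lemma closure_D: "closure D \<subseteq> {w. \<bar>Re w\<bar> <= L & - 1 - W (Re w) <= Im w & Im w <= U (Re w)}"
proof (rule closure_minimal)
 have "closed ({w. \<bar>Re w\<bar> <= L} \<inter> {w. - 1 - W (Re w) <= Im w} \<inter> {w. Im w <= U (Re w)})"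
  by (intro closed_Int closed_Collect_le continuous_intros
   continuous_on_compose2[OF U_cont_on[of UNIV]] continuous_on_compose2[OF bot.U_cont_on[of UNIV]]) auto
 also have "\<dots> = {w. \<bar>Re w\<bar> <= L & - 1 - W (Re w) <= Im w & Im w <= U (Re w)}" by auto
 finally show "closed {w. \<bar>Re w\<bar> <= L & - 1 - W (Re w) <= Im w & Im w <= U (Re w)}" .
qed (auto simp: cellD_def)

lemma in_D: "w \<in> D ==> \<bar>Re w\<bar> < L" "w \<in> D ==> - 1 - W (Re w) < Im w" "w \<in> D ==> Im w < U (Re w)"
 "w \<in> D ==> Im w < 0" "w \<in> D ==> - 1 < Im w"
 using U_nonpos[of "Re w"] bot.U_nonpos[of "Re w"] by (auto simp: cellD_def)

lemma bounded_D: "bounded D"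
proof (rule boundedI)
 fix w assume w: "w \<in> D"
 have "cmod w <= \<bar>Re w\<bar> + \<bar>Im w\<bar>" by (rule cmod_le)
 also have "\<dots> <= L + 1" using in_D[OF w] by simp
 finally show "norm w <= L + 1" .
qed

text \<open>The prescribed boundary datum (z - v) / (u - v) in rescaled coordinates, extended into
  the cell affinely along vertical lines. The potential is compared with this extension.\<close>

definition ramp where "ramp w = (Im w + 1 + W (Re w)) / (U (Re w) + 1 + W (Re w))"

lemma ramp_cont: "continuous_on D ramp"
 unfolding ramp_def
proof (intro continuous_intros continuous_on_compose2[OF U_cont_on[of UNIV]] continuous_on_compose2[OF bot.U_cont_on[of UNIV]] ballI)
 fix w assume "w \<in> D"
 then show "U (Re w) + 1 + W (Re w) \<noteq> 0" using gap[of "Re w"] in_D[of w] by simp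
qed auto

text \<open>Replacing the height by \<open>ramp\<close> stretches every vertical section to length 1
  and maps the cell onto a rectangle, which is convex.\<close>

lemma simply_connected_D: "simply_connected D"
proof -
 let ?R = "{w. \<bar>Re w\<bar> < L & 0 < Im w & Im w < 1}"
 define f where "f = (\<lambda>w. Complex (Re w) (ramp w))"
 define g where "g = (\<lambda>w. Complex (Re w) (Im w * (U (Re w) + 1 + W (Re w)) - 1 - W (Re w)))"
  have gf: "g (f w) = w" if "w \<in> D" for w
   using gap[of "Re w"] in_D[OF that] by (simp add: f_def g_def ramp_def complex_eq_iff)
  have fg: "f (g w) = w" if "w \<in> ?R" for w
   using gap[of "Re w"] that by (simp add: f_def g_def ramp_def complex_eq_iff)
 have "D homeomorphic ?R"
 proof (rule homeomorphicI)
  show "continuous_on D f" unfolding f_def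
   by (intro continuous_intros ramp_cont)
  show "continuous_on ?R g" unfolding g_def
   by (intro continuous_intros continuous_on_compose2[OF U_cont_on[of UNIV]] continuous_on_compose2[OF bot.U_cont_on[of UNIV]]) auto
  have fD: "f w \<in> ?R" if "w \<in> D" for w
   using gap[of "Re w"] in_D[OF that] by (simp add: f_def ramp_def field_simps)
  have gR: "g w \<in> D" if "w \<in> ?R" for w
  proof -
   have "U (Re w) + 1 + W (Re w) > 0" using gap[of "Re w"] that by simp
   then have "Im w * (U (Re w) + 1 + W (Re w)) > 0" "Im w * (U (Re w) + 1 + W (Re w)) < 1 * (U (Re w) + 1 + W (Re w))"
    using that by (auto intro!: mult_strict_right_mono)
   then show ?thesis using that by (simp add: g_def cellD_def)
  qed
  show "f ` D = ?R"
  proof safe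
   fix w assume "w \<in> D" then show "\<bar>Re (f w)\<bar> < L" "0 < Im (f w)" "Im (f w) < 1" using fD by auto
  next
   fix w :: complex assume "\<bar>Re w\<bar> < L" "0 < Im w" "Im w < 1"
   then show "w \<in> f ` D" using fg[of w] gR[of w] by (metis (mono_tags, lifting) imageI mem_Collect_eq)
  qed
  show "g ` ?R = D"
  proof safe
   fix w assume "\<bar>Re w\<bar> < L" "0 < Im w" "Im w < 1" then show "g w \<in> D" using gR by auto
  next
   fix w assume "w \<in> D"
   then show "w \<in> g ` ?R" using gf[of w] fD[of w] by (metis (mono_tags, lifting) imageI mem_Collect_eq)
  qed
 qed (use gf fg in auto)
 moreover have "convex ?R"
 proof -
  have "?R = {w. Re w < L} \<inter> {w. Re w > - L} \<inter> {w. Im w > 0} \<inter> {w. Im w < 1}" by auto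
  then show ?thesis
   by (auto intro!: convex_Int convex_halfspace_Re_lt convex_halfspace_Re_gt convex_halfspace_Im_lt convex_halfspace_Im_gt)
 qed
 ultimately show ?thesis
  using convex_imp_simply_connected homeomorphic_simply_connected_eq by blast
qed

lemma D_nonempty: "D \<noteq> {}" "D \<noteq> UNIV"
proof -
 have "Complex 0 (-1/2) \<in> D" using U_ge[of 0] bot.U_ge[of 0] L by (simp add: cellD_def)
 then show "D \<noteq> {}" by blast
 show "D \<noteq> UNIV" using bounded_D not_bounded_UNIV by metis
qed

end

section \<open>Approximation of boundary data on the unit circle\<close>

inductive trigpoly :: "(complex => real) => bool" where
 trigpoly_monom: "trigpoly (\<lambda>z. Re (a * z ^ n))"
| trigpoly_add: "trigpoly f ==> trigpoly g ==> trigpoly (\<lambda>z. f z + g z)"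

lemma trigpoly_holomorphic: "trigpoly f ==> \<exists>Q. Q holomorphic_on UNIV & f = (\<lambda>z. Re (Q z))"
proof (induction rule: trigpoly.induct)
 case (trigpoly_monom a n)
 show ?case by (rule exI[of _ "\<lambda>z. a * z ^ n"]) (auto intro!: holomorphic_intros)
next
 case (trigpoly_add f g)
 then obtain P Q where "P holomorphic_on UNIV" "f = (\<lambda>z. Re (P z))" "Q holomorphic_on UNIV" "g = (\<lambda>z. Re (Q z))" by blast
 then show ?case by (intro exI[of _ "\<lambda>z. P z + Q z"]) (auto intro!: holomorphic_intros)
qed

text \<open>Re x Re y = Re (x y) / 2 + Re (x cnj y) / 2, and z cnj z = 1 turns a product of z^m and
  cnj (z^n) into a monomial again. The latter holds on the circle only. The case distinction decides
  which factor is conjugated, so that the exponent stays nonnegative.\<close>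

lemma trigpoly_mult:
 assumes "trigpoly f" "trigpoly g"
 shows "\<exists>h. trigpoly h & (\<forall>z\<in>sphere 0 1. f z * g z = h z)"
 using assms(1)
proof (induction rule: trigpoly.induct)
 case (trigpoly_monom a m)
 show ?case using assms(2)
 proof (induction rule: trigpoly.induct)
  case (trigpoly_monom b n)
  have *: "Re x * Re y = Re (x * y / 2) + Re (x * cnj y / 2)" "Re x * Re y = Re (x * y / 2) + Re (cnj x * y / 2)" for x y
   by (simp_all add: field_simps)
  have z: "z * cnj z = 1" if "z \<in> sphere 0 1" for z
   using that by (simp add: complex_mult_cnj cmod_def power2_eq_square)
  have red: "z ^ (k + j) * cnj z ^ k = z ^ j" if "z \<in> sphere 0 1" for z k j
  proof -
   have "z ^ (k + j) * cnj z ^ k = (z * cnj z) ^ k * z ^ j" by (simp add: power_add power_mult_distrib)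
   then show ?thesis using z[OF that] by simp
  qed
  show ?case
  proof (cases "n <= m")
   case True
   then obtain j where j: "m = n + j" using le_Suc_ex by blast
   show ?thesis
   proof (intro exI conjI ballI)
    show "trigpoly (\<lambda>z. Re (a * b / 2 * z ^ (m + n)) + Re (a * cnj b / 2 * z ^ j))"
     by (intro trigpoly.intros)
    fix z :: complex assume "z \<in> sphere 0 1"
    then have "a * z ^ m * cnj (b * z ^ n) / 2 = a * cnj b / 2 * z ^ j" using red[of z n j] by (simp add: j)
    then show "Re (a * z ^ m) * Re (b * z ^ n) = Re (a * b / 2 * z ^ (m + n)) + Re (a * cnj b / 2 * z ^ j)"
     unfolding *(1) by (simp only:) (simp add: power_add mult_ac)
   qed
  next
   case False
   then obtain j where j: "n = m + j" using le_Suc_ex nat_le_linear by blast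
   show ?thesis
   proof (intro exI conjI ballI)
    show "trigpoly (\<lambda>z. Re (a * b / 2 * z ^ (m + n)) + Re (cnj a * b / 2 * z ^ j))"
     by (intro trigpoly.intros)
    fix z :: complex assume "z \<in> sphere 0 1"
    then have "cnj (a * z ^ m) * (b * z ^ n) / 2 = cnj a * b / 2 * z ^ j" using red[of z m j] by (simp add: j mult_ac)
    then show "Re (a * z ^ m) * Re (b * z ^ n) = Re (a * b / 2 * z ^ (m + n)) + Re (cnj a * b / 2 * z ^ j)"
     unfolding *(2) by (simp only:) (simp add: power_add mult_ac)
   qed
  qed
 next
  case (trigpoly_add f g)
  then obtain h k where h: "trigpoly h" "\<And>z. z \<in> sphere 0 1 ==> Re (a * z ^ m) * f z = h z"
   and k: "trigpoly k" "\<And>z. z \<in> sphere 0 1 ==> Re (a * z ^ m) * g z = k z" by blast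
  then have "trigpoly (\<lambda>z. h z + k z)" by (intro trigpoly.intros)
  moreover have "\<forall>z\<in>sphere 0 1. Re (a * z ^ m) * (f z + g z) = h z + k z"
   unfolding ring_distribs using h(2) k(2) by simp
  ultimately show ?case by blast
 qed
next
 case (trigpoly_add f1 f2)
 then obtain h k where h: "trigpoly h" "\<And>z. z \<in> sphere 0 1 ==> f1 z * g z = h z"
  and k: "trigpoly k" "\<And>z. z \<in> sphere 0 1 ==> f2 z * g z = k z" by blast
 then have "trigpoly (\<lambda>z. h z + k z)" by (intro trigpoly.intros)
 moreover have "\<forall>z\<in>sphere 0 1. (f1 z + f2 z) * g z = h z + k z"
  unfolding ring_distribs using h(2) k(2) by simp
 ultimately show ?case by blast
qed

text \<open>Stone-Weierstrass for trigonometric polynomials. Written as real parts of entire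
  functions, the approximants come with their harmonic extension to the disc, which takes the place
  of a Poisson integral.\<close>

lemma circle_approximation:
 fixes b :: "complex => real"
 assumes b: "continuous_on (sphere 0 1) b" and e: "e > 0"
 obtains Q where "Q holomorphic_on UNIV" "\<And>z. z \<in> sphere 0 1 ==> \<bar>b z - Re (Q z)\<bar> < e"
proof -
 define P where "P f \<longleftrightarrow> (\<exists>h. trigpoly h & (\<forall>z\<in>sphere 0 1. f z = h z))" for f :: "complex => real"
 have monom: "P (\<lambda>z. Re (a * z ^ n))" for a n unfolding P_def using trigpoly_monom by blast
 have "\<exists>g. P g & (\<forall>x\<in>sphere 0 1. \<bar>b x - g x\<bar> < e)"
 proof (rule Stone_Weierstrass_HOL[OF _ _ _ _ _ _ b e])
  show "P (\<lambda>x. c)" for c using monom[of "of_real c" 0] by simp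
  show "continuous_on (sphere 0 1) f" if "P f" for f
  proof -
   obtain h where h: "trigpoly h" "\<And>z. z \<in> sphere 0 1 ==> f z = h z" using \<open>P f\<close> P_def by blast
   then obtain Q where "Q holomorphic_on UNIV" "h = (\<lambda>z. Re (Q z))" using trigpoly_holomorphic by blast
   then have "continuous_on (sphere 0 1) h"
    by (auto intro!: continuous_intros intro: holomorphic_on_imp_continuous_on continuous_on_subset)
   then show ?thesis using h(2) by (subst continuous_on_cong[OF refl, of _ _ h]) auto
  qed
  show "P (\<lambda>x. f x + g x)" if fg: "P f & P g" for f g
  proof -
   obtain h where h: "trigpoly h" "\<And>z. z \<in> sphere 0 1 ==> f z = h z" using fg P_def by blast
   obtain k where k: "trigpoly k" "\<And>z. z \<in> sphere 0 1 ==> g z = k z" using fg P_def by blast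
   show ?thesis unfolding P_def using trigpoly_add[OF h(1) k(1)] h(2) k(2) by auto
  qed
  show "P (\<lambda>x. f x * g x)" if fg: "P f & P g" for f g
  proof -
   obtain h where h: "trigpoly h" "\<And>z. z \<in> sphere 0 1 ==> f z = h z" using fg P_def by blast
   obtain k where k: "trigpoly k" "\<And>z. z \<in> sphere 0 1 ==> g z = k z" using fg P_def by blast
   show ?thesis unfolding P_def using trigpoly_mult[OF h(1) k(1)] h(2) k(2) by auto
  qed
  show "\<exists>f. P f & f x \<noteq> f y" if "x \<in> sphere 0 1 & y \<in> sphere 0 1 & x \<noteq> y" for x y :: complex
  proof (cases "Re x = Re y")
   case False
   then show ?thesis using monom[of 1 1] by (intro exI[of _ "\<lambda>z. Re (1 * z ^ 1)"]) auto
  next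
   case True
   then have "Im x \<noteq> Im y" using that by (auto simp: complex_eq_iff)
   then show ?thesis using monom[of "-\<i>" 1] by (intro exI[of _ "\<lambda>z. Re (-\<i> * z ^ 1)"]) auto
  qed
 qed auto
 then obtain h where h: "trigpoly h" "\<And>x. x \<in> sphere 0 1 ==> \<bar>b x - h x\<bar> < e" unfolding P_def by force
 obtain Q where "Q holomorphic_on UNIV" "h = (\<lambda>z. Re (Q z))" using trigpoly_holomorphic[OF h(1)] by blast
 then show ?thesis using that h(2) by auto
qed

text \<open>The function t measures the vertical distance to a parabola and has Laplacian K, the
  wrong sign for an upper barrier. Subtracting t^2 / 3 contributes - 2/3 * |grad t|^2, and the
  vertical component of the gradient has modulus 1. So the Laplacian is at most K - 2/3 when K and t
  are nonnegative.\<close>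

lemma laplacian_at_quadratic_barrier:
 fixes w :: complex and alpha beta x0 K s :: real
 defines "t \<equiv> (\<lambda>w. alpha + beta * (Re w - x0) + K / 2 * (Re w - x0)\<^sup>2 + s * Im w)"
 assumes s: "s\<^sup>2 = 1"
 shows "laplacian_at (\<lambda>w. t w - (t w)\<^sup>2 / 3) w (K - 2/3 - 2/3 * (beta + K * (Re w - x0))\<^sup>2 - 2/3 * K * t w)"
 unfolding laplacian_at_def
proof (intro exI conjI)
 let ?a = "\<lambda>tau. beta + K * (Re w + tau - x0)"
 have tx: "((\<lambda>tau. t (w + of_real tau)) has_real_derivative ?a tau) (at tau)" for tau
  unfolding t_def by (auto intro!: derivative_eq_intros)
 have ty: "((\<lambda>tau. t (w + \<i> * of_real tau)) has_real_derivative s) (at tau)" for tau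
  unfolding t_def by (auto intro!: derivative_eq_intros)
 show "\<forall>\<^sub>F tau in nhds 0. ((\<lambda>tau. t (w + of_real tau) - (t (w + of_real tau))\<^sup>2 / 3) has_real_derivative
   ?a tau - 2 / 3 * (t (w + of_real tau) * ?a tau)) (at tau)"
  by (rule always_eventually, rule allI) (rule derivative_eq_intros tx refl | simp)+
 show "((\<lambda>tau. ?a tau - 2 / 3 * (t (w + of_real tau) * ?a tau)) has_real_derivative
   K - 2 / 3 * ((?a 0)\<^sup>2 + t w * K)) (at 0)"
  by (rule derivative_eq_intros tx refl | simp add: power2_eq_square algebra_simps)+
 show "\<forall>\<^sub>F tau in nhds 0. ((\<lambda>tau. t (w + \<i> * of_real tau) - (t (w + \<i> * of_real tau))\<^sup>2 / 3) has_real_derivative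
   s - 2 / 3 * (t (w + \<i> * of_real tau) * s)) (at tau)"
  by (rule always_eventually, rule allI) (rule derivative_eq_intros ty refl | simp)+
 show "((\<lambda>tau. s - 2 / 3 * (t (w + \<i> * of_real tau) * s)) has_real_derivative - 2/3 * s\<^sup>2) (at 0)"
  by (rule derivative_eq_intros ty refl | simp add: power2_eq_square)+
 show "K - 2 / 3 - 2 / 3 * (beta + K * (Re w - x0))\<^sup>2 - 2 / 3 * K * t w =
  K - 2 / 3 * ((?a 0)\<^sup>2 + t w * K) + - 2 / 3 * s\<^sup>2" by (simp add: s algebra_simps)
qed

section \<open>The potential of a cell\<close>

text \<open>Boundary data as rates: the values 1 and 0 are approached linearly in the vertical
  distance to the upper and the lower graph, and the real part tends to Im w + 1 at the vertical
  sides. This fixes the real part, hence also the derivative of h; an imaginary constant remains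
  free.\<close>

definition is_potential :: "real => (real => real) => (real => real) => (complex => complex) => bool" where
 "is_potential L U W h \<longleftrightarrow> h holomorphic_on cellD L U W & (\<forall>w\<in>cellD L U W.
   0 <= Re (h w) & Re (h w) <= 1 & 1 - Re (h w) <= 27/2 * (U (Re w) - Im w) &
   Re (h w) <= 27/2 * (Im w + 1 + W (Re w)) & \<bar>Re (h w) - (Im w + 1)\<bar> <= 2 * (L - \<bar>Re w\<bar>))"

lemma isCont_Re_compose: "isCont F (Re x) ==> isCont (\<lambda>w. F (Re w)) x"
 by (rule isCont_o2[OF linear_continuous_at[OF bounded_linear_Re]])

context cell
begin

text \<open>The boundary behaviour of h is recorded as a comparison property: a superharmonic
  function above \<open>s * ramp + c\<close> is also above \<open>s * Re h + c\<close>. The datum is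
  moved to the disc by the Riemann map, approximated on circles of radius \<open>r n\<close> < 1 by
  real parts of entire functions, and compared with the barrier there. Montel's theorem yields h as
  \<open>r n\<close> tends to 1.\<close>

lemma potential_core:
 obtains h where "h holomorphic_on D"
  "\<And>s c B w. s = 1 \<or> s = -1 ==> continuous_on D B ==> (\<And>w. w \<in> D ==> \<exists>l\<le>0. laplacian_at B w l)
   ==> (\<And>w. w \<in> D ==> s * ramp w + c <= B w) ==> w \<in> D ==> s * Re (h w) + c <= B w"
proof -
 have "\<exists>f k. f holomorphic_on D & k holomorphic_on ball 0 1 & (\<forall>z\<in>D. f z \<in> ball 0 1 & k (f z) = z)
   & (\<forall>z\<in>ball 0 1. k z \<in> D & f (k z) = z)"
  using Riemann_mapping_theorem[of D] open_D simply_connected_D D_nonempty by blast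
 then obtain f k where f: "f holomorphic_on D" and k: "k holomorphic_on ball 0 1"
  and fk: "\<And>z. z \<in> D ==> f z \<in> ball 0 1 & k (f z) = z" and kf: "\<And>z. z \<in> ball 0 1 ==> k z \<in> D & f (k z) = z"
  by blast
 have fc: "continuous_on D f" and kc: "continuous_on (ball 0 1) k"
  using f k holomorphic_on_imp_continuous_on by auto
 define r where "r n = 1 - 1 / real (n + 2)" for n :: nat
 have r: "0 < r n" "r n < 1" for n by (auto simp: r_def field_simps)
 have rlim: "r \<longlonglongrightarrow> 1"
 proof -
  have "(\<lambda>n. 1 - 1 / real (n + 2)) \<longlonglongrightarrow> 1 - 0"
   by (intro tendsto_intros LIMSEQ_ignore_initial_segment[OF lim_1_over_n])
  then show ?thesis by (simp add: r_def[abs_def])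
 qed
 have inb: "of_real (r n) * z \<in> ball 0 1" if "z \<in> cball 0 1" for n and z :: complex
 proof -
  have "r n * cmod z <= r n * 1" using that r[of n] by (intro mult_left_mono) auto
  moreover have "cmod (of_real (r n) * z) = r n * cmod z" using r[of n] by (simp add: norm_mult)
  ultimately have "cmod (of_real (r n) * z) < 1" using r(2)[of n] by linarith
  then show ?thesis by simp
 qed
 have "\<exists>Q. Q holomorphic_on UNIV & (\<forall>z\<in>sphere 0 1. \<bar>ramp (k (of_real (r n) * z)) - Re (Q z)\<bar> < 1 / real (Suc n))" for n
 proof -
  have "continuous_on (sphere 0 1) (\<lambda>z. ramp (k (of_real (r n) * z)))"
  proof (rule continuous_on_compose2[OF ramp_cont])
   show "continuous_on (sphere 0 1) (\<lambda>z. k (of_real (r n) * z))"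
    by (rule continuous_on_compose2[OF kc]) (use inb in \<open>auto intro!: continuous_intros simp: subset_iff\<close>)
   show "(\<lambda>z. k (of_real (r n) * z)) ` sphere 0 1 \<subseteq> D" using inb kf by fastforce
  qed
  then obtain Q where "Q holomorphic_on UNIV" "\<And>z. z \<in> sphere 0 1 ==> \<bar>ramp (k (of_real (r n) * z)) - Re (Q z)\<bar> < 1 / real (Suc n)"
   by (rule circle_approximation[of _ "1 / real (Suc n)"]) auto
  then show ?thesis by blast
 qed
 then obtain Q where Q: "\<And>n. Q n holomorphic_on UNIV"
  "\<And>n z. z \<in> sphere 0 1 ==> \<bar>ramp (k (of_real (r n) * z)) - Re (Q n z)\<bar> < 1 / real (Suc n)" by metis
 have Qc: "continuous_on A (Q n)" for n A
  using Q(1) holomorphic_on_imp_continuous_on continuous_on_subset by blast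
 have cmp: "s * Re (Q n zeta) + c <= B (k (of_real (r n) * zeta)) + 1 / real (Suc n)"
  if s: "s = 1 \<or> s = -1" and B: "continuous_on D B" and Bl: "\<And>w. w \<in> D ==> \<exists>l\<le>0. laplacian_at B w l"
   and le: "\<And>w. w \<in> D ==> s * ramp w + c <= B w" and z: "zeta \<in> ball 0 1" for s c B n zeta
 proof -
  \<comment> \<open>The preimage of the disc of radius \<open>r n\<close> has compact closure inside
    the cell. Its frontier is mapped to the circle of radius \<open>r n\<close>, where the
    approximation of \<open>ramp\<close> is known.\<close>
  define S where "S = D \<inter> f -` ball 0 (r n)"
  define F where "F = (\<lambda>w. of_real s * Q n (f w / of_real (r n)) + of_real (c - 1 / real (Suc n)))"
  define g where "g = (\<lambda>w. Re (F w) + (-1) * B w)"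
  have S: "open S" unfolding S_def using continuous_open_preimage[OF fc open_D open_ball] .
  have bS: "bounded S" using bounded_D by (rule bounded_subset) (auto simp: S_def)
  have "(\<lambda>w. f w / of_real (r n)) holomorphic_on D" using r[of n] by (auto intro!: holomorphic_intros f)
  from holomorphic_on_compose_gen[OF this Q(1)]
  have "(\<lambda>w. Q n (f w / of_real (r n))) holomorphic_on D" by (simp add: o_def)
  then have Fh: "F holomorphic_on D" unfolding F_def by (intro holomorphic_on_add holomorphic_on_mult holomorphic_on_const)
  have gD: "continuous_on D g" unfolding g_def
   by (intro continuous_intros B holomorphic_on_imp_continuous_on[OF Fh])
  define w where "w = k (of_real (r n) * zeta)"
  have zc: "zeta \<in> cball 0 1" using z by auto
  have w: "w \<in> D" "f w = of_real (r n) * zeta" using kf inb[OF zc] by (auto simp: w_def)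
  have wS: "w \<in> S" using w z r[of n] by (simp add: S_def norm_mult)
  have "g w <= 0"
  proof (rule maximum_principle[OF S bS _ _ _ wS])
   show "continuous_on S g" using gD by (rule continuous_on_subset) (auto simp: S_def)
   fix x assume "x \<in> S"
   then have x: "x \<in> D" by (simp add: S_def)
   obtain l where l: "l <= 0" "laplacian_at B x l" using Bl[OF x] by blast
   have "laplacian_at g x (0 + (-1) * l)" unfolding g_def
    by (rule laplacian_at_add[OF laplacian_at_Re[OF Fh open_D x] laplacian_at_cmult[OF l(2)]])
   then show "\<exists>l\<ge>0. laplacian_at g x l" using l by (intro exI[of _ "0 + (-1) * l"]) auto
  next
   fix x assume x: "x \<in> frontier S"
   have cp: "compact (k ` cball 0 (r n))"
    by (rule compact_continuous_image[OF continuous_on_subset[OF kc] compact_cball]) (use r[of n] in auto)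
   have "S \<subseteq> k ` cball 0 (r n)"
   proof
    fix w assume "w \<in> S"
    then have "w = k (f w)" "f w \<in> cball 0 (r n)" using fk[of w] by (auto simp: S_def)
    then show "w \<in> k ` cball 0 (r n)" by (rule image_eqI)
   qed
   then have "closure S \<subseteq> k ` cball 0 (r n)" using cp by (simp add: closure_minimal compact_imp_closed)
   then obtain y where y: "x = k y" "y \<in> cball 0 (r n)" using x by (auto simp: frontier_def)
   have yb: "y \<in> ball 0 1" using y r[of n] by auto
   have xD: "x \<in> D" "f x = y" using kf[OF yb] y by auto
   have "x \<notin> S" using x S by (simp add: frontier_def interior_open)
   then have ny: "cmod y = r n" using y xD by (auto simp: S_def)
   have sph: "y / of_real (r n) \<in> sphere 0 1" using ny r[of n] by (simp add: norm_divide)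
   have "\<bar>ramp x - Re (Q n (y / of_real (r n)))\<bar> < 1 / real (Suc n)"
    using Q(2)[OF sph, of n] y r[of n] by simp
   then have "s * Re (Q n (y / of_real (r n))) <= s * ramp x + 1 / real (Suc n)" using s by auto
   then have "g x <= 0" using le[OF xD(1)] by (simp add: g_def F_def xD(2))
   moreover have "isCont g x" using gD open_D xD by (simp add: continuous_on_eq_continuous_at)
   ultimately show "\<exists>m. isCont m x & m x <= 0 & (\<forall>w\<in>S. g w <= m w)" by blast
  qed
  moreover have "f w / of_real (r n) = zeta" using w r[of n] by simp
  ultimately show ?thesis by (simp add: g_def F_def w_def)
 qed
 have lapc: "\<exists>l\<le>0. laplacian_at (\<lambda>_. a) w l" for a w
  using laplacian_at_Re[of "\<lambda>_. of_real a" UNIV w] by (intro exI[of _ 0]) auto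
 have ramp01: "0 <= ramp w & ramp w <= 1" if "w \<in> D" for w
  using gap[of "Re w"] in_D[OF that] by (auto simp: ramp_def)
 have Qb: "\<bar>Re (Q n z) - 0\<bar> <= 2" if z: "z \<in> ball 0 1" for n z
 proof -
  have "1 * Re (Q n z) + 0 <= 1 + 1 / real (Suc n)"
   by (rule cmp[where B = "\<lambda>_. 1", OF _ continuous_on_const lapc _ z]) (use ramp01 in simp_all)
  moreover have "(-1) * Re (Q n z) + 0 <= 0 + 1 / real (Suc n)"
   by (rule cmp[where B = "\<lambda>_. 0", OF _ continuous_on_const lapc _ z]) (use ramp01 in simp_all)
  moreover have "1 / real (Suc n) <= 1" by simp
  ultimately show ?thesis by linarith
 qed
 \<comment> \<open>Subtracting an imaginary constant changes no real part and makes
   \<open>q n 0\<close> real. The bound on real parts then bounds the moduli locally, as Montel's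
   theorem demands.\<close>
 define q where "q n z = Q n z - \<i> * of_real (Im (Q n 0))" for n z
 have qh: "q n holomorphic_on UNIV" for n unfolding q_def by (intro holomorphic_intros Q(1))
 have qRe: "Re (q n z) = Re (Q n z)" for n z by (simp add: q_def)
 have qbd: "\<exists>B. \<forall>h\<in>range q. \<forall>z\<in>A. cmod (h z) <= B" if A: "compact A" "A \<subseteq> ball 0 1" for A
 proof -
  have "\<exists>rho. 0 <= rho & rho < 1 & A \<subseteq> cball 0 rho"
  proof (cases "A = {}")
   case False
   obtain y where y: "y \<in> A" "\<And>z. z \<in> A ==> cmod z <= cmod y"
    using continuous_attains_sup[OF A(1) False, of cmod] by (auto intro: continuous_intros)
   then show ?thesis using A(2) by (intro exI[of _ "cmod y"]) auto
  qed (auto intro: exI[of _ 0])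
  then obtain rho where rho: "0 <= rho" "rho < 1" "A \<subseteq> cball 0 rho" by blast
  have "cmod (q n z) <= 2 + 16 / (1 - rho)" if z: "z \<in> A" for n z
  proof -
   have zr: "z \<in> cball 0 rho" "0 \<in> cball (0::complex) rho" using z rho by auto
   have "cmod (q n z - q n 0) <= 16 / (1 - rho) * cmod (z - 0)"
   proof (rule field_differentiable_bound[OF convex_cball _ _ zr(1) zr(2)])
    fix x :: complex assume x: "x \<in> cball 0 rho"
    show "(q n has_field_derivative deriv (q n) x) (at x within cball 0 rho)"
     using holomorphic_derivI[OF qh open_UNIV] by auto
    have sub: "ball x (1 - rho) \<subseteq> ball 0 1"
    proof
     fix y assume "y \<in> ball x (1 - rho)"
     then show "y \<in> ball 0 1" using x dist_triangle[of 0 y x] by auto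
    qed
    have "cmod (deriv (q n) x) <= 8 * 2 / (1 - rho)"
     by (rule norm_deriv_le_Re_bound[where c = 0])
      (use qh Qb rho sub in \<open>auto simp: qRe intro: holomorphic_on_subset\<close>)
    then show "cmod (deriv (q n) x) <= 16 / (1 - rho)" by simp
   qed
   also have "\<dots> <= 16 / (1 - rho) * 1" using zr rho by (intro mult_left_mono) auto
   finally have "cmod (q n z - q n 0) <= 16 / (1 - rho)" by simp
   moreover have "cmod (q n 0) <= 2"
   proof -
    have "q n 0 = of_real (Re (Q n 0))" by (simp add: q_def complex_eq_iff)
    then show ?thesis using Qb[of 0 n] by simp
   qed
   ultimately show ?thesis using norm_triangle_ineq[of "q n z - q n 0" "q n 0"] by simp
  qed
  then show ?thesis by blast
 qed
 obtain g sigma where g: "g holomorphic_on ball 0 1" "strict_mono sigma"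
  "\<And>x. x \<in> ball 0 1 ==> (\<lambda>n. q (sigma n) x) \<longlonglongrightarrow> g x"
 proof (rule Montel[of "ball 0 1" "range q" q])
  show "h holomorphic_on ball 0 1" if "h \<in> range q" for h
   using that qh by (auto intro: holomorphic_on_subset)
 qed (use qbd in auto)
 show ?thesis
 proof (rule that[of "g \<circ> f"])
  show "(g \<circ> f) holomorphic_on D"
   by (rule holomorphic_on_compose_gen[OF f g(1)]) (use fk in auto)
  fix s c B w
  assume s: "s = 1 \<or> s = -1" and B: "continuous_on D B" and Bl: "\<And>w. w \<in> D ==> \<exists>l\<le>0. laplacian_at B w l"
   and le: "\<And>w. w \<in> D ==> s * ramp w + c <= B w" and w: "w \<in> D"
  have fw: "f w \<in> ball 0 1" "k (f w) = w" using fk[OF w] by auto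
  have r1: "(\<lambda>n. r (sigma n)) \<longlonglongrightarrow> 1" using LIMSEQ_subseq_LIMSEQ[OF rlim g(2)] by (simp add: o_def)
  have "(\<lambda>n. of_real (r (sigma n)) * f w) \<longlonglongrightarrow> of_real 1 * f w" by (intro tendsto_intros r1)
  moreover have "isCont k (f w)" using kc fw by (simp add: continuous_on_eq_continuous_at)
  ultimately have kl: "(\<lambda>n. k (of_real (r (sigma n)) * f w)) \<longlonglongrightarrow> w"
   using isCont_tendsto_compose[of "f w" k] fw(2) by simp
  have "isCont B w" using B w open_D by (simp add: continuous_on_eq_continuous_at)
  from isCont_tendsto_compose[OF this kl]
  have l1: "(\<lambda>n. B (k (of_real (r (sigma n)) * f w)) + 1 / real (Suc (sigma n))) \<longlonglongrightarrow> B w + 0"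
   by (intro tendsto_add) (use LIMSEQ_subseq_LIMSEQ[OF LIMSEQ_Suc[OF lim_1_over_n] g(2)] in \<open>auto simp: o_def\<close>)
  have l2: "(\<lambda>n. s * Re (q (sigma n) (f w)) + c) \<longlonglongrightarrow> s * Re (g (f w)) + c"
   by (intro tendsto_intros g(3) fw)
  have "s * Re (g (f w)) + c <= B w + 0"
  proof (rule LIMSEQ_le[OF l2 l1])
   show "\<exists>N. \<forall>n\<ge>N. s * Re (q (sigma n) (f w)) + c <= B (k (of_real (r (sigma n)) * f w)) + 1 / real (Suc (sigma n))"
    unfolding qRe using cmp[OF s B Bl le fw(1)] by blast
  qed
  then show "s * Re ((g \<circ> f) w) + c <= B w" by simp
 qed
qed

text \<open>Since t <= 7/3, the factor 1 - t / 3 is at least 2/9, and 27/2 * 2/9 = 3 is the slope of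
  the bound for \<open>ramp\<close>: this is the origin of 27/2. The number 7/3 is the height 1 of
  the cell plus 2 * K * L^2 <= 4/3 from the parabola.\<close>

lemma top_barrier:
 assumes x0: "\<bar>x0\<bar> <= L" and t_def: "t = (\<lambda>w. U x0 + p x0 * (Re w - x0) + K / 2 * (Re w - x0)\<^sup>2 + (-1) * Im w)"
  and w: "w \<in> D"
 shows "U (Re w) - Im w <= t w" "3 * t w <= 27/2 * (t w - (t w)\<^sup>2 / 3)" "t w >= 0"
proof -
 have X: "\<bar>Re w\<bar> <= L" using in_D[OF w] by simp
 show *: "U (Re w) - Im w <= t w" using U_le_parabola[of "Re w" x0] by (simp add: t_def)
 then show t0: "t w >= 0" using in_D[OF w] by simp
 have "(Re w - x0)\<^sup>2 <= (2 * L)\<^sup>2" using X x0 by (intro power2_le_iff_abs_le[THEN iffD2]) auto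
 then have "K / 2 * (Re w - x0)\<^sup>2 <= K / 2 * (2 * L)\<^sup>2" using K by (intro mult_left_mono) auto
 also have "\<dots> = 2 * (K * L\<^sup>2)" by (simp add: power2_eq_square)
 finally have "K / 2 * (Re w - x0)\<^sup>2 <= 4/3" using KL by simp
 moreover have "U x0 + p x0 * (Re w - x0) <= 0" using U_ge_tangent[of x0 "Re w"] U_nonpos[OF X] by simp
 ultimately have "t w <= 7/3" using in_D[OF w] by (simp add: t_def)
 then have "t w * (t w) <= t w * (7/3)" using t0 by (intro mult_left_mono) auto
 then show "3 * t w <= 27/2 * (t w - (t w)\<^sup>2 / 3)" by (simp add: power2_eq_square algebra_simps)
qed

lemma ramp_top: "w \<in> D ==> 1 - ramp w <= 3 * (U (Re w) - Im w)"
proof -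
 assume w: "w \<in> D"
 have g: "U (Re w) + 1 + W (Re w) >= 1/3" using gap[of "Re w"] in_D[OF w] by simp
 have "1 - ramp w = (U (Re w) - Im w) / (U (Re w) + 1 + W (Re w))" using g by (simp add: ramp_def field_simps)
 also have "\<dots> <= (U (Re w) - Im w) / (1/3)" using g in_D[OF w] by (intro divide_left_mono) auto
 finally show ?thesis by simp
qed

text \<open>The right-hand side has Laplacian -2 / L^2 and vanishes at both vertical sides, so it is
  a barrier there. The numerator of the difference is at most K / 2 * (L^2 - (Re w)^2), the gap
  contributes a factor 3, and 3/2 * K * L^2 <= 1.\<close>

lemma ramp_side: "w \<in> D ==> \<bar>ramp w - (Im w + 1)\<bar> <= 1 / L\<^sup>2 * (L\<^sup>2 - (Re w)\<^sup>2)"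
proof -
 assume w: "w \<in> D"
 define y where "y = K / 2 * (L\<^sup>2 - (Re w)\<^sup>2)"
 have g: "U (Re w) + 1 + W (Re w) >= 1/3" using gap[of "Re w"] in_D[OF w] by simp
 have X: "\<bar>Re w\<bar> <= L" using in_D[OF w] by simp
 have Lx: "L\<^sup>2 - (Re w)\<^sup>2 >= 0" using X L by (simp add: abs_le_square_iff[symmetric])
 have U: "- y <= U (Re w)" "U (Re w) <= 0" and W: "- y <= W (Re w)" "W (Re w) <= 0"
  using U_lower[OF X] U_nonpos[OF X] bot.U_lower[OF X] bot.U_nonpos[OF X] by (auto simp: y_def)
 define nu where "nu = W (Re w) * (- Im w) - (Im w + 1) * U (Re w)"
 have "W (Re w) * (- Im w) >= (-y) * (- Im w)" "(Im w + 1) * U (Re w) >= (Im w + 1) * (- y)"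
  using mult_right_mono[of "-y" "W (Re w)" "- Im w"] mult_left_mono[of "-y" "U (Re w)" "Im w + 1"] U W in_D[OF w]
  by linarith+
 moreover have "W (Re w) * (- Im w) <= 0" "(Im w + 1) * U (Re w) <= 0"
  using mult_nonpos_nonneg[of "W (Re w)" "- Im w"] mult_nonneg_nonpos[of "Im w + 1" "U (Re w)"] U W in_D[OF w]
  by linarith+
 moreover have "y * (- Im w) <= y * 1" "(Im w + 1) * y <= 1 * y"
  using mult_left_mono[of "- Im w" 1 y] mult_right_mono[of "Im w + 1" 1 y] U in_D[OF w] by linarith+
 ultimately have nu: "\<bar>nu\<bar> <= y" unfolding nu_def by linarith
 have "ramp w - (Im w + 1) = nu / (U (Re w) + 1 + W (Re w))"
  using g by (simp add: ramp_def nu_def field_simps)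
 then have "\<bar>ramp w - (Im w + 1)\<bar> = \<bar>nu\<bar> / (U (Re w) + 1 + W (Re w))" using g by simp
 also have "\<dots> <= \<bar>nu\<bar> / (1/3)" using g by (intro divide_left_mono) auto
 also have "\<dots> <= 3 * y" using nu by simp
 also have "\<dots> = (3/2 * (K * L\<^sup>2)) * (1 / L\<^sup>2 * (L\<^sup>2 - (Re w)\<^sup>2))" using L by (simp add: y_def field_simps)
 also have "\<dots> <= 1 * (1 / L\<^sup>2 * (L\<^sup>2 - (Re w)\<^sup>2))" using KL Lx by (intro mult_right_mono) auto
 finally show ?thesis by simp
qed

text \<open>Each inequality is an instance of the comparison property. A parabola is attached to the
  graph on the vertical line through w, and its barrier is evaluated at w alone, where t is the
  vertical distance to the graph.\<close>

theorem potential_exists: "\<exists>h. is_potential L U W h"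
proof -
 obtain h where h: "h holomorphic_on D"
  and core: "\<And>s c B w. s = 1 \<or> s = -1 ==> continuous_on D B ==> (\<And>w. w \<in> D ==> \<exists>l\<le>0. laplacian_at B w l)
   ==> (\<And>w. w \<in> D ==> s * ramp w + c <= B w) ==> w \<in> D ==> s * Re (h w) + c <= B w"
  by (rule potential_core) blast
 have lapc: "\<exists>l\<le>0. laplacian_at (\<lambda>_. a) w l" for a w
  using laplacian_at_Re[of "\<lambda>_. of_real a" UNIV w] by (intro exI[of _ 0]) auto
 have ramp01: "0 <= ramp w & ramp w <= 1" if "w \<in> D" for w
  using gap[of "Re w"] in_D[OF that] by (auto simp: ramp_def)
 interpret sw: cell L K W q U p by (rule swap)
 have flip: "cnj w - \<i> \<in> sw.D" if "w \<in> D" for w using in_D[OF that] by (simp add: cellD_def)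
 have par: "\<exists>l\<le>0. laplacian_at (\<lambda>w. 27/2 * (t w - (t w)\<^sup>2 / 3)) w l"
  if "t = (\<lambda>w. alpha + beta * (Re w - x0) + K / 2 * (Re w - x0)\<^sup>2 + s * Im w)" "s\<^sup>2 = 1" "t w >= 0" for t alpha beta x0 s w
 proof -
  have "laplacian_at (\<lambda>w. 27/2 * (t w - (t w)\<^sup>2 / 3)) w (27/2 * (K - 2/3 - 2/3 * (beta + K * (Re w - x0))\<^sup>2 - 2/3 * K * t w))"
   unfolding that(1) by (rule laplacian_at_cmult[OF laplacian_at_quadratic_barrier[OF that(2)]])
  moreover have "K - 2/3 - 2/3 * (beta + K * (Re w - x0))\<^sup>2 - 2/3 * K * t w <= 0"
  proof -
   have "2/3 * K * t w >= 0" "2/3 * (beta + K * (Re w - x0))\<^sup>2 >= 0" using K that(3) by auto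
   then show ?thesis using K_le by linarith
  qed
  ultimately show ?thesis
   by (intro exI[of _ "27/2 * (K - 2/3 - 2/3 * (beta + K * (Re w - x0))\<^sup>2 - 2/3 * K * t w)"]) simp
 qed
 show ?thesis unfolding is_potential_def
 proof (intro exI[of _ h] conjI ballI h)
  fix w assume w: "w \<in> D"
  have X: "\<bar>Re w\<bar> <= L" using in_D[OF w] by simp
  have "(-1) * Re (h w) + 0 <= 0"
   by (rule core[where B = "\<lambda>_. 0", OF _ continuous_on_const lapc _ w]) (use ramp01 in simp_all)
  then show "0 <= Re (h w)" by simp
  have "1 * Re (h w) + 0 <= 1"
   by (rule core[where B = "\<lambda>_. 1", OF _ continuous_on_const lapc _ w]) (use ramp01 in simp_all)
  then show "Re (h w) <= 1" by simp
  show "1 - Re (h w) <= 27/2 * (U (Re w) - Im w)"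
  proof -
   define t where "t = (\<lambda>v. U (Re w) + p (Re w) * (Re v - Re w) + K / 2 * (Re v - Re w)\<^sup>2 + (-1) * Im v)"
   note tb = top_barrier[OF X t_def]
   have "(-1) * Re (h w) + 1 <= 27/2 * (t w - (t w)\<^sup>2 / 3)"
   proof (rule core[where B = "\<lambda>w. 27/2 * (t w - (t w)\<^sup>2 / 3)"])
    show "continuous_on D (\<lambda>w. 27/2 * (t w - (t w)\<^sup>2 / 3))" unfolding t_def by (auto intro!: continuous_intros)
    show "\<exists>l\<le>0. laplacian_at (\<lambda>w. 27/2 * (t w - (t w)\<^sup>2 / 3)) v l" if "v \<in> D" for v
     by (rule par[OF t_def]) (use tb[OF that] in auto)
    show "(-1) * ramp v + 1 <= 27/2 * (t v - (t v)\<^sup>2 / 3)" if "v \<in> D" for v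
    proof -
     have "(-1) * ramp v + 1 <= 3 * (U (Re v) - Im v)" using ramp_top[OF that] by simp
     also have "\<dots> <= 3 * t v" using tb(1)[OF that] by simp
     also note tb(2)[OF that]
     finally show ?thesis .
    qed
   qed (use w in auto)
   also have "\<dots> <= 27/2 * t w" by simp
   also have "t w = U (Re w) - Im w" by (simp add: t_def)
   finally show ?thesis by simp
  qed
  show "Re (h w) <= 27/2 * (Im w + 1 + W (Re w))"
  proof -
   \<comment> \<open>The barrier for the lower graph is the one for the upper graph of the reflected
     cell, pulled back; the summand 1 comes from the shift in cnj w - \<i>.\<close>
   define t where "t = (\<lambda>v. (W (Re w) + 1) + q (Re w) * (Re v - Re w) + K / 2 * (Re v - Re w)\<^sup>2 + 1 * Im v)"
   define t' where "t' = (\<lambda>v. W (Re w) + q (Re w) * (Re v - Re w) + K / 2 * (Re v - Re w)\<^sup>2 + (-1) * Im v)"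
   note tb = sw.top_barrier[OF X t'_def flip]
   have tt: "t' (cnj v - \<i>) = t v" for v by (simp add: t_def t'_def)
   have "1 * Re (h w) + 0 <= 27/2 * (t w - (t w)\<^sup>2 / 3)"
   proof (rule core[where B = "\<lambda>w. 27/2 * (t w - (t w)\<^sup>2 / 3)"])
    show "continuous_on D (\<lambda>w. 27/2 * (t w - (t w)\<^sup>2 / 3))" unfolding t_def by (auto intro!: continuous_intros)
    show "\<exists>l\<le>0. laplacian_at (\<lambda>w. 27/2 * (t w - (t w)\<^sup>2 / 3)) v l" if "v \<in> D" for v
     by (rule par[OF t_def]) (use tb[OF that] tt in auto)
    show "1 * ramp v + 0 <= 27/2 * (t v - (t v)\<^sup>2 / 3)" if "v \<in> D" for v
    proof -
     have "1 - sw.ramp (cnj v - \<i>) = ramp v"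
      using gap[of "Re v"] in_D[OF that] by (simp add: ramp_def sw.ramp_def field_simps)
     then have "1 * ramp v + 0 <= 3 * (W (Re v) - Im (cnj v - \<i>))" using sw.ramp_top[OF flip[OF that]] by simp
     also have "\<dots> <= 3 * t v" using tb(1)[OF that] unfolding tt by simp
     also note tb(2)[OF that, unfolded tt]
     finally show ?thesis .
    qed
   qed (use w in auto)
   also have "\<dots> <= 27/2 * t w" by simp
   also have "t w = Im w + 1 + W (Re w)" by (simp add: t_def)
   finally show ?thesis by simp
  qed
  show "\<bar>Re (h w) - (Im w + 1)\<bar> <= 2 * (L - \<bar>Re w\<bar>)"
  proof -
   have side: "s * Re (h w) + 0 <= s * (Im w + 1) + 1 / L\<^sup>2 * (L\<^sup>2 - (Re w)\<^sup>2)" if s: "s = 1 \<or> s = -1" for s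
   proof (rule core[OF s, where B = "\<lambda>w. s * (Im w + 1) + 1 / L\<^sup>2 * (L\<^sup>2 - (Re w)\<^sup>2)"])
    show "continuous_on D (\<lambda>w. s * (Im w + 1) + 1 / L\<^sup>2 * (L\<^sup>2 - (Re w)\<^sup>2))" using L by (auto intro!: continuous_intros)
    show "\<exists>l\<le>0. laplacian_at (\<lambda>w. s * (Im w + 1) + 1 / L\<^sup>2 * (L\<^sup>2 - (Re w)\<^sup>2)) v l" for v
    proof -
     have "laplacian_at (\<lambda>w. Re (of_real s * (- \<i> * w + 1) + 1) + (- (1 / L\<^sup>2)) * (Re w)\<^sup>2) v (0 + (- (1 / L\<^sup>2)) * 2)"
      by (rule laplacian_at_add[OF laplacian_at_Re[of _ UNIV] laplacian_at_cmult[OF laplacian_at_Re_square]])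
       (auto intro!: holomorphic_intros)
     moreover have "(\<lambda>w. Re (of_real s * (- \<i> * w + 1) + 1) + (- (1 / L\<^sup>2)) * (Re w)\<^sup>2)
      = (\<lambda>w. s * (Im w + 1) + 1 / L\<^sup>2 * (L\<^sup>2 - (Re w)\<^sup>2))" using L by (auto simp: field_simps)
     ultimately show ?thesis by (intro exI[of _ "0 + (- (1 / L\<^sup>2)) * 2"]) auto
    qed
    show "s * ramp v + 0 <= s * (Im v + 1) + 1 / L\<^sup>2 * (L\<^sup>2 - (Re v)\<^sup>2)" if "v \<in> D" for v
     using ramp_side[OF that] s by auto
   qed (use w in auto)
   have "1 / L\<^sup>2 * (L\<^sup>2 - (Re w)\<^sup>2) <= 2 * (L - \<bar>Re w\<bar>)"
   proof -
    have "L\<^sup>2 - (Re w)\<^sup>2 = (L + \<bar>Re w\<bar>) * (L - \<bar>Re w\<bar>)"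
     by (simp add: power2_eq_square algebra_simps)
    also have "\<dots> <= (2 * L\<^sup>2) * (L - \<bar>Re w\<bar>)"
    proof (intro mult_right_mono)
     have "1 * L <= L * L" using L by (intro mult_right_mono) auto
     then show "L + \<bar>Re w\<bar> <= 2 * L\<^sup>2" using X by (simp add: power2_eq_square)
    qed (use X in auto)
    finally show ?thesis using L by (simp add: field_simps)
   qed
   then show ?thesis using side[of 1] side[of "-1"] by simp
  qed
 qed
qed

end

section \<open>Stability, symmetries and interior bounds of the potential\<close>

lemma is_potentialD:
 assumes "is_potential L U W h"
 shows "h holomorphic_on cellD L U W"
  and "w \<in> cellD L U W ==> 0 <= Re (h w)" "w \<in> cellD L U W ==> Re (h w) <= 1"
  "w \<in> cellD L U W ==> 1 - Re (h w) <= 27/2 * (U (Re w) - Im w)"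
  "w \<in> cellD L U W ==> Re (h w) <= 27/2 * (Im w + 1 + W (Re w))"
  "w \<in> cellD L U W ==> \<bar>Re (h w) - (Im w + 1)\<bar> <= 2 * (L - \<bar>Re w\<bar>)"
 using assms unfolding is_potential_def by auto

text \<open>Maximum principle on the intersection of the cells. At a frontier point on a graph one
  function has reached its boundary value, and the other is within delta of its own graph, hence
  within 27/2 * delta of the same value. The case delta = 0 is uniqueness of the real part.\<close>

lemma potential_stability:
 assumes c: "cell L K U p W q" and c': "cell L K U' p' W' q'"
  and h: "is_potential L U W h" and h': "is_potential L U' W' h'"
  and delta: "\<And>x. \<bar>x\<bar> <= L ==> \<bar>U x - U' x\<bar> <= delta" "\<And>x. \<bar>x\<bar> <= L ==> \<bar>W x - W' x\<bar> <= delta"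
  and w: "w \<in> cellD L U W" "w \<in> cellD L U' W'"
 shows "Re (h w) - Re (h' w) <= 27/2 * delta"
proof -
 interpret cell L K U p W q by fact
 interpret b: cell L K U' p' W' q' by fact
 note H = is_potentialD[OF h] and H' = is_potentialD[OF h']
 have delta0: "delta >= 0" using delta(1)[of 0] L by simp
 define S where "S = D \<inter> b.D"
 have "Re ((\<lambda>w. h w - h' w - of_real (27/2 * delta)) w) <= 0"
 proof (rule maximum_principle_Re[where S = S and w = w and f = "\<lambda>w. h w - h' w - of_real (27/2 * delta)"])
  show "open S" "bounded S" using open_D b.open_D bounded_D by (auto simp: S_def intro: bounded_subset)
  show "(\<lambda>w. h w - h' w - of_real (27/2 * delta)) holomorphic_on S"
   using H(1) H'(1) by (auto intro!: holomorphic_intros intro: holomorphic_on_subset simp: S_def)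
  show "w \<in> S" using w by (simp add: S_def)
  fix x assume x: "x \<in> frontier S"
  have "closure S \<subseteq> closure D" "closure S \<subseteq> closure b.D" by (auto simp: S_def intro!: closure_mono)
  then have x1: "\<bar>Re x\<bar> <= L" "- 1 - W (Re x) <= Im x" "Im x <= U (Re x)" "- 1 - W' (Re x) <= Im x" "Im x <= U' (Re x)"
   using x closure_D b.closure_D by (auto simp: frontier_def)
  have "x \<notin> S" using x \<open>open S\<close> by (simp add: frontier_def interior_open)
  then consider "\<bar>Re x\<bar> = L" | "Im x = U (Re x) \<or> Im x = U' (Re x)" | "Im x = - 1 - W (Re x) \<or> Im x = - 1 - W' (Re x)"
   using x1 by (force simp: S_def cellD_def)
  then show "\<exists>m. isCont m x & m x <= 0 & (\<forall>w\<in>S. Re (h w - h' w - of_real (27/2 * delta)) <= m w)"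
  proof cases
   case 1
   show ?thesis
   proof (intro exI[of _ "\<lambda>w. 4 * (L - \<bar>Re w\<bar>)"] conjI ballI)
    fix w assume "w \<in> S"
    then have "\<bar>Re (h w) - (Im w + 1)\<bar> <= 2 * (L - \<bar>Re w\<bar>)" "\<bar>Re (h' w) - (Im w + 1)\<bar> <= 2 * (L - \<bar>Re w\<bar>)"
     using H(6) H'(6) by (auto simp: S_def)
    then show "Re (h w - h' w - of_real (27/2 * delta)) <= 4 * (L - \<bar>Re w\<bar>)" using delta0 by simp
   qed (use 1 in \<open>auto intro!: continuous_intros\<close>)
  next
   case 2
   show ?thesis
   proof (intro exI[of _ "\<lambda>w. 27/2 * (U' (Re w) - Im w) - 27/2 * delta"] conjI ballI)
    show "isCont (\<lambda>w. 27/2 * (U' (Re w) - Im w) - 27/2 * delta) x"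
     by (intro continuous_intros isCont_Re_compose b.U_cont linear_continuous_at[OF bounded_linear_Im])
    show "27/2 * (U' (Re x) - Im x) - 27/2 * delta <= 0" using 2 delta(1)[OF x1(1)] delta0 by auto
    fix w assume "w \<in> S"
    then show "Re (h w - h' w - of_real (27/2 * delta)) <= 27/2 * (U' (Re w) - Im w) - 27/2 * delta"
     using H(3)[of w] H'(4)[of w] by (auto simp: S_def)
   qed
  next
   case 3
   show ?thesis
   proof (intro exI[of _ "\<lambda>w. 27/2 * (Im w + 1 + W (Re w)) - 27/2 * delta"] conjI ballI)
    show "isCont (\<lambda>w. 27/2 * (Im w + 1 + W (Re w)) - 27/2 * delta) x"
     by (intro continuous_intros isCont_Re_compose bot.U_cont linear_continuous_at[OF bounded_linear_Im])
    show "27/2 * (Im x + 1 + W (Re x)) - 27/2 * delta <= 0" using 3 delta(2)[OF x1(1)] delta0 by auto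
    fix w assume "w \<in> S"
    then show "Re (h w - h' w - of_real (27/2 * delta)) <= 27/2 * (Im w + 1 + W (Re w)) - 27/2 * delta"
     using H(5)[of w] H'(2)[of w] by (auto simp: S_def)
   qed
  qed
 qed
 then show ?thesis by simp
qed

text \<open>Schwarz reflection: conjugation before and after h cancels the antiholomorphic
  character, and the linear coefficient enters conjugated.\<close>

lemma has_field_derivative_cnj_affine:
 assumes "(h has_field_derivative D) (at (a * cnj w + b))"
 shows "((\<lambda>w. cnj (h (a * cnj w + b))) has_field_derivative cnj (a * D)) (at w)"
proof -
 have 1: "((\<lambda>w. a * cnj w + b) has_derivative (\<lambda>x. a * cnj x)) (at w)"
  by (auto intro!: derivative_eq_intros bounded_linear.has_derivative[OF bounded_linear_cnj])
 have 2: "(h has_derivative (\<lambda>x. D * x)) (at (a * cnj w + b))"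
  using assms by (simp add: has_field_derivative_def)
 have "((\<lambda>w. h (a * cnj w + b)) has_derivative (\<lambda>x. D * (a * cnj x))) (at w)"
  using has_derivative_compose[OF 1 2] .
 from bounded_linear.has_derivative[OF bounded_linear_cnj this]
 have "((\<lambda>w. cnj (h (a * cnj w + b))) has_derivative (\<lambda>x. cnj (D * (a * cnj x)))) (at w)" .
 also have "(\<lambda>x. cnj (D * (a * cnj x))) = (*) (cnj (a * D))" by (auto simp: mult_ac)
 finally show ?thesis by (simp only: has_field_derivative_def)
qed

text \<open>Turning the cell upside down exchanges the graphs, and subtracting the conjugate from 1
  exchanges the boundary values 0 and 1. In this way estimates at the upper graph carry over to the
  lower one.\<close>

lemma is_potential_swap:
 assumes c: "cell L K U p W q" and h: "is_potential L U W h"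
 defines "h' \<equiv> (\<lambda>w. 1 - cnj (h (1 * cnj w + (- \<i>))))"
 shows "is_potential L W U h'"
  and "\<And>w. w \<in> cellD L W U ==> cnj w - \<i> \<in> cellD L U W"
  and "\<And>w. w \<in> cellD L W U ==> deriv h' w = - cnj (deriv h (cnj w - \<i>))"
  and "\<And>w. w \<in> cellD L W U ==> deriv (deriv h') w = - cnj (deriv (deriv h) (cnj w - \<i>))"
proof -
 interpret cell L K U p W q by fact
 interpret sw: cell L K W q U p by (rule swap)
 note H = is_potentialD[OF h]
 show flip: "cnj w - \<i> \<in> D" if "w \<in> sw.D" for w using sw.in_D[OF that] by (simp add: cellD_def)
 have d1: "(h has_field_derivative deriv h w) (at w)" "(deriv h has_field_derivative deriv (deriv h) w) (at w)" if "w \<in> D" for w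
  using H(1) open_D that by (auto intro!: holomorphic_derivI[where S = D] holomorphic_deriv)
 have d2: "(h' has_field_derivative - cnj (deriv h (cnj w - \<i>))) (at w)" if "w \<in> sw.D" for w
  unfolding h'_def
  using has_field_derivative_cnj_affine[of h "deriv h (cnj w - \<i>)" 1 w "- \<i>"] d1(1)[OF flip[OF that]]
  by (auto intro!: derivative_eq_intros)
 show dd: "deriv h' w = - cnj (deriv h (cnj w - \<i>))" if "w \<in> sw.D" for w
  using d2[OF that] by (rule DERIV_imp_deriv)
 show "deriv (deriv h') w = - cnj (deriv (deriv h) (cnj w - \<i>))" if w: "w \<in> sw.D" for w
 proof (rule DERIV_imp_deriv)
  have "((\<lambda>w. - cnj (deriv h (1 * cnj w + (- \<i>)))) has_field_derivative - cnj (deriv (deriv h) (cnj w - \<i>))) (at w)"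
   using has_field_derivative_cnj_affine[of "deriv h" "deriv (deriv h) (cnj w - \<i>)" 1 w "- \<i>"] d1(2)[OF flip[OF w]]
   by (auto intro!: derivative_eq_intros)
  then show "(deriv h' has_field_derivative - cnj (deriv (deriv h) (cnj w - \<i>))) (at w)"
   by (rule has_field_derivative_transform_within_open[OF _ sw.open_D w]) (use dd in auto)
 qed
 show "is_potential L W U h'" unfolding is_potential_def
 proof (intro conjI ballI)
  show "h' holomorphic_on sw.D" using d2 sw.open_D by (meson holomorphic_on_open)
  fix w assume w: "w \<in> sw.D"
  have Re: "Re (h' w) = 1 - Re (h (cnj w - \<i>))" by (simp add: h'_def)
  note B = H(2)[OF flip[OF w]] H(3)[OF flip[OF w]] H(4)[OF flip[OF w]] H(5)[OF flip[OF w]] H(6)[OF flip[OF w]]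
  show "0 <= Re (h' w)" "Re (h' w) <= 1" using B unfolding Re by auto
  show "1 - Re (h' w) <= 27/2 * (W (Re w) - Im w)" using B(4) unfolding Re by simp
  show "Re (h' w) <= 27/2 * (Im w + 1 + U (Re w))" using B(3) unfolding Re by simp
  show "\<bar>Re (h' w) - (Im w + 1)\<bar> <= 2 * (L - \<bar>Re w\<bar>)" using B(5) unfolding Re by simp
 qed
qed

locale potential = cell L K U p W q for L K U p W q +
 fixes h :: "complex => complex"
 assumes pot: "is_potential L U W h"
begin

lemmas H = is_potentialD[OF pot]

lemma h_deriv: "w \<in> D ==> (h has_field_derivative deriv h w) (at w)"
 and h_deriv2: "w \<in> D ==> (deriv h has_field_derivative deriv (deriv h) w) (at w)"
 using H(1) open_D by (auto intro!: holomorphic_derivI[where S = D] holomorphic_deriv)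

lemma flip_even: "w \<in> D ==> - cnj w \<in> D"
 by (simp add: cellD_def U_even bot.U_even)

text \<open>The function reflected in the imaginary axis is a potential of the same cell, and
  stability with delta = 0 identifies the real parts.\<close>

lemma Re_h_even: assumes w: "w \<in> D" shows "Re (h (- cnj w)) = Re (h w)"
proof -
 define h' where "h' = (\<lambda>w. cnj (h ((-1) * cnj w + 0)))"
 have d: "(h' has_field_derivative cnj ((-1) * deriv h (- cnj w))) (at w)" if "w \<in> D" for w
  unfolding h'_def by (rule has_field_derivative_cnj_affine) (use h_deriv[OF flip_even[OF that]] in simp)
 have p': "is_potential L U W h'" unfolding is_potential_def
 proof (intro conjI ballI)
  show "h' holomorphic_on D" using d open_D by (meson holomorphic_on_open)
  fix w assume w: "w \<in> D"
  note B = H(2)[OF flip_even[OF w]] H(3)[OF flip_even[OF w]] H(4)[OF flip_even[OF w]] H(5)[OF flip_even[OF w]] H(6)[OF flip_even[OF w]]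
  show "0 <= Re (h' w)" "Re (h' w) <= 1" "1 - Re (h' w) <= 27/2 * (U (Re w) - Im w)"
   "Re (h' w) <= 27/2 * (Im w + 1 + W (Re w))" "\<bar>Re (h' w) - (Im w + 1)\<bar> <= 2 * (L - \<bar>Re w\<bar>)"
   using B by (auto simp: h'_def U_even bot.U_even)
 qed
 have c: "cell L K U p W q" by unfold_locales
 have "Re (h' w) - Re (h w) <= 27/2 * 0" "Re (h w) - Re (h' w) <= 27/2 * 0"
  by (rule potential_stability[OF c c]; use pot p' w in simp)+
 then show ?thesis by (simp add: h'_def)
qed

text \<open>Both graphs have slope at most 2/3. Over a distance r the vertical distance to a graph
  therefore changes by at most r + 2/3 * r, which is less than the available 2 * r.\<close>

lemma ball_in_D:
 assumes w: "w \<in> D" and r: "2 * r <= U (Re w) - Im w" "2 * r <= Im w + 1 + W (Re w)" "2 * r <= L - \<bar>Re w\<bar>"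
 shows "ball w r \<subseteq> D"
  and "\<And>v. v \<in> ball w r ==> \<bar>U (Re v) - Im v - (U (Re w) - Im w)\<bar> <= 5/3 * r"
proof -
 have *: "\<bar>Re v - Re w\<bar> < r & \<bar>Im v - Im w\<bar> < r & \<bar>Re v\<bar> < L" if "v \<in> ball w r" for v
  using that abs_Re_le_cmod[of "v - w"] abs_Im_le_cmod[of "v - w"] r(3) by (auto simp: dist_norm norm_minus_commute)
 have XL: "\<bar>Re w\<bar> <= L" using in_D[OF w] by simp
 show A: "\<bar>U (Re v) - Im v - (U (Re w) - Im w)\<bar> <= 5/3 * r" if "v \<in> ball w r" for v
  using *[OF that] U_lip[of "Re w" "Re v"] U_lip[of "Re v" "Re w"] XL by argo
 have B: "\<bar>W (Re v) + Im v - (W (Re w) + Im w)\<bar> <= 5/3 * r" if "v \<in> ball w r" for v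
  using *[OF that] bot.U_lip[of "Re w" "Re v"] bot.U_lip[of "Re v" "Re w"] XL by argo
 show "ball w r \<subseteq> D"
 proof
  fix v assume v: "v \<in> ball w r"
  then have "r > 0" by (metis ball_eq_empty empty_iff not_le)
  then have "Im v < U (Re v)" "- 1 - W (Re v) < Im v" using A[OF v] B[OF v] r by linarith+
  then show "v \<in> D" using *[OF v] by (simp add: cellD_def)
 qed
qed

text \<open>The ball has half the smallest distance to the three kinds of boundary as radius. On it
  the real part differs from the boundary value by at most 27/2 * 11/6 * delta, which is below 27 *
  delta, and 8 * 27 * 2 = 432. Near a vertical side adding \<i> * w removes the datum Im w +
  1.\<close>

lemma deriv_h_bound: assumes w: "w \<in> D" shows "cmod (deriv h w) <= 432"
proof -
 define delta where "delta = min (U (Re w) - Im w) (min (Im w + 1 + W (Re w)) (L - \<bar>Re w\<bar>))"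
 have delta: "delta > 0" using in_D[OF w] by (auto simp: delta_def)
 have sub: "ball w (delta / 2) \<subseteq> D" using ball_in_D(1)[OF w, of "delta / 2"] by (auto simp: delta_def)
 have hb: "h holomorphic_on ball w (delta / 2)" using H(1) sub by (rule holomorphic_on_subset)
 have nb: "\<bar>U (Re v) - Im v - (U (Re w) - Im w)\<bar> <= 5/3 * (delta/2)" if "v \<in> ball w (delta / 2)" for v
  using ball_in_D(2)[OF w, of "delta / 2"] that by (auto simp: delta_def)
 have d2: "\<bar>Re v - Re w\<bar> < delta / 2 & \<bar>Im v - Im w\<bar> < delta / 2" if "v \<in> ball w (delta / 2)" for v
  using that abs_Re_le_cmod[of "v - w"] abs_Im_le_cmod[of "v - w"] by (auto simp: dist_norm norm_minus_commute)
 consider "delta = U (Re w) - Im w" | "delta = Im w + 1 + W (Re w)" | "delta = L - \<bar>Re w\<bar>" unfolding delta_def by linarith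
 then show ?thesis
 proof cases
  case 1
  have "cmod (deriv h w) <= 8 * (27 * delta) / (delta / 2)"
  proof (rule norm_deriv_le_Re_bound[OF hb, where c = 1])
   fix v assume v: "v \<in> ball w (delta / 2)"
   then have vD: "v \<in> D" using sub by auto
   show "\<bar>Re (h v) - 1\<bar> <= 27 * delta" using H(3)[OF vD] H(4)[OF vD] nb[OF v] 1 delta by argo
  qed (use delta in auto)
  then show ?thesis using delta by simp
 next
  case 2
  have "cmod (deriv h w) <= 8 * (27 * delta) / (delta / 2)"
  proof (rule norm_deriv_le_Re_bound[OF hb, where c = 0])
   fix v assume v: "v \<in> ball w (delta / 2)"
   then have vD: "v \<in> D" using sub by auto
   have "W (Re v) - W (Re w) <= 2/3 * \<bar>Re v - Re w\<bar>" using in_D(1)[OF w] in_D(1)[OF vD] by (intro bot.U_lip less_imp_le)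
   then show "\<bar>Re (h v) - 0\<bar> <= 27 * delta" using H(2)[OF vD] H(5)[OF vD] d2[OF v] 2 delta by argo
  qed (use delta in auto)
  then show ?thesis using delta by simp
 next
  case 3
  have "cmod (deriv (\<lambda>v. h v + \<i> * v) w) <= 8 * (3 * delta) / (delta / 2)"
  proof (rule norm_deriv_le_Re_bound[where c = 1])
   show "(\<lambda>v. h v + \<i> * v) holomorphic_on ball w (delta / 2)" using hb by (auto intro!: holomorphic_intros)
   fix v assume v: "v \<in> ball w (delta / 2)"
   then have vD: "v \<in> D" using sub by auto
   show "\<bar>Re (h v + \<i> * v) - 1\<bar> <= 3 * delta" using H(6)[OF vD] d2[OF v] 3 delta by (simp; argo)
  qed (use delta in auto)
  moreover have "deriv (\<lambda>v. h v + \<i> * v) w = deriv h w + \<i>"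
   using h_deriv[OF w] by (auto intro!: DERIV_imp_deriv derivative_eq_intros)
  ultimately have "cmod (deriv h w + \<i>) <= 48" using delta by simp
  then show ?thesis using norm_triangle_ineq4[of "deriv h w + \<i>" \<i>] by simp
 qed
qed

text \<open>The cell need not be convex. If the segment leaves it, then some point of the segment
  lies on or beyond one graph. Both endpoints have vertical distance at most 5/3 * |a - b| to that
  graph, so both values are close to the same boundary value.\<close>

lemma Re_h_lipschitz:
 assumes a: "a \<in> D" and b: "b \<in> D"
 shows "\<bar>Re (h a) - Re (h b)\<bar> <= 432 * cmod (a - b)"
proof (cases "closed_segment a b \<subseteq> D")
 case True
 have "cmod (h a - h b) <= 432 * cmod (a - b)"
 proof (rule field_differentiable_bound[OF convex_closed_segment])
  fix z assume "z \<in> closed_segment a b"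
  then have z: "z \<in> D" using True by auto
  show "(h has_field_derivative deriv h z) (at z within closed_segment a b)" 
   using h_deriv[OF z] by (rule has_field_derivative_at_within)
  show "cmod (deriv h z) <= 432" by (rule deriv_h_bound[OF z])
 qed auto
 then show ?thesis using abs_Re_le_cmod[of "h a - h b"] by simp
next
 case False
 then obtain v where v: "v \<in> closed_segment a b" "v \<notin> D" by auto
 have va: "cmod (a - v) <= cmod (a - b)" and vb: "cmod (b - v) <= cmod (a - b)"
  using v(1) by (metis dist_in_closed_segment dist_norm norm_minus_commute)+
 have seg: "Re v \<in> closed_segment (Re a) (Re b)"
 proof -
  obtain u where u: "0 <= u" "u <= 1" "v = (1 - u) *\<^sub>R a + u *\<^sub>R b" using v(1) by (auto simp: in_segment)
  then have "Re v = (1 - u) *\<^sub>R Re a + u *\<^sub>R Re b" by simp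
  then show ?thesis using u in_segment(1) by blast
 qed
 have X: "\<bar>Re a\<bar> < L" "\<bar>Re b\<bar> < L" using in_D(1) a b by auto
 then have Xv: "\<bar>Re v\<bar> < L" using seg by (auto simp: closed_segment_eq_real_ivl split: if_splits)
 have ra: "\<bar>Re a - Re v\<bar> <= cmod (a - b)" "\<bar>Im a - Im v\<bar> <= cmod (a - b)"
  using va abs_Re_le_cmod[of "a - v"] abs_Im_le_cmod[of "a - v"] by auto
 have rb: "\<bar>Re b - Re v\<bar> <= cmod (a - b)" "\<bar>Im b - Im v\<bar> <= cmod (a - b)"
  using vb abs_Re_le_cmod[of "b - v"] abs_Im_le_cmod[of "b - v"] by auto
 from v(2) Xv consider "Im v >= U (Re v)" | "Im v <= - 1 - W (Re v)" by (auto simp: cellD_def not_less)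
 then show ?thesis
 proof cases
  case 1
  have "U (Re a) - U (Re v) <= 2/3 * \<bar>Re a - Re v\<bar>" "U (Re b) - U (Re v) <= 2/3 * \<bar>Re b - Re v\<bar>"
   using X Xv U_lip[of "Re v" "Re a"] U_lip[of "Re v" "Re b"] by argo+
  then have "1 - Re (h a) <= 27/2 * (5/3 * cmod (a - b))" "1 - Re (h b) <= 27/2 * (5/3 * cmod (a - b))"
   using H(4)[OF a] H(4)[OF b] ra rb 1 by argo+
  then show ?thesis using H(3)[OF a] H(3)[OF b] norm_ge_zero[of "a - b"] unfolding abs_le_iff by linarith
 next
  case 2
  have "W (Re a) - W (Re v) <= 2/3 * \<bar>Re a - Re v\<bar>" "W (Re b) - W (Re v) <= 2/3 * \<bar>Re b - Re v\<bar>"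
   using X Xv bot.U_lip[of "Re v" "Re a"] bot.U_lip[of "Re v" "Re b"] by argo+
  then have "Re (h a) <= 27/2 * (5/3 * cmod (a - b))" "Re (h b) <= 27/2 * (5/3 * cmod (a - b))"
   using H(5)[OF a] H(5)[OF b] ra rb 2 by argo+
  then show ?thesis using H(2)[OF a] H(2)[OF b] norm_ge_zero[of "a - b"] unfolding abs_le_iff by linarith
 qed
qed

end

lemma powr_polar:
 fixes y :: complex
 assumes "y \<noteq> 0"
 shows "Re (y powr of_real s) = cmod y powr s * cos (s * Arg y)"
  "Im (y powr of_real s) = cmod y powr s * sin (s * Arg y)"
proof -
 have "y powr of_real s = exp (of_real s * Ln y)" using assms by (simp add: powr_def)
 moreover have "Ln y = of_real (ln (cmod y)) + \<i> * of_real (Arg y)" using assms by (simp add: Arg_eq_Im_Ln complex_eq_iff)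
 moreover have "cmod y powr s = exp (s * ln (cmod y))" using assms by (simp add: powr_def)
 ultimately show "Re (y powr of_real s) = cmod y powr s * cos (s * Arg y)"
  "Im (y powr of_real s) = cmod y powr s * sin (s * Arg y)"
  by (simp_all add: Re_exp Im_exp)
qed

text \<open>For y with modulus r and argument -t, 0 < t <= pi/2, the quantity is r^(1 + beta) sin
  ((1 + beta) t), and the addition theorem puts the sine between cos (beta pi / 2) sin t and 2 sin
  t. In a quarter plane every exponent below 2 thus gives a positive harmonic function that vanishes
  linearly on one side.\<close>

lemma corner_barrier_bounds:
 assumes y: "Re y >= 0" "Im y < 0" and beta: "0 < beta" "beta < 1"
 shows "cos (beta * pi / 2) * (cmod y powr beta * (- Im y)) <= - Im (y powr of_real (1 + beta))"
  and "- Im (y powr of_real (1 + beta)) <= 2 * (cmod y powr beta * (- Im y))"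
proof -
 have y0: "y \<noteq> 0" using y by auto
 define t where "t = - Arg y"
 have "Arg y < 0" using Arg_less_0[of y] y(2) by linarith
 moreover have "\<bar>Arg y\<bar> <= pi / 2" using Arg_Re_nonneg[of y] y(1) by blast
 ultimately have t: "0 < t" "t <= pi / 2" by (auto simp: t_def)
 have "Im y = cmod y * sin (Arg y)" by (metis Im_rcis rcis_cmod_Arg)
 then have e: "- Im y = cmod y * sin t" by (simp add: t_def)
 have s: "- Im (y powr of_real (1 + beta)) = cmod y powr beta * (cmod y * sin ((1 + beta) * t))"
  using y0 unfolding powr_polar(2)[OF y0] by (simp add: t_def powr_add)
 have bt: "0 <= beta * t" "beta * t <= t" "beta * t <= beta * (pi / 2)"
  using t beta mult_right_mono[of beta 1 t] mult_left_mono[of t "pi/2" beta] by auto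
 have sn: "sin ((1 + beta) * t) = sin t * cos (beta * t) + cos t * sin (beta * t)"
  by (simp add: ring_distribs sin_add)
 have "beta * t <= pi" "t <= pi" using bt t by linarith+
 then have st: "sin t >= 0" "cos t >= 0" "sin (beta * t) >= 0"
  using t bt(1) by (auto simp del: mult_nonneg_nonneg intro!: sin_ge_zero cos_ge_zero)
 have "cos (beta * (pi / 2)) <= cos (beta * t)" 
 proof (rule cos_monotone_0_pi_le)
  show "beta * (pi / 2) <= pi" using beta mult_right_mono[of beta 1 "pi/2"] pi_gt_zero by linarith
 qed (use bt in auto)
 then have "sin t * cos (beta * pi / 2) <= sin t * cos (beta * t)" using st by (intro mult_left_mono) auto
 then have lo: "cos (beta * pi / 2) * sin t <= sin ((1 + beta) * t)" unfolding sn using st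
  by (simp add: mult.commute add_increasing2)
 have "sin (beta * t) <= sin t" using bt t by (intro sin_monotone_2pi_le) auto
 then have "cos t * sin (beta * t) <= 1 * sin t" using st by (intro mult_mono) auto
 moreover have "sin t * cos (beta * t) <= sin t * 1" using st by (intro mult_left_mono) auto
 ultimately have hi: "sin ((1 + beta) * t) <= 2 * sin t" unfolding sn by simp
 show "cos (beta * pi / 2) * (cmod y powr beta * (- Im y)) <= - Im (y powr of_real (1 + beta))"
  unfolding s e using mult_left_mono[OF lo, of "cmod y powr beta * cmod y"] by (simp add: mult_ac)
 show "- Im (y powr of_real (1 + beta)) <= 2 * (cmod y powr beta * (- Im y))"
  unfolding s e using mult_left_mono[OF hi, of "cmod y powr beta * cmod y"] by (simp add: mult_ac)
qed

section \<open>Estimates at the corners\<close>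

lemma holomorphic_isCont: "f holomorphic_on S ==> open S ==> x \<in> S ==> isCont f x"
 using continuous_on_eq_continuous_at holomorphic_on_imp_continuous_on by blast

lemma isCont_corner_barrier:
 assumes "y x \<notin> \<real>\<^sub>\<le>\<^sub>0" "isCont y x"
 shows "isCont (\<lambda>w. Im (y w powr of_real (1 + beta))) x"
 by (rule continuous_Im, rule isCont_o2[OF assms(2) DERIV_isCont[OF has_field_derivative_powr[OF assms(1)]]])

context potential
begin

text \<open>The affine function equals the datum on the side Re w = L and differs from 1 on the
  graph by at most K / 2 * (Re w - L)^2: it is the first order expansion of the potential at the
  upper right corner. The rotated variable y takes values in the fourth quadrant with that side on
  the real axis, and a multiple of - Im (y^(1 + beta)) dominates the error.\<close>

lemma corner_estimate:
 assumes beta: "0 < beta" "beta < 1" and w: "w \<in> D"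
 shows "\<bar>Re (h w) - (1 + Im w - p L * (Re w - L))\<bar>
  <= 2 * (2 * L + 1) / cos (beta * pi / 2) * (cmod (of_real L - w) powr beta * (L - Re w))"
proof -
 define y where "y w = - \<i> * (of_real L - w)" for w
 have yR: "Re (y w) = - Im w" "Im (y w) = Re w - L" "cmod (y w) = cmod (of_real L - w)" for w
  by (auto simp: y_def norm_mult)
 define B where "B w = - Im (y w powr of_real (1 + beta))" for w
 define c where "c = cos (beta * pi / 2)"
 have c: "c > 0" unfolding c_def using beta by (intro cos_gt_zero) (auto simp: field_simps)
 define M where "M = (2 * L + 1) / c"
 have M: "M > 0" using c L by (simp add: M_def)
 have Bb: "c * (cmod (of_real L - w) powr beta * (L - Re w)) <= B w" "B w <= 2 * (cmod (of_real L - w) powr beta * (L - Re w))"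
  if "\<bar>Re w\<bar> < L" "Im w <= 0" for w
  using corner_barrier_bounds[of "y w" beta] that beta by (auto simp: yR B_def c_def)
 have MB: "(2 * L + 1) * (cmod (of_real L - w) powr beta * (L - Re w)) <= M * B w" if "\<bar>Re w\<bar> < L" "Im w <= 0" for w
 proof -
  have "M * (c * (cmod (of_real L - w) powr beta * (L - Re w))) <= M * B w"
   using Bb(1)[OF that] M by (intro mult_left_mono) auto
  then show ?thesis using c by (simp add: M_def)
 qed
 have MB0: "M * B w >= 0" if "w \<in> D" for w
 proof -
  have "(2 * L + 1) * (cmod (of_real L - w) powr beta * (L - Re w)) >= 0" using L in_D[OF that] by auto
  then show ?thesis using MB[of w] in_D[OF that] by linarith
 qed
 define ell where "ell w = 1 + Im w - p L * (Re w - L)" for w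
 have pL: "0 <= p L" "p L <= 2/3" using p_bound'[of L] p_mono[of 0 L] p_0 L by auto
 have side: "s * Re ((\<lambda>w. h w - (1 - \<i> * w - of_real (p L) * (w - of_real L))) w) - M * B w <= 0" if s: "s = 1 \<or> s = -1" for s
 proof -
  define F where "F = (\<lambda>w. of_real s * (h w - (1 - \<i> * w - of_real (p L) * (w - of_real L))) - of_real M * (\<i> * y w powr of_real (1 + beta)))"
  have FR: "Re (F w) = s * (Re (h w) - ell w) - M * B w" for w
   by (simp add: F_def ell_def B_def)
  have "Re (F w) <= 0"
  proof (rule maximum_principle_Re[OF open_D bounded_D _ _ w])
   have hp: "(\<lambda>w. y w powr of_real (1 + beta)) holomorphic_on D"
     unfolding holomorphic_on_def
    proof
     fix w assume w: "w \<in> D"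
     have "y w \<notin> \<real>\<^sub>\<le>\<^sub>0" using in_D(1)[OF w] by (auto simp: complex_nonpos_Reals_iff yR)
     moreover have "(y has_field_derivative \<i>) (at w)" unfolding y_def by (auto intro!: derivative_eq_intros)
     ultimately have "((\<lambda>w. y w powr of_real (1 + beta)) has_field_derivative (of_real (1 + beta) * y w powr (of_real (1 + beta) - 1)) * \<i>) (at w)"
      by (intro DERIV_chain2[OF has_field_derivative_powr])
     then show "(\<lambda>w. y w powr of_real (1 + beta)) field_differentiable (at w within D)"
      using field_differentiable_at_within field_differentiable_def by blast
    qed
   show "F holomorphic_on D" unfolding F_def
    by (intro holomorphic_on_diff holomorphic_on_mult holomorphic_on_const holomorphic_on_ident hp H(1))
   fix x assume x: "x \<in> frontier D"
   then have x1: "\<bar>Re x\<bar> <= L" "- 1 - W (Re x) <= Im x" "Im x <= U (Re x)"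
    using closure_D by (auto simp: frontier_def)
   have x0: "Im x <= 0" "- 1 <= Im x" using x1 U_nonpos[OF x1(1)] bot.U_nonpos[OF x1(1)] by linarith+
   have "x \<notin> D" using x open_D by (simp add: frontier_def interior_open)
   then consider "Re x = L" | "Re x = - L" | "\<bar>Re x\<bar> < L" "Im x = U (Re x)" | "\<bar>Re x\<bar> < L" "Im x = - 1 - W (Re x)"
    using x1 by (force simp: cellD_def)
   then show "\<exists>m. isCont m x & m x <= 0 & (\<forall>w\<in>D. Re (F w) <= m w)"
   proof cases
    case 1
    show ?thesis
    proof (intro exI[of _ "\<lambda>w. 2 * (L - \<bar>Re w\<bar>) + 2/3 * (L - Re w)"] conjI ballI)
     fix w assume w: "w \<in> D"
     have "p L * (L - Re w) <= 2/3 * (L - Re w)" "0 <= p L * (L - Re w)" 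
      using pL in_D(1)[OF w] mult_right_mono[of "p L" "2/3" "L - Re w"] by auto
     then have "s * (Re (h w) - ell w) <= 2 * (L - \<bar>Re w\<bar>) + 2/3 * (L - Re w)"
     proof -
      define a where "a = p L * (L - Re w)"
      have "ell w = 1 + Im w + a" by (simp add: ell_def a_def algebra_simps)
      moreover have "a <= 2/3 * (L - Re w)" "0 <= a"
       using \<open>p L * (L - Re w) <= 2/3 * (L - Re w)\<close> \<open>0 <= p L * (L - Re w)\<close> by (auto simp: a_def)
      ultimately have "Re (h w) - ell w <= 2 * (L - \<bar>Re w\<bar>) + 2/3 * (L - Re w)"
       "- (Re (h w) - ell w) <= 2 * (L - \<bar>Re w\<bar>) + 2/3 * (L - Re w)" using H(6)[OF w] by argo+
      then show ?thesis using s by auto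
     qed
     then show "Re (F w) <= 2 * (L - \<bar>Re w\<bar>) + 2/3 * (L - Re w)" using MB0[OF w] by (simp add: FR)
    qed (use 1 L in \<open>auto intro!: continuous_intros linear_continuous_at bounded_linear_Re\<close>)
   next
    \<comment> \<open>The opposite side has distance at least 1 from the corner. The factor 2 * L +
      1 in \<open>M\<close> makes the barrier exceed the crude bound 1 + |ell|.\<close>
    case 2
    have Bc: "isCont B x" unfolding B_def using 2 L
     by (intro continuous_minus isCont_corner_barrier) (auto simp: y_def complex_nonpos_Reals_iff intro!: continuous_intros)
    show ?thesis
    proof (intro exI[of _ "\<lambda>w. 1 + \<bar>ell w\<bar> - M * B w"] conjI ballI)
     show "isCont (\<lambda>w. 1 + \<bar>ell w\<bar> - M * B w) x" unfolding ell_def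
      by (intro continuous_intros Bc linear_continuous_at bounded_linear_Re bounded_linear_Im)
     fix w assume w: "w \<in> D"
     have "s * (Re (h w) - ell w) <= 1 + \<bar>ell w\<bar>" using H(2)[OF w] H(3)[OF w] s by auto
     then show "Re (F w) <= 1 + \<bar>ell w\<bar> - M * B w" by (simp add: FR)
    next
     have "p L * (2 * L) <= 2/3 * (2 * L)" "0 <= p L * (2 * L)" 
      using pL L mult_right_mono[of "p L" "2/3" "2 * L"] by auto
     then have e: "\<bar>ell x\<bar> <= 1 + 4/3 * L" using 2 x0 by (simp add: ell_def abs_le_iff algebra_simps)
     have "\<bar>Re (of_real L - x)\<bar> <= cmod (of_real L - x)" by (rule abs_Re_le_cmod)
     then have "1 <= cmod (of_real L - x)" using 2 L by simp
     then have R: "1 <= cmod (of_real L - x) powr beta" using beta by (intro ge_one_powr_ge_zero) auto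
     have Bx: "c * (cmod (of_real L - x) powr beta * (L - Re x)) <= B x"
      using corner_barrier_bounds(1)[of "y x" beta] 2 L x0 beta by (simp add: yR B_def c_def)
     have "M * (c * (1 * (2 * L))) <= M * (c * (cmod (of_real L - x) powr beta * (L - Re x)))"
      using R M c L 2 by (intro mult_left_mono mult_right_mono) auto
     also have "\<dots> <= M * B x" using Bx M by (intro mult_left_mono) auto
     also have "M * (c * (1 * (2 * L))) = (2 * L + 1) * (2 * L)" using c by (simp add: M_def)
     finally have "M * B x >= (2 * L + 1) * (2 * L)" .
     moreover have "(2 * L + 1) * (2 * L) >= 3 * (2 * L)" using L by (intro mult_right_mono) auto
     ultimately show "1 + \<bar>ell x\<bar> - M * B x <= 0" using e L by linarith
    qed
   next
    case 3
    have Bc: "isCont B x" unfolding B_def using 3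
     by (intro continuous_minus isCont_corner_barrier) (auto simp: y_def complex_nonpos_Reals_iff intro!: continuous_intros)
    show ?thesis
    proof (intro exI[of _ "\<lambda>w. \<bar>1 - ell w\<bar> + 27/2 * (U (Re w) - Im w) - M * B w"] conjI ballI)
     show "isCont (\<lambda>w. \<bar>1 - ell w\<bar> + 27/2 * (U (Re w) - Im w) - M * B w) x" unfolding ell_def
      by (intro continuous_intros Bc isCont_Re_compose[OF U_cont] linear_continuous_at bounded_linear_Re bounded_linear_Im)
     fix w assume w: "w \<in> D"
     have "s * (Re (h w) - ell w) <= \<bar>1 - ell w\<bar> + 27/2 * (U (Re w) - Im w)" 
     proof -
      have "Re (h w) - ell w <= \<bar>1 - ell w\<bar> + 27/2 * (U (Re w) - Im w)" "- (Re (h w) - ell w) <= \<bar>1 - ell w\<bar> + 27/2 * (U (Re w) - Im w)" using H(3)[OF w] H(4)[OF w] in_D(3)[OF w] by argo+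
      then show ?thesis using s by auto
     qed
     then show "Re (F w) <= \<bar>1 - ell w\<bar> + 27/2 * (U (Re w) - Im w) - M * B w" by (simp add: FR)
    next
     \<comment> \<open>On the graph the error is quadratic in e. One factor e is traded for R, and
       R^(1 - beta) <= 2 * L + 1 leaves the required power of R.\<close>
     define e where "e = L - Re x"
     define R where "R = cmod (of_real L - x)"
     have e: "e > 0" "e <= R" using 3 abs_Re_le_cmod[of "of_real L - x"] by (auto simp: e_def R_def)
     have "R <= \<bar>Re (of_real L - x)\<bar> + \<bar>Im (of_real L - x)\<bar>" unfolding R_def by (rule cmod_le)
     then have RL: "R <= 2 * L + 1" using 3 x0 by simp
     have "U (Re x) <= U L + p L * (Re x - L) + K / 2 * (Re x - L)\<^sup>2" "U L + p L * (Re x - L) <= U (Re x)"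
      by (rule U_le_parabola U_ge_tangent)+
     then have "\<bar>1 - ell x\<bar> <= K / 2 * (Re x - L)\<^sup>2" using 3 by (simp add: ell_def U_L abs_le_iff)
     also have "(Re x - L)\<^sup>2 = e * e" by (simp add: e_def power2_eq_square algebra_simps)
     also have "K / 2 * (e * e) <= 1 * (e * e)" using K_le e by (intro mult_right_mono) auto
     also have "1 * (e * e) <= e * R" using e by simp
     also have "e * R = e * (R powr (1 - beta) * R powr beta)" using e by (simp flip: powr_add)
     also have "\<dots> <= e * ((2 * L + 1) * R powr beta)"
     proof -
      have "R powr (1 - beta) <= (2 * L + 1) powr (1 - beta)" using RL e beta by (intro powr_mono2) auto
      also have "\<dots> <= (2 * L + 1) powr 1" using L beta by (intro powr_mono) auto
      finally have "R powr (1 - beta) <= 2 * L + 1" using L by simp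
      then show ?thesis using e by (intro mult_left_mono mult_right_mono) auto
     qed
     also have "\<dots> <= M * B x" using MB[of x] 3 x0 by (simp add: e_def R_def mult_ac)
     finally show "\<bar>1 - ell x\<bar> + 27/2 * (U (Re x) - Im x) - M * B x <= 0" using 3 by simp
    qed
   next
    case 4
    have Bc: "isCont B x" unfolding B_def using 4
     by (intro continuous_minus isCont_corner_barrier) (auto simp: y_def complex_nonpos_Reals_iff intro!: continuous_intros)
    show ?thesis
    proof (intro exI[of _ "\<lambda>w. \<bar>ell w\<bar> + 27/2 * (Im w + 1 + W (Re w)) - M * B w"] conjI ballI)
     show "isCont (\<lambda>w. \<bar>ell w\<bar> + 27/2 * (Im w + 1 + W (Re w)) - M * B w) x" unfolding ell_def
      by (intro continuous_intros Bc isCont_Re_compose[OF bot.U_cont] linear_continuous_at bounded_linear_Re bounded_linear_Im)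
     fix w assume w: "w \<in> D"
     have "s * (Re (h w) - ell w) <= \<bar>ell w\<bar> + 27/2 * (Im w + 1 + W (Re w))" 
     proof -
      have "Re (h w) - ell w <= \<bar>ell w\<bar> + 27/2 * (Im w + 1 + W (Re w))" "- (Re (h w) - ell w) <= \<bar>ell w\<bar> + 27/2 * (Im w + 1 + W (Re w))" using H(2)[OF w] H(5)[OF w] in_D(2)[OF w] by argo+
      then show ?thesis using s by auto
     qed
     then show "Re (F w) <= \<bar>ell w\<bar> + 27/2 * (Im w + 1 + W (Re w)) - M * B w" by (simp add: FR)
    next
     define e where "e = L - Re x"
     define R where "R = cmod (of_real L - x)"
     have e: "e > 0" using 4 by (auto simp: e_def)
     have Wx: "- 1/3 <= W (Re x)" by (rule bot.U_ge[OF x1(1)])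
     have Wl: "W L - W (Re x) <= 2/3 * \<bar>L - Re x\<bar>" "W (Re x) <= 0" using bot.U_lip[of "Re x" L] bot.U_nonpos[OF x1(1)] x1 L by auto
     have "p L * (L - Re x) <= 2/3 * (L - Re x)" "0 <= p L * (L - Re x)" 
      using pL 4 mult_right_mono[of "p L" "2/3" "L - Re x"] by auto
     then have "\<bar>ell x\<bar> <= 4/3 * e"
      using Wl 4 by (simp add: ell_def e_def bot.U_L abs_le_iff algebra_simps)
     also have "\<dots> <= (2 * L + 1) * (R powr beta * e)"
     proof -
      have "2/3 <= R" using abs_Im_le_cmod[of "of_real L - x"] 4 Wx by (simp add: R_def)
      then have "(2/3) powr beta <= R powr beta" using beta by (intro powr_mono2) auto
      moreover have "(2/3) powr 1 <= (2/3::real) powr beta" using beta by (intro powr_mono') auto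
      ultimately have "2/3 <= R powr beta" by simp
      then have "3 * (2/3) <= (2 * L + 1) * R powr beta" using L by (intro mult_mono) auto
      then have "2 * e <= (2 * L + 1) * R powr beta * e" using e by (intro mult_right_mono) auto
      then show ?thesis using e by (simp add: mult_ac)
     qed
     also have "\<dots> <= M * B x" using MB[of x] 4 x0 by (simp add: e_def R_def)
     finally show "\<bar>ell x\<bar> + 27/2 * (Im x + 1 + W (Re x)) - M * B x <= 0" using 4 by simp
    qed
   qed
  qed
  then show ?thesis by (simp add: FR ell_def)
 qed
 have "\<bar>Re (h w) - (1 + Im w - p L * (Re w - L))\<bar> <= M * B w"
  using side[of 1] side[of "-1"] by (simp add: abs_le_iff)
 also have "\<dots> <= M * (2 * (cmod (of_real L - w) powr beta * (L - Re w)))"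
  using Bb(2)[of w] in_D[OF w] M by (intro mult_left_mono) auto
 also have "\<dots> = 2 * (2 * L + 1) / c * (cmod (of_real L - w) powr beta * (L - Re w))"
  unfolding M_def by (simp only: times_divide_eq_left times_divide_eq_right mult_ac)
 finally show ?thesis by (simp only: c_def)
qed

end

text \<open>Schwarz reflection for a real part that tends to 0 at the flat side at a linear rate.
  Its odd extension is continuous on the unit circle and is approximated there by odd real parts of
  entire functions Q. The maximum principle on the half disc makes Q close to the given function,
  and on the full disc Q obeys the interior bound for second derivatives.\<close>

lemma deriv2_near_flat_boundary:
 fixes f :: "complex => complex"
 defines "half \<equiv> (\<lambda>c rho. ball c rho \<inter> {w. Re w < Re c})"
 assumes rho: "rho > 0" and f: "f holomorphic_on half c rho"
  and M: "\<And>w. w \<in> half c rho ==> \<bar>Re (f w)\<bar> <= M"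
  and A: "\<And>w. w \<in> half c rho ==> \<bar>Re (f w)\<bar> <= A * (Re c - Re w)"
  and w: "w \<in> half c (rho / 2)"
 shows "cmod (deriv (deriv f) w) <= 4096 * M / rho\<^sup>2"
proof -
 \<comment> \<open>After rescaling, the half disc has radius 4/3, so the arc of the unit circle lies
   in the domain. The point has modulus below 2/3 and hence distance 1/3 to that circle: 256 * 3^2 =
   2304, and 2304 * (4/3)^2 = 4096.\<close>
 define sigma where "sigma = 3/4 * rho"
 have sigma: "sigma > 0" using rho by (simp add: sigma_def)
 define T where "T = half 0 (4/3)"
 define F where "F z = f (c + of_real sigma * z)" for z
 have inT: "c + of_real sigma * z \<in> half c rho" if "z \<in> T" for z
 proof -
  have "sigma * cmod z < sigma * (4/3)" using that sigma by (intro mult_strict_left_mono) (auto simp: T_def half_def)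
  then have "cmod (of_real sigma * z) < rho" using sigma by (simp add: norm_mult sigma_def)
  moreover have "sigma * Re z < 0" using that sigma by (simp add: T_def half_def mult_pos_neg)
  ultimately show ?thesis by (simp add: half_def dist_norm)
 qed
 have openT: "open T" by (auto simp: T_def half_def intro!: open_Int open_halfspace_Re_lt)
 have oph: "open (half c rho)" by (auto simp: half_def intro!: open_Int open_halfspace_Re_lt)
 have Fh: "F holomorphic_on T" unfolding F_def
  by (rule holomorphic_on_compose_gen[of "\<lambda>z. c + of_real sigma * z" T f "half c rho", unfolded o_def])
   (use f inT in \<open>auto intro!: holomorphic_intros\<close>)
 have FM: "\<bar>Re (F z)\<bar> <= M" if "z \<in> T" for z using M[OF inT[OF that]] by (simp add: F_def)
 have FA: "\<bar>Re (F z)\<bar> <= A * sigma * (- Re z)" if "z \<in> T" for z using A[OF inT[OF that]] by (simp add: F_def)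
 define rf0 where "rf0 z = (if Re z < 0 then Re (F z) else 0)" for z
 have rf0c: "isCont rf0 z" if z: "z \<in> ball 0 (4/3)" for z
 proof -
  consider "Re z < 0" | "Re z > 0" | "Re z = 0" by linarith
  then show ?thesis
  proof cases
   case 1
   then have zT: "z \<in> T" using z by (simp add: T_def half_def)
   have "isCont (\<lambda>z. Re (F z)) z"
    by (intro continuous_Re holomorphic_isCont[OF Fh openT zT])
   moreover have "eventually (\<lambda>y. rf0 y = Re (F y)) (nhds z)"
    using eventually_nhds_in_open[OF openT zT] by eventually_elim (auto simp: rf0_def T_def half_def)
   ultimately show ?thesis by (simp add: isCont_cong)
  next
   case 2
   have "eventually (\<lambda>y. rf0 y = 0) (nhds z)"
    using eventually_nhds_in_open[OF open_halfspace_Re_gt[of 0], of z] 2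
    by (auto elim!: eventually_mono simp: rf0_def)
   then show ?thesis using isCont_cong[of rf0 "\<lambda>_. 0" z] by simp
  next
   case 3
   have rf0z: "rf0 z = 0" using 3 by (simp add: rf0_def)
   have "(rf0 \<longlongrightarrow> 0) (at z)"
   proof (rule Lim_null_comparison)
    show "eventually (\<lambda>y. norm (rf0 y) <= \<bar>A * sigma\<bar> * \<bar>Re y\<bar>) (at z)"
    proof -
     have "eventually (\<lambda>y. y \<in> ball 0 (4/3)) (at z)" using z by (intro eventually_at_in_open') auto
     then show ?thesis
     proof eventually_elim
      case (elim y)
      show ?case
      proof (cases "Re y < 0")
       case True
       then have "\<bar>Re (F y)\<bar> <= A * sigma * (- Re y)" using elim by (intro FA) (simp add: T_def half_def)
       also have "\<dots> <= \<bar>A * sigma\<bar> * (- Re y)" using True by (intro mult_right_mono) auto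
       finally show ?thesis using True by (simp add: rf0_def)
      qed (auto simp: rf0_def)
     qed
    qed
    have "((\<lambda>y. \<bar>A * sigma\<bar> * \<bar>Re y\<bar>) \<longlongrightarrow> \<bar>A * sigma\<bar> * \<bar>Re z\<bar>) (at z)" by (intro tendsto_intros)
    then show "((\<lambda>y. \<bar>A * sigma\<bar> * \<bar>Re y\<bar>) \<longlongrightarrow> 0) (at z)" using 3 by simp
   qed
   then show ?thesis using rf0z by (simp add: isCont_def)
  qed
 qed
 define psi where "psi z = rf0 z - rf0 (- cnj z)" for z
 have psic: "continuous_on (sphere 0 1) psi"
 proof (rule continuous_at_imp_continuous_on, rule ballI)
  fix z :: complex assume z: "z \<in> sphere 0 1"
  have "isCont (\<lambda>z. rf0 (- cnj z)) z"
   by (rule isCont_o2[where g = rf0]) (use z in \<open>auto intro!: rf0c continuous_intros\<close>)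
  then show "isCont psi z" unfolding psi_def using rf0c[of z] z by (intro continuous_diff) auto
 qed
 define zeta where "zeta = (w - c) / of_real sigma"
 have wzeta: "w = c + of_real sigma * zeta" using sigma by (simp add: zeta_def)
 have zeta: "cmod zeta < 2/3" "Re zeta < 0"
 proof -
  have "cmod (w - c) < rho / 2" "Re w < Re c" using w by (auto simp: half_def dist_norm norm_minus_commute)
  moreover have "cmod zeta = cmod (w - c) / sigma" using sigma by (simp add: zeta_def norm_divide)
  moreover have "Re zeta = (Re w - Re c) / sigma" using sigma by (simp add: zeta_def)
  moreover have "cmod (w - c) / sigma < (rho / 2) / sigma" using sigma calculation(1) by (intro divide_strict_right_mono)
  moreover have "(rho / 2) / sigma = 2/3" using rho by (simp add: sigma_def)
  ultimately show "cmod zeta < 2/3" "Re zeta < 0" using sigma by (auto simp: divide_neg_pos)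
 qed
 have zetaT: "zeta \<in> T" using zeta by (simp add: T_def half_def)
 define Hf where "Hf = half (0::complex) 1"
 have openH: "open Hf" "bounded Hf" by (auto simp: Hf_def half_def intro!: open_Int open_halfspace_Re_lt bounded_Int)
 have HT: "Hf \<subseteq> T" by (auto simp: Hf_def T_def half_def)
 have zetaH: "zeta \<in> Hf" using zeta by (simp add: Hf_def half_def)
 obtain delta where delta: "delta > 0" "ball zeta delta \<subseteq> Hf" using openH(1) zetaH open_contains_ball by blast
 have M0: "M >= 0" using FM[OF zetaT] by linarith
 have main: "cmod (deriv (deriv F) zeta) <= 2304 * (M + eta) + 256 * eta / delta\<^sup>2" if eta: "eta > 0" for eta
 proof -
  obtain P where P: "P holomorphic_on UNIV" "\<And>z. z \<in> sphere 0 1 ==> \<bar>psi z - Re (P z)\<bar> < eta"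
   using circle_approximation[OF psic eta] by blast
  \<comment> \<open>Antisymmetrising makes the real part odd under the reflection taking z to - cnj
    z, hence 0 on the imaginary axis.\<close>
  define Q where "Q z = (P z - cnj (P ((-1) * cnj z + 0))) / 2" for z
  have dP: "(P has_field_derivative deriv P z) (at z)" for z using P(1) holomorphic_derivI[OF P(1) open_UNIV] by auto
  have "(Q has_field_derivative (deriv P z - cnj ((-1) * deriv P ((-1) * cnj z + 0))) / 2) (at z)" for z
   unfolding Q_def by (rule DERIV_cdivide, rule DERIV_diff, rule dP, rule has_field_derivative_cnj_affine, rule dP)
  then have Qh: "Q holomorphic_on A" for A
   by (meson holomorphic_on_open holomorphic_on_subset open_UNIV subset_UNIV)
  have QR: "Re (Q z) = (Re (P z) - Re (P (- cnj z))) / 2" for z by (simp add: Q_def)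
  have Qs: "\<bar>Re (Q z) - psi z\<bar> <= eta" if z: "z \<in> sphere 0 1" for z
  proof -
   have "psi (- cnj z) = - psi z" by (simp add: psi_def)
   then have "\<bar>- psi z - Re (P (- cnj z))\<bar> < eta" using P(2)[of "- cnj z"] z by simp
   moreover have "\<bar>psi z - Re (P z)\<bar> < eta" using P(2) z by simp
   ultimately show ?thesis unfolding QR by argo
  qed
  have Qc: "isCont Q z" for z by (rule holomorphic_isCont[OF Qh open_UNIV]) simp
  have cmp: "s * Re (F z - Q z) <= eta" if z: "z \<in> Hf" and s: "s = 1 \<or> s = -1" for s z
  proof -
   define E where "E = (\<lambda>z. of_real s * (F z - Q z) - of_real eta)"
   have "Re (E z) <= 0"
   proof (rule maximum_principle_Re[OF openH _ _ z])
    show "E holomorphic_on Hf" unfolding E_def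
     using holomorphic_on_subset[OF Fh HT] Qh[of Hf] by (intro holomorphic_intros)
    fix x assume x: "x \<in> frontier Hf"
    have "closure Hf \<subseteq> cball 0 1 \<inter> {z. Re z <= 0}"
     by (rule closure_minimal) (auto simp: Hf_def half_def closed_halfspace_Re_le)
    then have x1: "cmod x <= 1" "Re x <= 0" using x by (auto simp: frontier_def)
    have "x \<notin> Hf" using x openH by (simp add: frontier_def interior_open)
    then consider "Re x = 0" | "cmod x = 1" "Re x < 0" using x1 by (force simp: Hf_def half_def)
    then show "\<exists>m. isCont m x & m x <= 0 & (\<forall>w\<in>Hf. Re (E w) <= m w)"
    proof cases
     case 1
     show ?thesis
     proof (intro exI[of _ "\<lambda>z. A * sigma * (- Re z) - s * Re (Q z) - eta"] conjI ballI)
      show "isCont (\<lambda>z. A * sigma * (- Re z) - s * Re (Q z) - eta) x"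
       by (intro continuous_intros continuous_Re Qc linear_continuous_at bounded_linear_Re)
      have "- cnj x = x" using 1 by (simp add: complex_eq_iff)
      then have "Re (Q x) = 0" by (simp add: QR)
      then show "A * sigma * (- Re x) - s * Re (Q x) - eta <= 0" using 1 eta by simp
      fix v assume "v \<in> Hf"
      then have "\<bar>Re (F v)\<bar> <= A * sigma * (- Re v)" using FA HT by blast
      then show "Re (E v) <= A * sigma * (- Re v) - s * Re (Q v) - eta" using s by (auto simp: E_def)
     qed
    next
     case 2
     then have xT: "x \<in> T" by (simp add: T_def half_def)
     have "isCont F x" by (rule holomorphic_isCont[OF Fh openT xT])
     then have "isCont (\<lambda>z. Re (E z)) x" unfolding E_def by (intro continuous_Re continuous_intros Qc)
     moreover have "psi x = Re (F x)" using 2 by (simp add: psi_def rf0_def)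
     then have "\<bar>Re (Q x) - Re (F x)\<bar> <= eta" using Qs[of x] 2 by simp
     then have "Re (E x) <= 0" using s by (auto simp: E_def)
     ultimately show ?thesis by blast
    qed
   qed
   then show ?thesis by (simp add: E_def)
  qed
  have cmpa: "\<bar>Re (F z) - Re (Q z)\<bar> <= eta" if "z \<in> Hf" for z using cmp[OF that, of 1] cmp[OF that, of "-1"] by simp
  have Qb: "\<bar>Re (Q z) - 0\<bar> <= M + eta" if z: "z \<in> ball 0 1" for z
  proof -
   have neg: "\<bar>Re (Q z)\<bar> <= M + eta" if "z \<in> Hf" for z using cmpa[OF that] FM[of z] HT that by fastforce
   consider "Re z < 0" | "Re z = 0" | "Re z > 0" by linarith
   then show ?thesis
   proof cases
    case 1 then show ?thesis using neg[of z] z by (simp add: Hf_def half_def)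
   next
    case 2
    have "- cnj z = z" using 2 by (simp add: complex_eq_iff)
    then have "Re (Q z) = 0" by (simp add: QR)
    then show ?thesis using M0 eta by simp
   next
    case 3
    have "Re (Q z) = - Re (Q (- cnj z))" by (simp add: QR field_simps)
    moreover have "- cnj z \<in> Hf" using 3 z by (simp add: Hf_def half_def)
    ultimately show ?thesis using neg[of "- cnj z"] by simp
   qed
  qed
  have "cmod (deriv (deriv Q) zeta) <= 256 * (M + eta) / (1/3)\<^sup>2"
  proof (rule norm_deriv_deriv_le_Re_bound[OF Qh, where c = 0])
   fix z assume "z \<in> ball zeta (1/3)"
   then have "z \<in> ball 0 1" using zeta(1) dist_triangle[of 0 z zeta] by auto
   then show "\<bar>Re (Q z) - 0\<bar> <= M + eta" by (rule Qb)
  qed auto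
  moreover have "cmod (deriv (deriv (\<lambda>z. F z - Q z)) zeta) <= 256 * eta / delta\<^sup>2"
  proof (rule norm_deriv_deriv_le_Re_bound[where c = 0])
   show "(\<lambda>z. F z - Q z) holomorphic_on ball zeta delta"
    by (rule holomorphic_on_diff[OF holomorphic_on_subset[OF Fh] Qh]) (use HT delta(2) in auto)
   show "\<bar>Re (F x - Q x) - 0\<bar> <= eta" if "x \<in> ball zeta delta" for x using cmpa[of x] that delta(2) by auto
  qed (use delta in auto)
  moreover have "deriv (deriv (\<lambda>z. F z - Q z)) zeta = deriv (deriv F) zeta - deriv (deriv Q) zeta"
  proof (rule DERIV_imp_deriv)
   have dF: "(F has_field_derivative deriv F z) (at z)" "(deriv F has_field_derivative deriv (deriv F) z) (at z)" if "z \<in> T" for z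
    using Fh openT that by (auto intro!: holomorphic_derivI[where S = T] holomorphic_deriv)
   have dQ: "(Q has_field_derivative deriv Q z) (at z)" "(deriv Q has_field_derivative deriv (deriv Q) z) (at z)" for z
    using Qh[of UNIV] by (auto intro!: holomorphic_derivI[where S = UNIV] holomorphic_deriv)
   have e: "deriv (\<lambda>z. F z - Q z) z = deriv F z - deriv Q z" if "z \<in> T" for z
    by (rule DERIV_imp_deriv, rule DERIV_diff[OF dF(1)[OF that] dQ(1)])
   have "((\<lambda>z. deriv F z - deriv Q z) has_field_derivative deriv (deriv F) zeta - deriv (deriv Q) zeta) (at zeta)"
    by (rule DERIV_diff[OF dF(2)[OF zetaT] dQ(2)])
   then show "(deriv (\<lambda>z. F z - Q z) has_field_derivative deriv (deriv F) zeta - deriv (deriv Q) zeta) (at zeta)"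
    by (rule has_field_derivative_transform_within_open[OF _ openT zetaT]) (use e in auto)
  qed
  ultimately have "cmod (deriv (deriv F) zeta - deriv (deriv Q) zeta) <= 256 * eta / delta\<^sup>2" "cmod (deriv (deriv Q) zeta) <= 2304 * (M + eta)"
   by (simp_all add: power2_eq_square)
  then show ?thesis using norm_triangle_ineq[of "deriv (deriv F) zeta - deriv (deriv Q) zeta" "deriv (deriv Q) zeta"] by simp
 qed
 have "cmod (deriv (deriv F) zeta) <= 2304 * M"
 proof -
  have "(\<lambda>n. 2304 * (M + 1 / real (Suc n)) + 256 * (1 / real (Suc n)) / delta\<^sup>2) \<longlonglongrightarrow> 2304 * (M + 0) + 256 * 0 / delta\<^sup>2"
   using delta by (intro tendsto_intros LIMSEQ_Suc[OF lim_1_over_n]) auto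
  then have "cmod (deriv (deriv F) zeta) <= 2304 * (M + 0) + 256 * 0 / delta\<^sup>2"
   by (rule LIMSEQ_le_const) (intro exI allI impI main, simp)
  then show ?thesis by simp
 qed
 moreover have "deriv (deriv F) zeta = (of_real sigma)\<^sup>2 * deriv (deriv f) w"
 proof (rule DERIV_imp_deriv)
  have df: "(f has_field_derivative deriv f z) (at z)" "(deriv f has_field_derivative deriv (deriv f) z) (at z)" if "z \<in> half c rho" for z
   using f oph that by (auto intro!: holomorphic_derivI[where S = "half c rho"] holomorphic_deriv)
  have lin: "((\<lambda>z. c + of_real sigma * z) has_field_derivative of_real sigma) (at z)" for z by (auto intro!: derivative_eq_intros)
  have e: "deriv F z = of_real sigma * deriv f (c + of_real sigma * z)" if "z \<in> T" for z
   unfolding F_def using DERIV_chain2[OF df(1)[OF inT[OF that]] lin] by (intro DERIV_imp_deriv) (simp add: mult.commute)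
  have "((\<lambda>z. of_real sigma * deriv f (c + of_real sigma * z)) has_field_derivative of_real sigma * (deriv (deriv f) (c + of_real sigma * zeta) * of_real sigma)) (at zeta)"
   by (rule DERIV_cmult, rule DERIV_chain2[OF df(2)[OF inT[OF zetaT]] lin])
  then have "((\<lambda>z. of_real sigma * deriv f (c + of_real sigma * z)) has_field_derivative (of_real sigma)\<^sup>2 * deriv (deriv f) w) (at zeta)"
   by (simp add: wzeta power2_eq_square mult_ac)
  then show "(deriv F has_field_derivative (of_real sigma)\<^sup>2 * deriv (deriv f) w) (at zeta)"
   by (rule has_field_derivative_transform_within_open[OF _ openT zetaT]) (use e in auto)
 qed
 ultimately have "sigma\<^sup>2 * cmod (deriv (deriv f) w) <= 2304 * M" by (simp add: norm_mult norm_power)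
 then show ?thesis using rho by (simp add: sigma_def power2_eq_square field_simps)
qed

section \<open>Tangential derivatives along the boundary\<close>

text \<open>The sector exceeds a half plane by eta on either side, which is the room for the
  curvature of a graph. The power beta still maps it into the right half plane: beta * (pi/2 + eta)
  = pi/2 * beta * (3 - beta) / 2, and beta * (3 - beta) < 2.\<close>

lemma powr_sector_lower:
 fixes zeta :: complex
 assumes beta: "0 < beta" "beta < 1" and eta: "eta = pi * (1 - beta) / 4" and zeta: "zeta \<noteq> 0" "Re zeta >= - sin eta * cmod zeta"
 shows "cos (beta * (pi / 2 + eta)) * cmod zeta powr beta <= Re (zeta powr of_real beta)" "0 < cos (beta * (pi / 2 + eta))" "zeta \<notin> \<real>\<^sub>\<le>\<^sub>0"
  "Re (zeta powr of_real beta) <= cmod zeta powr beta"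
proof -
 have "0 < pi * (1 - beta)" "pi * (1 - beta) < pi * 1" using beta pi_gt_zero by (auto intro!: mult_strict_left_mono mult_pos_pos)
 then have e: "0 < eta" "eta < pi / 2" using pi_gt_zero by (auto simp: eta)
 have a: "\<bar>Arg zeta\<bar> <= pi / 2 + eta"
 proof (rule ccontr)
  assume *: "\<not> ?thesis"
  have "\<bar>Arg zeta\<bar> <= pi" using Arg_bounded[of zeta] by (simp add: abs_le_iff)
  then have "cos \<bar>Arg zeta\<bar> < cos (pi / 2 + eta)" using * e by (intro cos_monotone_0_pi) auto
  then have "cos (Arg zeta) < - sin eta" by (simp add: cos_add)
  then have "cmod zeta * cos (Arg zeta) < cmod zeta * (- sin eta)" using zeta by (intro mult_strict_left_mono) auto
  moreover have "Re zeta = cmod zeta * cos (Arg zeta)" by (metis Re_rcis rcis_cmod_Arg)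
  ultimately show False using zeta by (simp add: mult.commute)
 qed
 have "beta * (3 - beta) < 2"
 proof -
  have "0 < (1 - beta) * (2 - beta)" using beta by (intro mult_pos_pos) auto
  then show ?thesis by (simp add: algebra_simps)
 qed
 then have "beta * (3 - beta) / 2 * (pi / 2) < 1 * (pi / 2)" by (intro mult_strict_right_mono) auto
 moreover have "beta * (pi / 2 + eta) = beta * (3 - beta) / 2 * (pi / 2)" by (simp add: eta field_simps)
 ultimately have b: "beta * (pi / 2 + eta) < pi / 2" by linarith
 have b0: "0 <= beta * (pi / 2 + eta)" using beta e by simp
 show "0 < cos (beta * (pi / 2 + eta))" using b b0 pi_gt_zero by (intro cos_gt_zero_pi) linarith+
 have q: "beta * \<bar>Arg zeta\<bar> <= beta * (pi / 2 + eta)" using a beta by (intro mult_left_mono) auto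
 have "beta * (pi / 2 + eta) <= pi" "0 <= beta * \<bar>Arg zeta\<bar>" using b pi_gt_zero beta by (linarith, simp)
 then have "cos (beta * (pi / 2 + eta)) <= cos (beta * \<bar>Arg zeta\<bar>)" using cos_monotone_0_pi_le[OF _ q] by simp
 also have "cos (beta * \<bar>Arg zeta\<bar>) = cos (beta * Arg zeta)" by (cases "Arg zeta >= 0") auto
 finally show "cos (beta * (pi / 2 + eta)) * cmod zeta powr beta <= Re (zeta powr of_real beta)"
  unfolding powr_polar(1)[OF zeta(1)] by (subst mult.commute) (intro mult_left_mono; simp)
 show "Re (zeta powr of_real beta) <= cmod zeta powr beta" unfolding powr_polar(1)[OF zeta(1)]
  using mult_left_mono[of "cos (beta * Arg zeta)" 1 "cmod zeta powr beta"] by simp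
 show "zeta \<notin> \<real>\<^sub>\<le>\<^sub>0"
 proof
  assume "zeta \<in> \<real>\<^sub>\<le>\<^sub>0"
  then have "Re zeta = - cmod zeta" by (auto simp: complex_nonpos_Reals_iff cmod_eq_Re)
  then have "sin eta * cmod zeta >= 1 * cmod zeta" using zeta by simp
  then have "sin eta >= 1" using zeta(1) by (simp add: mult_le_cancel_right)
  moreover have "sin eta < sin (pi / 2)" using e by (intro sin_monotone_2pi) auto
  ultimately show False by simp
 qed
qed

text \<open>Within this distance of a boundary point the bend of the graph keeps the cell inside the
  sector of \<open>powr_sector_lower\<close>; the bound 1/8 keeps the ball away from the lower
  graph.\<close>

definition rad :: "real => real" where "rad beta = min (1/8) (sin (pi * (1 - beta) / 4))"

lemma rad_bounds: assumes "0 < beta" "beta < 1" shows "0 < rad beta" "rad beta <= 1/8" "rad beta <= sin (pi * (1 - beta) / 4)"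
proof -
 have "0 < sin (pi * (1 - beta) / 4)" using assms pi_gt_zero
  by (intro sin_gt_zero) (auto simp: field_simps intro: add_pos_pos)
 then show "0 < rad beta" "rad beta <= 1/8" "rad beta <= sin (pi * (1 - beta) / 4)" by (auto simp: rad_def)
qed

definition sector_const :: "real => real" where "sector_const beta = cos (beta * (pi / 2 + pi * (1 - beta) / 4))"

lemma isCont_cmod_powr: "beta > 0 ==> isCont (\<lambda>w. cmod (w - a) powr beta) x"
 unfolding isCont_def by (rule tendsto_powr2) (auto intro!: tendsto_intros)

context cell
begin

text \<open>The rotation by \<i> * cnj tau makes Re zeta the vertical depth below the tangent line.
  A point of the cell can rise above this line by at most K / 2 * d^2, and for small r this is
  within the aperture of the sector.\<close>

lemma sector_barrier:
 assumes beta: "0 < beta" "beta < 1" and X0: "\<bar>X0\<bar> <= L"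
  and x: "cmod (x - Complex X0 (U X0)) <= rad beta" "x \<noteq> Complex X0 (U X0)" "\<bar>Re x\<bar> <= L" "Im x <= U (Re x)"
 defines "zeta \<equiv> \<i> * (x - Complex X0 (U X0)) * cnj (Complex 1 (p X0))"
 shows "zeta \<notin> \<real>\<^sub>\<le>\<^sub>0" "sector_const beta > 0"
  "sector_const beta * cmod (x - Complex X0 (U X0)) powr beta <= Re (zeta powr of_real beta)"
  "Re (zeta powr of_real beta) <= 2 * cmod (x - Complex X0 (U X0)) powr beta"
proof -
 define r where "r = cmod (x - Complex X0 (U X0))"
 define d where "d = Re x - X0"
 have r: "0 < r" "r <= rad beta" using x by (auto simp: r_def)
 have d: "\<bar>d\<bar> <= r" using abs_Re_le_cmod[of "x - Complex X0 (U X0)"] by (simp add: d_def r_def)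
 have nt: "1 <= cmod (Complex 1 (p X0))" "cmod (Complex 1 (p X0)) <= 2"
  using abs_Re_le_cmod[of "Complex 1 (p X0)"] cmod_le[of "Complex 1 (p X0)"] p_bound'[OF X0] by auto
 have nz: "cmod zeta = r * cmod (Complex 1 (p X0))" by (simp add: zeta_def norm_mult r_def)
 have zr: "r <= cmod zeta" "cmod zeta <= 2 * r" using nt r mult_left_mono[of 1 "cmod (Complex 1 (p X0))" r]
   mult_left_mono[of "cmod (Complex 1 (p X0))" 2 r] unfolding nz by auto
 have z0: "zeta \<noteq> 0" using zr r by auto
 have "Re zeta = p X0 * d - (Im x - U X0)" by (simp add: zeta_def d_def algebra_simps)
 moreover have "Im x - U X0 <= p X0 * d + K / 2 * d\<^sup>2" using U_le_parabola[of "Re x" X0] x(4) by (simp add: d_def)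
 ultimately have "Re zeta >= - (K / 2 * d\<^sup>2)" by simp
 moreover have "K / 2 * d\<^sup>2 <= sin (pi * (1 - beta) / 4) * cmod zeta"
 proof -
  have "d\<^sup>2 <= r\<^sup>2" using d by (simp add: abs_le_square_iff[symmetric])
  then have "K / 2 * d\<^sup>2 <= 1 * (r * r)" using K K_le by (intro mult_mono) (auto simp: power2_eq_square)
  also have "\<dots> <= sin (pi * (1 - beta) / 4) * cmod zeta" using r rad_bounds[OF beta] zr by (simp; intro mult_mono) auto
  finally show ?thesis .
 qed
 ultimately have "Re zeta >= - sin (pi * (1 - beta) / 4) * cmod zeta" by simp
 note S = powr_sector_lower[OF beta refl z0 this, folded sector_const_def]
 show "zeta \<notin> \<real>\<^sub>\<le>\<^sub>0" "sector_const beta > 0" using S by auto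
 have "sector_const beta * r powr beta <= sector_const beta * cmod zeta powr beta"
  using S(2) zr r beta by (intro mult_left_mono powr_mono2) auto
 then show "sector_const beta * cmod (x - Complex X0 (U X0)) powr beta <= Re (zeta powr of_real beta)" using S(1) by (simp add: r_def)
 have "cmod zeta powr beta <= (2 * r) powr beta" using zr beta by (intro powr_mono2) auto
 also have "\<dots> = 2 powr beta * r powr beta" using r by (simp add: powr_mult)
 also have "\<dots> <= 2 powr 1 * r powr beta" using beta by (intro mult_right_mono powr_mono) auto
 finally show "Re (zeta powr of_real beta) <= 2 * cmod (x - Complex X0 (U X0)) powr beta" using S(4) by (simp add: r_def)
qed

text \<open>Difference quotients along the tangent at a boundary point are compared with a harmonic
 function of the form Re (\<open>zeta powr beta\<close>), which is positive on the domain near that point.\<close>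

lemma tangential_derivative_estimate:
 fixes H :: "complex => complex" and sigma :: complex and k0 M A M2 M3 :: real
 assumes beta: "0 < beta" "beta < 1" and X0: "0 <= X0" "X0 < L" and rho: "0 < rho" "rho <= rad beta"
  and H: "H holomorphic_on D" and M: "0 <= M" "0 <= A" "0 <= M2"
 defines "P \<equiv> Complex X0 (U X0)" and "tau \<equiv> Complex 1 (p X0)"
 defines "Q \<equiv> (\<lambda>t w. Re ((H (w + of_real t * tau) - H w) * sigma) - t * k0)"
 assumes h1: "\<And>t w. [|0 < t; t < rho; w \<in> D; cmod (w - P) < rho; w + of_real t * tau \<in> D|] ==>
   \<bar>Q t w\<bar> <= M * t * (cmod (w - P) powr beta + t powr beta) + A * (U (Re w) - Im w) + A * (U (Re w + t) - Im w - t * p X0)"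
  and h2: "\<And>t w. [|0 < t; t < rho; w \<in> D; cmod (w - P) < rho; w + of_real t * tau \<in> D|] ==> \<bar>Q t w\<bar> <= M2 * t"
  and h3: "\<And>t w. [|0 < t; t < rho; w \<in> D; cmod (w - P) < rho; w + of_real t * tau \<in> D|] ==>
   \<bar>Q t w\<bar> <= M * t * (cmod (w - P) powr beta + t powr beta) + M3 * \<bar>L - Re w - t\<bar> powr beta"
  and w: "w \<in> D" "cmod (w - P) < rho"
 shows "\<bar>Re (deriv H w * tau * sigma) - k0\<bar> <= 2 * (M + A * K + M2 / rho powr beta) / sector_const beta * cmod (w - P) powr beta"
proof -
 \<comment> \<open>The barrier has to beat the given boundary error M, the curvature of the graph,
   which enters as A * K, and on the circle of radius rho the crude bound M2.\<close>
 define C0 where "C0 = M + A * K + M2 / rho powr beta"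
 have C0: "C0 >= 0" using M K by (simp add: C0_def)
 have C1: "M + A * K <= C0" "M2 / rho powr beta <= C0" using M K by (auto simp: C0_def)
 have X0': "\<bar>X0\<bar> <= L" using X0 by simp
 have rho8: "rho <= 1/8" using rho rad_bounds[OF beta] by simp
 define zeta where "zeta x = \<i> * (x - P) * cnj tau" for x
 have cpos: "sector_const beta > 0"
  by (rule sector_barrier(2)[OF beta X0', of "w"])
   (use w rho in_D[OF w(1)] in_D(3)[OF w(1)] in \<open>auto simp: P_def\<close>)
 define bb where "bb x = C0 / sector_const beta * Re (zeta x powr of_real beta)" for x
 note SB = sector_barrier[OF beta X0', folded P_def tau_def, folded zeta_def]
 have bb1: "zeta x \<notin> \<real>\<^sub>\<le>\<^sub>0" "C0 * cmod (x - P) powr beta <= bb x" "bb x <= 2 * C0 / sector_const beta * cmod (x - P) powr beta"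
  if x: "cmod (x - P) <= rho" "x \<noteq> P" "\<bar>Re x\<bar> <= L" "Im x <= U (Re x)" for x
 proof -
  have x': "cmod (x - P) <= rad beta" using x rho by simp
  note S = SB[OF x' x(2-4)]
  show "zeta x \<notin> \<real>\<^sub>\<le>\<^sub>0" by (rule S(1))
  have "C0 / sector_const beta * (sector_const beta * cmod (x - P) powr beta) <= bb x"
   unfolding bb_def using S(3) C0 cpos by (intro mult_left_mono) auto
  then show "C0 * cmod (x - P) powr beta <= bb x" using cpos by simp
  have "bb x <= C0 / sector_const beta * (2 * cmod (x - P) powr beta)"
   unfolding bb_def using S(4) C0 cpos by (intro mult_left_mono) auto
  then show "bb x <= 2 * C0 / sector_const beta * cmod (x - P) powr beta" by (simp add: mult_ac)
 qed
 have PD: "P \<notin> D" by (simp add: P_def cellD_def)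
 have main: "s * (Q t w / t) <= bb w + C0 * t powr beta"
  if s: "s = 1 \<or> s = -1" and t: "0 < t" "t < rho" and w: "w \<in> D" "cmod (w - P) < rho" "w + of_real t * tau \<in> D" for s t w
 proof -
  \<comment> \<open>The points whose translate lies in the cell as well; on this set the difference
    quotient is holomorphic.\<close>
  define S where "S = D \<inter> ball P rho \<inter> (\<lambda>w. w + of_real t * tau) -` D"
  define E where "E = (\<lambda>w. of_real s * (((H (w + of_real t * tau) - H w) * sigma - of_real (t * k0)) / of_real t)
   - of_real (C0 / sector_const beta) * zeta w powr of_real beta - of_real (C0 * t powr beta))"
  have ER: "Re (E w) = s * (Q t w / t) - bb w - C0 * t powr beta" for w
   using t by (simp add: E_def Q_def bb_def)
  have sub: "w \<in> D" "cmod (w - P) < rho" "w + of_real t * tau \<in> D" if "w \<in> S" for w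
   using that by (auto simp: S_def dist_norm norm_minus_commute)
  have bbS: "0 <= bb v" if "v \<in> S" for v
  proof -
   have "C0 * cmod (v - P) powr beta <= bb v"
    by (rule bb1(2)) (use sub[OF that] PD in_D[OF sub(1)[OF that]] in_D(3)[OF sub(1)[OF that]] in auto)
   moreover have "0 <= C0 * cmod (v - P) powr beta" using C0 by simp
   ultimately show ?thesis by linarith
  qed
  have Sop: "open S" unfolding S_def
   by (intro open_Int open_D open_ball open_vimage) (auto intro!: continuous_intros)
  have "Re (E w) <= 0"
  proof (rule maximum_principle_Re[OF Sop, where f = E and w = w])
   show "bounded S" using bounded_D by (rule bounded_subset) (auto simp: S_def)
   show "w \<in> S" using w by (auto simp: S_def dist_norm norm_minus_commute)
   show "E holomorphic_on S"
   proof -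
    have a1: "H holomorphic_on S" using H by (rule holomorphic_on_subset) (auto simp: S_def)
    have a2: "(\<lambda>w. H (w + of_real t * tau)) holomorphic_on S"
     by (rule holomorphic_on_compose_gen[OF _ H, of "\<lambda>w. w + of_real t * tau", unfolded o_def])
      (auto intro!: holomorphic_intros simp: S_def)
    have a3: "(\<lambda>w. zeta w powr of_real beta) holomorphic_on S"
    proof (rule holomorphic_on_powr)
     show "zeta holomorphic_on S" unfolding zeta_def by (intro holomorphic_intros)
     fix v assume v: "v \<in> S"
     show "zeta v \<notin> \<real>\<^sub>\<le>\<^sub>0"
      by (rule bb1(1)) (use sub[OF v] PD in_D[OF sub(1)[OF v]] in_D(3)[OF sub(1)[OF v]] in auto)
    qed auto
    show ?thesis unfolding E_def using t
     by (intro holomorphic_on_diff holomorphic_on_mult holomorphic_on_divide holomorphic_on_const a1 a2 a3) auto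
   qed
   fix x assume x: "x \<in> frontier S"
   then have xc: "x \<in> closure S" by (simp add: frontier_def)
   have cD: "x \<in> closure D" 
   proof -
    have "S \<subseteq> D" by (auto simp: S_def)
    then show ?thesis using xc closure_mono by blast
   qed
   have cB: "cmod (x - P) <= rho"
   proof -
    have "S \<subseteq> ball P rho" by (auto simp: S_def)
    then have "x \<in> cball P rho" using xc closure_mono[of S "ball P rho"] rho by auto
    then show ?thesis by (simp add: dist_norm norm_minus_commute)
   qed
   have cD2: "x + of_real t * tau \<in> closure D"
   proof -
    have "closed ((\<lambda>w. w + of_real t * tau) -` closure D)" by (intro closed_vimage) (auto intro!: continuous_intros)
    moreover have "S \<subseteq> (\<lambda>w. w + of_real t * tau) -` closure D" using closure_subset by (auto simp: S_def)
    ultimately show ?thesis using xc closure_minimal by blast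
   qed
   have x1: "\<bar>Re x\<bar> <= L" "- 1 - W (Re x) <= Im x" "Im x <= U (Re x)" using cD closure_D by auto
   have x2: "\<bar>Re x + t\<bar> <= L" "- 1 - W (Re x + t) <= Im x + t * p X0" "Im x + t * p X0 <= U (Re x + t)"
    using cD2 closure_D by (auto simp: tau_def)
   have xr: "\<bar>Re x - X0\<bar> <= cmod (x - P)" "\<bar>Im x - U X0\<bar> <= cmod (x - P)"
    using abs_Re_le_cmod[of "x - P"] abs_Im_le_cmod[of "x - P"] by (auto simp: P_def)
   have pX: "p X0 >= 0" using p_mono[of 0 X0] p_0 X0 by simp
   have xS: "x \<notin> S" using x Sop by (simp add: frontier_def interior_open)
   define r where "r = cmod (x - P)"
   have rb: "\<bar>Re x - X0\<bar> + t <= r powr beta + t powr beta"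
   proof -
    have "y <= y powr beta" if "0 <= y" "y <= 1" for y
    proof (cases "y = 0")
     case False
     then have "y powr 1 <= y powr beta" using that beta by (intro powr_mono') auto
     then show ?thesis using that by simp
    qed auto
    from this[of r] this[of t] show ?thesis using xr cB t rho8 unfolding r_def by auto
   qed
   \<comment> \<open>The power has no holomorphic branch around \<open>P\<close>. There the constant
     0 serves as lower bound of \<open>bb\<close>, which suffices because r = 0.\<close>
   have nx: "\<exists>n. isCont n x & C0 * r powr beta <= n x & (\<forall>v\<in>S. n v <= bb v)"
   proof (cases "x = P")
    case True
    then show ?thesis using bbS by (intro exI[of _ "\<lambda>_. 0"]) (auto simp: r_def)
   next
    case False
    have z: "isCont zeta x" unfolding zeta_def by (intro continuous_intros)
    have "isCont (\<lambda>x. zeta x powr of_real beta) x"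
     by (rule isCont_o2[OF z DERIV_isCont[OF has_field_derivative_powr]]) (rule bb1(1)[OF cB False x1(1,3)])
    then have "isCont bb x" unfolding bb_def by (intro continuous_mult continuous_const continuous_Re)
    then show ?thesis using bb1(2)[OF cB False x1(1,3)] by (intro exI[of _ bb]) (auto simp: r_def)
   qed
   then obtain n where n: "isCont n x" "C0 * r powr beta <= n x" "\<And>v. v \<in> S ==> n v <= bb v" by blast
   have fin: "\<exists>m. isCont m x & m x <= 0 & (\<forall>w\<in>S. Re (E w) <= m w)"
    if g: "isCont g x" "g x / t <= C0 * (r powr beta + t powr beta)" "\<And>v. v \<in> S ==> \<bar>Q t v\<bar> <= g v" for g
   proof (intro exI[of _ "\<lambda>v. g v / t - n v - C0 * t powr beta"] conjI ballI)
    show "isCont (\<lambda>v. g v / t - n v - C0 * t powr beta) x" using g(1) n(1) t by (intro continuous_intros) auto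
    show "g x / t - n x - C0 * t powr beta <= 0" using g(2) n(2) by (simp add: algebra_simps)
    fix v assume v: "v \<in> S"
    have "s * Q t v <= g v" using g(3)[OF v] s by auto
    then have "s * (Q t v / t) <= g v / t" using t by (simp add: divide_right_mono)
    then show "Re (E v) <= g v / t - n v - C0 * t powr beta" unfolding ER using n(3)[OF v] by simp
   qed
   have cU: "isCont (\<lambda>w. U (Re w + t)) x" "isCont (\<lambda>w. U (Re w)) x"
    by (rule isCont_o2[OF _ U_cont], intro continuous_intros linear_continuous_at bounded_linear_Re,
      rule isCont_Re_compose[OF U_cont])
   define g1 where "g1 = (\<lambda>w. M * t * (cmod (w - P) powr beta + t powr beta) + A * (U (Re w) - Im w) + A * (U (Re w + t) - Im w - t * p X0))"
   have g1c: "isCont g1 x" unfolding g1_def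
    by (intro continuous_intros isCont_cmod_powr beta cU linear_continuous_at bounded_linear_Im)
   have g1b: "\<bar>Q t v\<bar> <= g1 v" if "v \<in> S" for v unfolding g1_def using h1[OF t sub[OF that]] .
   \<comment> \<open>If the point or its translate lies on the graph, one depth vanishes. The other
     is t times a difference of slopes, since a step along the tangent at \<open>X0\<close> misses
     the graph only by the change of slope.\<close>
   have g1v: "g1 x / t <= C0 * (r powr beta + t powr beta)"
    if "U (Re x) - Im x + (U (Re x + t) - Im x - t * p X0) <= t * (K * (\<bar>Re x - X0\<bar> + t))"
   proof -
    have "g1 x = M * t * (r powr beta + t powr beta) + A * (U (Re x) - Im x + (U (Re x + t) - Im x - t * p X0))"
     by (simp add: g1_def r_def algebra_simps)
    also have "\<dots> <= M * t * (r powr beta + t powr beta) + A * (t * (K * (\<bar>Re x - X0\<bar> + t)))"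
     using that M by (intro add_left_mono mult_left_mono) auto
    also have "\<dots> <= M * t * (r powr beta + t powr beta) + A * (t * (K * (r powr beta + t powr beta)))"
     using rb M K t by (intro add_left_mono mult_left_mono) auto
    also have "\<dots> = t * ((M + A * K) * (r powr beta + t powr beta))" by (simp add: algebra_simps)
    also have "\<dots> <= t * (C0 * (r powr beta + t powr beta))" using C1 t by (intro mult_left_mono mult_right_mono) auto
    finally show ?thesis using t by (simp add: divide_le_eq mult.commute)
   qed
   have low: "Im x > - 1 - W y" "Im x + t * p X0 > - 1 - W y" if "\<bar>y\<bar> <= L" for y
   proof -
    have "Im x >= - 1/3 - 1/8" using xr(2) cB rho8 U_ge[OF X0'] by linarith
    moreover have "W y >= -1/3" by (rule bot.U_ge[OF that])
    moreover have "t * p X0 >= 0" using t pX by simp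
    ultimately show "Im x > - 1 - W y" "Im x + t * p X0 > - 1 - W y" by linarith+
   qed
   have left: "Re x > - L" "Re x < L" using xr(1) cB rho8 X0 L x2(1) t by linarith+
   have "cmod (x - P) = rho \<or> x \<notin> D \<or> x + of_real t * tau \<notin> D"
    using xS cB by (auto simp: S_def dist_norm norm_minus_commute)
   \<comment> \<open>The lower graph and the left side are out of reach: rho <= 1/8, X0 >= 0, and
     the translation goes to the right and never downwards.\<close>
   then consider "cmod (x - P) = rho" | "Im x = U (Re x)" | "Im x + t * p X0 = U (Re x + t)" | "Re x + t = L"
    using x1 x2 low(1)[OF x1(1)] low(2)[OF x2(1)] left t by (force simp: cellD_def tau_def)
   then show "\<exists>m. isCont m x & m x <= 0 & (\<forall>w\<in>S. Re (E w) <= m w)"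
   proof cases
    case 1
    show ?thesis
    proof (rule fin[of "\<lambda>_. M2 * t"])
     have "M2 <= C0 * r powr beta" using C1(2) 1 rho by (simp add: r_def field_simps)
     also have "\<dots> <= C0 * (r powr beta + t powr beta)" using C0 by (intro mult_left_mono) auto
     finally show "M2 * t / t <= C0 * (r powr beta + t powr beta)" using t by simp
    qed (use h2[OF t sub] in auto)
   next
    case 2
    have "U (Re x + t) + p (Re x + t) * (Re x - (Re x + t)) <= U (Re x)" by (rule U_ge_tangent)
    then have "U (Re x + t) - Im x - t * p X0 <= t * (p (Re x + t) - p X0)" using 2 by (simp add: algebra_simps)
    also have "\<dots> <= t * (K * (\<bar>Re x - X0\<bar> + t))"
    proof (intro mult_left_mono)
     have "p (Re x + t) - p X0 <= K * \<bar>Re x + t - X0\<bar>" using p_lip_abs[of "Re x + t" X0] by simp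
     also have "\<dots> <= K * (\<bar>Re x - X0\<bar> + t)" using K t by (intro mult_left_mono) auto
     finally show "p (Re x + t) - p X0 <= K * (\<bar>Re x - X0\<bar> + t)" .
    qed (use t in auto)
    finally show ?thesis using 2 by (intro fin[OF g1c g1v g1b]) auto
   next
    case 3
    have "U (Re x) + p (Re x) * (Re x + t - Re x) <= U (Re x + t)" by (rule U_ge_tangent)
    then have "U (Re x) - Im x <= t * (p X0 - p (Re x))" using 3 by (simp add: algebra_simps)
    also have "\<dots> <= t * (K * (\<bar>Re x - X0\<bar> + t))"
    proof (intro mult_left_mono)
     have "p X0 - p (Re x) <= K * \<bar>Re x - X0\<bar>" using p_lip_abs[of "Re x" X0] by simp
     also have "\<dots> <= K * (\<bar>Re x - X0\<bar> + t)" using K t by (intro mult_left_mono) auto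
     finally show "p X0 - p (Re x) <= K * (\<bar>Re x - X0\<bar> + t)" .
    qed (use t in auto)
    finally show ?thesis using 3 by (intro fin[OF g1c g1v g1b]) auto
   next
    case 4
    \<comment> \<open>The translate has reached the right side. The \<open>M3\<close> term vanishes
      at this point, which is why \<open>M3\<close> is absent from the final constant.\<close>
    define g3 where "g3 = (\<lambda>w. M * t * (cmod (w - P) powr beta + t powr beta) + M3 * \<bar>L - Re w - t\<bar> powr beta)"
    show ?thesis
    proof (rule fin[of g3])
     have "isCont (\<lambda>w. \<bar>L - Re w - t\<bar> powr beta) x" unfolding isCont_def
      by (rule tendsto_powr2) (use beta in \<open>auto intro!: tendsto_intros\<close>)
     then show "isCont g3 x" unfolding g3_def
      by (intro continuous_add continuous_mult continuous_const isCont_cmod_powr beta)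
     show "\<bar>Q t v\<bar> <= g3 v" if "v \<in> S" for v unfolding g3_def using h3[OF t sub[OF that]] .
     have "g3 x = t * (M * (r powr beta + t powr beta))" using 4 by (simp add: g3_def r_def)
     also have "\<dots> <= t * (C0 * (r powr beta + t powr beta))"
      using C1 M K t by (intro mult_left_mono mult_right_mono) (auto simp: C0_def)
     finally show "g3 x / t <= C0 * (r powr beta + t powr beta)" using t by (simp add: divide_le_eq mult.commute)
    qed
   qed
  qed
  then show ?thesis by (simp add: ER)
 qed
 \<comment> \<open>Step lengths t below rho that tend to 0. As the cell is open, the translates of
   the fixed point w eventually stay in it, and the quotients tend to the derivative along
   tau.\<close>
 define delta where "delta n = rho / real (n + 2)" for n :: nat
 have delta: "0 < delta n" "delta n < rho" for n
  using rho divide_strict_left_mono[of 1 "real (n + 2)" rho] by (auto simp: delta_def)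
 have delta0: "delta \<longlonglongrightarrow> 0"
 proof -
  have "(\<lambda>n. rho * (1 / real (n + 2))) \<longlonglongrightarrow> rho * 0"
   by (intro tendsto_intros LIMSEQ_ignore_initial_segment[OF lim_1_over_n])
  then show ?thesis by (simp add: delta_def[abs_def])
 qed
 have tau0: "tau \<noteq> 0" by (simp add: tau_def complex_eq_iff)
 have lim: "(\<lambda>n. w + of_real (delta n) * tau) \<longlonglongrightarrow> w + of_real 0 * tau" by (intro tendsto_intros delta0)
 have ev: "\<forall>\<^sub>F n in sequentially. w + of_real (delta n) * tau \<in> D"
  using topological_tendstoD[OF lim open_D] w by simp
 have fl: "filterlim (\<lambda>n. w + of_real (delta n) * tau) (at w) sequentially"
  unfolding filterlim_at using lim delta tau0 by (auto intro!: always_eventually simp: less_imp_neq[symmetric])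
 have dH: "(H has_field_derivative deriv H w) (at w)" using H open_D w(1) by (rule holomorphic_derivI)
 have "((\<lambda>x. (H x - H w) / (x - w)) \<longlongrightarrow> deriv H w) (at w)" using dH by (simp add: has_field_derivative_iff)
 from filterlim_compose[OF this fl]
 have "(\<lambda>n. (H (w + of_real (delta n) * tau) - H w) / (of_real (delta n) * tau)) \<longlonglongrightarrow> deriv H w" by simp
 then have "(\<lambda>n. Re ((H (w + of_real (delta n) * tau) - H w) / (of_real (delta n) * tau) * tau * sigma) - k0) \<longlonglongrightarrow> Re (deriv H w * tau * sigma) - k0"
  by (intro tendsto_intros)
 moreover have "Re ((H (w + of_real (delta n) * tau) - H w) / (of_real (delta n) * tau) * tau * sigma) - k0 = Q (delta n) w / delta n" for n
 proof -
  have "(H (w + of_real (delta n) * tau) - H w) / (of_real (delta n) * tau) * tau * sigma = ((H (w + of_real (delta n) * tau) - H w) * sigma) / of_real (delta n)"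
   using tau0 delta[of n] by simp
  then show ?thesis using delta[of n] by (simp add: Q_def diff_divide_distrib)
 qed
 ultimately have qlim: "(\<lambda>n. Q (delta n) w / delta n) \<longlonglongrightarrow> Re (deriv H w * tau * sigma) - k0" by simp
 have blim: "(\<lambda>n. bb w + C0 * delta n powr beta) \<longlonglongrightarrow> bb w + C0 * 0 powr beta"
  by (intro tendsto_intros tendsto_powr2 delta0) (use delta beta in \<open>auto intro!: always_eventually less_imp_le\<close>)
 have up: "s * (Re (deriv H w * tau * sigma) - k0) <= bb w + C0 * 0 powr beta" if s: "s = 1 \<or> s = -1" for s
 proof (rule tendsto_le[OF _ blim tendsto_mult[OF tendsto_const qlim]])
  show "\<forall>\<^sub>F n in sequentially. s * (Q (delta n) w / delta n) <= bb w + C0 * delta n powr beta"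
   using ev by eventually_elim (intro main s delta w)
 qed auto
 have "\<bar>Re (deriv H w * tau * sigma) - k0\<bar> <= bb w" using up[of 1] up[of "-1"] beta by simp
 also have "\<dots> <= 2 * C0 / sector_const beta * cmod (w - P) powr beta"
  by (rule bb1(3)) (use w PD in_D[OF w(1)] in_D(3)[OF w(1)] in auto)
 finally show ?thesis by (simp add: C0_def)
qed

end

definition corner_const :: "real => real => real" where
 "corner_const L beta = 2 * (2 * L + 1) / cos (beta * pi / 2)"

text \<open>The constant of \<open>tangential_derivative_estimate\<close> for M = K + 6 *
  corner_const, A = 27/2, M2 = 2 * 432 and rho = rad beta.\<close>

definition slope_const :: "real => real => real => real" where
 "slope_const L K beta = 2 * ((K + 6 * corner_const L beta) + 27/2 * K + 864 / rad beta powr beta) / sector_const beta"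

text \<open>One summand for each regime of \<open>deriv2_h_upper_half\<close>: close to a vertical
  side, close to the graph, and at a fixed distance from the graph.\<close>

definition hess_const :: "real => real => real => real" where
 "hess_const L K beta = 65536 * corner_const L beta + 512 * \<bar>slope_const L K beta\<bar> + 256 * (128 / rad beta)\<^sup>2"

lemma powr_sum3:
 fixes a b c beta :: real
 assumes "0 <= a" "0 <= b" "0 <= c" "0 < beta" "beta < 1"
 shows "(2 * (a + b + c)) powr beta <= 6 * (a powr beta + b powr beta + c powr beta)"
proof -
 define m where "m = max a (max b c)"
 have "(2 * (a + b + c)) powr beta <= (6 * m) powr beta" using assms by (intro powr_mono2) (auto simp: m_def)
 also have "\<dots> = 6 powr beta * m powr beta" by (simp add: powr_mult)
 also have "\<dots> <= 6 powr 1 * m powr beta" using assms by (intro mult_right_mono powr_mono) auto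
 also have "\<dots> <= 6 * (a powr beta + b powr beta + c powr beta)" by (auto simp: m_def max_def)
 finally show ?thesis .
qed

context potential
begin

lemma corner_const_pos: "0 < beta ==> beta < 1 ==> corner_const L beta > 0"
 unfolding corner_const_def using L
 by (intro divide_pos_pos cos_gt_zero) (auto simp: field_simps)

text \<open>The real part of h is constant along the graph, so the general estimate applies with
  sigma = 1 and k0 = 0. Its third hypothesis comes from the corner: both values are replaced by the
  affine expansion there, whose increment along the tangent at X0 is only - t * (p L - p
  X0).\<close>

lemma tangential_derivative_bound:
 assumes beta: "0 < beta" "beta < 1" and X0: "0 <= X0" "X0 < L" and w: "w \<in> D" "cmod (w - Complex X0 (U X0)) < rad beta"
 shows "\<bar>Re (deriv h w * Complex 1 (p X0))\<bar> <= slope_const L K beta * cmod (w - Complex X0 (U X0)) powr beta"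
proof -
 define c where "c = corner_const L beta"
 have c: "c > 0" using corner_const_pos[OF beta] by (simp add: c_def)
 define tau where "tau = Complex 1 (p X0)"
 define P where "P = Complex X0 (U X0)"
 have pX: "0 <= p X0" "p X0 <= 2/3" using p_mono[of 0 X0] p_0 X0 p_bound'[of X0] by auto
 have nt: "cmod tau <= 2" using cmod_le[of tau] pX by (simp add: tau_def)
 note r8 = rad_bounds[OF beta]
 have "\<bar>Re (deriv h w * tau * 1) - 0\<bar> <= 2 * ((K + 6 * c) + 27/2 * K + 864 / rad beta powr beta) / sector_const beta * cmod (w - P) powr beta"
 proof (rule tangential_derivative_estimate[OF beta X0 r8(1) order_refl H(1), where ?M3.0 = "K * (2 * L + 1) + 6 * c + 2 * (c * (2 * L + 1) * (2 * L + 1))", folded tau_def P_def])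
  show "0 <= K + 6 * c" using K c by simp
  show "w \<in> D" "cmod (w - P) < rad beta" using w by (auto simp: P_def)
  fix t v assume t: "0 < t" "t < rad beta" and v: "v \<in> D" "cmod (v - P) < rad beta" "v + of_real t * tau \<in> D"
  define v' where "v' = v + of_real t * tau"
  have v': "v' \<in> D" "Re v' = Re v + t" "Im v' = Im v + t * p X0" using v by (auto simp: v'_def tau_def)
  have Q: "Re ((h v' - h v) * 1) - t * 0 = Re (h v') - Re (h v)" by simp
  have Uv: "U (Re v') - Im v' = U (Re v + t) - Im v - t * p X0" by (simp add: v')
  have "\<bar>Re (h v') - Re (h v)\<bar> <= 27/2 * (U (Re v) - Im v) + 27/2 * (U (Re v') - Im v')"
   using H(3)[OF v(1)] H(4)[OF v(1)] H(3)[OF v'(1)] H(4)[OF v'(1)] by argo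
  moreover have "0 <= (K + 6 * c) * t * (cmod (v - P) powr beta + t powr beta)" using K c t by simp
  ultimately show "\<bar>Re ((h (v + of_real t * tau) - h v) * 1) - t * 0\<bar>
   <= (K + 6 * c) * t * (cmod (v - P) powr beta + t powr beta) + 27/2 * (U (Re v) - Im v) + 27/2 * (U (Re v + t) - Im v - t * p X0)"
   unfolding v'_def[symmetric] Q Uv by linarith
  have "\<bar>Re (h v') - Re (h v)\<bar> <= 432 * cmod (v' - v)" by (rule Re_h_lipschitz[OF v'(1) v(1)])
  also have "cmod (v' - v) = t * cmod tau" using t by (simp add: v'_def norm_mult)
  also have "432 * (t * cmod tau) <= 432 * (t * 2)" using nt t by (intro mult_left_mono) auto
  finally show "\<bar>Re ((h (v + of_real t * tau) - h v) * 1) - t * 0\<bar> <= 864 * t" unfolding v'_def[symmetric] Q by simp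
  define r where "r = cmod (v - P)"
  define y where "y = L - Re v - t"
  have y: "0 <= y" "y <= 2 * L + 1" using in_D(1)[OF v'(1)] in_D(1)[OF v(1)] v' t by (auto simp: y_def)
  have rr: "\<bar>Re v - X0\<bar> <= r" "\<bar>Im v - U X0\<bar> <= r" "0 <= r"
   using abs_Re_le_cmod[of "v - P"] abs_Im_le_cmod[of "v - P"] by (auto simp: P_def r_def)
  have LX: "L - X0 <= y + t + r" using rr by (auto simp: y_def)
  have N1: "\<bar>Re (h v) - (1 + Im v - p L * (Re v - L))\<bar> <= c * (cmod (of_real L - v) powr beta * (t + y))"
   using corner_estimate[OF beta v(1)] by (simp add: c_def corner_const_def y_def)
  have N2: "\<bar>Re (h v') - (1 + Im v' - p L * (Re v' - L))\<bar> <= c * (cmod (of_real L - v') powr beta * y)"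
   using corner_estimate[OF beta v'(1)] by (simp add: c_def corner_const_def y_def v' algebra_simps)
  have big: "cmod (of_real L - x) powr beta <= 2 * L + 1" if "x \<in> D" for x
  proof -
   have "cmod (of_real L - x) <= \<bar>Re (of_real L - x)\<bar> + \<bar>Im (of_real L - x)\<bar>" by (rule cmod_le)
   then have "cmod (of_real L - x) <= 2 * L + 1" using in_D[OF that] by simp
   then have "cmod (of_real L - x) powr beta <= (2 * L + 1) powr beta" using beta by (intro powr_mono2) auto
   also have "\<dots> <= (2 * L + 1) powr 1" using L beta by (intro powr_mono) auto
   finally show ?thesis using L by simp
  qed
  have yb: "y <= (2 * L + 1) * y powr beta"
  proof (cases "y = 0")
   case False
   have "y powr (1 - beta) <= (2 * L + 1) powr (1 - beta)" using y beta by (intro powr_mono2) auto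
   also have "\<dots> <= (2 * L + 1) powr 1" using L beta by (intro powr_mono) auto
   finally have "y powr (1 - beta) * y powr beta <= (2 * L + 1) * y powr beta" using L by (intro mult_right_mono) auto
   then show ?thesis using y False by (simp flip: powr_add)
  qed simp
  have T1: "cmod (of_real L - v) powr beta <= 6 * (t powr beta + r powr beta + y powr beta)"
  proof -
   have "cmod (of_real L - v) <= \<bar>Re (of_real L - v)\<bar> + \<bar>Im (of_real L - v)\<bar>" by (rule cmod_le)
   also have "\<dots> = (t + y) + \<bar>Im v\<bar>" using in_D(1)[OF v(1)] by (simp add: y_def)
   finally have a: "cmod (of_real L - v) <= (t + y) + \<bar>Im v\<bar>" .
   have "\<bar>Im v\<bar> <= r + 2/3 * (L - X0)"
   proof -
    have "U L - U X0 <= 2/3 * \<bar>L - X0\<bar>" "U X0 <= 0" using U_lip[of X0 L] U_nonpos[of X0] X0 by auto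
    then show ?thesis using rr(2) X0 U_L by argo
   qed
   then have "cmod (of_real L - v) <= 2 * (t + r + y)" using a LX rr t(1) y by argo
   then have "cmod (of_real L - v) powr beta <= (2 * (t + r + y)) powr beta" using beta by (intro powr_mono2) auto
   also have "\<dots> <= 6 * (t powr beta + r powr beta + y powr beta)" using t rr y beta by (intro powr_sum3) auto
   finally show ?thesis .
  qed
  have small: "x <= x powr beta" if "0 <= x" "x <= 1" for x
  proof (cases "x = 0")
   case False
   then have "x powr 1 <= x powr beta" using that beta by (intro powr_mono') auto
   then show ?thesis using that by simp
  qed auto
  have t1: "t <= 1" "r <= 1" using t v(2) r8 by (auto simp: r_def)
  \<comment> \<open>The distance of v to the side is t + y. The part with t goes into M; the part
    with y goes into M3, as y vanishes when the translate reaches the side.\<close>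
  have e1: "c * (cmod (of_real L - v) powr beta * (t + y)) <= 6 * c * t * (r powr beta + t powr beta) + 6 * c * y powr beta + c * (2 * L + 1) * (2 * L + 1) * y powr beta"
  proof -
   have "cmod (of_real L - v) powr beta * t <= 6 * (t powr beta + r powr beta + y powr beta) * t"
    using T1 t by (intro mult_right_mono) auto
   also have "\<dots> = 6 * t * (r powr beta + t powr beta) + 6 * y powr beta * t" by (simp add: algebra_simps)
   also have "6 * y powr beta * t <= 6 * y powr beta * 1" using t1 by (intro mult_left_mono) auto
   finally have a: "cmod (of_real L - v) powr beta * t <= 6 * t * (r powr beta + t powr beta) + 6 * y powr beta" by simp
   have "cmod (of_real L - v) powr beta * y <= (2 * L + 1) * ((2 * L + 1) * y powr beta)"
    using big[OF v(1)] yb y L by (intro mult_mono) auto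
   with a have "cmod (of_real L - v) powr beta * (t + y) <= 6 * t * (r powr beta + t powr beta) + 6 * y powr beta + (2 * L + 1) * ((2 * L + 1) * y powr beta)"
    by (simp add: ring_distribs)
   from mult_left_mono[OF this, of c] show ?thesis using c by (simp add: algebra_simps)
  qed
  have e2: "c * (cmod (of_real L - v') powr beta * y) <= c * (2 * L + 1) * (2 * L + 1) * y powr beta"
  proof -
   have "cmod (of_real L - v') powr beta * y <= (2 * L + 1) * ((2 * L + 1) * y powr beta)"
    using big[OF v'(1)] yb y L by (intro mult_mono) auto
   from mult_left_mono[OF this, of c] show ?thesis using c by (simp add: mult_ac)
  qed
  have e3: "\<bar>(1 + Im v' - p L * (Re v' - L)) - (1 + Im v - p L * (Re v - L))\<bar> <= K * t * (r powr beta + t powr beta) + K * (2 * L + 1) * y powr beta"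
  proof -
   have "(1 + Im v' - p L * (Re v' - L)) - (1 + Im v - p L * (Re v - L)) = - (t * (p L - p X0))"
    by (simp add: v' algebra_simps)
   then have "\<bar>(1 + Im v' - p L * (Re v' - L)) - (1 + Im v - p L * (Re v - L))\<bar> = t * \<bar>p L - p X0\<bar>" using t by (simp add: abs_mult)
   also have "\<dots> <= t * (K * \<bar>L - X0\<bar>)" using t p_lip_abs[of L X0] by (intro mult_left_mono) auto
   also have "\<dots> <= t * (K * (r powr beta + t powr beta + y))"
    using LX X0 t K small[of t] small[of r] t1 rr(3) by (intro mult_left_mono) auto
   also have "\<dots> = K * t * (r powr beta + t powr beta) + K * (t * y)" by (simp add: algebra_simps)
   also have "K * (t * y) <= K * (1 * ((2 * L + 1) * y powr beta))" using K t t1 y yb by (intro mult_left_mono mult_mono) auto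
   finally show ?thesis by (simp add: mult_ac)
  qed
  have tri: "\<bar>a' - a\<bar> <= \<bar>l' - l\<bar> + (\<bar>a - l\<bar> + \<bar>a' - l'\<bar>)" for a a' l l' :: real by argo
  have "\<bar>Re (h v') - Re (h v)\<bar> <= (K * t * (r powr beta + t powr beta) + K * (2 * L + 1) * y powr beta) +
   ((6 * c * t * (r powr beta + t powr beta) + 6 * c * y powr beta + c * (2 * L + 1) * (2 * L + 1) * y powr beta)
   + c * (2 * L + 1) * (2 * L + 1) * y powr beta)"
   by (rule order_trans[OF tri add_mono[OF e3 add_mono[OF order_trans[OF N1 e1] order_trans[OF N2 e2]]]])
  also have "\<dots> = (K + 6 * c) * t * (r powr beta + t powr beta) + (K * (2 * L + 1) + 6 * c + 2 * (c * (2 * L + 1) * (2 * L + 1))) * y powr beta"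
   by (simp only: ring_distribs mult_2 add_ac)
  finally show "\<bar>Re ((h (v + of_real t * tau) - h v) * 1) - t * 0\<bar> <= (K + 6 * c) * t * (cmod (v - P) powr beta + t powr beta)
   + (K * (2 * L + 1) + 6 * c + 2 * (c * (2 * L + 1) * (2 * L + 1))) * \<bar>L - Re v - t\<bar> powr beta"
   using y unfolding v'_def[symmetric] Q r_def y_def by simp
 qed auto
 then show ?thesis by (simp add: tau_def P_def slope_const_def c_def)
qed

text \<open>The difference of h and its reflection has real part 0, so the gradient bound with M = 0
  annihilates its derivative.\<close>

lemma deriv_h_even: assumes w: "w \<in> D" shows "deriv h w = - cnj (deriv h (- cnj w))"
 and "deriv (deriv h) w = cnj (deriv (deriv h) (- cnj w))"
proof -
 define h' where "h' = (\<lambda>w. cnj (h ((-1) * cnj w + 0)))"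
 have d: "(h' has_field_derivative - cnj (deriv h (- cnj w))) (at w)" if "w \<in> D" for w
  using has_field_derivative_cnj_affine[of h "deriv h (- cnj w)" "-1" w 0] h_deriv[OF flip_even[OF that]]
  by (simp add: h'_def)
 have e: "deriv h w = - cnj (deriv h (- cnj w))" if w: "w \<in> D" for w
 proof -
  obtain r where r: "r > 0" "ball w r \<subseteq> D" using open_D w open_contains_ball by blast
  have "cmod (deriv (\<lambda>w. h w - h' w) w) <= 8 * 0 / r"
  proof (rule norm_deriv_le_Re_bound[where c = 0])
   have "h' holomorphic_on D" using d open_D by (meson holomorphic_on_open)
   then show "(\<lambda>w. h w - h' w) holomorphic_on ball w r"
    using r H(1) by (intro holomorphic_on_diff) (auto intro: holomorphic_on_subset)
   show "\<bar>Re (h x - h' x) - 0\<bar> <= 0" if "x \<in> ball w r" for x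
    using Re_h_even[of x] r that by (auto simp: h'_def)
  qed (use r in auto)
  moreover have "deriv (\<lambda>w. h w - h' w) w = deriv h w - (- cnj (deriv h (- cnj w)))"
   by (rule DERIV_imp_deriv, rule DERIV_diff[OF h_deriv[OF w] d[OF w]])
  ultimately show ?thesis by (simp add: add_eq_0_iff)
 qed
 show "deriv h w = - cnj (deriv h (- cnj w))" by (rule e[OF w])
 show "deriv (deriv h) w = cnj (deriv (deriv h) (- cnj w))"
 proof (rule DERIV_imp_deriv)
  have "((\<lambda>w. - cnj (deriv h ((-1) * cnj w + 0))) has_field_derivative cnj (deriv (deriv h) (- cnj w))) (at w)"
   using has_field_derivative_cnj_affine[of "deriv h" "deriv (deriv h) (- cnj w)" "-1" w 0] h_deriv2[OF flip_even[OF w]]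
   by (auto intro!: derivative_eq_intros)
  then show "(deriv h has_field_derivative cnj (deriv (deriv h) (- cnj w))) (at w)"
   by (rule has_field_derivative_transform_within_open[OF _ open_D w]) (simp add: e)
 qed
qed

text \<open>Let d be the depth and R the distance to the right side. If R < d / 16, the corner
  expansion is subtracted and the reflection estimate is used on a half disc of radius d / 4. If d
  is small compared with \<open>rad beta\<close>, the tangential bound holds on a ball of radius d /
  32 and is differentiated once. Otherwise a ball of fixed radius fits into the cell. Evenness
  covers Re w < 0.\<close>

lemma deriv2_h_upper_half:
 assumes beta: "0 < beta" "beta < 1" and w: "w \<in> D" and up: "U (Re w) - Im w <= Im w + 1 + W (Re w)"
 shows "cmod (deriv (deriv h) w) <= hess_const L K beta * (U (Re w) - Im w) powr (beta - 1)"
proof -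
 have main: "cmod (deriv (deriv h) w) <= hess_const L K beta * (U (Re w) - Im w) powr (beta - 1)"
  if w: "w \<in> D" and up: "U (Re w) - Im w <= Im w + 1 + W (Re w)" and pos: "Re w >= 0" for w
 proof -
  define d where "d = U (Re w) - Im w"
  define R where "R = L - Re w"
  define c where "c = corner_const L beta"
  have c: "c > 0" using corner_const_pos[OF beta] by (simp add: c_def)
  have d: "0 < d" "d <= 1" "d <= Im w + 1 + W (Re w)" using in_D[OF w] up U_nonpos[of "Re w"] by (auto simp: d_def)
  have R: "0 < R" "R = L - \<bar>Re w\<bar>" using in_D(1)[OF w] pos by (auto simp: R_def)
  have dpow: "d powr beta / d = d powr (beta - 1)" using d by (simp add: powr_diff)
  have dp0: "0 < d powr (beta - 1)" using d by simp
  note rb = rad_bounds[OF beta]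
  have "cmod (deriv (deriv h) w) <= 65536 * c * d powr (beta - 1) \<or> cmod (deriv (deriv h) w) <= 512 * \<bar>slope_const L K beta\<bar> * d powr (beta - 1)
   \<or> cmod (deriv (deriv h) w) <= 256 * (128 / rad beta)\<^sup>2 * d powr (beta - 1)"
  proof (cases "R < d / 16")
   case True
   define cc where "cc = Complex L (Im w)"
   define f where "f = (\<lambda>v. h v - (1 - \<i> * v - of_real (p L) * (v - of_real L)))"
   have sub: "v \<in> D & L - Re v <= d / 4 & cmod (of_real L - v) <= 4 * d" if v: "v \<in> ball cc (d / 4)" "Re v < L" for v
   proof -
    have vr: "\<bar>Re v - L\<bar> < d / 4" "\<bar>Im v - Im w\<bar> < d / 4"
     using v abs_Re_le_cmod[of "v - cc"] abs_Im_le_cmod[of "v - cc"] by (auto simp: cc_def dist_norm norm_minus_commute)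
    have Xv: "\<bar>Re v\<bar> < L" using vr v d L by linarith
    have Xw: "\<bar>Re w\<bar> < L" using in_D(1)[OF w] .
    have dx: "\<bar>Re v - Re w\<bar> < d / 4" using vr v(2) True R(1) unfolding R_def by argo
    have "U (Re w) - U (Re v) <= 2/3 * \<bar>Re w - Re v\<bar>" "W (Re w) - W (Re v) <= 2/3 * \<bar>Re w - Re v\<bar>"
     using U_lip[of "Re v" "Re w"] bot.U_lip[of "Re v" "Re w"] Xv Xw by auto
    then have "Im v < U (Re v)" "- 1 - W (Re v) < Im v" using dx vr d unfolding d_def by argo+
    then have vD: "v \<in> D" using Xv by (simp add: cellD_def)
    have "cmod (of_real L - v) <= \<bar>Re (of_real L - v)\<bar> + \<bar>Im (of_real L - v)\<bar>" by (rule cmod_le)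
    then have "cmod (of_real L - v) <= d / 4 + \<bar>Im v\<bar>" using vr by (simp; argo)
    moreover have "U L - U (Re w) <= 2/3 * \<bar>L - Re w\<bar>" using U_lip[of "Re w" L] Xw L by simp
    then have "\<bar>Im w\<bar> <= d + d / 16" using True R(1) U_L in_D(4)[OF w] unfolding d_def R_def by argo
    ultimately have "cmod (of_real L - v) <= 4 * d" using vr d by argo
    then show ?thesis using vD vr v by auto
   qed
   have Nb: "\<bar>Re (f v)\<bar> <= c * (4 * d) powr beta * (L - Re v)" if v: "v \<in> ball cc (d / 4)" "Re v < L" for v
   proof -
    have "\<bar>Re (f v)\<bar> <= c * (cmod (of_real L - v) powr beta * (L - Re v))"
     using corner_estimate[OF beta, of v] sub[OF v] by (simp add: f_def c_def corner_const_def algebra_simps)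
    also have "\<dots> <= c * ((4 * d) powr beta * (L - Re v))"
     using sub[OF v] c beta v by (intro mult_left_mono mult_right_mono powr_mono2) auto
    finally show ?thesis by (simp add: mult.assoc)
   qed
   have "cmod (deriv (deriv f) w) <= 4096 * (c * (4 * d) powr beta * (d / 4)) / (d / 4)\<^sup>2"
   proof (rule deriv2_near_flat_boundary[where c = cc and A = "c * (4 * d) powr beta"])
    have cR: "Re cc = L" by (simp add: cc_def)
    show "f holomorphic_on ball cc (d / 4) \<inter> {w. Re w < Re cc}" unfolding f_def cR
     using H(1) sub by (intro holomorphic_intros) (auto intro: holomorphic_on_subset)
    fix v assume "v \<in> ball cc (d / 4) \<inter> {w. Re w < Re cc}"
    then have v: "v \<in> ball cc (d / 4)" "Re v < L" by (auto simp: cR)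
    show "\<bar>Re (f v)\<bar> <= c * (4 * d) powr beta * (Re cc - Re v)" using Nb[OF v] by (simp add: cR)
    have "c * (4 * d) powr beta * (L - Re v) <= c * (4 * d) powr beta * (d / 4)"
     using sub[OF v] c by (intro mult_left_mono) auto
    then show "\<bar>Re (f v)\<bar> <= c * (4 * d) powr beta * (d / 4)" using Nb[OF v] by simp
   next
    have "cc - w = of_real R" by (simp add: cc_def R_def complex_eq_iff)
    then have "dist cc w = R" using R(1) by (simp only: dist_norm norm_of_real abs_of_pos)
    then show "w \<in> ball cc (d / 4 / 2) \<inter> {w. Re w < Re cc}" using True R d by (simp add: cc_def R_def)
   qed (use d in auto)
   also have "4096 * (c * (4 * d) powr beta * (d / 4)) / (d / 4)\<^sup>2 = 16384 * c * (4 powr beta * (d powr beta / d))"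
    using d by (simp add: power2_eq_square powr_mult field_simps)
   also have "\<dots> <= 16384 * c * (4 powr 1 * (d powr beta / d))"
    using c d beta by (intro mult_left_mono mult_right_mono powr_mono) auto
   also have "\<dots> = 65536 * c * d powr (beta - 1)" unfolding dpow by simp
   also have "deriv (deriv f) w = deriv (deriv h) w"
   proof (rule DERIV_imp_deriv)
    have e: "deriv f v = deriv h v - (- \<i> - of_real (p L))" if "v \<in> D" for v
     unfolding f_def using h_deriv[OF that] by (auto intro!: DERIV_imp_deriv derivative_eq_intros)
    have "((\<lambda>v. deriv h v - (- \<i> - of_real (p L))) has_field_derivative deriv (deriv h) w) (at w)"
     using h_deriv2[OF w] by (auto intro!: derivative_eq_intros)
    then show "(deriv f has_field_derivative deriv (deriv h) w) (at w)"
     by (rule has_field_derivative_transform_within_open[OF _ open_D w]) (simp add: e)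
   qed
   finally show ?thesis by simp
  next
   case False
   show ?thesis
   proof (cases "d < rad beta / 4")
    case True
    define tau where "tau = Complex 1 (p (Re w))"
    define P where "P = Complex (Re w) (U (Re w))"
    have nt: "1 <= cmod tau" using abs_Re_le_cmod[of tau] by (simp add: tau_def)
    have b: "ball w (d / 32) \<subseteq> D" by (rule ball_in_D(1)[OF w]) (use d R False in \<open>auto simp: d_def\<close>)
    have "cmod (deriv (\<lambda>v. deriv h v * tau) w) <= 8 * (2 * \<bar>slope_const L K beta\<bar> * d powr beta) / (d / 32)"
    proof (rule norm_deriv_le_Re_bound[where c = 0])
     show "(\<lambda>v. deriv h v * tau) holomorphic_on ball w (d / 32)"
      by (intro holomorphic_on_mult holomorphic_on_const holomorphic_on_subset[OF holomorphic_deriv[OF H(1) open_D] b])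
     fix v assume v: "v \<in> ball w (d / 32)"
     have "w - P = of_real (- d) * \<i>" by (simp add: P_def d_def complex_eq_iff)
     then have "cmod (w - P) = d" using d by (simp add: norm_mult)
     then have vP: "cmod (v - P) <= 2 * d" using v d norm_triangle_ineq[of "v - w" "w - P"] by (simp add: dist_norm norm_minus_commute)
     have "\<bar>Re (deriv h v * tau)\<bar> <= slope_const L K beta * cmod (v - P) powr beta" unfolding tau_def P_def
      by (rule tangential_derivative_bound[OF beta pos]) (use in_D(1)[OF w] b v vP True d in \<open>auto simp: P_def\<close>)
     also have "\<dots> <= \<bar>slope_const L K beta\<bar> * (2 * d powr beta)"
     proof (intro mult_mono)
      have "cmod (v - P) powr beta <= (2 * d) powr beta" using vP beta by (intro powr_mono2) auto
      also have "\<dots> = 2 powr beta * d powr beta" using d by (simp add: powr_mult)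
      also have "\<dots> <= 2 powr 1 * d powr beta" using beta by (intro mult_right_mono powr_mono) auto
      finally show "cmod (v - P) powr beta <= 2 * d powr beta" by simp
     qed auto
     finally show "\<bar>Re (deriv h v * tau) - 0\<bar> <= 2 * \<bar>slope_const L K beta\<bar> * d powr beta" by simp
    qed (use d in auto)
    also have "8 * (2 * \<bar>slope_const L K beta\<bar> * d powr beta) / (d / 32) = 512 * \<bar>slope_const L K beta\<bar> * (d powr beta / d)" using d by simp
    also have "deriv (\<lambda>v. deriv h v * tau) w = deriv (deriv h) w * tau"
     by (rule DERIV_imp_deriv, rule DERIV_cmult_right[OF h_deriv2[OF w]])
    finally have "cmod (deriv (deriv h) w) * cmod tau <= 512 * \<bar>slope_const L K beta\<bar> * d powr (beta - 1)" by (simp add: norm_mult dpow)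
    moreover have "cmod (deriv (deriv h) w) * 1 <= cmod (deriv (deriv h) w) * cmod tau" using nt by (intro mult_left_mono) auto
    ultimately show ?thesis by simp
   next
    case F2: False
    have b: "ball w (rad beta / 128) \<subseteq> D" by (rule ball_in_D(1)[OF w]) (use d R False F2 rb in \<open>auto simp: d_def\<close>)
    have "cmod (deriv (deriv h) w) <= 256 * 1 / (rad beta / 128)\<^sup>2"
    proof (rule norm_deriv_deriv_le_Re_bound[where c = 0])
     show "h holomorphic_on ball w (rad beta / 128)" using H(1) b by (rule holomorphic_on_subset)
     show "\<bar>Re (h x) - 0\<bar> <= 1" if "x \<in> ball w (rad beta / 128)" for x
      using H(2)[of x] H(3)[of x] b that by auto
    qed (use rb in auto)
    also have "\<dots> = 256 * (128 / rad beta)\<^sup>2 * 1" by (simp add: power_divide)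
    also have "\<dots> <= 256 * (128 / rad beta)\<^sup>2 * d powr (beta - 1)"
    proof (intro mult_left_mono)
     have "d powr 0 <= d powr (beta - 1)" using d beta by (intro powr_mono') auto
     then show "1 <= d powr (beta - 1)" using d by simp
    qed auto
    finally show ?thesis by simp
   qed
  qed
  moreover have "65536 * c <= hess_const L K beta" "512 * \<bar>slope_const L K beta\<bar> <= hess_const L K beta" "256 * (128 / rad beta)\<^sup>2 <= hess_const L K beta"
   using c by (auto simp: hess_const_def c_def add_increasing2 add_increasing)
  from this[THEN mult_right_mono[OF _ less_imp_le[OF dp0]]]
  have "65536 * c * d powr (beta - 1) <= hess_const L K beta * d powr (beta - 1)"
   "512 * \<bar>slope_const L K beta\<bar> * d powr (beta - 1) <= hess_const L K beta * d powr (beta - 1)"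
   "256 * (128 / rad beta)\<^sup>2 * d powr (beta - 1) <= hess_const L K beta * d powr (beta - 1)" by auto
  ultimately show ?thesis unfolding d_def by linarith
 qed
 show ?thesis
 proof (cases "Re w >= 0")
  case True then show ?thesis using main w up by blast
 next
  case False
  have "cmod (deriv (deriv h) (- cnj w)) <= hess_const L K beta * (U (Re (- cnj w)) - Im (- cnj w)) powr (beta - 1)"
   by (rule main[OF flip_even[OF w]]) (use False up in \<open>auto simp: U_even bot.U_even\<close>)
  moreover have "cmod (deriv (deriv h) w) = cmod (deriv (deriv h) (- cnj w))"
   using deriv_h_even(2)[OF w] by (metis complex_mod_cnj)
  ultimately show ?thesis by (simp add: U_even)
 qed
qed

end

section \<open>Boundary traces\<close>

context cell
begin

definition strip :: "real => real => real => complex set" where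
 "strip a b eta = {w \<in> D. a < Re w & Re w < b & U (Re w) - Im w < eta}"

text \<open>Up to depth 1/3 the gap between the graphs already excludes the lower one, so membership
  is a condition on the upper graph alone.\<close>

lemma strip_iff:
 assumes "eta <= 1/3" "- L <= a" "b <= L"
 shows "w \<in> strip a b eta \<longleftrightarrow> a < Re w & Re w < b & 0 < U (Re w) - Im w & U (Re w) - Im w < eta"
proof -
 have "U (Re w) + 1 + W (Re w) >= 1/3 & \<bar>Re w\<bar> < L" if "a < Re w" "Re w < b"
  using gap[of "Re w"] assms that by auto
 then show ?thesis using assms(1) by (auto simp: strip_def cellD_def)
qed

text \<open>A derivative of size \<open>d powr (beta - 1)\<close>, with d the depth below the upper boundary, gives
 Hoelder continuity: connect two points at distance \<open>delta\<close> by first descending a depth \<open>2 * delta\<close>.\<close>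

lemma holder_near_top:
 assumes beta: "0 < beta" "beta <= 1" and eta: "0 < eta" "eta <= 1/3" and ab: "- L <= a" "b <= L"
  and F: "F holomorphic_on D" and C: "0 <= C"
  and bd: "\<And>v. v \<in> strip a b eta ==> cmod (deriv F v) <= C * (U (Re v) - Im v) powr (beta - 1)"
  and w: "w \<in> strip a b (eta / 2)" and w': "w' \<in> strip a b (eta / 2)" and dist: "cmod (w - w') <= eta / 8"
 shows "cmod (F w - F w') <= C * (4 / beta + 3) * cmod (w - w') powr beta"
proof (cases "w = w'")
 case False
 define delta where "delta = cmod (w - w')"
 have delta: "0 < delta" "delta <= eta / 8" using False dist by (auto simp: delta_def)
 have eta2: "eta / 2 <= 1/3" using eta by simp
 note S = strip_iff[OF eta(2) ab] strip_iff[OF eta2 ab]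
 have dF: "(F has_field_derivative deriv F v) (at v)" if "v \<in> strip a b eta" for v
  using F open_D that by (intro holomorphic_derivI[where S = D]) (auto simp: strip_def)
 have Fc: "isCont F v" if "v \<in> strip a b eta" for v using dF[OF that] DERIV_isCont by blast
 have vert: "cmod (F (v - of_real (2 * delta) * \<i>) - F v) <= C / beta * (2 * delta) powr beta" if v: "v \<in> strip a b (eta / 2)" for v
 proof -
  define g where "g s = F (v - of_real s * \<i>)" for s
  have inS: "v - of_real s * \<i> \<in> strip a b eta" if "0 <= s" "s <= 2 * delta" for s
   using v that delta by (simp add: S)
  have "cmod (g (2 * delta) - g 0) <= C / beta * (2 * delta) powr beta - C / beta * 0 powr beta"
  proof (rule differentiable_bound_general[where f' = "\<lambda>s. - \<i> * deriv F (v - of_real s * \<i>)" and \<phi>' = "\<lambda>s. C * s powr (beta - 1)"])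
   show "0 < 2 * delta" using delta by simp
   show "continuous_on {0..2 * delta} g" unfolding g_def
   proof (rule continuous_at_imp_continuous_on, rule ballI)
    fix s assume "s \<in> {0..2 * delta}"
    then have "isCont F (v - of_real s * \<i>)" using inS Fc by auto
    then show "isCont (\<lambda>s. F (v - of_real s * \<i>)) s"
     by (rule isCont_o2[rotated]) (intro continuous_intros)
   qed
   show "continuous_on {0..2 * delta} (\<lambda>s. C / beta * s powr beta)"
    by (intro continuous_on_mult continuous_on_const continuous_on_powr' continuous_on_id) (use beta in auto)
   fix s assume s: "0 < s" "s < 2 * delta"
   have st: "v - of_real s * \<i> \<in> strip a b eta" using inS s by simp
   have "((\<lambda>s. v - of_real s * \<i>) has_vector_derivative - \<i>) (at s)" by (auto intro!: derivative_eq_intros)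
   from field_vector_diff_chain_at[OF this dF[OF st]]
   show "(g has_vector_derivative - \<i> * deriv F (v - of_real s * \<i>)) (at s)" unfolding g_def o_def .
   have "((\<lambda>s. C / beta * s powr beta) has_real_derivative C / beta * (beta * s powr (beta - 1))) (at s)"
    using s by (intro DERIV_cmult has_real_derivative_powr) auto
   then show "((\<lambda>s. C / beta * s powr beta) has_vector_derivative C * s powr (beta - 1)) (at s)"
    using beta by (simp add: has_real_derivative_iff_has_vector_derivative)
   have "cmod (deriv F (v - of_real s * \<i>)) <= C * (U (Re v) - Im v + s) powr (beta - 1)" using bd[OF st] by (simp add: algebra_simps)
   also have "\<dots> <= C * s powr (beta - 1)"
    using C s v beta by (intro mult_left_mono powr_mono2') (auto simp: S)
   finally show "cmod (- \<i> * deriv F (v - of_real s * \<i>)) <= C * s powr (beta - 1)" by (simp add: norm_mult)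
  qed
  then show ?thesis using beta by (simp add: g_def)
 qed
 define v where "v = w - of_real (2 * delta) * \<i>"
 define v' where "v' = w' - of_real (2 * delta) * \<i>"
 have "cmod (F v - F v') <= 3 * C * delta powr (beta - 1) * cmod (v - v')"
 proof (rule field_differentiable_bound[OF convex_closed_segment[of v v']])
  fix x assume "x \<in> closed_segment v v'"
  then obtain u where u: "0 <= u" "u <= 1" "x = (1 - u) *\<^sub>R v + u *\<^sub>R v'" by (auto simp: in_segment)
  have "x = v + of_real u * (w' - w)" using u by (simp add: v_def v'_def scaleR_conv_of_real algebra_simps)
  then have xR: "Re x = Re w + u * (Re w' - Re w)" "Im x = Im w - 2 * delta + u * (Im w' - Im w)" by (auto simp: v_def)
  have "\<bar>Re w' - Re w\<bar> <= delta" "\<bar>Im w' - Im w\<bar> <= delta"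
   using abs_Re_le_cmod[of "w' - w"] abs_Im_le_cmod[of "w' - w"] by (auto simp: delta_def norm_minus_commute)
  then have "\<bar>u * (Re w' - Re w)\<bar> <= 1 * delta" "\<bar>u * (Im w' - Im w)\<bar> <= 1 * delta"
   unfolding abs_mult using u by (intro mult_mono; simp)+
  then have dx: "\<bar>Re x - Re w\<bar> <= delta" "\<bar>Im x - Im w + 2 * delta\<bar> <= delta" unfolding xR by auto
  have cv: "a < Re x" "Re x < b"
  proof -
   have "Re x = (1 - u) * Re w + u * Re w'" using xR(1) by (simp add: algebra_simps)
   moreover have "(1 - u) * Re w + u * Re w' > a" "(1 - u) * Re w + u * Re w' < b"
   proof -
    have "a < Re w" "a < Re w'" "Re w < b" "Re w' < b" using w w' by (auto simp: S)
    then have "- Re w < - a" "- Re w' < - a" "Re w < b" "Re w' < b" by auto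
    then show "(1 - u) * Re w + u * Re w' > a" "(1 - u) * Re w + u * Re w' < b"
     using convex_bound_lt[of "- Re w" "- a" "- Re w'" "1 - u" u] convex_bound_lt[of "Re w" b "Re w'" "1 - u" u] u by auto
   qed
   ultimately show "a < Re x" "Re x < b" by auto
  qed
  have "U (Re x) - U (Re w) <= 2/3 * \<bar>Re x - Re w\<bar>" "U (Re w) - U (Re x) <= 2/3 * \<bar>Re w - Re x\<bar>"
   using U_lip[of "Re w" "Re x"] U_lip[of "Re x" "Re w"] cv w ab by (auto simp: S)
  \<comment> \<open>From the depth gained by the descent, 2 * delta, the vertical displacement takes
    at most delta and the horizontal one at most 2/3 * delta through the slope of the graph.\<close>
  then have dep: "delta / 3 < U (Re x) - Im x" "U (Re x) - Im x < eta"
   using dx w delta unfolding S by argo+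
  have xs: "x \<in> strip a b eta" using dep cv delta by (simp add: S)
  show "(F has_field_derivative deriv F x) (at x within closed_segment v v')" using dF[OF xs] by (rule has_field_derivative_at_within)
  have "cmod (deriv F x) <= C * (U (Re x) - Im x) powr (beta - 1)" by (rule bd[OF xs])
  also have "\<dots> <= C * (delta / 3) powr (beta - 1)" using C dep delta beta by (intro mult_left_mono powr_mono2') auto
  also have "(delta / 3) powr (beta - 1) = 3 powr (1 - beta) * delta powr (beta - 1)"
   using delta by (simp add: powr_divide powr_minus_divide[symmetric] powr_diff field_simps)
  also have "C * (3 powr (1 - beta) * delta powr (beta - 1)) <= C * (3 powr 1 * delta powr (beta - 1))"
   using C beta by (intro mult_left_mono mult_right_mono powr_mono) auto
  finally show "cmod (deriv F x) <= 3 * C * delta powr (beta - 1)" by simp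
 qed auto
 also have "cmod (v - v') = delta" by (simp add: v_def v'_def delta_def)
 also have "3 * C * delta powr (beta - 1) * delta = 3 * C * delta powr beta" using delta by (simp add: powr_diff)
 finally have h: "cmod (F v - F v') <= 3 * C * delta powr beta" .
 have two: "(2 * delta) powr beta <= 2 * delta powr beta"
 proof -
  have "2 powr beta * delta powr beta <= 2 powr 1 * delta powr beta" using beta by (intro mult_right_mono powr_mono) auto
  then show ?thesis by (simp add: powr_mult)
 qed
 have "C / beta * (2 * delta) powr beta <= C / beta * (2 * delta powr beta)" using two C beta by (intro mult_left_mono) auto
 then have "cmod (F v - F w) <= C / beta * (2 * delta powr beta)" "cmod (F v' - F w') <= C / beta * (2 * delta powr beta)"
  using vert[OF w] vert[OF w'] unfolding v_def v'_def by linarith+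
 moreover have "F w - F w' = (F v - F v') - (F v - F w) + (F v' - F w')" by simp
 then have "cmod (F w - F w') <= cmod (F v - F v') + cmod (F v - F w) + cmod (F v' - F w')"
  by (simp only:) (rule order_trans[OF norm_triangle_ineq add_right_mono[OF norm_triangle_ineq4]])
 ultimately have "cmod (F w - F w') <= 3 * C * delta powr beta + C / beta * (2 * delta powr beta) + C / beta * (2 * delta powr beta)"
  using h by linarith
 also have "\<dots> = C * (4 / beta + 3) * delta powr beta" by (simp add: algebra_simps)
 finally show ?thesis by (simp add: delta_def)
qed simp

end

text \<open>The bound makes f uniformly continuous, which gives the extension, and it passes to
  limits of sequences. It is stated at scale d because the estimates inside the cell compare nearby
  points only.\<close>

lemma holder_extension:
 fixes f :: "'a::metric_space => 'b::{banach}"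
 assumes beta: "0 < beta" and C: "0 <= C" and d: "0 < d"
  and f: "\<And>x y. x \<in> S ==> y \<in> S ==> dist x y <= d ==> norm (f x - f y) <= C * dist x y powr beta"
 obtains g where "\<And>x. x \<in> S ==> g x = f x"
  "\<And>x y. x \<in> closure S ==> y \<in> closure S ==> dist x y < d ==> norm (g x - g y) <= C * dist x y powr beta"
proof -
 have "uniformly_continuous_on S f"
  unfolding uniformly_continuous_on_def
 proof (intro allI impI)
  fix e :: real assume e: "0 < e"
  define r where "r = min d ((e / (C + 1)) powr (1 / beta))"
  have r: "r > 0" using d e C by (simp add: r_def)
  show "\<exists>r>0. \<forall>x\<in>S. \<forall>x'\<in>S. dist x' x < r --> dist (f x') (f x) < e"
  proof (intro exI conjI ballI impI)
   fix x x' assume x: "x \<in> S" "x' \<in> S" "dist x' x < r"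
   have "dist x' x powr beta <= ((e / (C + 1)) powr (1 / beta)) powr beta" using x beta by (intro powr_mono2) (auto simp: r_def)
   also have "\<dots> = e / (C + 1)" using e C beta by (simp add: powr_powr)
   finally have "C * dist x' x powr beta <= C * (e / (C + 1))" using C by (intro mult_left_mono)
   also have "\<dots> < e" using C e by (simp add: field_simps)
   finally show "dist (f x') (f x) < e" using f[of x' x] x by (simp add: dist_norm r_def)
  qed (rule r)
 qed
 from uniformly_continuous_on_extension_on_closure[OF this] obtain g where
  g: "uniformly_continuous_on (closure S) g" "\<And>x. x \<in> S ==> f x = g x" by metis
 show ?thesis
 proof (rule that[of g])
  fix x y assume x: "x \<in> closure S" and y: "y \<in> closure S" and xy: "dist x y < d"
  obtain X where X: "\<And>n. X n \<in> S" "X \<longlonglongrightarrow> x" using x closure_sequential by blast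
  obtain Y where Y: "\<And>n. Y n \<in> S" "Y \<longlonglongrightarrow> y" using y closure_sequential by blast
  have gc: "continuous_on (closure S) g" using g(1) uniformly_continuous_imp_continuous by blast
  have "X n \<in> closure S" "Y n \<in> closure S" for n using X(1) Y(1) closure_subset by blast+
  then have gX: "(\<lambda>n. g (X n)) \<longlonglongrightarrow> g x" "(\<lambda>n. g (Y n)) \<longlonglongrightarrow> g y"
   using continuous_on_tendsto_compose[OF gc X(2) x] continuous_on_tendsto_compose[OF gc Y(2) y] by simp_all
  have dl: "(\<lambda>n. dist (X n) (Y n)) \<longlonglongrightarrow> dist x y" by (intro tendsto_intros X Y)
  have "(\<lambda>n. C * dist (X n) (Y n) powr beta) \<longlonglongrightarrow> C * dist x y powr beta"
   by (intro tendsto_mult tendsto_const tendsto_powr2 dl) (use beta in auto)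
  moreover have "(\<lambda>n. norm (g (X n) - g (Y n))) \<longlonglongrightarrow> norm (g x - g y)" by (intro tendsto_intros gX)
  moreover have "\<forall>\<^sub>F n in sequentially. norm (g (X n) - g (Y n)) <= C * dist (X n) (Y n) powr beta"
   using order_tendstoD(2)[OF dl xy] 
  proof eventually_elim
   case (elim n)
   then show ?case using f[OF X(1)[of n] Y(1)[of n]] g(2)[OF X(1)[of n]] g(2)[OF Y(1)[of n]] by simp
  qed
  ultimately show "norm (g x - g y) <= C * dist x y powr beta" 
   by (intro tendsto_le[OF sequentially_bot])
 qed (use g in auto)
qed

text \<open>The approximating points move towards the midpoint of the interval and downwards at the
  same time, so that the ends a and b are reached as well.\<close>

lemma (in cell) top_in_closure_strip:
 assumes eta: "0 < eta" "eta <= 1/3" and ab: "- L <= a" "b <= L" "a < b" and x: "a <= x" "x <= b"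
 shows "Complex x (U x) \<in> closure (strip a b eta)"
proof -
 define m where "m = (a + b) / 2"
 define y where "y n = x + (m - x) / real (n + 2)" for n :: nat
 define Z where "Z n = Complex (y n) (U (y n) - eta / real (n + 2))" for n :: nat
 have ylim: "y \<longlonglongrightarrow> x"
 proof -
  have "(\<lambda>n. x + (m - x) * (1 / real (n + 2))) \<longlonglongrightarrow> x + (m - x) * 0"
   by (intro tendsto_intros LIMSEQ_ignore_initial_segment[OF lim_1_over_n])
  then show ?thesis by (simp add: y_def[abs_def])
 qed
 have e0: "(\<lambda>n. eta / real (n + 2)) \<longlonglongrightarrow> 0"
 proof -
  have "(\<lambda>n. eta * (1 / real (n + 2))) \<longlonglongrightarrow> eta * 0"
   by (intro tendsto_intros LIMSEQ_ignore_initial_segment[OF lim_1_over_n])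
  then show ?thesis by simp
 qed
 have "Z \<longlonglongrightarrow> Complex x (U x - 0)" unfolding Z_def
  by (intro tendsto_Complex tendsto_diff ylim e0 isCont_tendsto_compose[OF U_cont])
 moreover have "Z n \<in> strip a b eta" for n
 proof -
  define s where "s = 1 / real (n + 2)"
  have s: "0 < s" "s < 1" by (auto simp: s_def field_simps)
  have "y n = x + (m - x) * s" by (simp add: y_def s_def)
  then have yn: "y n = (1 - s) * x + s * m" by (simp add: algebra_simps)
  have "a < y n" "y n < b"
  proof -
   have m: "a < m" "m < b" using ab by (auto simp: m_def)
   have "(1 - s) * a <= (1 - s) * x" "s * a < s * m" "(1 - s) * x <= (1 - s) * b" "s * m < s * b"
    using s x m by (auto intro!: mult_left_mono mult_strict_left_mono)
   then have "(1 - s) * a + s * a < y n" "y n < (1 - s) * b + s * b" unfolding yn by linarith+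
   then show "a < y n" "y n < b" by (auto simp: algebra_simps)
  qed
  moreover have "0 < eta / real (n + 2)" "eta / real (n + 2) < eta" using eta divide_strict_left_mono[of 1 "real (n + 2)" eta] by auto
  ultimately show ?thesis unfolding strip_iff[OF eta(2) ab(1,2)] by (simp add: Z_def)
 qed
 ultimately show ?thesis using closure_sequential by force
qed

text \<open>The full limit from inside the cell. The profiles are arguments because the trace at the
  lower graph is the upper trace of the reflected cell.\<close>

definition top_trace :: "real => (real => real) => (real => real) => (complex => complex) => real => complex" where
 "top_trace L U W F x = Lim (at (Complex x (U x)) within cellD L U W) F"

definition trace_const :: "real => real => real => real" where
 "trace_const L K beta = hess_const L K beta * (4 / beta + 3)"

context cell
begin

abbreviation top where "top x \<equiv> Complex x (U x)"

lemma top_dist: "\<bar>x\<bar> <= L ==> \<bar>y\<bar> <= L ==> cmod (top x - top y) <= 2 * \<bar>x - y\<bar>"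
proof -
 assume xy: "\<bar>x\<bar> <= L" "\<bar>y\<bar> <= L"
 have "\<bar>U x - U y\<bar> <= 2/3 * \<bar>x - y\<bar>" using U_lip[OF xy] U_lip[OF xy(2) xy(1)] by (simp add: abs_minus_commute abs_if[of "U x - U y"])
 moreover have "cmod (top x - top y) <= \<bar>Re (top x - top y)\<bar> + \<bar>Im (top x - top y)\<bar>" by (rule cmod_le)
 ultimately show ?thesis using abs_ge_zero[of "x - y"] by (simp; linarith)
qed

text \<open>At a corner the restriction on Re w is enforced by the cell itself, hence the
  alternatives a = - L and b = L.\<close>

lemma eventually_strip:
 assumes eta: "0 < eta" "eta <= 1/3" and ab: "- L <= a" "b <= L" and x: "a = - L \<or> a < x" "b = L \<or> x < b"
 shows "\<forall>\<^sub>F w in at (top x) within D. w \<in> strip a b eta"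
proof -
 have "((\<lambda>w. U (Re w) - Im w) \<longlongrightarrow> U (Re (top x)) - Im (top x)) (at (top x) within D)"
  by (intro tendsto_intros isCont_tendsto_compose[OF U_cont])
 then have 1: "\<forall>\<^sub>F w in at (top x) within D. U (Re w) - Im w < eta"
  using eta by (intro order_tendstoD(2)) auto
 have R: "((\<lambda>w. Re w) \<longlongrightarrow> Re (top x)) (at (top x) within D)" by (intro tendsto_intros)
 have D: "\<forall>\<^sub>F w in at (top x) within D. w \<in> D" by (simp add: eventually_at_filter)
 have 2: "\<forall>\<^sub>F w in at (top x) within D. a < Re w"
 proof (cases "a < x")
  case True then show ?thesis using order_tendstoD(1)[OF R, of a] by simp
 next
  case False
  then have "a = - L" using x by auto
  then show ?thesis by (intro eventually_mono[OF D]) (auto simp: abs_less_iff dest!: in_D(1))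
 qed
 have 3: "\<forall>\<^sub>F w in at (top x) within D. Re w < b"
 proof (cases "x < b")
  case True then show ?thesis using order_tendstoD(2)[OF R, of b] by simp
 next
  case False
  then have "b = L" using x by auto
  then show ?thesis by (intro eventually_mono[OF D]) (auto simp: abs_less_iff dest!: in_D(1))
 qed
 show ?thesis using 1 2 3 D by eventually_elim (simp add: strip_def)
qed

lemma top_limit_point: assumes "\<bar>x\<bar> <= L" shows "at (top x) within D \<noteq> bot"
proof -
 have "top x \<in> closure (strip (- L) L (1/3))" using assms L by (intro top_in_closure_strip) auto
 also have "\<dots> \<subseteq> closure D" by (intro closure_mono) (auto simp: strip_def)
 finally have "top x \<in> closure D" .
 moreover have "top x \<notin> D" by (simp add: cellD_def)
 ultimately show ?thesis by (simp add: trivial_limit_within closure_def)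
qed

text \<open>The trace is the value of the Hoelder extension to the closure of the strip. The index
  set \<open>J\<close> contains a corner exactly when the strip extends to that vertical side, so
  that near the corner the cell lies in the strip.\<close>

lemma trace_properties:
 assumes beta: "0 < beta" and C: "0 <= C" and eta: "0 < eta" "eta <= 1/3" and d: "0 < d" and ab: "- L <= a" "b <= L" "a < b"
  and F: "\<And>w w'. w \<in> strip a b eta ==> w' \<in> strip a b eta ==> cmod (w - w') <= d ==> cmod (F w - F w') <= C * cmod (w - w') powr beta"
 defines "J \<equiv> {x. (a < x \<or> a = - L & x = - L) & (x < b \<or> b = L & x = L)}"
 shows "x \<in> J ==> (F \<longlongrightarrow> top_trace L U W F x) (at (top x) within D)"
  and "x \<in> J ==> w \<in> strip a b eta ==> cmod (w - top x) < d ==> cmod (F w - top_trace L U W F x) <= C * cmod (w - top x) powr beta"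
  and "x \<in> J ==> y \<in> J ==> cmod (top x - top y) < d ==>
   cmod (top_trace L U W F x - top_trace L U W F y) <= C * cmod (top x - top y) powr beta"
proof -
 obtain g where g: "\<And>w. w \<in> strip a b eta ==> g w = F w"
  "\<And>x y. x \<in> closure (strip a b eta) ==> y \<in> closure (strip a b eta) ==> dist x y < d ==> norm (g x - g y) <= C * dist x y powr beta"
  using holder_extension[OF beta C d, of "strip a b eta" F] F unfolding dist_norm by metis
 have cl: "top x \<in> closure (strip a b eta)" if "x \<in> J" for x
  using that ab L by (intro top_in_closure_strip[OF eta ab]) (auto simp: J_def)
 have JL: "\<bar>x\<bar> <= L" if "x \<in> J" for x using that ab by (auto simp: J_def)
 have lim: "(F \<longlongrightarrow> g (top x)) (at (top x) within D)" if x: "x \<in> J" for x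
 proof -
  have ev: "\<forall>\<^sub>F w in at (top x) within D. w \<in> strip a b eta" by (rule eventually_strip[OF eta ab(1,2)]) (use x in \<open>auto simp: J_def\<close>)
  have "((\<lambda>w. F w - g (top x)) \<longlongrightarrow> 0) (at (top x) within D)"
  proof (rule Lim_null_comparison)
   have "((\<lambda>w. dist w (top x)) \<longlongrightarrow> dist (top x) (top x)) (at (top x) within D)" by (intro tendsto_intros)
   then have "\<forall>\<^sub>F w in at (top x) within D. dist w (top x) < d" using d by (intro order_tendstoD(2)) auto
   with ev show "\<forall>\<^sub>F w in at (top x) within D. norm (F w - g (top x)) <= C * dist w (top x) powr beta"
   proof eventually_elim
    case (elim w)
    then show ?case using g(2)[OF _ cl[OF x], of w] g(1)[of w] closure_subset[of "strip a b eta"] by auto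
   qed
   have "((\<lambda>w. C * dist w (top x) powr beta) \<longlongrightarrow> C * dist (top x) (top x) powr beta) (at (top x) within D)"
    by (intro tendsto_mult tendsto_const tendsto_powr2 tendsto_dist tendsto_ident_at) (use beta in auto)
   then show "((\<lambda>w. C * dist w (top x) powr beta) \<longlongrightarrow> 0) (at (top x) within D)" by simp
  qed
  then show ?thesis by (simp add: LIM_zero_iff)
 qed
 have T: "top_trace L U W F x = g (top x)" if "x \<in> J" for x
  unfolding top_trace_def using lim[OF that] top_limit_point[OF JL[OF that]] by (intro tendsto_Lim) auto
 show "x \<in> J ==> (F \<longlongrightarrow> top_trace L U W F x) (at (top x) within D)" using lim T by simp
 show "x \<in> J ==> w \<in> strip a b eta ==> cmod (w - top x) < d ==> cmod (F w - top_trace L U W F x) <= C * cmod (w - top x) powr beta"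
  using g(2)[of w "top x"] cl g(1)[of w] closure_subset[of "strip a b eta"] by (auto simp: T dist_norm)
 show "x \<in> J ==> y \<in> J ==> cmod (top x - top y) < d ==>
   cmod (top_trace L U W F x - top_trace L U W F y) <= C * cmod (top x - top y) powr beta"
  using g(2)[of "top x" "top y"] cl by (auto simp: T dist_norm)
qed

end

context potential
begin

lemma hess_const_nonneg: "0 < beta ==> beta < 1 ==> hess_const L K beta >= 0"
 using corner_const_pos[of beta] by (auto simp: hess_const_def)

lemma trace_const_nonneg: "0 < beta ==> beta < 1 ==> trace_const L K beta >= 0"
 using hess_const_nonneg by (auto simp: trace_const_def)

text \<open>At depth below 1/6 the gap of 1/3 makes the upper graph the nearer one. The constant
  depends on L, K and beta only, so that a whole sequence of cells can share it.\<close>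

lemma deriv_h_holder:
 assumes beta: "0 < beta" "beta < 1" and w: "w \<in> strip (- L) L (1/12)" "w' \<in> strip (- L) L (1/12)" "cmod (w - w') <= 1/48"
 shows "cmod (deriv h w - deriv h w') <= trace_const L K beta * cmod (w - w') powr beta"
 unfolding trace_const_def
proof (rule holder_near_top[where a = "- L" and b = L and eta = "1/6"])
 show "deriv h holomorphic_on D" using H(1) open_D by (rule holomorphic_deriv)
 fix v assume v: "v \<in> strip (- L) L (1/6)"
 then have "U (Re v) - Im v < 1/6" and vD: "v \<in> D" by (auto simp: strip_def)
 moreover have "U (Re v) + 1 + W (Re v) >= 1/3" using gap[of "Re v"] in_D(1)[OF vD] by simp
 ultimately show "cmod (deriv (deriv h) v) <= hess_const L K beta * (U (Re v) - Im v) powr (beta - 1)"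
  by (intro deriv2_h_upper_half[OF beta]) auto
qed (use w beta hess_const_nonneg in auto)

abbreviation T where "T \<equiv> top_trace L U W (deriv h)"

lemma T_tendsto: assumes "\<bar>x\<bar> <= L" shows "(deriv h \<longlongrightarrow> T x) (at (top x) within D)"
 by (rule trace_properties(1)[where beta = "1/2" and C = "trace_const L K (1/2)" and eta = "1/12" and d = "1/48" and a = "- L" and b = L])
  (use L assms trace_const_nonneg[of "1/2"] deriv_h_holder[of "1/2"] in \<open>auto simp: abs_le_iff\<close>)

lemma T_holder:
 assumes beta: "0 < beta" "beta < 1" and x: "\<bar>x\<bar> <= L" and w: "w \<in> strip (- L) L (1/12)" "cmod (w - top x) < 1/48"
 shows "cmod (deriv h w - T x) <= trace_const L K beta * cmod (w - top x) powr beta"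
 by (rule trace_properties(2)[where C = "trace_const L K beta" and eta = "1/12" and d = "1/48" and a = "- L" and b = L])
  (use L w x beta trace_const_nonneg[OF beta] deriv_h_holder[OF beta] in \<open>auto simp: abs_le_iff\<close>)

lemma T_holder2:
 assumes beta: "0 < beta" "beta < 1" and x: "\<bar>x\<bar> <= L" "\<bar>y\<bar> <= L" "cmod (top x - top y) < 1/48"
 shows "cmod (T x - T y) <= trace_const L K beta * cmod (top x - top y) powr beta"
 by (rule trace_properties(3)[where C = "trace_const L K beta" and eta = "1/12" and d = "1/48" and a = "- L" and b = L])
  (use L x beta trace_const_nonneg[OF beta] deriv_h_holder[OF beta] in \<open>auto simp: abs_le_iff\<close>)

lemma T_even: assumes x: "\<bar>x\<bar> <= L" shows "T (- x) = - cnj (T x)"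
proof -
 have "((\<lambda>w. - cnj (deriv h (- cnj w))) \<longlongrightarrow> - cnj (T x)) (at (top (- x)) within D)"
 proof (intro tendsto_minus tendsto_cnj)
  have "filterlim (\<lambda>w. - cnj w) (at (top x) within D) (at (top (- x)) within D)"
  proof -
   have "((\<lambda>w. - cnj w) \<longlongrightarrow> - cnj (top (- x))) (at (top (- x)) within D)" by (intro tendsto_intros)
   moreover have "- cnj (top (- x)) = top x" by (simp add: complex_eq_iff U_even)
   moreover have "\<forall>\<^sub>F w in at (top (- x)) within D. - cnj w \<in> D & - cnj w \<noteq> top x"
    unfolding eventually_at_filter
   proof (rule always_eventually, intro allI impI conjI)
    fix w assume "w \<noteq> top (- x)" "w \<in> D"
    then show "- cnj w \<in> D" using flip_even by blast
    show "- cnj w \<noteq> top x" using \<open>w \<noteq> top (- x)\<close> by (auto simp: complex_eq_iff U_even)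
   qed
   ultimately show ?thesis unfolding filterlim_at by simp
  qed
  from filterlim_compose[OF T_tendsto[OF x] this] show "((\<lambda>w. deriv h (- cnj w)) \<longlongrightarrow> T x) (at (top (- x)) within D)" .
 qed
 then have "(deriv h \<longlongrightarrow> - cnj (T x)) (at (top (- x)) within D)"
  by (rule Lim_transform_eventually) (auto simp: eventually_at_filter deriv_h_even(1)[symmetric] intro!: always_eventually)
 then show ?thesis using T_tendsto[of "- x"] x top_limit_point[of "- x"] by (intro tendsto_unique[of "at (top (- x)) within D"]) auto
qed

text \<open>The tangential bound tends to 0 at the boundary point, so h' times the tangent is purely
  imaginary there: the gradient is normal to the graph.\<close>

lemma T_tangential: assumes x: "\<bar>x\<bar> < L" shows "Re (T x * Complex 1 (p x)) = 0"
proof -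
 have main: "Re (T x * Complex 1 (p x)) = 0" if x: "0 <= x" "x < L" for x
 proof -
  have xl: "\<bar>x\<bar> <= L" using x by simp
  have 1: "((\<lambda>w. Re (deriv h w * Complex 1 (p x))) \<longlongrightarrow> Re (T x * Complex 1 (p x))) (at (top x) within D)"
   by (intro tendsto_intros T_tendsto xl)
  have 2: "((\<lambda>w. Re (deriv h w * Complex 1 (p x))) \<longlongrightarrow> 0) (at (top x) within D)"
  proof (rule Lim_null_comparison)
   have "((\<lambda>w. cmod (w - top x)) \<longlongrightarrow> cmod (top x - top x)) (at (top x) within D)" by (intro tendsto_intros)
   then have "\<forall>\<^sub>F w in at (top x) within D. cmod (w - top x) < rad (1/2)" using rad_bounds(1)[of "1/2"] by (intro order_tendstoD(2)) auto
   moreover have "\<forall>\<^sub>F w in at (top x) within D. w \<in> D" by (simp add: eventually_at_filter)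
   ultimately show "\<forall>\<^sub>F w in at (top x) within D. norm (Re (deriv h w * Complex 1 (p x))) <= slope_const L K (1/2) * cmod (w - top x) powr (1/2)"
    by eventually_elim (use tangential_derivative_bound[of "1/2" x] x in auto)
   have "((\<lambda>w. slope_const L K (1/2) * cmod (w - top x) powr (1/2)) \<longlongrightarrow> slope_const L K (1/2) * cmod (top x - top x) powr (1/2)) (at (top x) within D)"
    by (intro tendsto_mult tendsto_const tendsto_powr2 tendsto_norm tendsto_diff tendsto_ident_at) auto
   then show "((\<lambda>w. slope_const L K (1/2) * cmod (w - top x) powr (1/2)) \<longlongrightarrow> 0) (at (top x) within D)" by simp
  qed
  show ?thesis using tendsto_unique[OF top_limit_point[OF xl] 1 2] .
 qed
 show ?thesis
 proof (cases "x >= 0")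
  case False
  then have "Re (T (- x) * Complex 1 (p (- x))) = 0" using x by (intro main) auto
  then show ?thesis using T_even[of x] x by (simp add: p_odd)
 qed (use main x in auto)
qed

text \<open>The number - Im T is the vertical derivative of Re h at the boundary. On the vertical
  line below the boundary point 1 - Re h lies between 0 and 27/2 * s at depth s, and its slope
  converges. A limit outside [0, 27/2] would break one of the two bounds by the mean value
  theorem.\<close>

lemma T_Im: assumes x: "\<bar>x\<bar> < L" shows "0 <= - Im (T x)" "- Im (T x) <= 27/2"
proof -
 define c where "c s = top x - of_real s * \<i>" for s
 define f where "f s = 1 - Re (h (c s))" for s
 have cD: "c s \<in> D" if "0 < s" "s < 1/3" for s
  using that gap[of x] x by (auto simp: c_def cellD_def)
 have fl: "filterlim c (at (top x) within D) (at_right 0)"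
 proof -
  have "(c \<longlongrightarrow> top x - of_real 0 * \<i>) (at_right 0)" unfolding c_def by (intro tendsto_intros)
  moreover have "\<forall>\<^sub>F s in at_right 0. c s \<in> D & c s \<noteq> top x"
   unfolding eventually_at_right_field
  proof (intro exI[of _ "1/3"] conjI allI impI)
   fix s :: real assume s: "0 < s" "s < 1/3"
   show "c s \<in> D" by (rule cD[OF s])
   show "c s \<noteq> top x" using s by (simp add: c_def)
  qed simp
  ultimately show ?thesis unfolding filterlim_at by simp
 qed
 have dl: "((\<lambda>s. - Im (deriv h (c s))) \<longlongrightarrow> - Im (T x)) (at_right 0)"
  using filterlim_compose[OF T_tendsto fl] x by (intro tendsto_intros) auto
 have df: "(f has_real_derivative - Im (deriv h (c s))) (at s)" if "0 < s" "s < 1/3" for s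
 proof -
  have e: "c s = top x + (- \<i>) * of_real s" for s by (simp add: c_def)
  have "((\<lambda>s. Re (h (top x + (- \<i>) * of_real s))) has_real_derivative Re (- \<i> * deriv h (c s))) (at s)"
   using h_deriv[OF cD[OF that]] unfolding e by (rule has_real_derivative_Re_line)
  from DERIV_diff[OF DERIV_const[of 1] this] show ?thesis unfolding f_def[abs_def] e by simp
 qed
 have fb: "0 <= f s" "f s <= 27/2 * s" if "0 < s" "s < 1/3" for s
  using H(3)[OF cD[OF that]] H(4)[OF cD[OF that]] by (auto simp: f_def c_def)
 have mv: "\<exists>z. s' < z & z < s & f s - f s' = (s - s') * - Im (deriv h (c z))" if "0 < s'" "s' < s" "s < 1/3" for s s'
  using MVT2[of s' s f "\<lambda>z. - Im (deriv h (c z))"] df that by force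
 have ev13: "\<exists>b>0. b < 1/3 & (\<forall>s. 0 < s --> s <= b --> P s)" if "\<forall>\<^sub>F s in at_right 0. P s" for P :: "real => bool"
 proof -
  obtain b where b: "b > 0" "\<forall>s>0. s < b --> P s" using \<open>\<forall>\<^sub>F s in at_right 0. P s\<close> by (auto simp: eventually_at_right_field)
  then show ?thesis by (intro exI[of _ "min (b/2) (1/4)"]) auto
 qed
 show "0 <= - Im (T x)"
 proof (rule ccontr)
  assume neg: "\<not> 0 <= - Im (T x)"
  define m where "m = - Im (T x) / 2"
  have m: "m < 0" "- Im (T x) < m" using neg by (auto simp: m_def)
  obtain b where b: "b > 0" "b < 1/3" "\<And>s. 0 < s ==> s <= b ==> - Im (deriv h (c s)) < m"
   using ev13[OF order_tendstoD(2)[OF dl m(2)]] by blast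
  \<comment> \<open>The mean value theorem starts at a positive s', where f is differentiable. The
    factor 54 = 4 * 27/2 makes f s' at most - m * b / 4.\<close>
  define s' where "s' = min (b/2) (- m * b / 54)"
  have s': "0 < s'" "s' <= b / 2" "s' <= - m * b / 54" using b m by (auto simp: s'_def mult_neg_pos)
  obtain z where z: "s' < z" "z < b" "f b - f s' = (b - s') * - Im (deriv h (c z))" using mv[of s' b] s' b by auto
  have "- Im (deriv h (c z)) <= m" using b(3)[of z] z s' by linarith
  then have "(b - s') * - Im (deriv h (c z)) <= (b - s') * m" using z by (intro mult_left_mono) linarith+
  also have "\<dots> <= (b / 2) * m" using m s' by (intro mult_right_mono_neg) auto
  finally have "f b <= f s' + (b / 2) * m" using z by simp
  also have "\<dots> <= 27/2 * s' + (b / 2) * m" using fb(2)[of s'] s' b by simp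
  also have "\<dots> <= - m * b / 4 + (b / 2) * m" using s'(3) by (simp add: field_simps)
  also have "\<dots> < 0" using b m mult_neg_pos[of m b] by (simp add: field_simps)
  finally show False using fb(1)[of b] b by simp
 qed
 show "- Im (T x) <= 27/2"
 proof (rule ccontr)
  assume neg: "\<not> - Im (T x) <= 27/2"
  define m where "m = (- Im (T x) + 27/2) / 2"
  have m: "m > 27/2" "m < - Im (T x)" using neg by (auto simp: m_def)
  obtain b where b: "b > 0" "b < 1/3" "\<And>s. 0 < s ==> s <= b ==> m < - Im (deriv h (c s))"
   using ev13[OF order_tendstoD(1)[OF dl m(2)]] by blast
  define s' where "s' = b * (m - 27/2) / (2 * m)"
  have s': "0 < s'" "s' < b" "m * s' = b * (m - 27/2) / 2"
  proof -
   have q: "(m - 27/2) / (2 * m) < 1" "0 < (m - 27/2) / (2 * m)" using m by (auto simp: divide_less_eq)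
   show "s' < b" "0 < s'" using mult_strict_left_mono[OF q(1) b(1)] mult_pos_pos[OF b(1) q(2)] by (auto simp: s'_def)
   show "m * s' = b * (m - 27/2) / 2" using m by (simp add: s'_def)
  qed
  obtain z where z: "s' < z" "z < b" "f b - f s' = (b - s') * - Im (deriv h (c z))" using mv[of s' b] s' b by auto
  have "m <= - Im (deriv h (c z))" using b(3)[of z] z s' by linarith
  then have "(b - s') * m <= (b - s') * - Im (deriv h (c z))" using z by (intro mult_left_mono) linarith+
  then have "(b - s') * m <= f b - f s'" using z(3) by linarith
  moreover have "0 <= f s'" by (rule fb(1)) (use s' b in linarith)+
  moreover have "(b - s') * m = b * m - m * s'" by (simp add: algebra_simps)
  ultimately have "b * m - m * s' <= f b" by linarith
  also have "f b <= 27/2 * b" using fb(2) b by auto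
  finally have "b * m - b * (m - 27/2) / 2 <= 27/2 * b" unfolding s'(3) .
  moreover have "b * (m - 27/2) = b * m - 27/2 * b" by (simp add: algebra_simps)
  ultimately have "b * (m - 27/2) <= b * (m - 27/2) / 2" by linarith
  moreover have "b * (m - 27/2) > 0" using b m by simp
  ultimately show False by simp
 qed
qed

text \<open>A normal gradient satisfies |T|^2 = (1 + p^2) (Im T)^2, and (1 + 4/9) (27/2)^2 = 263.25.
  This is the origin of 270.\<close>

lemma T_norm: assumes x: "\<bar>x\<bar> < L" shows "(cmod (T x))\<^sup>2 <= 270"
proof -
 have R: "Re (T x) = p x * Im (T x)" using T_tangential[OF x] by (simp add: mult.commute)
 have "\<bar>Im (T x)\<bar> <= 27/2" using T_Im[OF x] by simp
 then have I: "(Im (T x))\<^sup>2 <= (27/2)\<^sup>2" using abs_le_square_iff[of "Im (T x)" "27/2"] by simp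
 have P: "(p x)\<^sup>2 <= (2/3)\<^sup>2" using p_bound'[of x] x abs_le_square_iff[of "p x" "2/3"] by simp
 have "(cmod (T x))\<^sup>2 = ((p x)\<^sup>2 + 1) * (Im (T x))\<^sup>2" unfolding cmod_power2 R by (simp add: power_mult_distrib algebra_simps)
 also have "\<dots> <= ((2/3)\<^sup>2 + 1) * (27/2)\<^sup>2" using I P by (intro mult_mono) auto
 finally show ?thesis by (simp add: power2_eq_square)
qed

end

section \<open>The truncated free boundary problem\<close>

lemma bounded_finite_coordinates_subseq:
 fixes X :: "nat => nat => real"
 assumes "\<And>m i. i < N ==> 0 <= X m i & X m i <= 1"
 shows "\<exists>r x. strict_mono (r :: nat => nat) & (\<forall>i<N. (\<lambda>m. X (r m) i) \<longlonglongrightarrow> x i)"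
 using assms
proof (induction N)
 case 0
 then show ?case by (intro exI[of _ id]) (auto simp: strict_mono_def)
next
 case (Suc N)
 have "\<exists>r x. strict_mono (r :: nat => nat) & (\<forall>i<N. (\<lambda>m. X (r m) i) \<longlonglongrightarrow> x i)"
  by (rule Suc.IH) (use Suc.prems in auto)
 then obtain r x where r: "strict_mono (r :: nat => nat)" "\<And>i. i < N ==> (\<lambda>m. X (r m) i) \<longlonglongrightarrow> x i" by blast
 have "\<forall>m. X (r m) N \<in> {0..1}" using Suc.prems by auto
 then obtain l s where s: "strict_mono (s :: nat => nat)" "((\<lambda>m. X (r m) N) \<circ> s) \<longlonglongrightarrow> l"
  using compact_Icc[of 0 "1::real"] unfolding compact_def by metis
 show ?case
 proof (intro exI[of _ "r \<circ> s"] exI[of _ "x(N := l)"] conjI allI impI)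
  show "strict_mono (r \<circ> s)" using r(1) s(1) by (simp add: strict_mono_o)
  fix i assume "i < Suc N"
  then consider "i < N" | "i = N" by linarith
  then show "(\<lambda>m. X ((r \<circ> s) m) i) \<longlonglongrightarrow> (x(N := l)) i"
  proof cases
   case 1
   then show ?thesis using LIMSEQ_subseq_LIMSEQ[OF r(2)[OF 1] s(1)] by (simp add: o_def)
  qed (use s in \<open>simp add: o_def\<close>)
 qed
qed

text \<open>Kuhn's combinatorial lemma on finer and finer grids. The dimension N is a value, so
  points are functions on the natural numbers, and \<open>cont\<close> ties the values of f to the
  coordinates below N. In the selected grid cube every coordinate has one corner where f does not
  decrease it and one where f does not increase it; the cubes shrink to a fixed point along a
  subsequence.\<close>

theorem brouwer_cube_nat:
 fixes f :: "(nat => real) => nat => real" and N :: nat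
 defines "cube \<equiv> (\<lambda>x :: nat => real. \<forall>i<N. 0 <= x i & x i <= 1)"
 assumes f: "\<And>x i. cube x ==> i < N ==> 0 <= f x i & f x i <= 1"
  and cont: "\<And>X x i. (\<And>m :: nat. cube (X m)) ==> (\<And>j. j < N ==> (\<lambda>m. X m j) \<longlonglongrightarrow> x j) ==> i < N ==> (\<lambda>m. f (X m) i) \<longlonglongrightarrow> f x i"
 shows "\<exists>x. cube x & (\<forall>i<N. f x i = x i)"
proof -
 have grid: "\<exists>q :: nat => nat. (\<forall>i<N. q i < P) & (\<forall>i<N. \<exists>a b. (\<forall>j<N. q j <= a j & a j <= q j + 1) & (\<forall>j<N. q j <= b j & b j <= q j + 1) &
   real (a i) / P <= f (\<lambda>j. real (a j) / P) i & f (\<lambda>j. real (b j) / P) i <= real (b i) / P)" if P: "0 < P" for P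
 proof -
  define g where "g x = (\<lambda>j. real (x j) / P)" for x :: "nat => nat"
  \<comment> \<open>Label 0 stands for a coordinate that f does not decrease. The faces
    \<open>x i = 0\<close> and \<open>x i = P\<close> get the labels prescribed by Kuhn's
    lemma.\<close>
  define label where "label x i = (if x i = 0 \<or> x i \<noteq> P & g x i <= f (g x) i then 0 else 1 :: nat)" for x i
  have gc: "cube (g x)" if "\<forall>i<N. x i <= P" for x using that P by (auto simp: cube_def g_def)
  obtain q where q: "\<forall>i<N. q i < P" "\<forall>i<N. \<exists>r s. (\<forall>j<N. q j <= r j & r j <= q j + 1) & (\<forall>j<N. q j <= s j & s j <= q j + 1) & label r i \<noteq> label s i"
   by (rule kuhn_lemma[OF P, of N label]) (use P in \<open>auto simp: label_def\<close>)
  have l0: "g x i <= f (g x) i" if "\<forall>j<N. x j <= P" "i < N" "label x i = 0" for x i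
   using that f[OF gc[OF that(1)] that(2)] by (auto simp: label_def g_def split: if_splits)
  have l1: "f (g x) i <= g x i" if "\<forall>j<N. x j <= P" "i < N" "label x i \<noteq> 0" for x i
   using that f[OF gc[OF that(1)] that(2)] P by (auto simp: label_def g_def split: if_splits)
  show ?thesis
  proof (rule exI[of _ q], intro conjI allI impI)
   fix i assume i: "i < N"
   then show "q i < P" using q by blast
   obtain r s where rs: "\<forall>j<N. q j <= r j & r j <= q j + 1" "\<forall>j<N. q j <= s j & s j <= q j + 1" "label r i \<noteq> label s i"
    using q(2) i by blast
   have "\<forall>j<N. r j <= P" "\<forall>j<N. s j <= P" using rs q(1) by (metis Suc_eq_plus1 Suc_leI le_trans)+
   then show "\<exists>a b. (\<forall>j<N. q j <= a j & a j <= q j + 1) & (\<forall>j<N. q j <= b j & b j <= q j + 1) &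
    real (a i) / P <= f (\<lambda>j. real (a j) / P) i & f (\<lambda>j. real (b j) / P) i <= real (b i) / P"
   proof (cases "label r i = 0")
    case True
    then have "label s i \<noteq> 0" using rs by simp
    then show ?thesis using True l0[of r i] l1[of s i] rs i \<open>\<forall>j<N. r j <= P\<close> \<open>\<forall>j<N. s j <= P\<close>
     by (intro exI[of _ r] exI[of _ s]) (simp add: g_def)
   next
    case False
    then have "label s i = 0" using rs by (auto simp: label_def split: if_splits)
    then show ?thesis using False l0[of s i] l1[of r i] rs i \<open>\<forall>j<N. r j <= P\<close> \<open>\<forall>j<N. s j <= P\<close>
     by (intro exI[of _ s] exI[of _ r]) (simp add: g_def)
   qed
  qed
 qed
 define Pm where "Pm m = Suc m" for m
 have "\<exists>q a b. \<forall>m. (\<forall>i<N. q m i < Pm m) & (\<forall>i<N. (\<forall>j<N. q m j <= a m i j & a m i j <= q m j + 1) & (\<forall>j<N. q m j <= b m i j & b m i j <= q m j + 1) &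
   real (a m i i) / Pm m <= f (\<lambda>j. real (a m i j) / Pm m) i & f (\<lambda>j. real (b m i j) / Pm m) i <= real (b m i i) / Pm m)"
 proof -
  have "\<exists>q a b. (\<forall>i<N. q i < Pm m) & (\<forall>i<N. (\<forall>j<N. q j <= a i j & a i j <= q j + 1) & (\<forall>j<N. q j <= b i j & b i j <= q j + 1) &
   real (a i i) / Pm m <= f (\<lambda>j. real (a i j) / Pm m) i & f (\<lambda>j. real (b i j) / Pm m) i <= real (b i i) / Pm m)" for m
  proof -
   obtain q where q: "\<forall>i<N. q i < Pm m" "\<forall>i<N. \<exists>a b. (\<forall>j<N. q j <= a j & a j <= q j + 1) & (\<forall>j<N. q j <= b j & b j <= q j + 1) &
    real (a i) / Pm m <= f (\<lambda>j. real (a j) / Pm m) i & f (\<lambda>j. real (b j) / Pm m) i <= real (b i) / Pm m"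
    using grid[of "Pm m"] by (auto simp: Pm_def simp del: of_nat_Suc)
   have "\<forall>i. \<exists>a b. i < N --> (\<forall>j<N. q j <= a j & a j <= q j + 1) & (\<forall>j<N. q j <= b j & b j <= q j + 1) &
    real (a i) / Pm m <= f (\<lambda>j. real (a j) / Pm m) i & f (\<lambda>j. real (b j) / Pm m) i <= real (b i) / Pm m"
    using q(2) by blast
   then obtain a b where "\<forall>i. i < N --> (\<forall>j<N. q j <= a i j & a i j <= q j + 1) & (\<forall>j<N. q j <= b i j & b i j <= q j + 1) &
    real (a i i) / Pm m <= f (\<lambda>j. real (a i j) / Pm m) i & f (\<lambda>j. real (b i j) / Pm m) i <= real (b i i) / Pm m"
    unfolding choice_iff by blast
   then show ?thesis using q(1) by blast
  qed
  from allI[OF this] show ?thesis unfolding choice_iff .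
 qed
 then obtain q a b where qab: "\<forall>m. (\<forall>i<N. q m i < Pm m) & (\<forall>i<N. (\<forall>j<N. q m j <= a m i j & a m i j <= q m j + 1) & (\<forall>j<N. q m j <= b m i j & b m i j <= q m j + 1) &
   real (a m i i) / Pm m <= f (\<lambda>j. real (a m i j) / Pm m) i & f (\<lambda>j. real (b m i j) / Pm m) i <= real (b m i i) / Pm m)"
  by (elim exE)
 have q: "\<And>m i. i < N ==> q m i < Pm m" using qab by blast
 have ab: "\<And>m i j. i < N ==> j < N ==> q m j <= a m i j & a m i j <= q m j + 1"
   "\<And>m i j. i < N ==> j < N ==> q m j <= b m i j & b m i j <= q m j + 1" using qab by blast+
 have fl: "\<And>m i. i < N ==> real (a m i i) / Pm m <= f (\<lambda>j. real (a m i j) / Pm m) i"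
   "\<And>m i. i < N ==> f (\<lambda>j. real (b m i j) / Pm m) i <= real (b m i i) / Pm m" using qab by blast+
 define X where "X m i = real (q m i) / Pm m" for m i
 have Pp: "0 < real (Pm m)" for m by (simp add: Pm_def)
 have X01: "0 <= X m i & X m i <= 1" if "i < N" for m i
  using q[OF that, of m] Pp[of m] by (simp add: X_def)
 obtain r x where r: "strict_mono r" "\<And>i. i < N ==> (\<lambda>m. X (r m) i) \<longlonglongrightarrow> x i"
  using bounded_finite_coordinates_subseq[of N X] X01 by blast
 have close: "(\<lambda>m. real (c (r m) j) / Pm (r m)) \<longlonglongrightarrow> x j"
  if j: "j < N" and c: "\<And>m. q m j <= c m j & c m j <= q m j + 1" for c :: "nat => nat => nat" and j
 proof -
  have "(\<lambda>m. real (c (r m) j) / Pm (r m) - X (r m) j) \<longlonglongrightarrow> 0"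
  proof (rule Lim_null_comparison)
   show "\<forall>\<^sub>F m in sequentially. norm (real (c (r m) j) / Pm (r m) - X (r m) j) <= 1 / real (Suc (r m))"
   proof (rule always_eventually, rule allI)
    fix m
    have "real (c (r m) j) / Pm (r m) - X (r m) j = (real (c (r m) j) - real (q (r m) j)) / Pm (r m)" by (simp add: X_def diff_divide_distrib)
    moreover have "0 <= real (c (r m) j) - real (q (r m) j)" "real (c (r m) j) - real (q (r m) j) <= 1" using c[of "r m"] by auto
    ultimately show "norm (real (c (r m) j) / Pm (r m) - X (r m) j) <= 1 / real (Suc (r m))"
     using Pp[of "r m"] by (simp add: Pm_def divide_right_mono)
   qed
   show "(\<lambda>m. 1 / real (Suc (r m))) \<longlonglongrightarrow> 0"
    using LIMSEQ_subseq_LIMSEQ[OF LIMSEQ_Suc[OF lim_1_over_n] r(1)] by (simp add: o_def)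
  qed
  from tendsto_add[OF this r(2)[OF j]] show ?thesis by simp
 qed
 have cubec: "cube (\<lambda>j. real (c m j) / Pm m)" if c: "\<And>m j. j < N ==> q m j <= c m j & c m j <= q m j + 1" for c m
  unfolding cube_def
 proof (intro allI impI conjI)
  fix j assume j: "j < N"
  have "c m j <= Pm m" using c[OF j, of m] q[OF j, of m] by linarith
  then show "real (c m j) / Pm m <= 1" using Pp[of m] by simp
 qed simp
 have "cube x" unfolding cube_def
 proof (intro allI impI conjI)
  fix i assume i: "i < N"
  show "0 <= x i" by (rule LIMSEQ_le_const[OF r(2)[OF i]]) (use X01[OF i] in auto)
  show "x i <= 1" by (rule LIMSEQ_le_const2[OF r(2)[OF i]]) (use X01[OF i] in auto)
 qed
 moreover have "f x i = x i" if i: "i < N" for i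
 proof (rule antisym)
  have A: "(\<lambda>m. f (\<lambda>j. real (a (r m) i j) / Pm (r m)) i) \<longlonglongrightarrow> f x i"
   by (rule cont) (use i ab close[of _ "\<lambda>m. a m i"] cubec[of "\<lambda>m. a m i"] in auto)
  have A': "(\<lambda>m. real (a (r m) i i) / Pm (r m)) \<longlonglongrightarrow> x i" by (rule close[of i "\<lambda>m. a m i"]) (use i ab in auto)
  show "x i <= f x i" by (rule LIMSEQ_le[OF A' A]) (use fl(1)[OF i] in auto)
  have B: "(\<lambda>m. f (\<lambda>j. real (b (r m) i j) / Pm (r m)) i) \<longlonglongrightarrow> f x i"
   by (rule cont) (use i ab close[of _ "\<lambda>m. b m i"] cubec[of "\<lambda>m. b m i"] in auto)
  have B': "(\<lambda>m. real (b (r m) i i) / Pm (r m)) \<longlonglongrightarrow> x i" by (rule close[of i "\<lambda>m. b m i"]) (use i ab in auto)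
  show "f x i <= x i" by (rule LIMSEQ_le[OF B B']) (use fl(2)[OF i] in auto)
 qed
 ultimately show ?thesis by blast
qed

text \<open>Odd and piecewise linear, with derivative 1 where j * delta < |x| < (j + 1) * delta and
  0 away from these shells. A combination with coefficients a j is the slope of an even graph of
  curvature a j on the j-th shell.\<close>

definition bump :: "real => nat => real => real" where
 "bump delta j x = max 0 (min delta (x - real j * delta)) - max 0 (min delta (- x - real j * delta))"

lemma bump_odd: "bump delta j (- x) = - bump delta j x" by (simp add: bump_def)

lemma bump_mono: "x <= y ==> bump delta j x <= bump delta j y"
 unfolding bump_def by (intro diff_mono max.mono min.mono) auto

lemma sum_clamp: "0 <= delta ==> (\<Sum>j<n. max 0 (min delta (x - real j * delta))) = max 0 (min (real n * delta) x)" for x delta :: real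
proof (induction n)
 case (Suc n)
 have *: "max 0 (min a x) + max 0 (min delta (x - a)) = max 0 (min (a + delta) x)" if "0 <= a" for a
  using that Suc.prems by (auto simp: max_def min_def)
 have "real (Suc n) * delta = real n * delta + delta" by (simp add: algebra_simps)
 then show ?case using Suc *[of "real n * delta"] by simp
qed simp

lemma sum_bump:
 assumes "0 <= delta"
 shows "(\<Sum>j<n. bump delta j x) = max 0 (min (real n * delta) x) - max 0 (min (real n * delta) (- x))"
 unfolding bump_def sum_subtractf sum_clamp[OF assms] ..

text \<open>The shells with index below n fill [- n * delta, n * delta], so inside it the increments
  of all bumps add up to that of the argument.\<close>

lemma sum_bump_diff:
 assumes "0 <= delta" "x <= y"
 shows "(\<Sum>j<n. bump delta j y - bump delta j x) <= y - x"
  and "- (real n * delta) <= x ==> y <= real n * delta ==> (\<Sum>j<n. bump delta j y - bump delta j x) = y - x"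
proof -
 define a where "a = real n * delta"
 have a: "0 <= a" using assms by (simp add: a_def)
 show "(\<Sum>j<n. bump delta j y - bump delta j x) <= y - x"
  unfolding sum_subtractf sum_bump[OF assms(1)] a_def[symmetric] using assms(2) a by (auto simp: max_def min_def)
 show "- (real n * delta) <= x ==> y <= real n * delta ==> (\<Sum>j<n. bump delta j y - bump delta j x) = y - x"
  unfolding sum_subtractf sum_bump[OF assms(1)] a_def[symmetric] using assms(2) a by (auto simp: max_def min_def)
qed

text \<open>On an interval of radius d around x that does not meet the shells in its interior the
  bump is constant; hence only shells near |x| influence a slope near x.\<close>

lemma bump_outside:
 assumes delta: "0 <= delta" and far: "\<bar>x\<bar> + d <= real j * delta \<or> real j * delta + delta + d <= \<bar>x\<bar>"
  and y: "\<bar>y - x\<bar> <= d" and z: "\<bar>z - x\<bar> <= d"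
 shows "bump delta j y = bump delta j z"
proof -
 define a where "a = real j * delta"
 have a: "0 <= a" using delta by (simp add: a_def)
 from far consider "\<bar>x\<bar> + d <= a" | "a + delta + d <= \<bar>x\<bar>" by (auto simp: a_def)
 then show ?thesis
 proof cases
  case 1
  then have "y <= a" "- y <= a" "z <= a" "- z <= a" using y z by argo+
  then show ?thesis unfolding bump_def a_def[symmetric] by (auto simp: max_def min_def)
 next
  case 2
  show ?thesis
  proof (cases "x >= 0")
   case True
   then have "a + delta <= y" "a + delta <= z" using 2 y z by argo+
   then show ?thesis unfolding bump_def a_def[symmetric] using a delta by (auto simp: max_def min_def)
  next
   case False
   then have "a + delta <= - y" "a + delta <= - z" using 2 y z by argo+
   then show ?thesis unfolding bump_def a_def[symmetric] using a delta by (auto simp: max_def min_def)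
  qed
 qed
qed

lemma profile_exists:
 assumes p: "\<And>x. p (-x) = - p x" "\<And>x y. x <= y ==> p x <= p y & p y - p x <= K * (y - x)" and K: "0 <= K"
 shows "\<exists>U. profile L K U p"
proof -
 have ab: "\<bar>p x - p y\<bar> <= K * \<bar>x - y\<bar>" for x y
  using p(2)[of x y] p(2)[of y x] by (cases "x <= y") auto
 have "isCont p x" for x
 proof -
  have "((\<lambda>y. p y - p x) \<longlongrightarrow> 0) (at x)"
  proof (rule Lim_null_comparison)
   show "\<forall>\<^sub>F y in at x. norm (p y - p x) <= K * \<bar>y - x\<bar>" using ab by auto
   have "((\<lambda>y. K * \<bar>y - x\<bar>) \<longlongrightarrow> K * \<bar>x - x\<bar>) (at x)" by (intro tendsto_intros)
   then show "((\<lambda>y. K * \<bar>y - x\<bar>) \<longlongrightarrow> 0) (at x)" by simp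
  qed
  then show ?thesis by (simp add: isCont_def LIM_zero_iff)
 qed
 then obtain F where F: "\<And>x. (F has_real_derivative p x) (at x)"
  using einterval_antiderivative[of "-\<infinity>" "\<infinity>" p] by (auto simp: has_real_derivative_iff_has_vector_derivative)
 have "profile L K (\<lambda>x. F x - F L) p" unfolding profile_def
  using p F by (auto intro!: derivative_eq_intros)
 then show ?thesis by blast
qed

lemma profile_diff:
 assumes "profile L K U p" "profile L K U' p'" and d: "\<And>x. \<bar>x\<bar> <= L ==> \<bar>p x - p' x\<bar> <= d" and x: "\<bar>x\<bar> <= L" and d0: "0 <= d"
 shows "\<bar>U x - U' x\<bar> <= 2 * L * d"
proof (cases "x = L")
 case True then show ?thesis using assms by (auto simp: profile_def)
next
 case False
 then have xl: "x < L" using x by auto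
 have "((\<lambda>x. U x - U' x) has_real_derivative p x - p' x) (at x)" for x
  using assms(1,2) by (auto simp: profile_def intro!: derivative_eq_intros)
 then obtain z where z: "x < z" "z < L" "(U L - U' L) - (U x - U' x) = (L - x) * (p z - p' z)"
  using MVT2[OF xl, of "\<lambda>x. U x - U' x" "\<lambda>x. p x - p' x"] by blast
 have "U x - U' x = - ((L - x) * (p z - p' z))" using z(3) assms(1,2) by (simp add: profile_def)
 then have "\<bar>U x - U' x\<bar> = (L - x) * \<bar>p z - p' z\<bar>" using xl by (simp add: abs_mult)
 also have "\<dots> <= (2 * L) * d" using x z d[of z] xl by (intro mult_mono) auto
 finally show ?thesis by simp
qed

section \<open>The discrete problem and its limit\<close>

definition swp :: "(complex => complex) => complex => complex" where
 "swp h = (\<lambda>w. 1 - cnj (h (1 * cnj w + (- \<i>))))"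

lemma potential_swap: "potential L K U p W q h ==> potential L K W q U p (swp h)"
 unfolding swp_def using is_potential_swap(1)[of L K U p W q h]
 by (simp add: potential_def potential_axioms_def cell.swap)

text \<open>Around the limit point a fixed ball lies in all cells with small
  \<open>deltam m\<close>. There the real parts differ by at most 27/2 * \<open>deltam m\<close>,
  and the interior gradient bound turns this into convergence of derivatives, uniformly enough for
  moving evaluation points.\<close>

lemma deriv_potential_converge:
 assumes pm: "\<And>m. potential L K (Um m) (pm m) (Wm m) (qm m) (hm m)" and pt: "potential L K U p W q h"
  and delta0: "deltam \<longlonglongrightarrow> 0" and delta: "\<And>m x. \<bar>x\<bar> <= L ==> \<bar>Um m x - U x\<bar> <= deltam m" "\<And>m x. \<bar>x\<bar> <= L ==> \<bar>Wm m x - W x\<bar> <= deltam m"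
  and w: "w \<in> cellD L U W" and wm: "wm \<longlonglongrightarrow> w"
 shows "(\<lambda>m. deriv (hm m) (wm m)) \<longlonglongrightarrow> deriv h w"
proof -
 interpret potential L K U p W q h by fact
 define s where "s = min (U (Re w) - Im w) (min (Im w + 1 + W (Re w)) (L - \<bar>Re w\<bar>))"
 have s: "s > 0" "s <= U (Re w) - Im w" "s <= Im w + 1 + W (Re w)" "s <= L - \<bar>Re w\<bar>" using in_D[OF w] by (auto simp: s_def)
 define r where "r = s / 8"
 have r: "r > 0" using s by (simp add: r_def)
 have inD: "v \<in> D & (deltam m < s / 8 --> v \<in> cellD L (Um m) (Wm m))" if v: "v \<in> ball w r" for v m
 proof -
  have vr: "\<bar>Re v - Re w\<bar> < r" "\<bar>Im v - Im w\<bar> < r"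
   using v abs_Re_le_cmod[of "v - w"] abs_Im_le_cmod[of "v - w"] by (auto simp: dist_norm norm_minus_commute)
  have X: "\<bar>Re v\<bar> < L" "\<bar>Re w\<bar> < L" using vr s unfolding r_def by argo+
  have u: "U (Re w) - U (Re v) <= 2/3 * \<bar>Re w - Re v\<bar>" "W (Re w) - W (Re v) <= 2/3 * \<bar>Re w - Re v\<bar>"
   using U_lip[of "Re v" "Re w"] bot.U_lip[of "Re v" "Re w"] X by auto
  have m: "\<bar>Um m (Re v) - U (Re v)\<bar> <= deltam m" "\<bar>Wm m (Re v) - W (Re v)\<bar> <= deltam m" using delta[of "Re v" m] X by auto
  have "Im v < U (Re v)" "- 1 - W (Re v) < Im v" using u vr s unfolding r_def by argo+
  moreover have "Im v < Um m (Re v)" "- 1 - Wm m (Re v) < Im v" if "deltam m < s / 8" using u vr s m that unfolding r_def by argo+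
  ultimately show ?thesis using X by (auto simp: cellD_def)
 qed
 have c0: "cell L K U p W q" by unfold_locales
 have "(\<lambda>m. deriv (hm m) (wm m) - deriv h (wm m)) \<longlonglongrightarrow> 0"
 proof (rule Lim_null_comparison)
  have "\<forall>\<^sub>F m in sequentially. deltam m < s / 8" using order_tendstoD(2)[OF delta0, of "s/8"] s by simp
  moreover have "\<forall>\<^sub>F m in sequentially. dist (wm m) w < r / 2" using tendstoD[OF wm, of "r/2"] r by simp
  ultimately show "\<forall>\<^sub>F m in sequentially. norm (deriv (hm m) (wm m) - deriv h (wm m)) <= 8 * (27/2 * deltam m) / (r / 2)"
  proof eventually_elim
   case (elim m)
   interpret m: potential L K "Um m" "pm m" "Wm m" "qm m" "hm m" by (rule pm)
   have cm: "cell L K (Um m) (pm m) (Wm m) (qm m)" by unfold_locales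
   have b: "ball (wm m) (r / 2) \<subseteq> ball w r"
   proof
    fix x assume "x \<in> ball (wm m) (r / 2)"
    then show "x \<in> ball w r" using elim(2) dist_triangle[of w x "wm m"] by (auto simp: dist_commute)
   qed
   have vD: "v \<in> D" "v \<in> m.D" if "v \<in> ball (wm m) (r / 2)" for v using inD[of v m] b that elim by auto
   have wc: "wm m \<in> ball (wm m) (r / 2)" using r by simp
   have "cmod (deriv (\<lambda>v. hm m v - h v) (wm m)) <= 8 * (27/2 * deltam m) / (r / 2)"
   proof (rule norm_deriv_le_Re_bound[where c = 0])
    show "(\<lambda>v. hm m v - h v) holomorphic_on ball (wm m) (r / 2)"
     using vD by (intro holomorphic_on_diff holomorphic_on_subset[OF H(1)] holomorphic_on_subset[OF m.H(1)]) auto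
    fix v assume v: "v \<in> ball (wm m) (r / 2)"
    have "Re (hm m v) - Re (h v) <= 27/2 * deltam m"
     by (rule potential_stability[OF cm c0 m.pot pot delta]) (use vD[OF v] in auto)
    moreover have "Re (h v) - Re (hm m v) <= 27/2 * deltam m"
     by (rule potential_stability[OF c0 cm pot m.pot]) (use vD[OF v] delta in \<open>auto simp: abs_minus_commute\<close>)
    ultimately show "\<bar>Re (hm m v - h v) - 0\<bar> <= 27/2 * deltam m" by (simp add: abs_if)
   qed (use r in auto)
   moreover have "deriv (\<lambda>v. hm m v - h v) (wm m) = deriv (hm m) (wm m) - deriv h (wm m)"
    by (rule DERIV_imp_deriv, rule DERIV_diff[OF m.h_deriv[OF vD(2)[OF wc]] h_deriv[OF vD(1)[OF wc]]])
   ultimately show ?case by simp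
  qed
  have "(\<lambda>m. 8 * (27/2 * deltam m) / (r / 2)) \<longlonglongrightarrow> 8 * (27/2 * 0) / (r / 2)" using r by (intro tendsto_intros delta0) auto
  then show "(\<lambda>m. 8 * (27/2 * deltam m) / (r / 2)) \<longlonglongrightarrow> 0" by simp
 qed
 moreover have "(\<lambda>m. deriv h (wm m)) \<longlonglongrightarrow> deriv h w"
  by (rule isCont_tendsto_compose[OF DERIV_isCont[OF h_deriv2[OF w]] wm])
 ultimately show ?thesis using tendsto_add by fastforce
qed

text \<open>The derivative is evaluated at depth 1 / (24 * n) and not on the graph, because interior
  derivatives depend continuously on the profiles. The depth shrinks with the mesh and is below
  1/12, inside the strip of the Hoelder bound.\<close>

definition sample :: "real => nat => (real => real) => nat => complex" where
 "sample L n U j = Complex (real j * (L / real n)) (U (real j * (L / real n)) - 1 / (24 * real n))"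

lemma (in cell) sample_in_strip:
 assumes "j < n" shows "sample L n U j \<in> strip (- L) L (1/12)" "sample L n U j \<in> D"
proof -
 have n: "real n >= 1" using assms by simp
 have "real j * (L / real n) < real n * (L / real n)" using assms L by (intro mult_strict_right_mono) auto
 then have "real j * (L / real n) < L" using n by simp
 moreover have "- L < real j * (L / real n)" using L n by (smt (verit) divide_nonneg_nonneg mult_nonneg_nonneg of_nat_0_le_iff)
 moreover have "0 < 1 / (24 * real n)" "1 / (24 * real n) < 1/12" using n by (auto simp: field_simps)
 ultimately show "sample L n U j \<in> strip (- L) L (1/12)" using strip_iff[of "1/12" "- L" L "sample L n U j"] by (simp add: sample_def)
 then show "sample L n U j \<in> D" by (simp add: strip_def)
qed

lemma step_slope_profile:
 fixes a :: "nat => real"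
 assumes L: "0 <= L" and a: "\<And>j. j < n ==> 0 <= a j & a j <= K" and K: "0 <= K"
 defines "p \<equiv> (\<lambda>y. \<Sum>j<n. a j * bump (L / real n) j y)"
 shows "p (- x) = - p x" "x <= y ==> p x <= p y & p y - p x <= K * (y - x)"
proof -
 show "p (- x) = - p x" unfolding p_def by (simp add: bump_odd sum_negf)
 assume xy: "x <= y"
 have e: "p y - p x = (\<Sum>j<n. a j * (bump (L / real n) j y - bump (L / real n) j x))"
  unfolding p_def by (simp add: sum_subtractf algebra_simps)
 have b: "0 <= bump (L / real n) j y - bump (L / real n) j x" for j using bump_mono[OF xy] by simp
 have "0 <= p y - p x" unfolding e using a b by (intro sum_nonneg mult_nonneg_nonneg) auto
 moreover have "p y - p x <= (\<Sum>j<n. K * (bump (L / real n) j y - bump (L / real n) j x))"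
  unfolding e using a b by (intro sum_mono mult_right_mono) auto
 moreover have "\<dots> <= K * (y - x)" unfolding sum_distrib_left[symmetric]
  using L K xy by (intro mult_left_mono sum_bump_diff(1)) auto
 ultimately show "p x <= p y & p y - p x <= K * (y - x)" by linarith
qed

text \<open>The unknowns are n curvatures for each graph, scaled to [0, 1]. They determine slopes,
  profiles and a potential, whose truncated squared gradients at the sample points are the new
  curvatures. Truncation at K keeps the image in the cube, where Brouwer's theorem applies.\<close>

lemma discrete_solution:
 assumes L: "1 <= L" and K: "0 < K" and KL: "K * L\<^sup>2 <= 2/3" and c: "0 <= c1" "0 <= c2" and n: "0 < n"
 shows "\<exists>a b U W h. (\<forall>j<n. 0 <= a j & a j <= K & 0 <= b j & b j <= K) &
  potential L K U (\<lambda>y. \<Sum>j<n. a j * bump (L / real n) j y) W (\<lambda>y. \<Sum>j<n. b j * bump (L / real n) j y) h &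
  (\<forall>j<n. a j = min K (c1 * (cmod (deriv h (sample L n U j)))\<^sup>2) & b j = min K (c2 * (cmod (deriv (swp h) (sample L n W j)))\<^sup>2))"
proof -
 define P where "P x = (\<lambda>y. \<Sum>j<n. K * x j * bump (L / real n) j y)" for x :: "nat => real"
 define Q where "Q x = (\<lambda>y. \<Sum>j<n. K * x (n + j) * bump (L / real n) j y)" for x :: "nat => real"
 define cube where "cube x \<longleftrightarrow> (\<forall>i<2 * n. 0 <= x i & x i <= 1)" for x :: "nat => real"
 define good where "good x U W h \<longleftrightarrow> potential L K U (P x) W (Q x) h" for x U W h
 have ex: "\<exists>Z. case Z of (U, W, h) => good x U W h" if x: "cube x" for x
 proof -
  have xb: "0 <= K * x j & K * x j <= K" if "j < 2 * n" for j
   using x that K by (auto simp: cube_def mult_le_cancel_left1)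
  have "\<exists>U. profile L K U (P x)" unfolding P_def
   by (rule profile_exists) (use step_slope_profile[of L n "\<lambda>j. K * x j" K] xb L K in auto)
  then obtain U where U: "profile L K U (P x)" by blast
  have "\<exists>W. profile L K W (Q x)" unfolding Q_def
   by (rule profile_exists) (use step_slope_profile[of L n "\<lambda>j. K * x (n + j)" K] xb L K in auto)
  then obtain W where W: "profile L K W (Q x)" by blast
  have cl: "cell L K U (P x) W (Q x)" by unfold_locales (use L K KL U W in auto)
  then obtain h where "is_potential L U W h" using cell.potential_exists by blast
  then have "good x U W h" using cl by (simp add: good_def potential_def potential_axioms_def)
  then show ?thesis by auto
 qed
 \<comment> \<open>The choice is harmless: a profile is fixed by its slope and the value 0 at L, the
   real part of h by the cell, and \<open>f\<close> uses only derivatives of h.\<close>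
 define Z where "Z x = (SOME Z. case Z of (U, W, h) => good x U W h)" for x
 define Uf where "Uf x = fst (Z x)" for x
 define Wf where "Wf x = fst (snd (Z x))" for x
 define hf where "hf x = snd (snd (Z x))" for x
 have gd: "potential L K (Uf x) (P x) (Wf x) (Q x) (hf x)" if "cube x" for x
 proof -
  have "case Z x of (U, W, h) => good x U W h" unfolding Z_def by (rule someI_ex[OF ex[OF that]])
  then show ?thesis by (simp add: good_def Uf_def Wf_def hf_def case_prod_beta)
 qed
 define f where "f x i = (if i < n then min K (c1 * (cmod (deriv (hf x) (sample L n (Uf x) i)))\<^sup>2) / K
  else min K (c2 * (cmod (deriv (swp (hf x)) (sample L n (Wf x) (i - n))))\<^sup>2) / K)" for x i
 have bumpb: "\<bar>bump (L / real n) j y\<bar> <= L" for j y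
 proof -
  have "1 * L <= real n * L" using n L by (intro mult_right_mono) auto
  then have "0 <= L / real n" "L / real n <= L" using n L by (auto simp: divide_le_eq mult.commute)
  then show ?thesis unfolding bump_def by (auto simp: max_def min_def)
 qed
 have "\<exists>x. (\<forall>i<2 * n. 0 <= x i & x i <= 1) & (\<forall>i<2 * n. f x i = x i)"
 proof (rule brouwer_cube_nat, unfold cube_def[symmetric])
  fix x i assume "cube x" "i < 2 * n"
  show "0 <= f x i & f x i <= 1" using K c by (auto simp: f_def min_def)
 next
  fix X x i assume X: "\<And>m. cube (X m)" and lim: "\<And>j. j < 2 * n ==> (\<lambda>m. X m j) \<longlonglongrightarrow> x j" and i: "i < 2 * n"
  have x: "cube x" unfolding cube_def
  proof (intro allI impI conjI)
   fix j assume j: "j < 2 * n"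
   show "0 <= x j" by (rule LIMSEQ_le_const[OF lim[OF j]]) (use X j in \<open>auto simp: cube_def\<close>)
   show "x j <= 1" by (rule LIMSEQ_le_const2[OF lim[OF j]]) (use X j in \<open>auto simp: cube_def\<close>)
  qed
  \<comment> \<open>Each bump is at most L in modulus, so \<open>e m\<close> bounds the change of
    both slopes at every argument; profiles move by at most 2 * L * \<open>e m\<close>.\<close>
  define e where "e m = (\<Sum>j<2 * n. K * \<bar>X m j - x j\<bar> * L)" for m
  have e0: "e \<longlonglongrightarrow> 0"
  proof -
   have "(\<lambda>m. \<Sum>j<2 * n. K * \<bar>X m j - x j\<bar> * L) \<longlonglongrightarrow> (\<Sum>j<2 * n. K * \<bar>x j - x j\<bar> * L)"
    by (intro tendsto_intros lim) auto
   then show ?thesis by (simp add: e_def[abs_def])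
  qed
  have ep: "0 <= e m" for m unfolding e_def using K L by (intro sum_nonneg) auto
  have diff: "\<bar>(\<Sum>j<n. K * X m (k j) * bump (L / real n) j y) - (\<Sum>j<n. K * x (k j) * bump (L / real n) j y)\<bar> <= e m"
   if k: "inj_on k {..<n}" "k ` {..<n} \<subseteq> {..<2 * n}" for m k y
  proof -
   have "\<bar>(\<Sum>j<n. K * X m (k j) * bump (L / real n) j y) - (\<Sum>j<n. K * x (k j) * bump (L / real n) j y)\<bar>
    = \<bar>\<Sum>j<n. K * (X m (k j) - x (k j)) * bump (L / real n) j y\<bar>" by (simp add: sum_subtractf[symmetric] algebra_simps)
   also have "\<dots> <= (\<Sum>j<n. \<bar>K * (X m (k j) - x (k j)) * bump (L / real n) j y\<bar>)" by (rule sum_abs)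
   also have "\<dots> <= (\<Sum>j<n. K * \<bar>X m (k j) - x (k j)\<bar> * L)"
    using K bumpb by (intro sum_mono) (auto simp: abs_mult intro!: mult_left_mono)
   also have "\<dots> = (\<Sum>j\<in>k ` {..<n}. K * \<bar>X m j - x j\<bar> * L)" using k(1) by (simp add: sum.reindex)
   also have "\<dots> <= e m" unfolding e_def using k(2) K L by (intro sum_mono2) auto
   finally show ?thesis .
  qed
  have dP: "\<bar>P (X m) y - P x y\<bar> <= e m" for m y unfolding P_def by (rule diff[of "\<lambda>j. j"]) auto
  have dQ: "\<bar>Q (X m) y - Q x y\<bar> <= e m" for m y unfolding Q_def by (rule diff[of "\<lambda>j. n + j"]) (auto simp: inj_on_def)
  have prfl: "profile L K (Uf y) (P y)" "profile L K (Wf y) (Q y)" if "cube y" for y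
   using gd[OF that] by (auto simp: potential_def cell_def cell_top_def)
  have dU: "\<bar>Uf (X m) y - Uf x y\<bar> <= 2 * L * e m" "\<bar>Wf (X m) y - Wf x y\<bar> <= 2 * L * e m" if "\<bar>y\<bar> <= L" for m y
   using profile_diff[OF prfl(1)[OF X] prfl(1)[OF x] dP that ep] profile_diff[OF prfl(2)[OF X] prfl(2)[OF x] dQ that ep] by auto
  have delta0: "(\<lambda>m. 2 * L * e m) \<longlonglongrightarrow> 0" using tendsto_mult_left[OF e0, of "2 * L"] by simp
  have cU: "(\<lambda>m. Uf (X m) y) \<longlonglongrightarrow> Uf x y" if "\<bar>y\<bar> <= L" for y
   by (rule LIM_zero_cancel, rule Lim_null_comparison[OF _ delta0]) (use dU(1)[OF that] in auto)
  have cW: "(\<lambda>m. Wf (X m) y) \<longlonglongrightarrow> Wf x y" if "\<bar>y\<bar> <= L" for y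
   by (rule LIM_zero_cancel, rule Lim_null_comparison[OF _ delta0]) (use dU(2)[OF that] in auto)
  have yL: "\<bar>real j * (L / real n)\<bar> <= L" if "j < n" for j
   using that L n mult_right_mono[of "real j" "real n" "L / real n"] by auto
  show "(\<lambda>m. f (X m) i) \<longlonglongrightarrow> f x i"
  proof (cases "i < n")
   case True
   interpret px: potential L K "Uf x" "P x" "Wf x" "Q x" "hf x" by (rule gd[OF x])
   have "(\<lambda>m. deriv (hf (X m)) (sample L n (Uf (X m)) i)) \<longlonglongrightarrow> deriv (hf x) (sample L n (Uf x) i)"
   proof (rule deriv_potential_converge[OF gd[OF X] gd[OF x] delta0 dU])
    show "sample L n (Uf x) i \<in> px.D" by (rule px.sample_in_strip[OF True])
    show "(\<lambda>m. sample L n (Uf (X m)) i) \<longlonglongrightarrow> sample L n (Uf x) i"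
     unfolding sample_def by (intro tendsto_Complex tendsto_diff tendsto_const cU yL True)
   qed
   then show ?thesis unfolding f_def using True K by (auto intro!: tendsto_intros)
  next
   case False
   then have i': "i - n < n" using i by simp
   interpret px: potential L K "Wf x" "Q x" "Uf x" "P x" "swp (hf x)" by (rule potential_swap[OF gd[OF x]])
   have "(\<lambda>m. deriv (swp (hf (X m))) (sample L n (Wf (X m)) (i - n))) \<longlonglongrightarrow> deriv (swp (hf x)) (sample L n (Wf x) (i - n))"
   proof (rule deriv_potential_converge[OF potential_swap[OF gd[OF X]] potential_swap[OF gd[OF x]] delta0 dU(2) dU(1)])
    show "sample L n (Wf x) (i - n) \<in> px.D" by (rule px.sample_in_strip[OF i'])
    show "(\<lambda>m. sample L n (Wf (X m)) (i - n)) \<longlonglongrightarrow> sample L n (Wf x) (i - n)"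
     unfolding sample_def by (intro tendsto_Complex tendsto_diff tendsto_const cW yL i')
   qed
   then show ?thesis unfolding f_def using False K by (auto intro!: tendsto_intros)
  qed
 qed
 then obtain x where x: "cube x" "\<And>i. i < 2 * n ==> f x i = x i" by (auto simp: cube_def)
 show ?thesis
 proof (intro exI conjI allI impI)
  show "potential L K (Uf x) (\<lambda>y. \<Sum>j<n. (K * x j) * bump (L / real n) j y) (Wf x) (\<lambda>y. \<Sum>j<n. (K * x (n + j)) * bump (L / real n) j y) (hf x)"
   using gd[OF x(1)] by (simp add: P_def Q_def)
  fix j assume j: "j < n"
  show "0 <= K * x j" "K * x j <= K" "0 <= K * x (n + j)" "K * x (n + j) <= K"
   using x(1) j K by (auto simp: cube_def mult_le_cancel_left1)
  show "K * x j = min K (c1 * (cmod (deriv (hf x) (sample L n (Uf x) j)))\<^sup>2)"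
   using x(2)[of j, symmetric] j K by (simp add: f_def)
  show "K * x (n + j) = min K (c2 * (cmod (deriv (swp (hf x)) (sample L n (Wf x) j)))\<^sup>2)"
   using x(2)[of "n + j", symmetric] j K by (simp add: f_def)
 qed
qed

text \<open>A fixed interior point v close to the graph links the sampled gradients to the trace T
  of the limit: the Hoelder bound in the m-th cell, convergence at v, and the Hoelder bound in the
  limit cell cost eta / 3 each. So all curvatures on shells near |X| approach the same number S, and
  the slope increments, being combinations of these curvatures, give derivative S.\<close>

lemma limit_slope:
 assumes pm: "\<And>m. potential L K (Um m) (pm m) (Wm m) (qm m) (hm m)" and pt: "potential L K U p W q h"
  and delta0: "deltam \<longlonglongrightarrow> 0" and delta: "\<And>m x. \<bar>x\<bar> <= L ==> \<bar>Um m x - U x\<bar> <= deltam m" "\<And>m x. \<bar>x\<bar> <= L ==> \<bar>Wm m x - W x\<bar> <= deltam m"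
  and plim: "\<And>x. \<bar>x\<bar> <= L ==> (\<lambda>m. pm m x) \<longlonglongrightarrow> p x"
  and nm: "filterlim nm at_top sequentially" "\<And>m. 0 < (nm m :: nat)"
  and pe: "\<And>m. pm m = (\<lambda>y. \<Sum>j<nm m. am m j * bump (L / real (nm m)) j y)"
  and am: "\<And>m j. j < nm m ==> am m j = min K (c * (cmod (deriv (hm m) (sample L (nm m) (Um m) j)))\<^sup>2)"
  and X: "\<bar>X\<bar> <= L"
 shows "(p has_real_derivative min K (c * (cmod (top_trace L U W (deriv h) \<bar>X\<bar>))\<^sup>2)) (at X within {-L..L})"
proof -
 interpret potential L K U p W q h by fact
 have c0: "cell L K U p W q" by unfold_locales
 define Y where "Y = \<bar>X\<bar>"
 have Y: "\<bar>Y\<bar> <= L" "0 <= Y" using X by (auto simp: Y_def)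
 define phi where "phi z = min K (c * (cmod z)\<^sup>2)" for z
 define S where "S = phi (T Y)"
 define C where "C = trace_const L K (1/2)"
 have C: "C >= 0" unfolding C_def by (rule trace_const_nonneg) auto
 have "(p has_derivative (\<lambda>y. S * y)) (at X within {-L..L})"
  unfolding has_derivative_within_alt
 proof (intro conjI allI impI)
  show "bounded_linear (\<lambda>y. S * y)" by (rule bounded_linear_mult_right)
  fix e :: real assume e: "0 < e"
  have "isCont phi (T Y)" unfolding phi_def by (intro continuous_intros)
  then obtain eta where eta: "eta > 0" "\<And>z. dist z (T Y) < eta ==> dist (phi z) S < e"
   using e unfolding continuous_at_eps_delta S_def by (meson dist_commute)
  \<comment> \<open>The number 1/50 is below the scale 1/48 of the Hoelder bounds; the other entry
    makes C * sqrt x smaller than eta / 3 for x <= R.\<close>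
  define R where "R = min (1/50) ((eta / (3 * (C + 1)))\<^sup>2)"
  have R: "R > 0" "R <= 1/50" using eta C by (auto simp: R_def)
  have CR: "C * x powr (1/2) < eta / 3" if "0 <= x" "x <= R" for x
  proof -
   have "x powr (1/2) = sqrt x" using that by (simp add: powr_half_sqrt)
   also have "\<dots> <= sqrt ((eta / (3 * (C + 1)))\<^sup>2)" using that by (intro real_sqrt_le_mono) (auto simp: R_def)
   also have "\<dots> = eta / (3 * (C + 1))" using eta C by simp
   finally have "C * x powr (1/2) <= C * (eta / (3 * (C + 1)))" using C by (intro mult_left_mono)
   also have "\<dots> < eta / 3" using eta C by (simp add: field_simps)
   finally show ?thesis .
  qed
  have "top Y \<in> closure (strip (- L) L (1/24))" using Y L by (intro top_in_closure_strip) auto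
  then obtain v where v: "v \<in> strip (- L) L (1/24)" "dist v (top Y) < R / 8"
   using R closure_approachable[of "top Y"] by (meson divide_pos_pos zero_less_numeral)
  have vs: "- L < Re v" "Re v < L" "0 < U (Re v) - Im v" "U (Re v) - Im v < 1/24"
   using v(1) strip_iff[of "1/24" "- L" L v] by auto
  have vD: "v \<in> D" using v(1) by (simp add: strip_def)
  have v12: "v \<in> strip (- L) L (1/12)" using v(1) by (simp add: strip_def)
  define d where "d = R / 32"
  have d: "d > 0" using R by (simp add: d_def)
  have hv: "(\<lambda>m. deriv (hm m) v) \<longlonglongrightarrow> deriv h v"
   by (rule deriv_potential_converge[OF pm pt delta0 delta vD tendsto_const])
  have L1: "((\<lambda>n::nat. L / real n) \<longlongrightarrow> 0) at_top"
   using tendsto_mult_right[OF lim_1_over_n, of L] by simp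
  have Ln: "(\<lambda>m. L / real (nm m)) \<longlonglongrightarrow> 0" by (rule filterlim_compose[OF L1 nm(1)])
  have ev2: "\<forall>\<^sub>F m in sequentially. L / real (nm m) < R / 32" by (rule order_tendstoD(2)[OF Ln]) (use R in simp)
  have "\<forall>\<^sub>F m in sequentially. deltam m < R / 8" by (rule order_tendstoD(2)[OF delta0]) (use R in simp)
  moreover have "\<forall>\<^sub>F m in sequentially. deltam m < U (Re v) - Im v" by (rule order_tendstoD(2)[OF delta0]) (use vs in simp)
  moreover note ev2
  moreover have "\<forall>\<^sub>F m in sequentially. dist (deriv (hm m) v) (deriv h v) < eta / 3" by (rule tendstoD[OF hv]) (use eta(1) in simp)
  ultimately have ev: "\<forall>\<^sub>F m in sequentially. \<forall>j<nm m. \<bar>real j * (L / real (nm m)) - Y\<bar> < R / 16 --> \<bar>am m j - S\<bar> < e"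
  proof eventually_elim
   case (elim m)
   interpret m: potential L K "Um m" "pm m" "Wm m" "qm m" "hm m" by (rule pm)
   show ?case
   proof (intro allI impI)
    fix j assume j: "j < nm m" and near: "\<bar>real j * (L / real (nm m)) - Y\<bar> < R / 16"
    define x where "x = real j * (L / real (nm m))"
    define w where "w = sample L (nm m) (Um m) j"
    have ws: "w \<in> m.strip (- L) L (1/12)" unfolding w_def by (rule m.sample_in_strip[OF j])
    have wR: "Re w = x" "Im w = Um m x - 1 / (24 * real (nm m))" by (auto simp: w_def sample_def x_def)
    have xL: "\<bar>x\<bar> <= L" using ws m.in_D(1)[of w] wR by (auto simp: m.strip_def)
    have n24: "0 < 1 / (24 * real (nm m))" "1 / (24 * real (nm m)) < R / 32"
    proof -
     have "1 / real (nm m) <= L / real (nm m)" using L by (intro divide_right_mono) auto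
     then have "1 / real (nm m) < R / 32" using elim(3) by linarith
     moreover have "1 / (24 * real (nm m)) <= 1 / real (nm m)" using nm(2)[of m] by (intro divide_left_mono) auto
     ultimately show "1 / (24 * real (nm m)) < R / 32" by simp
     show "0 < 1 / (24 * real (nm m))" using nm(2)[of m] by simp
    qed
    have "\<bar>Um m x - U x\<bar> <= deltam m" by (rule delta(1)[OF xL])
    moreover have "\<bar>U x - U Y\<bar> <= 2/3 * \<bar>x - Y\<bar>" using U_lip[OF xL Y(1)] U_lip[OF Y(1) xL] by (simp add: abs_if split: if_splits)
    ultimately have "\<bar>Im w - U Y\<bar> < R / 4" "\<bar>Re w - Y\<bar> < R / 4"
     using wR n24 near elim(1) R(1) unfolding x_def[symmetric] by argo+
    then have wt: "cmod (w - top Y) < R / 2" using cmod_le[of "w - top Y"] by simp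
    have wv: "cmod (w - v) < R"
     using norm_triangle_ineq[of "w - top Y" "top Y - v"] wt v(2) R by (simp add: dist_norm norm_minus_commute)
    have vm: "v \<in> m.strip (- L) L (1/12)"
    proof -
     have "\<bar>Um m (Re v) - U (Re v)\<bar> <= deltam m" using delta(1)[of "Re v" m] vs by auto
     then show ?thesis using m.strip_iff[of "1/12" "- L" L v] vs elim(1,2) R by auto
    qed
    have "cmod (deriv (hm m) w - deriv (hm m) v) <= C * cmod (w - v) powr (1/2)"
     unfolding C_def by (rule m.deriv_h_holder[OF _ _ ws vm]) (use wv R in auto)
    also have "\<dots> < eta / 3" using wv by (intro CR) auto
    finally have 1: "dist (deriv (hm m) w) (deriv (hm m) v) < eta / 3" by (simp add: dist_norm)
    have "cmod (deriv h v - T Y) <= C * cmod (v - top Y) powr (1/2)"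
     unfolding C_def by (rule T_holder[OF _ _ Y(1) v12]) (use v(2) R in \<open>auto simp: dist_norm\<close>)
    also have "\<dots> < eta / 3" using v(2) R by (intro CR) (auto simp: dist_norm)
    finally have 2: "dist (deriv h v) (T Y) < eta / 3" by (simp add: dist_norm)
    have "dist (deriv (hm m) w) (T Y) < eta"
     using 1 2 elim(4) dist_triangle[of "deriv (hm m) w" "T Y" "deriv (hm m) v"] dist_triangle[of "deriv (hm m) v" "T Y" "deriv h v"] by linarith
    from eta(2)[OF this] show "\<bar>am m j - S\<bar> < e" using am[OF j] by (simp add: phi_def w_def dist_real_def)
   qed
  qed
  show "\<exists>d>0. \<forall>y\<in>{- L..L}. norm (y - X) < d --> norm (p y - p X - S * (y - X)) <= e * norm (y - X)"
  proof (intro exI[of _ d] conjI ballI impI d)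
   fix y assume y: "y \<in> {- L..L}" "norm (y - X) < d"
   have yL: "\<bar>y\<bar> <= L" using y by auto
   have "(\<lambda>m. \<bar>pm m y - pm m X - S * (y - X)\<bar>) \<longlonglongrightarrow> \<bar>p y - p X - S * (y - X)\<bar>"
    by (intro tendsto_intros plim yL X)
   moreover have "\<forall>\<^sub>F m in sequentially. \<bar>pm m y - pm m X - S * (y - X)\<bar> <= e * \<bar>y - X\<bar>"
    using ev ev2
   proof eventually_elim
    case (elim m)
    have A1: "\<bar>am m j - S\<bar> < e" if "j < nm m" "\<bar>real j * (L / real (nm m)) - Y\<bar> < R / 16" for j using elim(1) that by blast
    have A2: "L / real (nm m) < R / 32" using elim(2) .
    define D where "D = L / real (nm m)"
    have D: "0 <= D" "real (nm m) * D = L" "D < R / 32" using L nm(2)[of m] A2 by (auto simp: D_def)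
    define B where "B j = bump D j y - bump D j X" for j
    have sB: "(\<Sum>j<nm m. B j) = y - X"
    proof (cases "X <= y")
     case True
     then show ?thesis unfolding B_def using sum_bump_diff(2)[OF D(1) True, of "nm m"] D(2) y X by auto
    next
     case False
     then have yX: "y <= X" by simp
     have "(\<Sum>j<nm m. bump D j X - bump D j y) = X - y" using sum_bump_diff(2)[OF D(1) yX, of "nm m"] D(2) y X by auto
     moreover have "(\<Sum>j<nm m. B j) = - (\<Sum>j<nm m. bump D j X - bump D j y)" unfolding B_def by (simp add: sum_negf[symmetric])
     ultimately show ?thesis by simp
    qed
    have aB: "(\<Sum>j<nm m. \<bar>B j\<bar>) = \<bar>y - X\<bar>"
    proof (cases "X <= y")
     case True
     then have "\<bar>B j\<bar> = B j" for j using bump_mono[OF True, of D j] by (simp add: B_def)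
     then show ?thesis using sB True by simp
    next
     case False
     then have "\<bar>B j\<bar> = - B j" for j using bump_mono[of y X D j] by (simp add: B_def)
     then show ?thesis using sB False by (simp add: sum_negf)
    qed
    \<comment> \<open>The increments \<open>B j\<close> have one sign and total y - X, so the error
      is an average of \<open>am m j - S\<close>. Only shells meeting the interval around |X| have
      nonzero \<open>B j\<close>.\<close>
    have "pm m y - pm m X - S * (y - X) = (\<Sum>j<nm m. (am m j - S) * B j)"
    proof -
     have "pm m y - pm m X = (\<Sum>j<nm m. am m j * B j)" unfolding pe B_def D_def by (simp add: sum_subtractf[symmetric] algebra_simps)
     moreover have "S * (y - X) = (\<Sum>j<nm m. S * B j)" by (simp add: sB[symmetric] sum_distrib_left)
     ultimately show ?thesis by (simp add: sum_subtractf[symmetric] algebra_simps)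
    qed
    also have "\<bar>\<dots>\<bar> <= (\<Sum>j<nm m. \<bar>(am m j - S) * B j\<bar>)" by (rule sum_abs)
    also have "\<dots> <= (\<Sum>j<nm m. e * \<bar>B j\<bar>)"
    proof (rule sum_mono)
     fix j assume "j \<in> {..<nm m}"
     then have j: "j < nm m" by simp
     show "\<bar>(am m j - S) * B j\<bar> <= e * \<bar>B j\<bar>"
     proof (cases "B j = 0")
      case False
      have "\<not> (\<bar>X\<bar> + d <= real j * D \<or> real j * D + D + d <= \<bar>X\<bar>)"
       using bump_outside[OF D(1), of X d j y X] False y(2) d by (auto simp: B_def)
      then have "\<bar>real j * D - Y\<bar> < d + D" using D(1) unfolding Y_def by argo
      then have "\<bar>real j * (L / real (nm m)) - Y\<bar> < R / 16" using D(3) unfolding D_def[symmetric] d_def by simp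
      then have "\<bar>am m j - S\<bar> <= e" using A1[OF j] by simp
      then show ?thesis unfolding abs_mult by (intro mult_right_mono) auto
     qed simp
    qed
    also have "\<dots> = e * \<bar>y - X\<bar>" by (simp add: sum_distrib_left[symmetric] aB)
    finally show ?case .
   qed
   ultimately have "\<bar>p y - p X - S * (y - X)\<bar> <= e * \<bar>y - X\<bar>" by (rule tendsto_upperbound) simp
   then show "norm (p y - p X - S * (y - X)) <= e * norm (y - X)" by simp
  qed
 qed
 then show ?thesis unfolding has_field_derivative_def S_def phi_def Y_def by simp
qed

text \<open>The slopes share the Lipschitz constant K, so Arzela-Ascoli gives a common uniformly
  convergent subsequence. The potential of the limit profiles is constructed anew, and stability
  relates it to those of the approximations.\<close>

theorem coupled_solution:
 assumes L: "1 <= L" and K: "0 < K" and KL: "K * L\<^sup>2 <= 2/3" and c: "0 <= c1" "0 <= c2"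
 obtains U p W q h where "potential L K U p W q h"
  "\<And>X. \<bar>X\<bar> <= L ==> (p has_real_derivative min K (c1 * (cmod (top_trace L U W (deriv h) \<bar>X\<bar>))\<^sup>2)) (at X within {-L..L})"
  "\<And>X. \<bar>X\<bar> <= L ==> (q has_real_derivative min K (c2 * (cmod (top_trace L W U (deriv (swp h)) \<bar>X\<bar>))\<^sup>2)) (at X within {-L..L})"
proof -
 have "\<forall>m. \<exists>a b U W h. (\<forall>j<Suc m. 0 <= a j & a j <= K & 0 <= b j & b j <= K) &
  potential L K U (\<lambda>y. \<Sum>j<Suc m. a j * bump (L / real (Suc m)) j y) W (\<lambda>y. \<Sum>j<Suc m. b j * bump (L / real (Suc m)) j y) h &
  (\<forall>j<Suc m. a j = min K (c1 * (cmod (deriv h (sample L (Suc m) U j)))\<^sup>2) & b j = min K (c2 * (cmod (deriv (swp h) (sample L (Suc m) W j)))\<^sup>2))"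
  by (intro allI discrete_solution[OF L K KL c]) simp
 then obtain a b U W h where all: "\<forall>m. (\<forall>j<Suc m. 0 <= a m j & a m j <= K & 0 <= b m j & b m j <= K) &
  potential L K (U m) (\<lambda>y. \<Sum>j<Suc m. a m j * bump (L / real (Suc m)) j y) (W m) (\<lambda>y. \<Sum>j<Suc m. b m j * bump (L / real (Suc m)) j y) (h m) &
  (\<forall>j<Suc m. a m j = min K (c1 * (cmod (deriv (h m) (sample L (Suc m) (U m) j)))\<^sup>2) & b m j = min K (c2 * (cmod (deriv (swp (h m)) (sample L (Suc m) (W m) j)))\<^sup>2))"
  unfolding choice_iff by (elim exE)
 have pot: "\<And>m. potential L K (U m) (\<lambda>y. \<Sum>j<Suc m. a m j * bump (L / real (Suc m)) j y) (W m) (\<lambda>y. \<Sum>j<Suc m. b m j * bump (L / real (Suc m)) j y) (h m)"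
  using all by blast
 have ab: "\<And>m j. j < Suc m ==> a m j = min K (c1 * (cmod (deriv (h m) (sample L (Suc m) (U m) j)))\<^sup>2) & b m j = min K (c2 * (cmod (deriv (swp (h m)) (sample L (Suc m) (W m) j)))\<^sup>2)"
  using all by blast
 define p where "p m = (\<lambda>y. \<Sum>j<Suc m. a m j * bump (L / real (Suc m)) j y)" for m
 define q where "q m = (\<lambda>y. \<Sum>j<Suc m. b m j * bump (L / real (Suc m)) j y)" for m
 have pot': "potential L K (U m) (p m) (W m) (q m) (h m)" for m using pot by (simp add: p_def q_def)
 have prp: "profile L K (U m) (p m)" "profile L K (W m) (q m)" for m
  using pot'[of m] by (auto simp: potential_def cell_def cell_top_def)
 \<comment> \<open>Convergence is known on [-L, L] only. Composition with this projection continues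
   the limit slopes by constants and keeps them odd, monotone and Lipschitz, as a profile on the
   whole line demands.\<close>
 define cl where "cl x = max (- L) (min L x)" for x
 have clL: "\<bar>cl x\<bar> <= L" "\<bar>x\<bar> <= L ==> cl x = x" for x using L by (auto simp: cl_def)
 have cls: "cl (- x) = - cl x" "x <= y ==> cl x <= cl y & cl y - cl x <= y - x" for x y
  using L by (auto simp: cl_def max_def min_def)
 have lip: "\<bar>f x - f y\<bar> <= K * \<bar>x - y\<bar>" if "profile L K V f" for V f x y
 proof -
  have "x <= y ==> f x <= f y & f y - f x <= K * (y - x)" "y <= x ==> f y <= f x & f x - f y <= K * (x - y)"
   using that by (auto simp: profile_def)
  then show ?thesis by (cases "x <= y") auto
 qed
 have arz: "\<exists>g k. strict_mono (k :: nat => nat) & (\<forall>e>0. \<exists>N. \<forall>n x. n >= N & x \<in> {-L..L} --> norm (f (k n) x - g x) < e)"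
  if f: "\<And>m. profile L K (V m) (f m)" for f V
 proof -
  obtain g k where "continuous_on {-L..L} g" "strict_mono (k :: nat => nat)"
   "\<And>e. 0 < e ==> \<exists>N. \<forall>n x. n >= N & x \<in> {-L..L} --> norm (f (k n) x - g x) < e"
  proof (rule Arzela_Ascoli[of "{-L..L}" f "K * L"])
   fix m x assume x: "x \<in> {-L..L}"
   have "f m (- 0) = - f m 0" using f[of m] unfolding profile_def by blast
   then have "f m 0 = 0" by simp
   then have "\<bar>f m x\<bar> <= K * \<bar>x\<bar>" using lip[OF f, of m x 0] by simp
   also have "\<dots> <= K * L" using x K by (intro mult_left_mono) auto
   finally show "norm (f m x) <= K * L" by simp
  next
   fix x e :: real assume "0 < e"
   show "\<exists>d>0. \<forall>n y. y \<in> {-L..L} & norm (x - y) < d --> norm (f n x - f n y) < e"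
   proof (intro exI[of _ "e / K"] conjI allI impI)
    fix n y assume "y \<in> {-L..L} & norm (x - y) < e / K"
    then have "K * \<bar>x - y\<bar> < e" using K by (simp add: field_simps)
    then show "norm (f n x - f n y) < e" using lip[OF f, of n x y] by simp
   qed (use K \<open>0 < e\<close> in auto)
  qed auto
  then show ?thesis by blast
 qed
 obtain g1 k1 where k1: "strict_mono (k1 :: nat => nat)" "\<And>e. e > 0 ==> \<exists>N. \<forall>n x. n >= N & x \<in> {-L..L} --> norm (p (k1 n) x - g1 x) < e"
  using arz[of U p] prp(1) by blast
 obtain g2 k2 where k2: "strict_mono (k2 :: nat => nat)" "\<And>e. e > 0 ==> \<exists>N. \<forall>n x. n >= N & x \<in> {-L..L} --> norm (q (k1 (k2 n)) x - g2 x) < e"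
  using arz[of "\<lambda>m. W (k1 m)" "\<lambda>m. q (k1 m)"] prp(2) by blast
 define k where "k n = k1 (k2 n)" for n
 have kmono: "strict_mono k" using k1(1) k2(1) by (simp add: k_def strict_mono_def)
 have u1: "\<exists>N. \<forall>n x. n >= N & \<bar>x\<bar> <= L --> \<bar>p (k n) x - g1 x\<bar> < e" if e: "e > 0" for e
 proof -
  obtain N where N: "\<forall>n x. n >= N & x \<in> {-L..L} --> norm (p (k1 n) x - g1 x) < e" using k1(2)[OF e] by blast
  show ?thesis
  proof (intro exI[of _ N] allI impI)
   fix n x assume "N <= n & \<bar>x\<bar> <= L"
   moreover have "n <= k2 n" using k2(1) by (rule strict_mono_imp_increasing)
   ultimately have "norm (p (k1 (k2 n)) x - g1 x) < e" using N by (auto simp: abs_le_iff)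
   then show "\<bar>p (k n) x - g1 x\<bar> < e" by (simp add: k_def)
  qed
 qed
 have u2: "\<exists>N. \<forall>n x. n >= N & \<bar>x\<bar> <= L --> \<bar>q (k n) x - g2 x\<bar> < e" if e: "e > 0" for e
 proof -
  obtain N where N: "\<forall>n x. n >= N & x \<in> {-L..L} --> norm (q (k1 (k2 n)) x - g2 x) < e" using k2(2)[OF e] by blast
  show ?thesis
  proof (intro exI[of _ N] allI impI)
   fix n x assume "N <= n & \<bar>x\<bar> <= L"
   then have "N <= n & x \<in> {-L..L}" by auto
   then show "\<bar>q (k n) x - g2 x\<bar> < e" using N by (simp add: k_def)
  qed
 qed
 have lim1: "(\<lambda>n. p (k n) x) \<longlonglongrightarrow> g1 x" if "\<bar>x\<bar> <= L" for x
  unfolding LIMSEQ_iff real_norm_def using u1 that by blast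
 have lim2: "(\<lambda>n. q (k n) x) \<longlonglongrightarrow> g2 x" if "\<bar>x\<bar> <= L" for x
  unfolding LIMSEQ_iff real_norm_def using u2 that by blast
 have prl: "\<exists>V'. profile L K V' (\<lambda>x. g (cl x))"
  if f: "\<And>m. profile L K (V m) (f m)" and l: "\<And>x. \<bar>x\<bar> <= L ==> (\<lambda>n. f (k n) x) \<longlonglongrightarrow> g x" for V f g
 proof (rule profile_exists)
  show "g (cl (- x)) = - g (cl x)" for x
  proof -
   have "(\<lambda>n. - f (k n) (cl x)) \<longlonglongrightarrow> - g (cl x)" by (intro tendsto_minus l clL)
   moreover have "f m (cl (- x)) = - f m (cl x)" for m using f[of m] unfolding profile_def cls by blast
   ultimately have "(\<lambda>n. f (k n) (cl (- x))) \<longlonglongrightarrow> - g (cl x)" by simp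
   then show ?thesis using l[OF clL(1)[of "- x"]] LIMSEQ_unique by blast
  qed
  show "g (cl x) <= g (cl y) & g (cl y) - g (cl x) <= K * (y - x)" if xy: "x <= y" for x y
  proof
   have m: "f m (cl x) <= f m (cl y)" "f m (cl y) - f m (cl x) <= K * (cl y - cl x)" for m
    using f[of m] cls(2)[OF xy] unfolding profile_def by blast+
   show "g (cl x) <= g (cl y)" by (rule LIMSEQ_le[OF l[OF clL(1)] l[OF clL(1)]]) (use m in auto)
   have "g (cl y) - g (cl x) <= K * (cl y - cl x)"
    by (rule LIMSEQ_le_const2[OF tendsto_diff[OF l[OF clL(1)] l[OF clL(1)]]]) (use m in auto)
   also have "\<dots> <= K * (y - x)" using K cls(2)[OF xy] by (intro mult_left_mono) auto
   finally show "g (cl y) - g (cl x) <= K * (y - x)" .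
  qed
 qed (use K in auto)
 obtain U' where U': "profile L K U' (\<lambda>x. g1 (cl x))" using prl[OF prp(1) lim1] by blast
 obtain W' where W': "profile L K W' (\<lambda>x. g2 (cl x))" using prl[OF prp(2) lim2] by blast
 have cel: "cell L K U' (\<lambda>x. g1 (cl x)) W' (\<lambda>x. g2 (cl x))" by unfold_locales (use L K KL U' W' in auto)
 then obtain h' where h': "is_potential L U' W' h'" using cell.potential_exists by blast
 have pt: "potential L K U' (\<lambda>x. g1 (cl x)) W' (\<lambda>x. g2 (cl x)) h'" using cel h' by (simp add: potential_def potential_axioms_def)
 define eps where "eps n = (SUP x\<in>{-L..L}. \<bar>p (k n) x - g1 x\<bar>) + (SUP x\<in>{-L..L}. \<bar>q (k n) x - g2 x\<bar>)" for n
 have gL: "\<bar>g (cl x)\<bar> <= K * L" if "profile L K V (\<lambda>x. g (cl x))" for V g x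
 proof -
  have "g (cl (- 0)) = - g (cl 0)" using that unfolding profile_def by blast
  then have "g (cl 0) = 0" by simp
  moreover have "\<bar>g (cl (cl x)) - g (cl 0)\<bar> <= K * \<bar>cl x - 0\<bar>" using lip[OF that] by blast
  moreover have "cl (cl x) = cl x" using clL by blast
  moreover have "K * \<bar>cl x - 0\<bar> <= K * L" using K clL(1)[of x] by (intro mult_left_mono) auto
  ultimately show ?thesis by simp
 qed
 have fL: "\<bar>f x\<bar> <= K * L" if "profile L K V f" "\<bar>x\<bar> <= L" for V f x
 proof -
  have "f (- 0) = - f 0" using that(1) unfolding profile_def by blast
  then have "f 0 = 0" by simp
  moreover have "\<bar>f x - f 0\<bar> <= K * \<bar>x - 0\<bar>" using lip[OF that(1)] by blast
  moreover have "K * \<bar>x - 0\<bar> <= K * L" using K that(2) by (intro mult_left_mono) auto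
  ultimately show ?thesis by simp
 qed
 have bdd: "bdd_above ((\<lambda>x. \<bar>f x - g x\<bar>) ` {-L..L})" if "profile L K V f" "profile L K V' (\<lambda>x. g (cl x))" for V f V' g
 proof (rule bdd_aboveI2[of _ _ "2 * (K * L)"])
  fix x assume x: "x \<in> {-L..L}"
  then have "cl x = x" using clL(2) by auto
  then have "\<bar>g x\<bar> <= K * L" using gL[OF that(2), of x] by simp
  moreover have "\<bar>f x\<bar> <= K * L" using fL[OF that(1), of x] x by auto
  ultimately show "\<bar>f x - g x\<bar> <= 2 * (K * L)" by linarith
 qed
 have epsb: "\<bar>p (k n) x - g1 (cl x)\<bar> <= eps n" "\<bar>q (k n) x - g2 (cl x)\<bar> <= eps n" "0 <= eps n" if x: "\<bar>x\<bar> <= L" for n x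
 proof -
  have x': "x \<in> {-L..L}" "cl x = x" using x clL(2) by auto
  have 1: "\<bar>p (k n) x - g1 x\<bar> <= (SUP x\<in>{-L..L}. \<bar>p (k n) x - g1 x\<bar>)" by (rule cSUP_upper[OF x'(1) bdd[OF prp(1) U']])
  have 2: "\<bar>q (k n) x - g2 x\<bar> <= (SUP x\<in>{-L..L}. \<bar>q (k n) x - g2 x\<bar>)" by (rule cSUP_upper[OF x'(1) bdd[OF prp(2) W']])
  show "\<bar>p (k n) x - g1 (cl x)\<bar> <= eps n" "\<bar>q (k n) x - g2 (cl x)\<bar> <= eps n" "0 <= eps n"
   using 1 2 x'(2) unfolding eps_def by auto
 qed
 have eps0: "eps \<longlonglongrightarrow> 0"
 proof (rule LIMSEQ_I)
  fix e :: real assume e: "0 < e"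
  obtain N1 where N1: "\<forall>n x. n >= N1 & \<bar>x\<bar> <= L --> \<bar>p (k n) x - g1 x\<bar> < e / 4" using u1[of "e/4"] e by auto
  obtain N2 where N2: "\<forall>n x. n >= N2 & \<bar>x\<bar> <= L --> \<bar>q (k n) x - g2 x\<bar> < e / 4" using u2[of "e/4"] e by auto
  have ne: "{-L..L} \<noteq> {}" using L by auto
  show "\<exists>N. \<forall>n\<ge>N. norm (eps n - 0) < e"
  proof (intro exI[of _ "max N1 N2"] allI impI)
   fix n assume n: "max N1 N2 <= n"
   have "(SUP x\<in>{-L..L}. \<bar>p (k n) x - g1 x\<bar>) <= e / 4" by (rule cSUP_least[OF ne]) (use N1 n in \<open>auto simp: less_imp_le abs_le_iff\<close>)
   moreover have "(SUP x\<in>{-L..L}. \<bar>q (k n) x - g2 x\<bar>) <= e / 4" by (rule cSUP_least[OF ne]) (use N2 n in \<open>auto simp: less_imp_le abs_le_iff\<close>)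
   moreover have "0 <= eps n" using epsb(3)[of 0 n] L by simp
   ultimately show "norm (eps n - 0) < e" using e unfolding eps_def by simp
  qed
 qed
 have dU: "\<bar>U (k n) x - U' x\<bar> <= 2 * L * eps n" "\<bar>W (k n) x - W' x\<bar> <= 2 * L * eps n" if "\<bar>x\<bar> <= L" for n x
  using profile_diff[OF prp(1) U' epsb(1) that epsb(3)[OF that]] profile_diff[OF prp(2) W' epsb(2) that epsb(3)[OF that]] by auto
 have delta0: "(\<lambda>n. 2 * L * eps n) \<longlonglongrightarrow> 0" using tendsto_mult_left[OF eps0, of "2 * L"] by simp
 have nm: "filterlim (\<lambda>n. Suc (k n)) at_top sequentially"
  using filterlim_subseq[OF kmono] filterlim_Suc filterlim_compose by blast
 have l1: "(\<lambda>n. p (k n) x) \<longlonglongrightarrow> g1 (cl x)" "(\<lambda>n. q (k n) x) \<longlonglongrightarrow> g2 (cl x)" if "\<bar>x\<bar> <= L" for x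
  using lim1[OF that] lim2[OF that] clL(2)[OF that] by auto
 show ?thesis
 proof (rule that[OF pt])
  fix X assume X: "\<bar>X\<bar> <= L"
  show "((\<lambda>x. g1 (cl x)) has_real_derivative min K (c1 * (cmod (top_trace L U' W' (deriv h') \<bar>X\<bar>))\<^sup>2)) (at X within {-L..L})"
   by (rule limit_slope[OF pot' pt delta0 dU l1(1) nm, where am = "\<lambda>n. a (k n)"]) (use ab X in \<open>auto simp: p_def\<close>)
  show "((\<lambda>x. g2 (cl x)) has_real_derivative min K (c2 * (cmod (top_trace L W' U' (deriv (swp h')) \<bar>X\<bar>))\<^sup>2)) (at X within {-L..L})"
   by (rule limit_slope[OF potential_swap[OF pot'] potential_swap[OF pt] delta0 dU(2) dU(1) l1(2) nm, where am = "\<lambda>n. b (k n)"]) (use ab X in \<open>auto simp: q_def\<close>)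
 qed
qed

section \<open>Second derivatives up to the boundary\<close>

text \<open>For c = a + \<i> b this bounds Re (c^2 - c^3) from below by |c|^3 / 10, when Re (c^2) is
  at worst - |c|^4 / 3. If a^2 <= 2 * b^2, the negative part of Re (c^3) provides the gain;
  otherwise Re (c^2) dominates.\<close>

lemma quadratic_cubic_barrier:
 fixes a b n :: real
 assumes a: "0 <= a" and n: "0 <= n" "n <= 3/10" "n\<^sup>2 = a\<^sup>2 + b\<^sup>2" and ab: "a\<^sup>2 - b\<^sup>2 >= - (n\<^sup>2 * n\<^sup>2) / 3"
 shows "n ^ 3 / 10 <= a\<^sup>2 - b\<^sup>2 - a * (a\<^sup>2 - 3 * b\<^sup>2)"
proof -
 have n2: "n\<^sup>2 * n\<^sup>2 <= 9/100 * n\<^sup>2" using n(1,2) mult_mono[of n "3/10" n "3/10"] by (intro mult_right_mono) (auto simp: power2_eq_square)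
 have n3: "n\<^sup>2 * n\<^sup>2 <= 3/10 * n ^ 3" using n(1,2) mult_right_mono[of n "3/10" "n ^ 3"] by (simp add: power2_eq_square power3_eq_cube)
 have n3': "n ^ 3 <= 3/10 * n\<^sup>2" using n(1,2) mult_right_mono[of n "3/10" "n\<^sup>2"] by (simp add: power2_eq_square power3_eq_cube)
 show ?thesis
 proof (cases "a\<^sup>2 <= 2 * b\<^sup>2")
  case True
  have "(69/100 * n)\<^sup>2 = 4761/10000 * n\<^sup>2" by (simp add: power2_eq_square)
  then have "(69/100 * n)\<^sup>2 <= a\<^sup>2" using ab n(3) n2 zero_le_power2[of n] by linarith
  then have an: "69/100 * n <= a" using a by (rule power2_le_imp_le)
  have bn: "n\<^sup>2 / 3 <= b\<^sup>2" using True n(3) by simp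
  have "69/100 * n * (n\<^sup>2 / 3) <= a * b\<^sup>2" using an bn a n by (intro mult_mono) auto
  then have 1: "23/100 * n ^ 3 <= a * b\<^sup>2" by (simp add: power2_eq_square power3_eq_cube)
  have "a * (a\<^sup>2 - 3 * b\<^sup>2 + b\<^sup>2) <= 0" using a True by (intro mult_nonneg_nonpos) auto
  then have 2: "a * (a\<^sup>2 - 3 * b\<^sup>2) <= - (a * b\<^sup>2)" by (simp add: algebra_simps)
  have 3: "0 <= n ^ 3" using n by simp
  show ?thesis using 1 2 3 ab n3 by linarith
 next
  case False
  have 1: "n\<^sup>2 / 3 <= a\<^sup>2 - b\<^sup>2" using False n(3) by simp
  have "a\<^sup>2 <= n\<^sup>2" using n(3) by simp
  then have "a <= n" using n(1) by (rule power2_le_imp_le)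
  moreover have "a\<^sup>2 - 3 * b\<^sup>2 <= n\<^sup>2" using n(3) zero_le_power2[of b] by linarith
  ultimately have "a * (a\<^sup>2 - 3 * b\<^sup>2) <= n * n\<^sup>2"
  proof (cases "a\<^sup>2 - 3 * b\<^sup>2 >= 0")
   case False
   then have "a * (a\<^sup>2 - 3 * b\<^sup>2) <= 0" using a by (intro mult_nonneg_nonpos) auto
   moreover have "0 <= n * n\<^sup>2" using n by simp
   ultimately show ?thesis by linarith
  qed (use a n in \<open>intro mult_mono; simp\<close>)
  then have "a * (a\<^sup>2 - 3 * b\<^sup>2) <= n ^ 3" by (simp add: power2_eq_square power3_eq_cube)
  then show ?thesis using 1 n3' zero_le_power2[of n] by linarith
 qed
qed

lemma powr_three_halves: "0 <= r ==> r powr (1 + 1/2) = sqrt r ^ 3"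
 unfolding powr_add by (simp add: powr_half_sqrt power3_eq_cube)

text \<open>Here S is the curvature of the upper graph. Its Hoelder continuity is expressed as a
  Taylor expansion of the slope with remainder of order 1 + beta, the form in which the comparison
  arguments use it.\<close>

locale smooth_potential = potential L K U p W q h for L K U p W q h +
 fixes S :: "real => real"
 assumes S_bound: "\<bar>x\<bar> <= L ==> \<bar>S x\<bar> <= K"
  and S_expansion: "0 < beta ==> beta < 1 ==> \<exists>C\<ge>0. \<forall>x y. \<bar>x\<bar> <= L --> \<bar>y\<bar> <= L --> \<bar>p x - p y - S y * (x - y)\<bar> <= C * \<bar>x - y\<bar> powr (1 + beta)"
begin

lemma tau_bounds: "\<bar>x\<bar> <= L ==> 1 <= cmod (Complex 1 (p x))" "\<bar>x\<bar> <= L ==> cmod (Complex 1 (p x)) <= 2"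
 using abs_Re_le_cmod[of "Complex 1 (p x)"] cmod_le[of "Complex 1 (p x)"] p_bound'[of x] by auto

lemma near_top:
 assumes x: "\<bar>x\<bar> <= L" and w: "\<bar>Re w\<bar> <= L" and r: "cmod (w - top x) <= r"
 shows "\<bar>Re w - x\<bar> <= r" "\<bar>U (Re w) - Im w\<bar> <= 5/3 * r"
proof -
 have 1: "\<bar>Re w - x\<bar> <= r" "\<bar>Im w - U x\<bar> <= r"
  using abs_Re_le_cmod[of "w - top x"] abs_Im_le_cmod[of "w - top x"] r by auto
 then show "\<bar>Re w - x\<bar> <= r" by simp
 show "\<bar>U (Re w) - Im w\<bar> <= 5/3 * r" using 1 U_lip[OF x w] U_lip[OF w x] by argo
qed

text \<open>The harmonic function vanishes to order 3/2 on the boundary. It is compared with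
 the real part of \<open>zeta - zeta powr (3/2)\<close>, which is positive and of linear growth.\<close>

lemma tangential_derivative_linear:
 assumes X1: "0 <= X1" "X1 < L"
 shows "\<exists>C\<ge>0. \<exists>rho>0. \<forall>X0 w. \<bar>X0\<bar> <= X1 --> w \<in> D --> cmod (w - top X0) < rho -->
  \<bar>Re (deriv h w * Complex 1 (p X0) + of_real (- Im (T X0) * S X0) * (w - of_real X0))\<bar> <= C * cmod (w - top X0)"
proof -
 obtain Cs where Cs: "Cs >= 0" "\<And>x y. \<bar>x\<bar> <= L ==> \<bar>y\<bar> <= L ==> \<bar>p x - p y - S y * (x - y)\<bar> <= Cs * \<bar>x - y\<bar> powr (1 + 1/2)"
  using S_expansion[of "1/2"] by auto
 define rho where "rho = min (1/100) ((L - X1) / 2)"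
 have rho: "0 < rho" "rho <= 1/100" "rho < L - X1" using X1 by (auto simp: rho_def min_def)
 define cT where "cT = trace_const L K (1/2)"
 have cT: "cT >= 0" using trace_const_nonneg[of "1/2"] by (simp add: cT_def)
 define M where "M = 2 * cT + 27/2 * Cs"
 \<comment> \<open>The barrier is at least a tenth of the distance to the power 3/2. With this C it
   absorbs M on the graph and exceeds the crude bound 1000 on the circle of radius rho.\<close>
 define C where "C = 10 * (M + 1000 / sqrt rho ^ 3)"
 have M: "M >= 0" using cT Cs by (simp add: M_def)
 have C: "C >= 0" "C >= 10 * M" "C * sqrt rho ^ 3 >= 10000"
 proof -
  have s: "sqrt rho ^ 3 > 0" using rho by simp
  then show "C >= 0" "C >= 10 * M" using M by (auto simp: C_def)
  have "C * sqrt rho ^ 3 = 10 * (M * sqrt rho ^ 3) + 10000" using s by (simp add: C_def field_simps)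
  then show "C * sqrt rho ^ 3 >= 10000" using M s by simp
 qed
 show ?thesis
 proof (rule exI[of _ "4 * C"], rule conjI[rotated], rule exI[of _ rho], intro conjI allI impI)
  fix X0 w assume X0: "\<bar>X0\<bar> <= X1" and wD: "w \<in> D" and wrho: "cmod (w - top X0) < rho"
  define P where "P = top X0"
  define tau where "tau = Complex 1 (p X0)"
  define a where "a x = - Im (T x)" for x
  have XL: "\<bar>X0\<bar> < L" using X0 X1 by simp
  \<comment> \<open>On the graph Re (T x * tau) = a x * (p X0 - p x). The added linear term cancels
    the first order part - a X0 * S X0 * (x - X0), and a remainder of order 3/2 is left.\<close>
  define g where "g w = deriv h w * tau + of_real (a X0 * S X0) * (w - of_real X0)" for w
  define zeta where "zeta w = \<i> * (w - P) * cnj tau" for w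
  define Bc where "Bc w = zeta w - csqrt (zeta w) ^ 3" for w
  have nt: "1 <= cmod tau" "cmod tau <= 2" using tau_bounds[of X0] XL by (auto simp: tau_def)
  have zeta: "cmod (w - P) <= cmod (zeta w)" "cmod (zeta w) <= 2 * cmod (w - P)" for w
   using nt mult_left_mono[of 1 "cmod tau" "cmod (w - P)"] mult_left_mono[of "cmod tau" 2 "cmod (w - P)"] by (auto simp: zeta_def norm_mult)
  have zRe: "Re (zeta v) >= - (cmod (zeta v))\<^sup>2 / 3" if v: "v \<in> D" for v
  proof -
   have "Re (zeta v) = p X0 * (Re v - X0) - (Im v - U X0)" by (simp add: zeta_def tau_def P_def algebra_simps)
   moreover have "Im v - U X0 <= p X0 * (Re v - X0) + K / 2 * (Re v - X0)\<^sup>2" using U_le_parabola[of "Re v" X0] in_D(3)[OF v] by simp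
   moreover have "K / 2 * (Re v - X0)\<^sup>2 <= (1/3) * (cmod (zeta v))\<^sup>2"
   proof (intro mult_mono)
    have "\<bar>Re v - X0\<bar> <= cmod (zeta v)" using abs_Re_le_cmod[of "v - P"] zeta(1)[of v] by (simp add: P_def)
    then show "(Re v - X0)\<^sup>2 <= (cmod (zeta v))\<^sup>2" using abs_le_square_iff[of "Re v - X0" "cmod (zeta v)"] by simp
   qed (use K K_le in auto)
   ultimately show ?thesis by linarith
  qed
  have barrier: "zeta v \<notin> \<real>\<^sub>\<le>\<^sub>0" "sqrt (cmod (v - P)) ^ 3 / 10 <= Re (Bc v)" "Re (Bc v) <= 4 * cmod (v - P)"
   if v: "v \<in> D" "cmod (v - P) < rho" for v
  proof -
   define n where "n = sqrt (cmod (zeta v))"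
   define c where "c = csqrt (zeta v)"
   have zs: "cmod (zeta v) <= 2/100" using zeta(2)[of v] v rho by simp
   have vP: "v \<noteq> P" using in_D(3)[OF v(1)] by (auto simp: P_def)
   then have z0: "cmod (zeta v) > 0" using zeta(1)[of v] by (smt (verit) zero_less_norm_iff right_minus_eq)
   have n2: "n\<^sup>2 = cmod (zeta v)" by (simp add: n_def)
   have n: "0 <= n" "n <= 3/10"
   proof -
    show "0 <= n" by (simp add: n_def)
    have "n\<^sup>2 <= (3/10)\<^sup>2" using zs n2 by (simp add: power2_eq_square)
    then show "n <= 3/10" by (rule power2_le_imp_le) simp
   qed
   have c2: "c\<^sup>2 = zeta v" by (simp add: c_def)
   have cn: "cmod c = n" by (simp add: c_def n_def)
   have ca: "0 <= Re c" using csqrt_principal[of "zeta v"] by (auto simp: c_def)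
   have RI: "Re (zeta v) = (Re c)\<^sup>2 - (Im c)\<^sup>2" unfolding c2[symmetric] by (simp add: power2_eq_square)
   have nc: "n\<^sup>2 = (Re c)\<^sup>2 + (Im c)\<^sup>2" using cn cmod_power2[of c] by simp
   have c3: "Re (c ^ 3) = Re c * ((Re c)\<^sup>2 - 3 * (Im c)\<^sup>2)" by (simp add: power3_eq_cube power2_eq_square algebra_simps)
   have "n ^ 3 / 10 <= (Re c)\<^sup>2 - (Im c)\<^sup>2 - Re c * ((Re c)\<^sup>2 - 3 * (Im c)\<^sup>2)"
   proof (rule quadratic_cubic_barrier[OF ca n nc])
    show "(Re c)\<^sup>2 - (Im c)\<^sup>2 >= - (n\<^sup>2 * n\<^sup>2) / 3" using zRe[OF v(1)] unfolding RI[symmetric] n2 by (simp add: power2_eq_square)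
   qed
   also have "\<dots> = Re (Bc v)" unfolding Bc_def c_def[symmetric] by (simp only: minus_complex.sel RI c3)
   finally have lo: "n ^ 3 / 10 <= Re (Bc v)" .
   have "sqrt (cmod (v - P)) ^ 3 <= n ^ 3" unfolding n_def using zeta(1)[of v] by (intro power_mono) auto
   then show "sqrt (cmod (v - P)) ^ 3 / 10 <= Re (Bc v)" using lo by simp
   have "cmod (c ^ 3) = n * n\<^sup>2" unfolding norm_power cn by (simp add: power3_eq_cube power2_eq_square)
   also have "\<dots> <= 1 * cmod (zeta v)" unfolding n2 using n by (intro mult_right_mono) auto
   finally have "Re (Bc v) <= 2 * cmod (zeta v)"
    using complex_Re_le_cmod[of "zeta v"] abs_Re_le_cmod[of "c ^ 3"] unfolding Bc_def c_def[symmetric] by (simp; argo)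
   then show "Re (Bc v) <= 4 * cmod (v - P)" using zeta(2)[of v] by simp
   show "zeta v \<notin> \<real>\<^sub>\<le>\<^sub>0"
   proof
    assume "zeta v \<in> \<real>\<^sub>\<le>\<^sub>0"
    then have "cmod (zeta v) = - Re (zeta v)" by (auto simp: complex_nonpos_Reals_iff cmod_def)
    then have "cmod (zeta v) <= cmod (zeta v) * cmod (zeta v) / 3" using zRe[OF v(1)] by (simp add: power2_eq_square)
    also have "\<dots> <= cmod (zeta v) * 1 / 3" using zs by (intro divide_right_mono mult_left_mono) auto
    finally show False using z0 by simp
   qed
  qed
  have a_bound: "0 <= a x" "a x <= 27/2" if "\<bar>x\<bar> < L" for x using T_Im[OF that] by (auto simp: a_def)
  have KS: "\<bar>S X0\<bar> <= 1" using S_bound[of X0] XL K_le by auto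
  \<comment> \<open>The square root of the depth bounds the distance of h' from its trace and
    vanishes on the graph; the crude bound is for the circle around \<open>P\<close>.\<close>
  have qb: "\<bar>Re (g v)\<bar> <= 2 * cT * sqrt \<bar>U (Re v) - Im v\<bar> + M * sqrt (cmod (v - P)) ^ 3" "\<bar>Re (g v)\<bar> <= 1000"
   if v: "v \<in> D" "cmod (v - P) < rho" for v
  proof -
   define x where "x = Re v"
   define r where "r = cmod (v - P)"
   have xL: "\<bar>x\<bar> < L" using in_D(1)[OF v(1)] by (simp add: x_def)
   have r: "0 <= r" "r <= 1/100" using v rho by (auto simp: r_def)
   have nr: "\<bar>x - X0\<bar> <= r" "\<bar>U x - Im v\<bar> <= 5/3 * r"
    using near_top[of X0 v r] XL xL by (auto simp: x_def r_def P_def)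
   have dpos: "0 < U x - Im v" using in_D(3)[OF v(1)] by (simp add: x_def)
   have vt: "v - top x = - (of_real (U x - Im v) * \<i>)" by (simp add: complex_eq_iff x_def)
   have vt': "cmod (v - top x) = \<bar>U x - Im v\<bar>" unfolding vt by (simp add: norm_mult del: of_real_diff)
   have st: "v \<in> strip (- L) L (1/12)" using v(1) xL nr(2) r dpos unfolding strip_def by (simp add: x_def[symmetric]; linarith)
   define e where "e = deriv h v - T x"
   have e: "cmod e <= cT * sqrt \<bar>U x - Im v\<bar>"
    using T_holder[of "1/2" x v] xL st nr(2) r vt' by (simp add: e_def cT_def powr_half_sqrt)
   have RT: "Re (T x * tau) = a x * (p X0 - p x)" using T_tangential[OF xL] by (simp add: tau_def a_def algebra_simps)
   have gv: "Re (g v) = Re (e * tau) + (a X0 - a x) * S X0 * (x - X0) - a x * (p x - p X0 - S X0 * (x - X0))"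
   proof -
    have "Re (g v) = Re (e * tau) + Re (T x * tau) + a X0 * S X0 * (x - X0)"
     unfolding g_def e_def by (simp add: x_def algebra_simps)
    then show ?thesis unfolding RT by (simp add: algebra_simps)
   qed
   have n1: "\<bar>Re (e * tau)\<bar> <= 2 * cT * sqrt \<bar>U x - Im v\<bar>"
   proof -
    have "\<bar>Re (e * tau)\<bar> <= cmod e * cmod tau" using abs_Re_le_cmod[of "e * tau"] by (simp add: norm_mult)
    also have "\<dots> <= (cT * sqrt \<bar>U x - Im v\<bar>) * 2" using e nt cT by (intro mult_mono) auto
    finally show ?thesis by simp
   qed
   have sq: "\<bar>x - X0\<bar> * sqrt \<bar>x - X0\<bar> <= sqrt r ^ 3"
   proof -
    have "\<bar>x - X0\<bar> * sqrt \<bar>x - X0\<bar> <= r * sqrt r" using nr r by (intro mult_mono) auto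
    also have "\<dots> = sqrt r ^ 3" using r by (simp add: power3_eq_cube)
    finally show ?thesis .
   qed
   have n2: "\<bar>(a X0 - a x) * S X0 * (x - X0)\<bar> <= 2 * cT * sqrt r ^ 3"
   proof -
    have td: "cmod (top X0 - top x) <= 2 * \<bar>x - X0\<bar>" using top_dist[of X0 x] XL xL by (simp add: abs_minus_commute)
    then have "cmod (T X0 - T x) <= cT * cmod (top X0 - top x) powr (1/2)"
     using T_holder2[of "1/2" X0 x] XL xL nr(1) r by (simp add: cT_def)
    also have "\<dots> <= cT * (2 * sqrt \<bar>x - X0\<bar>)"
    proof (intro mult_left_mono cT)
     have "cmod (top X0 - top x) powr (1/2) = sqrt (cmod (top X0 - top x))" by (simp add: powr_half_sqrt)
     also have "\<dots> <= sqrt (4 * \<bar>x - X0\<bar>)" by (intro real_sqrt_le_mono) (use td abs_ge_zero[of "x - X0"] in argo)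
     finally show "cmod (top X0 - top x) powr (1/2) <= 2 * sqrt \<bar>x - X0\<bar>" by (simp add: real_sqrt_mult)
    qed
    finally have "\<bar>a X0 - a x\<bar> <= cT * (2 * sqrt \<bar>x - X0\<bar>)" using abs_Im_le_cmod[of "T X0 - T x"] by (simp add: a_def)
    then have "\<bar>a X0 - a x\<bar> * \<bar>S X0\<bar> * \<bar>x - X0\<bar> <= cT * (2 * sqrt \<bar>x - X0\<bar>) * 1 * \<bar>x - X0\<bar>"
     using KS cT by (intro mult_mono) auto
    also have "\<dots> = 2 * cT * (\<bar>x - X0\<bar> * sqrt \<bar>x - X0\<bar>)" by simp
    also have "\<dots> <= 2 * cT * sqrt r ^ 3" using sq cT by (intro mult_left_mono) auto
    finally show ?thesis by (simp add: abs_mult)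
   qed
   have n3: "\<bar>a x * (p x - p X0 - S X0 * (x - X0))\<bar> <= 27/2 * Cs * sqrt r ^ 3"
   proof -
    have "\<bar>p x - p X0 - S X0 * (x - X0)\<bar> <= Cs * \<bar>x - X0\<bar> powr (1 + 1/2)" using Cs(2) xL XL by simp
    also have "\<dots> = Cs * sqrt \<bar>x - X0\<bar> ^ 3" by (subst powr_three_halves) auto
    also have "\<dots> <= Cs * sqrt r ^ 3" using Cs(1) nr by (intro mult_left_mono power_mono) auto
    finally have "\<bar>a x\<bar> * \<bar>p x - p X0 - S X0 * (x - X0)\<bar> <= 27/2 * (Cs * sqrt r ^ 3)"
     using a_bound[OF xL] by (intro mult_mono) auto
    then show ?thesis by (simp add: abs_mult)
   qed
   have "M * sqrt r ^ 3 = 2 * cT * sqrt r ^ 3 + 27/2 * Cs * sqrt r ^ 3" by (simp add: M_def algebra_simps)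
   then show "\<bar>Re (g v)\<bar> <= 2 * cT * sqrt \<bar>U (Re v) - Im v\<bar> + M * sqrt (cmod (v - P)) ^ 3"
    using n1 n2 n3 unfolding gv r_def[symmetric] x_def[symmetric] by linarith
   have "cmod (deriv h v * tau) <= 432 * 2" unfolding norm_mult using deriv_h_bound[OF v(1)] nt by (intro mult_mono) auto
   then have "\<bar>Re (deriv h v * tau)\<bar> <= 864" using abs_Re_le_cmod[of "deriv h v * tau"] by linarith
   moreover have "\<bar>a X0\<bar> * \<bar>S X0\<bar> * \<bar>x - X0\<bar> <= 27/2 * 1 * 1" using a_bound[OF XL] KS nr r by (intro mult_mono) auto
   moreover have "Re (g v) = Re (deriv h v * tau) + a X0 * S X0 * (x - X0)" by (simp add: g_def x_def)
   ultimately show "\<bar>Re (g v)\<bar> <= 1000" unfolding abs_mult[symmetric] by linarith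
  qed
  define V where "V = D \<inter> ball P rho"
  have Vsub: "v \<in> D" "cmod (v - P) < rho" if "v \<in> V" for v using that by (auto simp: V_def dist_norm norm_minus_commute)
  have key: "Re (of_real s * g w - of_real C * Bc w) <= 0" if s: "s = 1 \<or> s = -1" for s
  proof (rule maximum_principle_Re[where S = V and f = "\<lambda>w. of_real s * g w - of_real C * Bc w" and w = w])
   show "open V" "bounded V" using open_D bounded_D by (auto simp: V_def)
   show "w \<in> V" using wD wrho by (auto simp: V_def P_def dist_norm norm_minus_commute)
   have "deriv h holomorphic_on D" using H(1) open_D by (rule holomorphic_deriv)
   then have 1: "deriv h holomorphic_on V" by (rule holomorphic_on_subset) (auto simp: V_def)
   have 2: "zeta holomorphic_on V" unfolding zeta_def by (intro holomorphic_intros)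
   have 3: "(\<lambda>w. csqrt (zeta w)) holomorphic_on V"
    using holomorphic_on_compose_gen[OF 2 holomorphic_on_csqrt, unfolded o_def] barrier(1) Vsub by blast
   show "(\<lambda>w. of_real s * g w - of_real C * Bc w) holomorphic_on V" unfolding g_def Bc_def
    by (intro 1 2 3 holomorphic_on_add holomorphic_on_mult holomorphic_on_const holomorphic_on_diff holomorphic_on_ident holomorphic_on_power)
   fix x assume x: "x \<in> frontier V"
   have sgn: "Re (of_real s * g v - of_real C * Bc v) <= \<bar>Re (g v)\<bar> - C / 10 * sqrt (cmod (v - P)) ^ 3" if v: "v \<in> V" for v
   proof -
    have "C * (sqrt (cmod (v - P)) ^ 3 / 10) <= C * Re (Bc v)" using barrier(2)[OF Vsub[OF v]] C(1) by (rule mult_left_mono)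
    then show ?thesis using s by auto
   qed
   have xcl: "x \<in> closure D" "x \<in> cball P rho" "x \<notin> V"
   proof -
    have "x \<in> closure V" "x \<notin> interior V" using x by (auto simp: frontier_def)
    moreover have "interior V = V" using open_D by (intro interior_open) (auto simp: V_def)
    moreover have "closure V \<subseteq> closure D" "closure V \<subseteq> closure (ball P rho)" by (auto intro!: closure_mono simp: V_def)
    ultimately show "x \<in> closure D" "x \<in> cball P rho" "x \<notin> V" using rho by auto
   qed
   have xb: "\<bar>Re x\<bar> <= L" "- 1 - W (Re x) <= Im x" "Im x <= U (Re x)" using closure_D xcl(1) by auto
   show "\<exists>m. isCont m x & m x <= 0 & (\<forall>v\<in>V. Re (of_real s * g v - of_real C * Bc v) <= m v)"
   proof (cases "cmod (x - P) = rho")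
    case True
    show ?thesis
    proof (intro exI[of _ "\<lambda>v. 1000 - C / 10 * sqrt (cmod (v - P)) ^ 3"] conjI ballI)
     show "isCont (\<lambda>v. 1000 - C / 10 * sqrt (cmod (v - P)) ^ 3) x" by (intro continuous_intros)
     show "1000 - C / 10 * sqrt (cmod (x - P)) ^ 3 <= 0" using C(3) True by simp
     show "Re (of_real s * g v - of_real C * Bc v) <= 1000 - C / 10 * sqrt (cmod (v - P)) ^ 3" if "v \<in> V" for v
      using sgn[OF that] qb(2)[OF Vsub[OF that]] by linarith
    qed
   next
    case False
    then have xP: "cmod (x - P) < rho" using xcl(2) by (auto simp: dist_norm norm_minus_commute)
    then have nD: "x \<notin> D" using xcl(3) by (auto simp: V_def dist_norm norm_minus_commute)
    have nr: "\<bar>Re x - X0\<bar> <= rho" "\<bar>U (Re x) - Im x\<bar> <= 5/3 * rho" using near_top[of X0 x rho] XL xb xP by (auto simp: P_def)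
    have "\<bar>Re x\<bar> < L" using nr X0 rho by linarith
    then have "Im x = U (Re x)" using nD xb gap[of "Re x"] nr(2) rho unfolding cellD_def by force
    then show ?thesis
    proof (intro exI[of _ "\<lambda>v. 2 * cT * sqrt \<bar>U (Re v) - Im v\<bar> + M * sqrt (cmod (v - P)) ^ 3 - C / 10 * sqrt (cmod (v - P)) ^ 3"] conjI ballI)
     show "isCont (\<lambda>v. 2 * cT * sqrt \<bar>U (Re v) - Im v\<bar> + M * sqrt (cmod (v - P)) ^ 3 - C / 10 * sqrt (cmod (v - P)) ^ 3) x"
      by (intro continuous_intros isCont_Re_compose U_cont continuous_Im)
     have "M * sqrt (cmod (x - P)) ^ 3 <= C / 10 * sqrt (cmod (x - P)) ^ 3" using C(2) by (intro mult_right_mono) auto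
     then show "2 * cT * sqrt \<bar>U (Re x) - Im x\<bar> + M * sqrt (cmod (x - P)) ^ 3 - C / 10 * sqrt (cmod (x - P)) ^ 3 <= 0"
      using \<open>Im x = U (Re x)\<close> by simp
     show "Re (of_real s * g v - of_real C * Bc v) <= 2 * cT * sqrt \<bar>U (Re v) - Im v\<bar> + M * sqrt (cmod (v - P)) ^ 3 - C / 10 * sqrt (cmod (v - P)) ^ 3" if "v \<in> V" for v
      using sgn[OF that] qb(1)[OF Vsub[OF that]] by linarith
    qed
   qed
  qed
  have "\<bar>Re (g w)\<bar> <= C * Re (Bc w)" using key[of 1] key[of "-1"] by (simp add: abs_le_iff)
  also have "\<dots> <= C * (4 * cmod (w - P))" using barrier(3)[of w] wD wrho C(1) by (intro mult_left_mono) (auto simp: P_def)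
  finally show "\<bar>Re (deriv h w * Complex 1 (p X0) + of_real (- Im (T X0) * S X0) * (w - of_real X0))\<bar> <= 4 * C * cmod (w - top X0)"
   by (simp add: g_def tau_def a_def P_def)
 qed (use C rho in auto)
qed

lemma strip_ball:
 assumes w: "w \<in> strip (- X1) X1 eta" and X1: "X1 < L" and eta: "eta <= 1/12" "eta <= L - X1"
 shows "w \<in> D" "\<bar>Re w\<bar> <= X1" "0 < U (Re w) - Im w" "U (Re w) - Im w < eta" "ball w ((U (Re w) - Im w) / 2) \<subseteq> D"
  "v \<in> ball w ((U (Re w) - Im w) / 2) ==> cmod (v - top (Re w)) <= 3/2 * (U (Re w) - Im w)"
proof -
 show wD: "w \<in> D" and x: "\<bar>Re w\<bar> <= X1" and d: "0 < U (Re w) - Im w" "U (Re w) - Im w < eta"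
  using w in_D(3)[of w] by (auto simp: strip_def)
 show "ball w ((U (Re w) - Im w) / 2) \<subseteq> D"
  by (rule ball_in_D(1)[OF wD]) (use gap[of "Re w"] x X1 d eta in auto)
 have "w - top (Re w) = - (of_real (U (Re w) - Im w) * \<i>)" by (simp add: complex_eq_iff)
 then have "cmod (w - top (Re w)) = U (Re w) - Im w" using d by (simp add: norm_mult del: of_real_diff)
 then show "v \<in> ball w ((U (Re w) - Im w) / 2) ==> cmod (v - top (Re w)) <= 3/2 * (U (Re w) - Im w)"
  using norm_triangle_ineq[of "v - w" "w - top (Re w)"] by (simp add: dist_norm norm_minus_commute)
qed

text \<open>The linear bound at the boundary point vertically above w is of the order of the depth
  on a ball of half that depth, so the interior gradient bound gives a constant. The linear term
  that was added has derivative at most 27/2.\<close>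

lemma deriv2_h_bounded:
 assumes X1: "0 <= X1" "X1 < L"
 shows "\<exists>C\<ge>0. \<exists>eta>0. eta <= 1/12 & (\<forall>w\<in>strip (- X1) X1 eta. cmod (deriv (deriv h) w) <= C)"
proof -
 obtain C rho where C: "C >= 0" "rho > 0" and lin: "\<And>X0 w. \<bar>X0\<bar> <= X1 ==> w \<in> D ==> cmod (w - top X0) < rho ==>
  \<bar>Re (deriv h w * Complex 1 (p X0) + of_real (- Im (T X0) * S X0) * (w - of_real X0))\<bar> <= C * cmod (w - top X0)"
  using tangential_derivative_linear[OF X1] by metis
 define eta where "eta = min (1/12) (min (rho / 2) (L - X1))"
 have eta: "eta > 0" "eta <= 1/12" "eta <= rho / 2" "eta <= L - X1" using C X1 by (auto simp: eta_def min_def)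
 show ?thesis
 proof (rule exI[of _ "24 * C + 27/2"], rule conjI[rotated], rule exI[of _ eta], intro conjI ballI)
  fix w assume w: "w \<in> strip (- X1) X1 eta"
  note sb = strip_ball[OF w X1(2) eta(2) eta(4)]
  define d where "d = U (Re w) - Im w"
  define tau where "tau = Complex 1 (p (Re w))"
  define k where "k = - Im (T (Re w)) * S (Re w)"
  define g where "g v = deriv h v * tau + of_real k * (v - of_real (Re w))" for v
  have d: "0 < d" "d < eta" using sb by (auto simp: d_def)
  have "cmod (deriv g w) <= 8 * (C * (3/2 * d)) / (d / 2)"
  proof (rule norm_deriv_le_Re_bound[where c = 0])
   have "deriv h holomorphic_on D" using H(1) open_D by (rule holomorphic_deriv)
   then have "deriv h holomorphic_on ball w (d / 2)" by (rule holomorphic_on_subset) (use sb(5) in \<open>simp add: d_def\<close>)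
   then show "g holomorphic_on ball w (d / 2)" unfolding g_def by (intro holomorphic_on_add holomorphic_on_mult holomorphic_on_const holomorphic_on_diff holomorphic_on_ident)
   fix v assume v: "v \<in> ball w (d / 2)"
   have vt: "cmod (v - top (Re w)) <= 3/2 * d" using sb(6)[of v] v by (simp add: d_def)
   then have "\<bar>Re (g v)\<bar> <= C * cmod (v - top (Re w))" unfolding g_def tau_def k_def
    using sb(2,5) v d eta by (intro lin) (auto simp: d_def)
   also have "\<dots> <= C * (3/2 * d)" using vt C by (intro mult_left_mono) auto
   finally show "\<bar>Re (g v) - 0\<bar> <= C * (3/2 * d)" by simp
  qed (use d in auto)
  then have 1: "cmod (deriv g w) <= 24 * C" using d by simp
  have "(g has_field_derivative deriv (deriv h) w * tau + of_real k) (at w)" unfolding g_def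
   by (rule derivative_eq_intros h_deriv2[OF sb(1)] refl | simp)+
  then have "deriv (deriv h) w * tau = deriv g w - of_real k" by (simp add: DERIV_imp_deriv)
  then have "cmod (deriv (deriv h) w * tau) <= cmod (deriv g w) + cmod (of_real k)" by (simp add: norm_triangle_ineq4 del: norm_of_real)
  also have "cmod (of_real k) <= 27/2"
  proof -
   have "\<bar>- Im (T (Re w))\<bar> * \<bar>S (Re w)\<bar> <= 27/2 * 1" using T_Im[of "Re w"] S_bound[of "Re w"] K_le sb(2) X1 by (intro mult_mono) auto
   then show ?thesis by (simp add: k_def norm_mult)
  qed
  finally have 2: "cmod (deriv (deriv h) w * tau) <= 24 * C + 27/2" using 1 by simp
  have "cmod (deriv (deriv h) w) * 1 <= cmod (deriv (deriv h) w) * cmod tau"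
   using tau_bounds(1)[of "Re w"] sb(2) X1 by (intro mult_left_mono) (auto simp: tau_def)
  then show "cmod (deriv (deriv h) w) <= 24 * C + 27/2" using 2 by (simp add: norm_mult)
 qed (use C eta in auto)
qed

lemma deriv3_h_even: assumes w: "w \<in> D" shows "deriv (deriv (deriv h)) w = - cnj (deriv (deriv (deriv h)) (- cnj w))"
proof -
 have w': "- cnj w \<in> D" using flip_even[OF w] .
 have hd: "deriv (deriv h) holomorphic_on D" using H(1) open_D by (intro holomorphic_deriv)
 have "(deriv (deriv h) has_field_derivative deriv (deriv (deriv h)) (- cnj w)) (at (-1 * cnj w + 0))"
  using holomorphic_derivI[OF hd open_D w'] by simp
 from has_field_derivative_cnj_affine[OF this]
 have "((\<lambda>v. cnj (deriv (deriv h) (- 1 * cnj v + 0))) has_field_derivative - cnj (deriv (deriv (deriv h)) (- cnj w))) (at w)" by simp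
 then have "(deriv (deriv h) has_field_derivative - cnj (deriv (deriv (deriv h)) (- cnj w))) (at w)"
  by (rule has_field_derivative_transform_within_open[OF _ open_D w]) (use deriv_h_even(2) in auto)
 then show ?thesis by (rule DERIV_imp_deriv)
qed

text \<open>The comparison for h, one derivative higher: H = h' and sigma = tau. The limit k0 = - a
  X0 * S X0 of Re (h'' tau^2) is what differentiating Re (T x * tau) = a x * (p X0 - p x) at x = X0
  gives. The number \<open>X2\<close> leaves room between the range of X0 and the vertical
  sides.\<close>

lemma deriv3_h_bound:
 assumes X1: "0 <= X1" "X1 < L" and beta: "0 < beta" "beta < 1"
 shows "\<exists>C\<ge>0. \<exists>eta>0. eta <= 1/12 & (\<forall>w\<in>strip (- X1) X1 eta. cmod (deriv (deriv (deriv h)) w) <= C * (U (Re w) - Im w) powr (beta - 1))"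
proof -
 obtain Cs where Cs: "Cs >= 0" "\<And>x y. \<bar>x\<bar> <= L ==> \<bar>y\<bar> <= L ==> \<bar>p x - p y - S y * (x - y)\<bar> <= Cs * \<bar>x - y\<bar> powr (1 + beta)"
  using S_expansion[OF beta] by auto
 have S_holder: "\<bar>S x - S y\<bar> <= 2 * Cs * \<bar>x - y\<bar> powr beta" if "\<bar>x\<bar> <= L" "\<bar>y\<bar> <= L" for x y
 proof (cases "x = y")
  case False
  have "(S x - S y) * (x - y) = (p x - p y - S y * (x - y)) + (p y - p x - S x * (y - x))" by (simp add: algebra_simps)
  then have "\<bar>S x - S y\<bar> * \<bar>x - y\<bar> <= 2 * (Cs * \<bar>x - y\<bar> powr (1 + beta))"
   using Cs(2)[OF that] Cs(2)[OF that(2,1)] unfolding abs_mult[symmetric] by (simp add: abs_minus_commute; argo)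
  also have "\<dots> = 2 * Cs * \<bar>x - y\<bar> powr beta * \<bar>x - y\<bar>" by (simp add: powr_add)
  finally show ?thesis using False by simp
 qed simp
 define X2 where "X2 = (X1 + L) / 2"
 have X2: "0 <= X2" "X1 < X2" "X2 < L" using X1 by (auto simp: X2_def)
 obtain C2 eta2 where C2: "C2 >= 0" "eta2 > 0" "eta2 <= 1/12" and b2: "\<And>w. w \<in> strip (- X2) X2 eta2 ==> cmod (deriv (deriv h) w) <= C2"
  using deriv2_h_bounded[OF X2(1,3)] by metis
 define C3 where "C3 = 7 * C2"
 have C3: "C3 >= 0" using C2 by (simp add: C3_def)
 have hd: "deriv h holomorphic_on D" "deriv (deriv h) holomorphic_on D" using H(1) open_D by (auto intro!: holomorphic_deriv)
 have lip: "cmod (deriv h w - deriv h w') <= C3 * cmod (w - w') powr 1"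
  if "w \<in> strip (- X2) X2 (eta2 / 2)" "w' \<in> strip (- X2) X2 (eta2 / 2)" "cmod (w - w') <= eta2 / 8" for w w'
 proof -
  have "cmod (deriv h w - deriv h w') <= C2 * (4 / 1 + 3) * cmod (w - w') powr 1"
  proof (rule holder_near_top[where a = "- X2" and b = X2 and eta = eta2])
   fix v assume v: "v \<in> strip (- X2) X2 eta2"
   then have "U (Re v) - Im v > 0" using in_D(3)[of v] by (auto simp: strip_def)
   then show "cmod (deriv (deriv h) v) <= C2 * (U (Re v) - Im v) powr (1 - 1)" using b2[OF v] by simp
  qed (use that C2 X2 hd in auto)
  then show ?thesis by (simp add: C3_def)
 qed
 have eta2': "0 < eta2 / 2" "eta2 / 2 <= 1/3" "0 < eta2 / 8" and X2': "- L <= - X2" "X2 <= L" "- X2 < X2" using C2 X2 X1 by auto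
 \<comment> \<open>A bounded second derivative is the case of exponent 1, so away from the corners
   the trace of h' is Lipschitz.\<close>
 note tr = trace_properties(2,3)[OF zero_less_one C3 eta2' X2' lip, simplified]
 define rho where "rho = min (rad beta) (min (eta2 / 50) ((L - X1) / 8))"
 have rho: "0 < rho" "rho <= rad beta" "rho <= eta2 / 50" "rho <= (L - X1) / 8" using rad_bounds[OF beta] C2 X1 by (auto simp: rho_def min_def)
 have rho1: "rho < 1" using rho rad_bounds[OF beta] by linarith
 define a where "a x = - Im (T x)" for x
 have a_bound: "0 <= a x" "a x <= 27/2" if "\<bar>x\<bar> < L" for x using T_Im[OF that] by (auto simp: a_def)
 have a_lip: "\<bar>a x - a y\<bar> <= 2 * C3 * \<bar>x - y\<bar>" if "\<bar>x\<bar> < X2" "\<bar>y\<bar> < X2" "\<bar>x - y\<bar> < eta2 / 16" for x y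
 proof -
  have td: "cmod (top x - top y) <= 2 * \<bar>x - y\<bar>" using top_dist[of x y] that X2 by simp
  then have "cmod (T x - T y) <= C3 * cmod (top x - top y)" using that by (intro tr(2)) auto
  also have "\<dots> <= C3 * (2 * \<bar>x - y\<bar>)" using td C3 by (intro mult_left_mono)
  finally show ?thesis using abs_Im_le_cmod[of "T x - T y"] by (simp add: a_def)
 qed
 define M2 where "M2 = 4 * C3 + 27/2"
 define M where "M = 4 * C3 + 81/2 * Cs"
 define M3 where "M3 = M2 * rho / rho powr beta"
 define C5 where "C5 = \<bar>2 * (M + 2 * C3 * K + M2 / rho powr beta) / sector_const beta\<bar>"
 have M: "M >= 0" "M2 >= 0" "M3 >= 0" "C5 >= 0" using C3 Cs rho by (auto simp: M_def M2_def M3_def C5_def)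
 have second: "\<bar>Re (deriv (deriv h) w * Complex 1 (p X0) * Complex 1 (p X0)) - - a X0 * S X0\<bar> <= C5 * cmod (w - top X0) powr beta"
  if X0: "0 <= X0" "X0 <= X1" and w: "w \<in> D" "cmod (w - top X0) < rho" for X0 w
 proof -
  define P where "P = top X0"
  define tau where "tau = Complex 1 (p X0)"
  have XL: "\<bar>X0\<bar> < L" using X0 X1 by simp
  have nt: "1 <= cmod tau" "cmod tau <= 2" using tau_bounds[of X0] XL by (auto simp: tau_def)
  have KS: "\<bar>S x\<bar> <= 1" if "\<bar>x\<bar> <= L" for x using S_bound[OF that] K_le by auto
  have loc: "v \<in> strip (- X2) X2 (eta2 / 2)" "\<bar>Re v\<bar> < X2" "\<bar>Re v - X0\<bar> <= 3 * rho" "cmod (deriv h v - T (Re v)) <= C3 * (U (Re v) - Im v)"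
   if v: "v \<in> D" "cmod (v - P) <= 3 * rho" for v
  proof -
   have nr: "\<bar>Re v - X0\<bar> <= 3 * rho" "\<bar>U (Re v) - Im v\<bar> <= 5 * rho" using near_top[of X0 v "3 * rho"] XL in_D(1)[OF v(1)] v(2) by (auto simp: P_def)
   show "\<bar>Re v - X0\<bar> <= 3 * rho" by fact
   show xv: "\<bar>Re v\<bar> < X2" using nr X0 rho X1 unfolding X2_def by argo
   then show st: "v \<in> strip (- X2) X2 (eta2 / 2)" using v nr rho C2 by (auto simp: strip_def)
   have dp: "0 < U (Re v) - Im v" using in_D(3)[OF v(1)] by simp
   have "v - top (Re v) = - (of_real (U (Re v) - Im v) * \<i>)" by (simp add: complex_eq_iff)
   then have cm: "cmod (v - top (Re v)) = U (Re v) - Im v" using dp by (simp add: norm_mult del: of_real_diff)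
   have "cmod (deriv h v - T (Re v)) <= C3 * cmod (v - top (Re v))"
    by (rule tr(1)) (use st xv cm nr rho C2 in auto)
   then show "cmod (deriv h v - T (Re v)) <= C3 * (U (Re v) - Im v)" unfolding cm .
  qed
  have loc2: "cmod (v + of_real t * tau - P) <= 3 * rho" "cmod (of_real t * tau) <= 2 * t" if "0 < t" "t < rho" "cmod (v - P) < rho" for t v
  proof -
   show c: "cmod (of_real t * tau) <= 2 * t" using that nt mult_left_mono[of "cmod tau" 2 t] by (simp add: norm_mult mult.commute)
   show "cmod (v + of_real t * tau - P) <= 3 * rho" using norm_triangle_ineq[of "v - P" "of_real t * tau"] c that by (simp add: algebra_simps)
  qed
  have Q2: "\<bar>Re ((deriv h (v + of_real t * tau) - deriv h v) * tau) - t * (- a X0 * S X0)\<bar> <= M2 * t"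
   if t: "0 < t" "t < rho" and v: "v \<in> D" "cmod (v - P) < rho" "v + of_real t * tau \<in> D" for t v
  proof -
   have "cmod (v - P) <= 3 * rho" using v(2) rho by linarith
   note s1 = loc(1)[OF v(1) this] and s2 = loc(1)[OF v(3) loc2(1)[OF t v(2)]]
   have "cmod (deriv h (v + of_real t * tau) - deriv h v) <= C3 * cmod (v + of_real t * tau - v) powr 1"
    by (rule lip[OF s2 s1]) (use loc2(2)[OF t v(2)] t rho C2 in auto)
   also have "\<dots> <= C3 * (2 * t)" using loc2(2)[OF t v(2)] C3 by (simp; intro mult_left_mono) auto
   finally have 1: "cmod ((deriv h (v + of_real t * tau) - deriv h v) * tau) <= (C3 * (2 * t)) * 2"
    unfolding norm_mult using nt C3 t by (intro mult_mono) auto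
   have 2: "\<bar>a X0\<bar> * \<bar>S X0\<bar> <= 27/2 * 1" using a_bound[OF XL] KS[of X0] XL by (intro mult_mono) auto
   have "t * \<bar>a X0 * S X0\<bar> <= t * (27/2)" using 2 t by (intro mult_left_mono) (auto simp: abs_mult)
   then have 3: "\<bar>t * (- a X0 * S X0)\<bar> <= 27/2 * t" using t by (simp add: abs_mult)
   have "M2 * t = (C3 * (2 * t)) * 2 + 27/2 * t" by (simp add: M2_def algebra_simps)
   then show ?thesis using 1 3 abs_Re_le_cmod[of "(deriv h (v + of_real t * tau) - deriv h v) * tau"] by linarith
  qed
  have Q1: "\<bar>Re ((deriv h (v + of_real t * tau) - deriv h v) * tau) - t * (- a X0 * S X0)\<bar>
    <= M * t * (cmod (v - P) powr beta + t powr beta) + 2 * C3 * (U (Re v) - Im v) + 2 * C3 * (U (Re v + t) - Im v - t * p X0)"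
   if t: "0 < t" "t < rho" and v: "v \<in> D" "cmod (v - P) < rho" "v + of_real t * tau \<in> D" for t v
  proof -
   define v' where "v' = v + of_real t * tau"
   define x where "x = Re v"
   define r where "r = cmod (v - P)"
   have v3: "cmod (v - P) <= 3 * rho" using v(2) rho by linarith
   note l1 = loc[OF v(1) v3] and l2 = loc[OF v(3) loc2(1)[OF t v(2)], folded v'_def]
   have v'x: "Re v' = x + t" "Im v' = Im v + t * p X0" by (auto simp: v'_def x_def tau_def)
   have xL: "\<bar>x\<bar> < X2" "\<bar>x + t\<bar> < X2" using l1(2) l2(2) by (auto simp: x_def v'x)
   have xL': "\<bar>x\<bar> < L" "\<bar>x + t\<bar> < L" using xL X2 by auto
   have xr: "\<bar>x - X0\<bar> <= r" using near_top(1)[of X0 v r] XL xL' by (auto simp: x_def r_def P_def)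
   have r: "0 <= r" "r < 1" using v(2) rho1 by (auto simp: r_def)
   have rb: "r <= r powr beta" "t <= t powr beta"
    using powr_mono'[of beta 1 r] powr_mono'[of beta 1 t] beta r t rho1 by auto
   define e where "e = deriv h v - T x"
   define e' where "e' = deriv h v' - T (x + t)"
   have e: "cmod (e * tau) <= 2 * C3 * (U x - Im v)" "cmod (e' * tau) <= 2 * C3 * (U (x + t) - Im v - t * p X0)"
   proof -
    have e1: "cmod e <= C3 * (U x - Im v)" using l1(4) by (simp add: e_def x_def)
    have e2: "cmod e' <= C3 * (U (x + t) - Im v - t * p X0)" using l2(4) unfolding v'x by (simp add: e'_def algebra_simps)
    have "cmod (e * tau) <= (C3 * (U x - Im v)) * 2" unfolding norm_mult
     using e1 nt order_trans[OF norm_ge_zero e1] by (intro mult_mono) auto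
    then show "cmod (e * tau) <= 2 * C3 * (U x - Im v)" by simp
    have "cmod (e' * tau) <= (C3 * (U (x + t) - Im v - t * p X0)) * 2" unfolding norm_mult
     using e2 nt order_trans[OF norm_ge_zero e2] by (intro mult_mono) auto
    then show "cmod (e' * tau) <= 2 * C3 * (U (x + t) - Im v - t * p X0)" by simp
   qed
   have RT: "Re (T y * tau) = a y * (p X0 - p y)" if "\<bar>y\<bar> < L" for y
    using T_tangential[OF that] by (simp add: tau_def a_def algebra_simps)
   \<comment> \<open>The errors of the expansion: the change of \<open>a\<close> over the step, the
     Taylor remainder of the slope over the step, and the difference between the limit values at X0
     and at x, which enters multiplied by t.\<close>
   define z1 where "z1 = (a (x + t) - a x) * (p X0 - p (x + t))"
   define z2 where "z2 = a x * (p (x + t) - p x - S x * t)"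
   define z3 where "z3 = a X0 * S X0 - a x * S x"
   have eq: "Re ((deriv h v' - deriv h v) * tau) - t * (- a X0 * S X0) = Re (e' * tau) - Re (e * tau) + z1 - z2 + t * z3"
   proof -
    have "Re ((deriv h v' - deriv h v) * tau) = Re (e' * tau) - Re (e * tau) + Re (T (x + t) * tau) - Re (T x * tau)"
     by (simp add: e_def e'_def algebra_simps)
    then show ?thesis unfolding RT[OF xL'(1)] RT[OF xL'(2)] z1_def z2_def z3_def by (simp add: algebra_simps)
   qed
   have b1: "\<bar>z1\<bar> <= 2 * C3 * (t * (r powr beta + t powr beta))"
   proof -
    have al: "\<bar>a (x + t) - a x\<bar> <= 2 * C3 * t" using a_lip[of "x + t" x] xL t rho C2 by simp
    have "\<bar>p X0 - p (x + t)\<bar> <= K * \<bar>X0 - (x + t)\<bar>" by (rule p_lip_abs)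
    also have "\<dots> <= 1 * (r + t)" using K K_le xr t by (intro mult_mono) auto
    finally have "\<bar>p X0 - p (x + t)\<bar> <= r + t" by simp
    then have "\<bar>p X0 - p (x + t)\<bar> <= r powr beta + t powr beta" using add_mono[OF rb] by (rule order_trans)
    then have "\<bar>z1\<bar> <= (2 * C3 * t) * (r powr beta + t powr beta)" unfolding z1_def abs_mult using al C3 t by (intro mult_mono) auto
    then show ?thesis by (simp add: mult.assoc)
   qed
   have b2: "\<bar>z2\<bar> <= 27/2 * Cs * (t * (r powr beta + t powr beta))"
   proof -
    have "\<bar>p (x + t) - p x - S x * (x + t - x)\<bar> <= Cs * \<bar>x + t - x\<bar> powr (1 + beta)" by (rule Cs(2)) (use xL' in auto)
    then have "\<bar>p (x + t) - p x - S x * t\<bar> <= Cs * (t * t powr beta)" using t by (simp add: powr_add)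
    then have "\<bar>z2\<bar> <= 27/2 * (Cs * (t * t powr beta))" unfolding z2_def abs_mult using a_bound[OF xL'(1)] by (intro mult_mono) auto
    also have "\<dots> <= 27/2 * (Cs * (t * (r powr beta + t powr beta)))" using Cs t by (intro mult_left_mono) auto
    finally show ?thesis by (simp add: mult.assoc)
   qed
   have b3: "\<bar>z3\<bar> <= (2 * C3 + 27 * Cs) * (r powr beta + t powr beta)"
   proof -
    have d3: "\<bar>x - X0\<bar> <= 3 * rho" using l1(3) by (simp add: x_def)
    have al: "\<bar>a X0 - a x\<bar> <= 2 * C3 * r"
    proof -
     have "\<bar>X0 - x\<bar> < eta2 / 16" using d3 rho(1,3) by argo
     then have "\<bar>a X0 - a x\<bar> <= 2 * C3 * \<bar>X0 - x\<bar>" by (intro a_lip) (use xL X0 X2 in auto)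
     also have "\<dots> <= 2 * C3 * r" using xr C3 by (intro mult_left_mono) auto
     finally show ?thesis .
    qed
    have "\<bar>S X0 - S x\<bar> <= 2 * Cs * \<bar>X0 - x\<bar> powr beta" using S_holder XL xL' by simp
    also have "\<dots> <= 2 * Cs * r powr beta" using xr Cs beta by (intro mult_left_mono powr_mono2) auto
    finally have Sl: "\<bar>a x\<bar> * \<bar>S X0 - S x\<bar> <= 27/2 * (2 * Cs * r powr beta)" using a_bound[OF xL'(1)] by (intro mult_mono) auto
    have al': "\<bar>a X0 - a x\<bar> * \<bar>S X0\<bar> <= (2 * C3 * r) * 1" using al KS[of X0] XL C3 r by (intro mult_mono) auto
    have "z3 = (a X0 - a x) * S X0 + a x * (S X0 - S x)" by (simp add: z3_def algebra_simps)
    then have "\<bar>z3\<bar> <= 2 * C3 * r + 27 * Cs * r powr beta" using Sl al' unfolding abs_mult[symmetric] by linarith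
    also have "\<dots> <= 2 * C3 * r powr beta + 27 * Cs * r powr beta" using rb C3 by (intro add_right_mono mult_left_mono) auto
    also have "\<dots> = (2 * C3 + 27 * Cs) * r powr beta" by (simp add: algebra_simps)
    also have "\<dots> <= (2 * C3 + 27 * Cs) * (r powr beta + t powr beta)" using C3 Cs by (intro mult_left_mono) auto
    finally show ?thesis .
   qed
   have "\<bar>t * z3\<bar> <= t * ((2 * C3 + 27 * Cs) * (r powr beta + t powr beta))" using mult_left_mono[OF b3, of t] t by (simp add: abs_mult)
   moreover have "M * t * (r powr beta + t powr beta) = 2 * C3 * (t * (r powr beta + t powr beta)) + 27/2 * Cs * (t * (r powr beta + t powr beta)) + t * ((2 * C3 + 27 * Cs) * (r powr beta + t powr beta))"
    by (simp add: M_def algebra_simps)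
   moreover have "\<bar>Re (e * tau)\<bar> <= 2 * C3 * (U x - Im v)" "\<bar>Re (e' * tau)\<bar> <= 2 * C3 * (U (x + t) - Im v - t * p X0)"
    using e abs_Re_le_cmod order_trans by blast+
   ultimately show ?thesis using b1 b2 unfolding v'_def[symmetric] eq r_def[symmetric] x_def[symmetric] by linarith
  qed
  have "\<bar>Re (deriv (deriv h) w * tau * tau) - (- a X0 * S X0)\<bar> <= 2 * (M + 2 * C3 * K + M2 / rho powr beta) / sector_const beta * cmod (w - top X0) powr beta"
   unfolding tau_def
  proof (rule tangential_derivative_estimate[where H = "deriv h" and sigma = "Complex 1 (p X0)" and M = M and A = "2 * C3" and ?M2.0 = M2 and ?M3.0 = M3 and rho = rho, OF beta])
   show "2 * C3 >= 0" using C3 by simp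
  next
   fix t v assume t: "0 < t" "t < rho" and v: "v \<in> D" "cmod (v - top X0) < rho" "v + complex_of_real t * Complex 1 (p X0) \<in> D"
   note v' = v[folded P_def tau_def]
   show "\<bar>Re ((deriv h (v + complex_of_real t * Complex 1 (p X0)) - deriv h v) * Complex 1 (p X0)) - t * (- a X0 * S X0)\<bar>
    <= M * t * (cmod (v - top X0) powr beta + t powr beta) + 2 * C3 * (U (Re v) - Im v) + 2 * C3 * (U (Re v + t) - Im v - t * p X0)"
    using Q1[OF t v'] unfolding P_def tau_def .
   show q2: "\<bar>Re ((deriv h (v + complex_of_real t * Complex 1 (p X0)) - deriv h v) * Complex 1 (p X0)) - t * (- a X0 * S X0)\<bar> <= M2 * t"
    using Q2[OF t v'] unfolding tau_def .
   \<comment> \<open>By the choice of rho the translate keeps distance rho from the right side. The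
     crude bound then implies the hypothesis designed for that side.\<close>
   have "M2 * t <= M2 * rho" using t M by (intro mult_left_mono) auto
   also have "\<dots> = M3 * rho powr beta" using rho by (simp add: M3_def)
   also have "\<dots> <= M3 * \<bar>L - Re v - t\<bar> powr beta"
   proof (intro mult_left_mono powr_mono2)
    have "\<bar>Re v - X0\<bar> <= rho" using near_top(1)[of X0 v rho] XL in_D(1)[OF v(1)] v(2) by simp
    then show "rho <= \<bar>L - Re v - t\<bar>" using t X0(2) rho(1,4) by argo
   qed (use M beta rho in auto)
   moreover have "0 <= M * t * (cmod (v - top X0) powr beta + t powr beta)" using M t by simp
   ultimately show "\<bar>Re ((deriv h (v + complex_of_real t * Complex 1 (p X0)) - deriv h v) * Complex 1 (p X0)) - t * (- a X0 * S X0)\<bar>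
    <= M * t * (cmod (v - top X0) powr beta + t powr beta) + M3 * \<bar>L - Re v - t\<bar> powr beta" using q2 by linarith
  qed (use X0 X1 rho hd M w in auto)
  also have "\<dots> <= C5 * cmod (w - top X0) powr beta" unfolding C5_def by (intro mult_right_mono abs_ge_self) simp
  finally show ?thesis by (simp add: tau_def)
 qed
 define eta where "eta = min (1/12) (min (rho / 2) (L - X1))"
 have eta: "eta > 0" "eta <= 1/12" "eta <= rho / 2" "eta <= L - X1" using rho X1 by (auto simp: eta_def min_def)
 have main: "cmod (deriv (deriv (deriv h)) w) <= 32 * C5 * (U (Re w) - Im w) powr (beta - 1)" if w: "w \<in> strip (- X1) X1 eta" and pos: "0 <= Re w" for w
 proof -
  note sb = strip_ball[OF w X1(2) eta(2) eta(4)]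
  define d where "d = U (Re w) - Im w"
  define tau where "tau = Complex 1 (p (Re w))"
  define g where "g v = deriv (deriv h) v * tau * tau" for v
  have d: "0 < d" "d < eta" using sb by (auto simp: d_def)
  have "cmod (deriv g w) <= 8 * (C5 * (2 * d powr beta)) / (d / 2)"
  proof (rule norm_deriv_le_Re_bound[where c = "- a (Re w) * S (Re w)"])
   have "deriv (deriv h) holomorphic_on ball w (d / 2)" using hd(2) by (rule holomorphic_on_subset) (use sb(5) in \<open>simp add: d_def\<close>)
   then show "g holomorphic_on ball w (d / 2)" unfolding g_def by (intro holomorphic_on_add holomorphic_on_mult holomorphic_on_const holomorphic_on_diff holomorphic_on_ident)
   fix v assume v: "v \<in> ball w (d / 2)"
   have vt: "cmod (v - top (Re w)) <= 3/2 * d" using sb(6)[of v] v by (simp add: d_def)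
   then have "\<bar>Re (g v) - - a (Re w) * S (Re w)\<bar> <= C5 * cmod (v - top (Re w)) powr beta" unfolding g_def tau_def
    using sb(2,5) v d eta pos by (intro second) (auto simp: d_def)
   also have "\<dots> <= C5 * (2 * d) powr beta" using vt M beta d by (intro mult_left_mono powr_mono2) auto
   also have "\<dots> = C5 * (2 powr beta * d powr beta)" using d by (simp add: powr_mult)
   also have "\<dots> <= C5 * (2 powr 1 * d powr beta)" using M beta by (intro mult_left_mono mult_right_mono powr_mono) auto
   finally show "\<bar>Re (g v) - - a (Re w) * S (Re w)\<bar> <= C5 * (2 * d powr beta)" by simp
  qed (use d in auto)
  also have "\<dots> = 32 * C5 * d powr (beta - 1)" using d by (simp add: powr_diff)
  finally have 1: "cmod (deriv g w) <= 32 * C5 * d powr (beta - 1)" .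
  have "(g has_field_derivative deriv (deriv (deriv h)) w * tau * tau) (at w)" unfolding g_def
   by (rule derivative_eq_intros holomorphic_derivI[OF hd(2) open_D sb(1)] refl | simp)+
  then have eq: "deriv g w = deriv (deriv (deriv h)) w * tau * tau" by (rule DERIV_imp_deriv)
  have nt: "1 <= cmod tau" using tau_bounds(1)[of "Re w"] sb(2) X1 by (simp add: tau_def)
  have "cmod (deriv (deriv (deriv h)) w) * 1 * 1 <= cmod (deriv (deriv (deriv h)) w) * cmod tau * cmod tau"
   using nt by (intro mult_mono) auto
  then show ?thesis using 1 by (simp add: eq norm_mult d_def)
 qed
 show ?thesis
 proof (rule exI[of _ "32 * C5"], rule conjI[rotated], rule exI[of _ eta], intro conjI ballI)
  fix w assume w: "w \<in> strip (- X1) X1 eta"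
  show "cmod (deriv (deriv (deriv h)) w) <= 32 * C5 * (U (Re w) - Im w) powr (beta - 1)"
  proof (cases "0 <= Re w")
   case False
   have wD: "w \<in> D" using w by (simp add: strip_def)
   have "- cnj w \<in> strip (- X1) X1 eta" using w flip_even[of w] by (auto simp: strip_def U_even)
   from main[OF this] False show ?thesis by (simp add: deriv3_h_even[OF wD] U_even)
  qed (use main w in auto)
 qed (use M eta in auto)
qed

lemma deriv2_h_holder:
 assumes X1: "0 <= X1" "X1 < L" and beta: "0 < beta" "beta < 1"
 shows "\<exists>C\<ge>0. \<exists>eta>0. eta <= 1/12 & (\<forall>w\<in>strip (- X1) X1 eta. \<forall>w'\<in>strip (- X1) X1 eta. cmod (w - w') <= eta / 4 -->
  cmod (deriv (deriv h) w - deriv (deriv h) w') <= C * cmod (w - w') powr beta)"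
proof -
 obtain C eta where C: "C >= 0" "eta > 0" "eta <= 1/12" and b: "\<And>w. w \<in> strip (- X1) X1 eta ==> cmod (deriv (deriv (deriv h)) w) <= C * (U (Re w) - Im w) powr (beta - 1)"
  using deriv3_h_bound[OF X1 beta] by metis
 have hd: "deriv (deriv h) holomorphic_on D" using H(1) open_D by (auto intro!: holomorphic_deriv)
 show ?thesis
 proof (rule exI[of _ "C * (4 / beta + 3)"], rule conjI[rotated], rule exI[of _ "eta / 2"], intro conjI ballI impI)
  fix w w' assume "w \<in> strip (- X1) X1 (eta / 2)" "w' \<in> strip (- X1) X1 (eta / 2)" "cmod (w - w') <= eta / 2 / 4"
  then show "cmod (deriv (deriv h) w - deriv (deriv h) w') <= C * (4 / beta + 3) * cmod (w - w') powr beta"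
   using beta C X1 hd b by (intro holder_near_top[where a = "- X1" and b = X1 and eta = eta]) auto
 qed (use C beta in auto)
qed

end

section \<open>Hoelder functions and weak derivatives in the plane\<close>

text \<open>Radius and constant may depend on the point, which may lie in the closure of A:
  regularity up to a boundary portion, with no uniformity towards the corners.\<close>

definition locally_holder :: "real => 'a::metric_space set => ('a => 'b::real_normed_vector) => 'a => bool" where
 "locally_holder beta A f p \<longleftrightarrow> (\<exists>r>0. \<exists>C\<ge>0. \<forall>a\<in>A \<inter> ball p r. \<forall>b\<in>A \<inter> ball p r. norm (f a - f b) <= C * dist a b powr beta)"

lemma locally_holderE:
 assumes "locally_holder beta A f p"
 obtains r C where "r > 0" "C >= 0" "\<And>a b. a \<in> A ==> b \<in> A ==> dist p a < r ==> dist p b < r ==> norm (f a - f b) <= C * dist a b powr beta"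
proof -
 obtain r C where "r > 0" "C >= 0" "\<forall>a\<in>A \<inter> ball p r. \<forall>b\<in>A \<inter> ball p r. norm (f a - f b) <= C * dist a b powr beta"
  using assms unfolding locally_holder_def by blast
 then show ?thesis by (intro that[of r C]) auto
qed

lemma locally_holderI:
 assumes "r > 0" "C >= 0" "\<And>a b. a \<in> A ==> b \<in> A ==> dist p a < r ==> dist p b < r ==> norm (f a - f b) <= C * dist a b powr beta"
 shows "locally_holder beta A f p"
 unfolding locally_holder_def by (rule exI[of _ r], rule conjI[OF assms(1)], rule exI[of _ C], rule conjI[OF assms(2)]) (use assms(3) in auto)

lemma locally_holder_mono:
 assumes "locally_holder beta A f p" and alpha: "alpha <= beta"
 shows "locally_holder alpha A f p"
proof -
 obtain r C where rC: "r > 0" "C >= 0" "\<And>a b. a \<in> A ==> b \<in> A ==> dist p a < r ==> dist p b < r ==> norm (f a - f b) <= C * dist a b powr beta"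
  using assms(1) by (rule locally_holderE, blast)
 show ?thesis
 proof (rule locally_holderI[of "min r (1/2)" C])
  fix a b assume ab: "a \<in> A" "b \<in> A" "dist p a < min r (1/2)" "dist p b < min r (1/2)"
  have "dist a b <= dist p a + dist p b" by (simp add: dist_triangle3)
  then have "dist a b <= 1" using ab by simp
  then have "C * dist a b powr beta <= C * dist a b powr alpha" using rC(2) alpha by (intro mult_left_mono powr_mono') auto
  then show "norm (f a - f b) <= C * dist a b powr alpha" using rC(3)[of a b] ab by simp
 qed (use rC in auto)
qed

lemma tendsto_of_holder_bound:
 fixes f :: "'a::metric_space => 'b::real_normed_vector"
 assumes beta: "0 < beta" and r: "0 < r" and b: "\<And>a. a \<in> A ==> dist p a < r ==> norm (f a - l) <= C * dist a p powr beta"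
 shows "(f \<longlongrightarrow> l) (at p within A)"
proof -
 have "((\<lambda>a. f a - l) \<longlongrightarrow> 0) (at p within A)"
 proof (rule Lim_null_comparison)
  show "\<forall>\<^sub>F a in at p within A. norm (f a - l) <= C * dist a p powr beta"
   unfolding eventually_at using r b by (auto simp: dist_commute intro!: exI[of _ r])
  have "((\<lambda>a. C * dist a p powr beta) \<longlongrightarrow> C * dist p p powr beta) (at p within A)"
   by (intro tendsto_mult tendsto_const tendsto_powr2 tendsto_dist tendsto_ident_at) (use beta in auto)
  then show "((\<lambda>a. C * dist a p powr beta) \<longlongrightarrow> 0) (at p within A)" by simp
 qed
 then show ?thesis by (simp add: LIM_zero_iff)
qed

lemma locally_holder_boundary_value:
 fixes f :: "'a::metric_space => 'b::banach"
 assumes lh: "locally_holder beta A f p" and beta: "0 < beta" and p: "p \<in> closure A"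
 shows "\<exists>l r C. 0 < r & 0 <= C & (\<forall>a\<in>A. dist p a < r --> norm (f a - l) <= C * dist a p powr beta)"
proof -
 obtain r C where rC: "r > 0" "C >= 0" "\<And>a b. a \<in> A ==> b \<in> A ==> dist p a < r ==> dist p b < r ==> norm (f a - f b) <= C * dist a b powr beta"
  using lh by (rule locally_holderE, blast)
 obtain g where g: "\<And>x. x \<in> A \<inter> ball p r ==> g x = f x"
  "\<And>x y. x \<in> closure (A \<inter> ball p r) ==> y \<in> closure (A \<inter> ball p r) ==> dist x y < r ==> norm (g x - g y) <= C * dist x y powr beta"
  using holder_extension[OF beta rC(2) rC(1), of "A \<inter> ball p r" f] rC(3) by auto
 have pc: "p \<in> closure (A \<inter> ball p r)"
  using p open_Int_closure_subset[of "ball p r" A] rC(1) by (auto simp: Int_commute)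
 show ?thesis
 proof (rule exI[of _ "g p"], rule exI[of _ r], rule exI[of _ C], intro conjI ballI impI)
  fix a assume a: "a \<in> A" "dist p a < r"
  then show "norm (f a - g p) <= C * dist a p powr beta"
   using g(2)[of a p] pc g(1)[of a] closure_subset[of "A \<inter> ball p r"] by (auto simp: dist_commute)
 qed (use rC in auto)
qed

text \<open>Every point of S receives a limit value with a Hoelder rate. A neighbouring point of S
  is approximated from U to obtain continuity; at a point of U the rate at distance 0 forces the
  value of f.\<close>

lemma locally_holder_extension:
 fixes f :: "'a::metric_space => 'b::banach"
 assumes beta: "0 < beta" and US: "U \<subseteq> S" "S \<subseteq> closure U" and lh: "\<And>p. p \<in> S ==> locally_holder beta U f p"
 shows "\<exists>g. continuous_on S g & (\<forall>p\<in>U. g p = f p)"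
proof -
 have "\<forall>p. \<exists>l r C. p \<in> S --> (0 < r & 0 <= C & (\<forall>a\<in>U. dist p a < r --> norm (f a - l) <= C * dist a p powr beta))"
  using locally_holder_boundary_value[OF lh beta] US by blast
 then obtain g r C where grC: "\<forall>p. p \<in> S --> (0 < r p & 0 <= C p & (\<forall>a\<in>U. dist p a < r p --> norm (f a - g p) <= C p * dist a p powr beta))"
  unfolding choice_iff by (elim exE)
 have gf: "g p = f p" if "p \<in> U" for p
 proof -
  have "p \<in> S" using that US by auto
  then have 1: "0 < r p" and 2: "\<forall>a\<in>U. dist p a < r p --> norm (f a - g p) <= C p * dist a p powr beta" using grC by auto
  have "norm (f p - g p) <= C p * dist p p powr beta" using bspec[OF 2 that] 1 by (simp only: dist_self simp_thms)
  then show ?thesis by simp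
 qed
 have hold: "norm (g p' - g p) <= C p * dist p' p powr beta" if p: "p \<in> S" "p' \<in> S" "dist p p' < r p" for p p'
 proof -
  obtain a where a: "\<And>n. a n \<in> U" "a \<longlonglongrightarrow> p'" using subsetD[OF US(2) p(2)] unfolding closure_sequential by blast
  have ev: "\<forall>\<^sub>F n in sequentially. dist (a n) p' < r p'" using tendstoD[OF a(2)] grC p(2) by blast
  have "(\<lambda>n. f (a n) - g p') \<longlonglongrightarrow> 0"
  proof (rule Lim_null_comparison)
   show "\<forall>\<^sub>F n in sequentially. norm (f (a n) - g p') <= C p' * dist (a n) p' powr beta"
    using ev by eventually_elim (use grC p(2) a(1) in \<open>auto simp: dist_commute\<close>)
   have "(\<lambda>n. C p' * dist (a n) p' powr beta) \<longlonglongrightarrow> C p' * dist p' p' powr beta"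
    by (intro tendsto_mult tendsto_const tendsto_powr2 tendsto_dist a) (use beta in auto)
   then show "(\<lambda>n. C p' * dist (a n) p' powr beta) \<longlonglongrightarrow> 0" by simp
  qed
  then have 1: "(\<lambda>n. norm (f (a n) - g p)) \<longlonglongrightarrow> norm (g p' - g p)"
   by (intro tendsto_norm tendsto_diff tendsto_const) (simp add: LIM_zero_iff)
  have 2: "(\<lambda>n. C p * dist (a n) p powr beta) \<longlonglongrightarrow> C p * dist p' p powr beta"
   by (intro tendsto_mult tendsto_const tendsto_powr2 tendsto_dist a) (use beta in auto)
  have "(\<lambda>n. dist p (a n)) \<longlonglongrightarrow> dist p p'" by (intro tendsto_intros a)
  then have "\<forall>\<^sub>F n in sequentially. dist p (a n) < r p" using p(3) by (rule order_tendstoD(2))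
  then have "\<forall>\<^sub>F n in sequentially. norm (f (a n) - g p) <= C p * dist (a n) p powr beta"
   by eventually_elim (use grC p(1) a(1) in auto)
  then show ?thesis by (rule tendsto_le[OF _ 2 1, rotated]) simp
 qed
 have "continuous_on S g" unfolding continuous_on_def
  by (intro ballI tendsto_of_holder_bound[OF beta]) (use grC hold in blast)+
 then show ?thesis using gf by blast
qed

text \<open>A Lebesgue number e of a finite cover settles pairs closer than e. For the other pairs
  the continuous extension is bounded by some M on the compact set, and 2 * M / e^alpha is a
  constant for them.\<close>

lemma locally_holder_compact:
 fixes f :: "'a::metric_space => 'b::banach"
 assumes beta: "0 < beta" and alpha: "0 <= alpha" "alpha <= beta" and US: "U \<subseteq> S" "S \<subseteq> closure U"
  and lh: "\<And>p. p \<in> S ==> locally_holder beta U f p" and K: "compact K" "K \<subseteq> S"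
 shows "\<exists>C\<ge>0. \<forall>p\<in>K \<inter> U. \<forall>q\<in>K \<inter> U. norm (f p - f q) <= C * dist p q powr alpha"
proof -
 obtain g where g: "continuous_on S g" "\<And>p. p \<in> U ==> g p = f p" using locally_holder_extension[OF beta US lh] by auto
 have "compact (g ` K)" using K g(1) by (auto intro: compact_continuous_image continuous_on_subset)
 then obtain M where M: "\<And>p. p \<in> K ==> norm (g p) <= M" using compact_imp_bounded[of "g ` K"] by (auto simp: bounded_iff)
 have "\<forall>p. \<exists>r C. p \<in> K --> (0 < r & 0 <= C & (\<forall>a\<in>U. \<forall>b\<in>U. dist p a < r --> dist p b < r --> norm (f a - f b) <= C * dist a b powr alpha))"
 proof
  fix p
  show "\<exists>r C. p \<in> K --> (0 < r & 0 <= C & (\<forall>a\<in>U. \<forall>b\<in>U. dist p a < r --> dist p b < r --> norm (f a - f b) <= C * dist a b powr alpha))"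
  proof (cases "p \<in> K")
   case True
   then have "locally_holder alpha U f p" using lh K alpha by (auto intro: locally_holder_mono)
   then show ?thesis by (rule locally_holderE) blast
  qed simp
 qed
 then obtain r C where rC: "\<forall>p. p \<in> K --> (0 < r p & 0 <= C p & (\<forall>a\<in>U. \<forall>b\<in>U. dist p a < r p --> dist p b < r p --> norm (f a - f b) <= C p * dist a b powr alpha))"
  unfolding choice_iff by (elim exE)
 have cov: "K \<subseteq> (\<Union>p\<in>K. ball p (r p))" using rC by force
 obtain F where F: "F \<subseteq> K" "finite F" "K \<subseteq> (\<Union>p\<in>F. ball p (r p))"
  by (rule compactE_image[OF K(1) _ cov]) auto
 obtain e where e: "0 < e" "\<And>x. x \<in> K ==> \<exists>G\<in>(\<lambda>p. ball p (r p)) ` F. ball x e \<subseteq> G"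
  by (rule Heine_Borel_lemma[OF K(1), of "(\<lambda>p. ball p (r p)) ` F"]) (use F(3) in auto)
 have Csum: "0 <= sum C F" "\<And>p. p \<in> F ==> C p <= sum C F" using rC F(1,2) by (auto intro!: sum_nonneg member_le_sum)
 show ?thesis
 proof (intro exI[of _ "sum C F + 2 * \<bar>M\<bar> / e powr alpha"] conjI ballI)
  show "0 <= sum C F + 2 * \<bar>M\<bar> / e powr alpha" using Csum by simp
  fix p q assume pq: "p \<in> K \<inter> U" "q \<in> K \<inter> U"
  show "norm (f p - f q) <= (sum C F + 2 * \<bar>M\<bar> / e powr alpha) * dist p q powr alpha"
  proof (cases "dist p q < e")
   case True
   obtain c where c: "c \<in> F" "ball p e \<subseteq> ball c (r c)" using e(2) pq by blast
   then have "p \<in> ball c (r c)" "q \<in> ball c (r c)" using True e(1) by (auto simp: subset_iff)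
   then have "norm (f p - f q) <= C c * dist p q powr alpha" using rC F(1) c(1) pq by auto
   also have "\<dots> <= (sum C F + 2 * \<bar>M\<bar> / e powr alpha) * dist p q powr alpha" using Csum(2)[OF c(1)] by (intro mult_right_mono) (auto intro: add_increasing2)
   finally show ?thesis .
  next
   case False
   have "norm (f p - f q) <= norm (f p) + norm (f q)" by (rule norm_triangle_ineq4)
   also have "\<dots> <= 2 * \<bar>M\<bar> * 1" using M[of p] M[of q] g(2)[of p] g(2)[of q] pq by auto
   also have "\<dots> <= 2 * \<bar>M\<bar> * (dist p q powr alpha / e powr alpha)"
    using False e(1) alpha(1) powr_mono2[of alpha e "dist p q"] by (intro mult_left_mono) (auto simp: divide_simps)
   also have "\<dots> <= (sum C F + 2 * \<bar>M\<bar> / e powr alpha) * dist p q powr alpha" using Csum(1) by (simp add: distrib_right)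
   finally show ?thesis .
  qed
 qed
qed

section \<open>Integration by parts and integrable singularities\<close>

lemma continuous_on_extend_zero:
 fixes g :: "'a::t2_space => real"
 assumes "open \<Omega>" "compact K0" "K0 \<subseteq> \<Omega>" "continuous_on \<Omega> g" "\<And>p. p \<in> \<Omega> - K0 ==> g p = 0"
 shows "continuous_on UNIV (\<lambda>p. if p \<in> \<Omega> then g p else 0)"
proof -
 have "continuous_on \<Omega> (\<lambda>p. if p \<in> \<Omega> then g p else 0)" using assms(4) by (rule continuous_on_eq) simp
 moreover have "continuous_on (- K0) (\<lambda>p. if p \<in> \<Omega> then g p else 0)" by (rule continuous_on_eq[OF continuous_on_const[of _ 0]]) (use assms in auto)
 moreover have "open (- K0)" using assms(2) by (simp add: compact_imp_closed open_Compl)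
 ultimately have "continuous_on (\<Omega> \<union> - K0) (\<lambda>p. if p \<in> \<Omega> then g p else 0)" using assms(1) by (intro continuous_on_open_Un)
 moreover have "\<Omega> \<union> - K0 = UNIV" using assms(3) by auto
 ultimately show ?thesis by simp
qed

lemma DERIV_pdir:
 assumes "f differentiable (at p)"
 shows "((\<lambda>t. f (t, snd p)) has_real_derivative pdir True f p) (at (fst p))"
  and "((\<lambda>t. f (fst p, t)) has_real_derivative pdir False f p) (at (snd p))"
proof -
 have "(\<lambda>t. (t, snd p)) differentiable (at (fst p))" "(\<lambda>t. (fst p, t)) differentiable (at (snd p))"
  unfolding differentiable_def by (rule exI, rule has_derivative_Pair[OF has_derivative_ident has_derivative_const], rule exI, rule has_derivative_Pair[OF has_derivative_const has_derivative_ident])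
 then have "(\<lambda>t. f (t, snd p)) differentiable (at (fst p))" "(\<lambda>t. f (fst p, t)) differentiable (at (snd p))"
  using differentiable_chain_at[of "\<lambda>t. (t, snd p)" "fst p" f] differentiable_chain_at[of "\<lambda>t. (fst p, t)" "snd p" f] assms by (auto simp: o_def)
 then show "((\<lambda>t. f (t, snd p)) has_real_derivative pdir True f p) (at (fst p))"
  "((\<lambda>t. f (fst p, t)) has_real_derivative pdir False f p) (at (snd p))"
  by (auto simp: pdir_def DERIV_deriv_iff_real_differentiable)
qed

lemma integral_derivative_zero:
 fixes k :: "real => real"
 assumes "\<And>t. (F has_real_derivative k t) (at t)" "\<And>t. isCont k t" "\<And>t. \<bar>t\<bar> >= R ==> F t = 0" "\<And>t. \<bar>t\<bar> >= R ==> k t = 0" "R >= 0"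
 shows "integral\<^sup>L lborel k = 0"
proof -
 have "(\<integral>x. k x * indicator {-R..R} x \<partial>lborel) = F R - F (-R)"
  by (rule integral_FTC_Icc_real) (use assms in auto)
 also have "(\<lambda>x. k x * indicator {-R..R} x) = k" 
 proof
  fix x show "k x * indicator {-R..R} x = k x" using assms(4)[of x] by (cases "\<bar>x\<bar> >= R") (auto simp: indicator_def)
 qed
 finally show ?thesis using assms(3,5) by simp
qed

text \<open>Fubini with the inner integral in the direction of differentiation, where compact
  support and the fundamental theorem of calculus give 0.\<close>

lemma integral_pdir_zero:
 fixes G G' :: "real \<times> real => real"
 assumes der: "\<And>p. if d then ((\<lambda>t. G (t, snd p)) has_real_derivative G' p) (at (fst p)) else ((\<lambda>t. G (fst p, t)) has_real_derivative G' p) (at (snd p))"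
  and cont: "continuous_on UNIV G'" and K0: "compact K0" "\<And>p. p \<notin> K0 ==> G p = 0 & G' p = 0"
 shows "integral\<^sup>L lborel G' = 0"
proof -
 have "integrable lborel (\<lambda>p. indicator K0 p *\<^sub>R G' p)" using K0(1) cont by (intro borel_integrable_compact) (auto intro: continuous_on_subset)
 also have "(\<lambda>p. indicator K0 p *\<^sub>R G' p) = G'" using K0(2) by (auto simp: fun_eq_iff indicator_def)
 finally have int: "integrable (lborel \<Otimes>\<^sub>M lborel) G'" by (simp add: lborel_prod)
 obtain R where R: "R >= 0" "\<And>p. p \<in> K0 ==> norm p < R"
  using compact_imp_bounded[OF K0(1)] unfolding bounded_iff by (metis abs_ge_self abs_ge_zero dual_order.trans le_less_trans less_add_one linorder_not_le norm_ge_zero)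
 have out: "G (x, z) = 0 & G' (x, z) = 0" if "\<bar>x\<bar> >= R \<or> \<bar>z\<bar> >= R" for x z
 proof (rule K0(2), rule)
  assume "(x, z) \<in> K0"
  then have "norm (x, z) < R" by (rule R(2))
  moreover have "\<bar>x\<bar> <= norm (x, z)" "\<bar>z\<bar> <= norm (x, z)" using norm_fst_le[of x z] norm_snd_le[of z x] by auto
  ultimately show False using that by linarith
 qed
 have c: "isCont (\<lambda>t. G' (t, z)) x" "isCont (\<lambda>t. G' (x, t)) z" for x z
 proof -
  have "isCont G' (x, z)" using cont by (simp add: continuous_on_eq_continuous_at)
  then show "isCont (\<lambda>t. G' (t, z)) x" "isCont (\<lambda>t. G' (x, t)) z"
   by (auto intro!: isCont_o2[of _ _ G'] continuous_intros)
 qed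
 show ?thesis
 proof (cases d)
  case True
  have "(\<integral>x. G' (x, z) \<partial>lborel) = 0" for z
   by (rule integral_derivative_zero[where F = "\<lambda>t. G (t, z)" and R = R]) (use der[of "(_, z)"] True c out R in auto)
  moreover have "(\<integral>z. (\<integral>x. G' (x, z) \<partial>lborel) \<partial>lborel) = integral\<^sup>L (lborel \<Otimes>\<^sub>M lborel) (case_prod (\<lambda>x z. G' (x, z)))"
   by (rule lborel_pair.integral_snd) (use int in simp)
  ultimately show ?thesis by (simp add: lborel_prod)
 next
  case False
  have "(\<integral>z. G' (x, z) \<partial>lborel) = 0" for x
   by (rule integral_derivative_zero[where F = "\<lambda>t. G (x, t)" and R = R]) (use der[of "(x, _)"] False c out R in auto)
  moreover have "(\<integral>x. (\<integral>z. G' (x, z) \<partial>lborel) \<partial>lborel) = integral\<^sup>L (lborel \<Otimes>\<^sub>M lborel) G'"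
   by (rule lborel_pair.integral_fst') (use int in simp)
  ultimately show ?thesis by (simp add: lborel_prod)
 qed
qed

lemma pdir_zero_outside:
 assumes "compact K0" "\<And>p. p \<notin> K0 ==> psi p = 0" "p \<notin> K0"
 shows "((\<lambda>t. psi (t, snd p)) has_real_derivative 0) (at (fst p))" "((\<lambda>t. psi (fst p, t)) has_real_derivative 0) (at (snd p))" "pdir d psi p = 0"
proof -
 have op: "open (- K0)" using assms(1) by (simp add: compact_imp_closed open_Compl)
 have o: "open ((\<lambda>t. (t, snd p)) -` (- K0))" "open ((\<lambda>t. (fst p, t)) -` (- K0))"
  by (auto intro!: open_vimage op continuous_intros)
 show 1: "((\<lambda>t. psi (t, snd p)) has_real_derivative 0) (at (fst p))"
  by (rule has_field_derivative_transform_within_open[OF DERIV_const[of 0] o(1)]) (use assms in auto)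
 show 2: "((\<lambda>t. psi (fst p, t)) has_real_derivative 0) (at (snd p))"
  by (rule has_field_derivative_transform_within_open[OF DERIV_const[of 0] o(2)]) (use assms in auto)
 show "pdir d psi p = 0" using DERIV_imp_deriv[OF 1] DERIV_imp_deriv[OF 2] by (simp add: pdir_def)
qed

lemma set_integrable_compact_support:
 fixes g :: "real \<times> real => real"
 assumes "compact K0" "K0 \<subseteq> \<Omega>" "continuous_on \<Omega> g" "\<And>p. p \<in> \<Omega> - K0 ==> g p = 0"
 shows "set_integrable lborel \<Omega> g"
proof -
 have "integrable lborel (\<lambda>p. indicator K0 p *\<^sub>R g p)" using assms by (intro borel_integrable_compact) (auto intro: continuous_on_subset)
 also have "(\<lambda>p. indicator K0 p *\<^sub>R g p) = (\<lambda>p. indicator \<Omega> p *\<^sub>R g p)" using assms(2,4) by (auto simp: fun_eq_iff indicator_def)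
 finally show ?thesis by (simp add: set_integrable_def)
qed

text \<open>The product f * psi vanishes outside a compact subset of \<Omega>; extended by 0 it is
  differentiable in the chosen direction on the whole plane, and the integral of this derivative is
  0.\<close>

lemma integration_by_parts_pdir:
 assumes \<Omega>: "open \<Omega>" and K0: "compact K0" "K0 \<subseteq> \<Omega>" and f: "\<And>p. p \<in> \<Omega> ==> f differentiable (at p)" "continuous_on \<Omega> (pdir d f)"
  and psi: "\<And>p. psi differentiable (at p)" "continuous_on UNIV (pdir d psi)" "\<And>p. p \<notin> K0 ==> psi p = 0"
 shows "set_integrable lborel \<Omega> (\<lambda>p. f p * pdir d psi p)" "set_integrable lborel \<Omega> (\<lambda>p. pdir d f p * psi p)"
  "(LINT p:\<Omega>|lborel. f p * pdir d psi p) = - (LINT p:\<Omega>|lborel. pdir d f p * psi p)"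
proof -
 have z: "pdir d psi p = 0" if "p \<notin> K0" for p using pdir_zero_outside(3)[OF K0(1) psi(3) that] by simp
 have fc: "continuous_on \<Omega> f" using f(1) by (intro continuous_at_imp_continuous_on) (auto intro: differentiable_imp_continuous_within)
 have pc: "continuous_on \<Omega> psi" "continuous_on \<Omega> (pdir d psi)"
  using psi continuous_on_subset[OF psi(2), of \<Omega>] by (auto intro!: continuous_at_imp_continuous_on[of _ psi] differentiable_imp_continuous_within)
 show i1: "set_integrable lborel \<Omega> (\<lambda>p. f p * pdir d psi p)"
  by (rule set_integrable_compact_support[OF K0]) (auto intro!: continuous_intros fc pc simp: z)
 show i2: "set_integrable lborel \<Omega> (\<lambda>p. pdir d f p * psi p)"
  by (rule set_integrable_compact_support[OF K0]) (auto intro!: continuous_intros f pc simp: psi)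
 define G where "G p = (if p \<in> \<Omega> then f p * psi p else 0)" for p
 define G' where "G' p = (if p \<in> \<Omega> then f p * pdir d psi p + pdir d f p * psi p else 0)" for p
 have "integral\<^sup>L lborel G' = 0"
 proof (rule integral_pdir_zero[where G = G and ?K0.0 = K0 and d = d])
  show "continuous_on UNIV G'" unfolding G'_def
   by (rule continuous_on_extend_zero[OF \<Omega> K0]) (auto intro!: continuous_intros f fc pc simp: z psi)
  show "compact K0" by fact
  show out: "G p = 0 & G' p = 0" if "p \<notin> K0" for p using that by (simp add: G_def G'_def psi z)
  fix p
  show "if d then ((\<lambda>t. G (t, snd p)) has_real_derivative G' p) (at (fst p)) else ((\<lambda>t. G (fst p, t)) has_real_derivative G' p) (at (snd p))"
  proof (cases "p \<in> \<Omega>")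
   case True
   have op: "open ((\<lambda>t. (t, snd p)) -` \<Omega>)" "open ((\<lambda>t. (fst p, t)) -` \<Omega>)" by (auto intro!: open_vimage \<Omega> continuous_intros)
   have "((\<lambda>t. G (t, snd p)) has_real_derivative pdir True f p * psi p + pdir True psi p * f p) (at (fst p))"
    by (rule has_field_derivative_transform_within_open[OF _ op(1)], rule DERIV_cong[OF DERIV_mult[OF DERIV_pdir(1)[OF f(1)[OF True]] DERIV_pdir(1)[OF psi(1)]]]) (use True in \<open>auto simp: G_def\<close>)
   moreover have "((\<lambda>t. G (fst p, t)) has_real_derivative pdir False f p * psi p + pdir False psi p * f p) (at (snd p))"
    by (rule has_field_derivative_transform_within_open[OF _ op(2)], rule DERIV_cong[OF DERIV_mult[OF DERIV_pdir(2)[OF f(1)[OF True]] DERIV_pdir(2)[OF psi(1)]]]) (use True in \<open>auto simp: G_def\<close>)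
   ultimately show ?thesis using True by (auto simp: G'_def algebra_simps)
  next
   case False
   then have "p \<notin> K0" using K0 by auto
   then show ?thesis using pdir_zero_outside(1,2)[OF K0(1), of G p] out False by (auto simp: G'_def)
  qed
 qed
 moreover have "G' = (\<lambda>p. indicator \<Omega> p *\<^sub>R (f p * pdir d psi p + pdir d f p * psi p))" by (auto simp: G'_def fun_eq_iff)
 ultimately have "(LINT p:\<Omega>|lborel. f p * pdir d psi p + pdir d f p * psi p) = 0" by (simp add: set_lebesgue_integral_def)
 then show "(LINT p:\<Omega>|lborel. f p * pdir d psi p) = - (LINT p:\<Omega>|lborel. pdir d f p * psi p)"
  using set_integral_add(2)[OF i1 i2] by simp
qed

lemma pd_append: "pd (ds @ es) f = pd ds (pd es f)"
 by (induction ds) auto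

text \<open>Integration by parts removes the outermost derivative of psi, which becomes the
  innermost one on f: hence the reversed list.\<close>

lemma weak_pd_classical:
 assumes \<Omega>: "open \<Omega>" and f: "\<And>ds p. p \<in> \<Omega> ==> pd ds f differentiable (at p)"
 shows "weak_pd \<Omega> ds f (pd (rev ds) f)"
proof -
 have main: "set_integrable lborel \<Omega> (\<lambda>p. f p * pd ds psi p) & set_integrable lborel \<Omega> (\<lambda>p. pd (rev ds) f p * psi p) &
   (LINT p:\<Omega>|lborel. f p * pd ds psi p) = (-1) ^ length ds * (LINT p:\<Omega>|lborel. pd (rev ds) f p * psi p)"
  if sm: "smooth_fun psi" and K0: "compact K0" "K0 \<subseteq> \<Omega>" and out: "\<And>p. p \<notin> K0 ==> psi p = 0" for psi K0
  using f
 proof (induction ds arbitrary: f)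
  case Nil
  have "continuous_on \<Omega> f" using Nil[of _ "[]"] by (intro continuous_at_imp_continuous_on) (auto intro: differentiable_imp_continuous_within)
  moreover have "continuous_on \<Omega> psi" using sm[unfolded smooth_fun_def, rule_format, of "[]"]
   by (intro continuous_at_imp_continuous_on) (auto intro: differentiable_imp_continuous_within)
  ultimately have "set_integrable lborel \<Omega> (\<lambda>p. f p * psi p)"
   by (intro set_integrable_compact_support[OF K0]) (auto intro!: continuous_intros simp: out)
  then show ?case by simp
 next
  case (Cons d ds)
  have o: "pd es psi p = 0" if "p \<notin> K0" for es p
   using that by (induction es arbitrary: p) (auto simp: out intro!: pdir_zero_outside(3)[OF K0(1)])
  have df: "\<And>es p. p \<in> \<Omega> ==> pd es (pdir d f) differentiable (at p)" using Cons.prems[of _ "_ @ [d]"] by (simp add: pd_append)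
  have fc: "continuous_on \<Omega> (pdir d f)" using df[of _ "[]"] by (intro continuous_at_imp_continuous_on) (auto intro: differentiable_imp_continuous_within)
  have pc: "continuous_on UNIV (pdir d (pd ds psi))" using sm[unfolded smooth_fun_def, rule_format, of "d # ds"]
   by (intro continuous_at_imp_continuous_on) (auto intro: differentiable_imp_continuous_within)
  note ip = integration_by_parts_pdir[OF \<Omega> K0 Cons.prems[of _ "[]", simplified] fc sm[unfolded smooth_fun_def, rule_format, of ds] pc o]
  show ?case using Cons.IH[OF df] ip by (simp add: pd_append)
 qed
 show ?thesis unfolding weak_pd_def test_fun_def
 proof (intro allI impI)
  fix psi assume "smooth_fun psi & compact (closure {p. psi p \<noteq> 0}) & closure {p. psi p \<noteq> 0} \<subseteq> \<Omega>"
  moreover have "psi p = 0" if "p \<notin> closure {p. psi p \<noteq> 0}" for p using that closure_subset[of "{p. psi p \<noteq> 0}"] by blast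
  ultimately show "set_integrable lborel \<Omega> (\<lambda>p. f p * pd ds psi p) & set_integrable lborel \<Omega> (\<lambda>p. pd (rev ds) f p * psi p) &
   (LINT p:\<Omega>|lborel. f p * pd ds psi p) = (-1) ^ length ds * (LINT p:\<Omega>|lborel. pd (rev ds) f p * psi p)"
   by (intro main[of psi "closure {p. psi p \<noteq> 0}"]) blast+
 qed
qed

text \<open>On each vertical line the distance to the graph is an affine coordinate, so the inner
  integral is that of t^(-1/2) over [0, 1], equal to 2 for every x. The exponent is twice beta - 1
  for beta = 3/4.\<close>

lemma inverse_sqrt_integrable:
 fixes w0 :: "real => real"
 assumes w0: "continuous_on UNIV w0" and s: "s = 1 \<or> s = -1"
 shows "integrable lborel (\<lambda>p. indicator {p. \<bar>fst p\<bar> <= 1 & 0 <= s * (w0 (fst p) - snd p) & s * (w0 (fst p) - snd p) <= 1} p * (s * (w0 (fst p) - snd p)) powr (-1/2))"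
proof -
 define k where "k t = indicator {0..1} t * t powr (-1/2)" for t :: real
 define f where "f p = indicator {-1..1} (fst p) * k (s * (w0 (fst p) - snd p))" for p :: "real \<times> real"
 have [measurable]: "w0 \<in> borel_measurable borel" using w0 by (rule borel_measurable_continuous_onI)
 have km[measurable]: "k \<in> borel_measurable borel" unfolding k_def by measurable
 have fm: "f \<in> borel_measurable (lborel \<Otimes>\<^sub>M lborel)" unfolding f_def by measurable
 have "((\<lambda>t. t powr (-1/2)) has_integral (1 powr (-1/2+1) / (-1/2+1))) {0..1::real}" by (rule has_integral_powr_from_0) auto
 then have k2: "((\<lambda>t. t powr (-1/2)) has_integral 2) {0..1::real}" by simp
 have keq: "k = (\<lambda>t. if t \<in> {0..1} then t powr (-1/2) else 0)" by (auto simp: k_def fun_eq_iff)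
 have "(k has_integral 2) UNIV" unfolding keq has_integral_restrict_UNIV by (rule k2)
 then have kI: "(\<integral>\<^sup>+ t. ennreal (k t) \<partial>lborel) = ennreal 2" by (intro nn_integral_has_integral_lborel[OF km]) (auto simp: k_def)
 have inner: "(\<integral>\<^sup>+ z. ennreal (k (s * (a - z))) \<partial>lborel) = ennreal 2" for a
 proof -
  have "ennreal 2 = \<bar>- s\<bar> * (\<integral>\<^sup>+ z. ennreal (k (s * a + (- s) * z)) \<partial>lborel)"
   unfolding kI[symmetric] by (rule nn_integral_real_affine) (use s in auto)
  then show ?thesis using s by (auto simp: algebra_simps)
 qed
 have "(\<integral>\<^sup>+ p. ennreal (f p) \<partial>(lborel \<Otimes>\<^sub>M lborel)) = (\<integral>\<^sup>+ x. \<integral>\<^sup>+ z. ennreal (f (x, z)) \<partial>lborel \<partial>lborel)"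
  by (rule lborel.nn_integral_fst[symmetric]) (rule measurable_compose[OF fm measurable_ennreal])
 also have "\<dots> = (\<integral>\<^sup>+ x. ennreal 2 * indicator {-1..1} x \<partial>(lborel :: real measure))"
 proof (intro nn_integral_cong)
  fix x :: real
  have "(\<integral>\<^sup>+ z. ennreal (f (x, z)) \<partial>lborel) = (\<integral>\<^sup>+ z. indicator {-1..1} x * ennreal (k (s * (w0 x - z))) \<partial>lborel)"
   by (intro nn_integral_cong) (auto simp: f_def indicator_def)
  also have "\<dots> = indicator {-1..1} x * ennreal 2" by (subst nn_integral_cmult) (auto simp: inner)
  finally show "(\<integral>\<^sup>+ z. ennreal (f (x, z)) \<partial>lborel) = ennreal 2 * indicator {-1..1} x" by (simp add: mult.commute)
 qed
 also have "\<dots> = ennreal 4" by (subst nn_integral_cmult_indicator) (auto simp: ennreal_mult'[symmetric])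
 finally have fin: "(\<integral>\<^sup>+ p. ennreal (f p) \<partial>(lborel \<Otimes>\<^sub>M lborel)) = ennreal 4" .
 have "AE p in lborel \<Otimes>\<^sub>M lborel. 0 <= f p" by (rule AE_I2) (simp add: f_def k_def)
 from integrableI_nn_integral_finite[OF fm this fin] have "integrable (lborel \<Otimes>\<^sub>M lborel) f" .
 moreover have "f = (\<lambda>p. indicator {p. \<bar>fst p\<bar> <= 1 & 0 <= s * (w0 (fst p) - snd p) & s * (w0 (fst p) - snd p) <= 1} p * (s * (w0 (fst p) - snd p)) powr (-1/2))"
  by (auto simp: f_def k_def fun_eq_iff indicator_def)
 ultimately show ?thesis by (simp add: lborel_prod)
qed

section \<open>Hoelder continuity of the curvature\<close>

context potential
begin

lemma T_bound: assumes x: "\<bar>x\<bar> <= L" shows "cmod (T x) <= 432"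
proof (rule tendsto_upperbound[OF tendsto_norm[OF T_tendsto[OF x]]])
 show "\<forall>\<^sub>F w in at (top x) within D. cmod (deriv h w) <= 432"
  using deriv_h_bound by (auto simp: eventually_at_filter intro!: always_eventually)
qed (rule top_limit_point[OF x])

text \<open>For |x - y| < 1/96 the boundary points are closer than 1/48 and the trace is Hoelder
  continuous. Beyond that the truncation bounds the difference by K, and (96 * |x - y|)^beta is at
  least 1.\<close>

lemma boundary_gradient_holder:
 assumes beta: "0 < beta" "beta < 1" and c: "0 <= c"
 shows "\<exists>C\<ge>0. \<forall>x y. \<bar>x\<bar> <= L --> \<bar>y\<bar> <= L -->
  \<bar>min K (c * (cmod (T \<bar>x\<bar>))\<^sup>2) - min K (c * (cmod (T \<bar>y\<bar>))\<^sup>2)\<bar> <= C * \<bar>x - y\<bar> powr beta"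
proof (intro exI[of _ "1728 * (c * trace_const L K beta) + 96 * K"] conjI allI impI)
 have tc: "0 <= c * trace_const L K beta" using trace_const_nonneg[OF beta] c by simp
 then show "0 <= 1728 * (c * trace_const L K beta) + 96 * K" using K by simp
 fix x y assume xy: "\<bar>x\<bar> <= L" "\<bar>y\<bar> <= L"
 define t where "t = \<bar>x - y\<bar>"
 have t0: "0 <= t" by (simp add: t_def)
 define a where "a = cmod (T \<bar>x\<bar>)"
 define b where "b = cmod (T \<bar>y\<bar>)"
 have tt: "\<bar>\<bar>x\<bar> - \<bar>y\<bar>\<bar> <= t" by (simp add: t_def abs_triangle_ineq3)
 have ab: "0 <= a" "a <= 432" "0 <= b" "b <= 432" using T_bound[of "\<bar>x\<bar>"] T_bound[of "\<bar>y\<bar>"] xy by (auto simp: a_def b_def)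
 show "\<bar>min K (c * (cmod (T \<bar>x\<bar>))\<^sup>2) - min K (c * (cmod (T \<bar>y\<bar>))\<^sup>2)\<bar> <= (1728 * (c * trace_const L K beta) + 96 * K) * \<bar>x - y\<bar> powr beta"
  unfolding t_def[symmetric] a_def[symmetric] b_def[symmetric]
 proof (cases "t < 1/96")
  case True
  have td: "cmod (top \<bar>x\<bar> - top \<bar>y\<bar>) <= 2 * t" using top_dist[of "\<bar>x\<bar>" "\<bar>y\<bar>"] xy tt by simp
  have "cmod (T \<bar>x\<bar> - T \<bar>y\<bar>) <= trace_const L K beta * cmod (top \<bar>x\<bar> - top \<bar>y\<bar>) powr beta"
   by (rule T_holder2[OF beta]) (use xy td True in auto)
  also have "\<dots> <= trace_const L K beta * (2 * t) powr beta" using td beta trace_const_nonneg[OF beta] by (intro mult_left_mono powr_mono2) auto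
  also have "\<dots> <= trace_const L K beta * (2 * t powr beta)"
  proof (rule mult_left_mono)
   have "(2 * t) powr beta = 2 powr beta * t powr beta" using t0 by (simp add: powr_mult)
   also have "\<dots> <= 2 powr 1 * t powr beta" using beta by (intro mult_right_mono powr_mono) auto
   finally show "(2 * t) powr beta <= 2 * t powr beta" by simp
  qed (rule trace_const_nonneg[OF beta])
  finally have "\<bar>a - b\<bar> <= trace_const L K beta * (2 * t powr beta)" using norm_triangle_ineq3[of "T \<bar>x\<bar>" "T \<bar>y\<bar>"] by (simp add: a_def b_def)
  then have "c * (\<bar>a - b\<bar> * (a + b)) <= c * (trace_const L K beta * (2 * t powr beta) * 864)"
   using ab c trace_const_nonneg[OF beta] by (intro mult_left_mono mult_mono) auto
  also have "c * (\<bar>a - b\<bar> * (a + b)) = \<bar>c * a\<^sup>2 - c * b\<^sup>2\<bar>"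
  proof -
   have "c * a\<^sup>2 - c * b\<^sup>2 = c * ((a - b) * (a + b))" by (simp add: power2_eq_square algebra_simps)
   then show ?thesis using ab c by (simp add: abs_mult)
  qed
  finally have "\<bar>c * a\<^sup>2 - c * b\<^sup>2\<bar> <= 1728 * (c * trace_const L K beta) * t powr beta" by (simp add: mult_ac)
  moreover have "\<bar>min K (c * a\<^sup>2) - min K (c * b\<^sup>2)\<bar> <= \<bar>c * a\<^sup>2 - c * b\<^sup>2\<bar>" by (auto simp: min_def)
  moreover have "1728 * (c * trace_const L K beta) * t powr beta <= (1728 * (c * trace_const L K beta) + 96 * K) * t powr beta"
   using K by (intro mult_right_mono) auto
  ultimately show "\<bar>min K (c * a\<^sup>2) - min K (c * b\<^sup>2)\<bar> <= (1728 * (c * trace_const L K beta) + 96 * K) * t powr beta" by linarith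
 next
  case False
  have "0 <= c * a\<^sup>2" "0 <= c * b\<^sup>2" using c by auto
  then have "\<bar>min K (c * a\<^sup>2) - min K (c * b\<^sup>2)\<bar> <= K * 1" using K by (auto simp: min_def)
  also have "\<dots> <= K * (96 * t powr beta)"
  proof (intro mult_left_mono K)
   have "1 <= (96 * t) powr beta" using False beta by (intro ge_one_powr_ge_zero) auto
   also have "\<dots> = 96 powr beta * t powr beta" using t0 by (simp add: powr_mult)
   also have "\<dots> <= 96 powr 1 * t powr beta" using beta by (intro mult_right_mono powr_mono) auto
   finally show "1 <= 96 * t powr beta" by simp
  qed
  also have "\<dots> = 96 * K * t powr beta" by simp
  also have "\<dots> <= (1728 * (c * trace_const L K beta) + 96 * K) * t powr beta" using tc by (intro mult_right_mono) auto
  finally show "\<bar>min K (c * a\<^sup>2) - min K (c * b\<^sup>2)\<bar> <= (1728 * (c * trace_const L K beta) + 96 * K) * t powr beta" .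
 qed
qed

text \<open>This closes the bootstrap: the curvature is built from the trace of h', hence Hoelder
  continuous for every exponent below 1, and the mean value inequality turns this into the expansion
  of the slope.\<close>

lemma smooth_potentialI:
 assumes c: "0 <= c" and der: "\<And>X. \<bar>X\<bar> <= L ==> (p has_real_derivative min K (c * (cmod (T \<bar>X\<bar>))\<^sup>2)) (at X within {-L..L})"
 shows "smooth_potential L K U p W q h (\<lambda>X. min K (c * (cmod (T \<bar>X\<bar>))\<^sup>2))"
proof unfold_locales
 fix x :: real
 have "0 <= c * (cmod (T \<bar>x\<bar>))\<^sup>2" using c by simp
 then show "\<bar>min K (c * (cmod (T \<bar>x\<bar>))\<^sup>2)\<bar> <= K" using K by (auto simp: min_def)
next
 fix beta :: real assume beta: "0 < beta" "beta < 1"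
 define S where "S X = min K (c * (cmod (T \<bar>X\<bar>))\<^sup>2)" for X
 obtain C where C: "C >= 0" "\<And>x y. \<bar>x\<bar> <= L ==> \<bar>y\<bar> <= L ==> \<bar>S x - S y\<bar> <= C * \<bar>x - y\<bar> powr beta"
  using boundary_gradient_holder[OF beta c] unfolding S_def by blast
 show "\<exists>C\<ge>0. \<forall>x y. \<bar>x\<bar> <= L --> \<bar>y\<bar> <= L --> \<bar>p x - p y - min K (c * (cmod (T \<bar>y\<bar>))\<^sup>2) * (x - y)\<bar> <= C * \<bar>x - y\<bar> powr (1 + beta)"
 proof (intro exI[of _ C] conjI allI impI)
  fix x y assume xy: "\<bar>x\<bar> <= L" "\<bar>y\<bar> <= L"
  define I where "I = {min x y..max x y}"
  have I: "I \<subseteq> {-L..L}" "x \<in> I" "y \<in> I" "convex I" using xy by (auto simp: I_def)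
  have "norm ((p x - S y * x) - (p y - S y * y)) <= (C * \<bar>x - y\<bar> powr beta) * norm (x - y)"
  proof (rule field_differentiable_bound[OF I(4), where f = "\<lambda>t. p t - S y * t" and f' = "\<lambda>t. S t - S y"])
   fix t assume t: "t \<in> I"
   then have "t \<in> {-L..L}" using I(1) by blast
   then have tL: "\<bar>t\<bar> <= L" by auto
   have "(p has_real_derivative S t) (at t within I)" using der[OF tL] I(1) unfolding S_def by (rule DERIV_subset)
   then show "((\<lambda>t. p t - S y * t) has_field_derivative S t - S y) (at t within I)" by (auto intro!: derivative_eq_intros)
   have "\<bar>t - y\<bar> <= \<bar>x - y\<bar>" using t by (auto simp: I_def min_def max_def split: if_splits)
   then have "C * \<bar>t - y\<bar> powr beta <= C * \<bar>x - y\<bar> powr beta" using C(1) beta by (intro mult_left_mono powr_mono2) auto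
   then show "norm (S t - S y) <= C * \<bar>x - y\<bar> powr beta" using C(2)[OF tL xy(2)] by simp
  qed (use I in auto)
  also have "(p x - S y * x) - (p y - S y * y) = p x - p y - S y * (x - y)" by (simp add: algebra_simps)
  also have "(C * \<bar>x - y\<bar> powr beta) * norm (x - y) = C * \<bar>x - y\<bar> powr (1 + beta)" by (simp add: powr_add)
  finally show "\<bar>p x - p y - min K (c * (cmod (T \<bar>y\<bar>))\<^sup>2) * (x - y)\<bar> <= C * \<bar>x - y\<bar> powr (1 + beta)" by (simp add: S_def)
 qed (use C in auto)
qed

end

section \<open>The change of variables X = x / eps\<close>

definition emb :: "real => real \<times> real => complex" where
 "emb eps p = Complex (fst p / eps) (snd p)"

text \<open>The image of a coordinate direction under \<open>emb\<close>: a partial derivative of Re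
  (h (emb eps p)) is the real part of this factor times h'.\<close>

definition dirn :: "real => bool => complex" where
 "dirn eps d = (if d then of_real (1 / eps) else \<i>)"

lemma emb_simps[simp]: "Re (emb eps p) = fst p / eps" "Im (emb eps p) = snd p"
 by (auto simp: emb_def)

lemma emb_diff: "emb eps p - emb eps q = emb eps (p - q)"
 by (simp add: complex_eq_iff diff_divide_distrib)

lemma bounded_linear_emb: "bounded_linear (emb eps)"
proof -
 have "emb eps = (\<lambda>p. fst p *\<^sub>R Complex (1 / eps) 0 + snd p *\<^sub>R \<i>)" by (auto simp: fun_eq_iff complex_eq_iff)
 then show ?thesis by (auto intro!: bounded_linear_add bounded_linear_scaleR_const bounded_linear_fst bounded_linear_snd)
qed

lemma norm_emb_le: assumes "0 < eps" shows "cmod (emb eps p) <= (1 / eps + 1) * norm p"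
proof -
 have "cmod (emb eps p) <= \<bar>Re (emb eps p)\<bar> + \<bar>Im (emb eps p)\<bar>" by (rule cmod_le)
 also have "\<dots> <= norm p / eps + norm p" using norm_fst_le[of "fst p" "snd p"] norm_snd_le[of "snd p" "fst p"] assms
  by (intro add_mono) (auto intro!: divide_right_mono)
 finally show ?thesis by (simp add: algebra_simps)
qed

lemma pdir_Re_holomorphic:
 assumes \<Omega>: "open \<Omega>" and D: "open D" and k: "k holomorphic_on D" and emb: "\<And>p. p \<in> \<Omega> ==> emb eps p \<in> D"
  and f: "\<And>p. p \<in> \<Omega> ==> f p = Re (c * k (emb eps p))" and p: "p \<in> \<Omega>"
 shows "f differentiable (at p)" "pdir d f p = Re (c * dirn eps d * deriv k (emb eps p))"
proof -
 define k' where "k' = deriv k (emb eps p)"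
 have "(k has_derivative (\<lambda>v. v * k')) (at (emb eps p))"
  using holomorphic_derivI[OF k D emb[OF p]] by (simp add: k'_def has_field_derivative_def mult.commute[of _ "deriv k _"])
 from has_derivative_compose[OF bounded_linear_imp_has_derivative[OF bounded_linear_emb] this]
 have "((\<lambda>p. Re (c * k (emb eps p))) has_derivative (\<lambda>v. Re (c * (emb eps v * k')))) (at p)"
  by (intro has_derivative_Re has_derivative_mult_right)
 then have hd: "(f has_derivative (\<lambda>v. Re (c * (emb eps v * k')))) (at p)"
  by (rule has_derivative_transform_within_open[OF _ \<Omega> p]) (use f in auto)
 then show df: "f differentiable (at p)" by (auto simp: differentiable_def)
 have "((\<lambda>t. f (t, snd p)) has_derivative (\<lambda>t. Re (c * (emb eps (t, 0) * k')))) (at (fst p))"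
  by (rule has_derivative_compose[of "\<lambda>t. (t, snd p)" "\<lambda>t. (t, 0)"]) (use hd in \<open>auto intro!: derivative_eq_intros\<close>)
 then have "((\<lambda>t. f (t, snd p)) has_real_derivative Re (c * dirn eps True * k')) (at (fst p))"
  by (rule has_derivative_imp_has_field_derivative) (simp add: emb_def dirn_def algebra_simps diff_divide_distrib)
 then have 1: "pdir True f p = Re (c * dirn eps True * k')" by (rule DERIV_unique[OF DERIV_pdir(1)[OF df]])
 have "((\<lambda>t. f (fst p, t)) has_derivative (\<lambda>t. Re (c * (emb eps (0, t) * k')))) (at (snd p))"
  by (rule has_derivative_compose[of "\<lambda>t. (fst p, t)" "\<lambda>t. (0, t)"]) (use hd in \<open>auto intro!: derivative_eq_intros\<close>)
 then have "((\<lambda>t. f (fst p, t)) has_real_derivative Re (c * dirn eps False * k')) (at (snd p))"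
  by (rule has_derivative_imp_has_field_derivative) (simp add: emb_def dirn_def algebra_simps)
 then have 2: "pdir False f p = Re (c * dirn eps False * k')" by (rule DERIV_unique[OF DERIV_pdir(2)[OF df]])
 show "pdir d f p = Re (c * dirn eps d * deriv k (emb eps p))" using 1 2 by (cases d) (auto simp: k'_def)
qed

text \<open>Each partial derivative contributes one factor \<open>dirn\<close> and one complex
  derivative, so bounds for complex derivatives of h cover mixed derivatives in any order.\<close>

lemma pd_Re_holomorphic:
 assumes \<Omega>: "open \<Omega>" and D: "open D" and h: "h holomorphic_on D" and emb: "\<And>p. p \<in> \<Omega> ==> emb eps p \<in> D"
  and phi: "\<And>p. p \<in> \<Omega> ==> phi p = Re (h (emb eps p))" and p: "p \<in> \<Omega>"
 shows "pd ds phi p = Re (prod_list (map (dirn eps) ds) * (deriv ^^ length ds) h (emb eps p))" "pd ds phi differentiable (at p)"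
proof -
 have hol: "(deriv ^^ n) h holomorphic_on D" for n using h D by (rule holomorphic_higher_deriv)
 have f: "pd ds phi p = Re (prod_list (map (dirn eps) ds) * (deriv ^^ length ds) h (emb eps p))" if "p \<in> \<Omega>" for p ds
  using that
 proof (induction ds arbitrary: p)
  case (Cons d ds)
  show ?case using pdir_Re_holomorphic(2)[OF \<Omega> D hol emb Cons.IH Cons.prems] by (simp add: mult.commute[of "dirn eps d"])
 qed (simp add: phi)
 show "pd ds phi p = Re (prod_list (map (dirn eps) ds) * (deriv ^^ length ds) h (emb eps p))" using f p by blast
 show "pd ds phi differentiable (at p)" using pdir_Re_holomorphic(1)[OF \<Omega> D hol emb f p] by blast
qed

section \<open>Hoelder bounds for derivatives at boundary points\<close>

lemma locally_holder_emb:
 assumes lh: "locally_holder beta D F (emb eps p)" and eps: "0 < eps" and beta: "0 <= beta" and emb: "\<And>p. p \<in> \<Omega> ==> emb eps p \<in> D"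
  and f: "\<And>p. p \<in> \<Omega> ==> f p = Re (c * F (emb eps p))"
 shows "locally_holder beta \<Omega> f p"
proof -
 obtain r C where rC: "r > 0" "C >= 0" "\<And>a b. a \<in> D ==> b \<in> D ==> dist (emb eps p) a < r ==> dist (emb eps p) b < r ==> norm (F a - F b) <= C * dist a b powr beta"
  using lh by (rule locally_holderE, blast)
 define k where "k = 1 / eps + 1"
 have k: "k > 0" using eps by (simp add: k_def add_pos_pos)
 have de: "dist (emb eps a) (emb eps b) <= k * dist a b" for a b
  unfolding dist_norm emb_diff k_def by (rule norm_emb_le[OF eps])
 show ?thesis
 proof (rule locally_holderI[of "r / k" "cmod c * (C * k powr beta)"])
  fix a b assume ab: "a \<in> \<Omega>" "b \<in> \<Omega>" "dist p a < r / k" "dist p b < r / k"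
  have "dist (emb eps p) (emb eps a) < r" "dist (emb eps p) (emb eps b) < r"
   using de[of p a] de[of p b] ab(3,4) k by (auto simp: field_simps)
  then have "norm (F (emb eps a) - F (emb eps b)) <= C * dist (emb eps a) (emb eps b) powr beta" using rC(3) emb ab by blast
  also have "\<dots> <= C * (k * dist a b) powr beta" using rC(2) de beta by (intro mult_left_mono powr_mono2) auto
  also have "\<dots> = C * k powr beta * dist a b powr beta" using k by (simp add: powr_mult)
  finally have "cmod c * norm (F (emb eps a) - F (emb eps b)) <= cmod c * (C * k powr beta * dist a b powr beta)" by (rule mult_left_mono) simp
  moreover have "f a - f b = Re (c * (F (emb eps a) - F (emb eps b)))" by (simp add: f ab algebra_simps)
  then have "\<bar>f a - f b\<bar> <= cmod c * norm (F (emb eps a) - F (emb eps b))"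
   using abs_Re_le_cmod[of "c * (F (emb eps a) - F (emb eps b))"] by (simp only: norm_mult)
  ultimately show "norm (f a - f b) <= cmod c * (C * k powr beta) * dist a b powr beta" by (simp add: mult.assoc)
 qed (use k rC in auto)
qed

lemma locally_holder_holomorphic:
 assumes F: "F holomorphic_on D" and D: "open D" and w: "w \<in> D" and beta: "beta <= 1"
 shows "locally_holder beta D F w"
proof -
 obtain r where r: "r > 0" "cball w r \<subseteq> D" using D w open_contains_cball by blast
 define s where "s = min r (1/2)"
 have s: "s > 0" "cball w s \<subseteq> D" "s <= 1/2" using r by (auto simp: s_def)
 have "continuous_on (cball w s) (deriv F)"
  using holomorphic_deriv[OF F D] s(2) holomorphic_on_imp_continuous_on holomorphic_on_subset by blast
 then have "bounded (deriv F ` cball w s)" by (intro compact_imp_bounded compact_continuous_image) auto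
 then obtain M where M: "\<And>v. v \<in> cball w s ==> cmod (deriv F v) <= M" unfolding bounded_iff by blast
 show ?thesis
 proof (rule locally_holderI[of s "\<bar>M\<bar>"])
  fix a b assume ab: "dist w a < s" "dist w b < s"
  have "norm (F a - F b) <= \<bar>M\<bar> * norm (a - b)"
  proof (rule field_differentiable_bound[of "cball w s" F "deriv F"])
   fix z assume z: "z \<in> cball w s"
   show "(F has_field_derivative deriv F z) (at z within cball w s)" using holomorphic_derivI[OF F D] z s by blast
   show "norm (deriv F z) <= \<bar>M\<bar>" using M[OF z] by simp
  qed (use ab in auto)
  also have "\<dots> <= \<bar>M\<bar> * dist a b powr beta"
  proof (rule mult_left_mono)
   have "dist a b <= dist w a + dist w b" by (simp add: dist_triangle3)
   then have "dist a b <= 1" using ab s by linarith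
   then have "dist a b powr 1 <= dist a b powr beta" using beta by (intro powr_mono') auto
   then show "norm (a - b) <= dist a b powr beta" by (simp add: dist_norm)
  qed simp
  finally show "norm (F a - F b) <= \<bar>M\<bar> * dist a b powr beta" .
 qed (use s in auto)
qed

lemma (in cell) locally_holder_strip:
 assumes eta: "0 < eta" "eta <= 1/3" and X1: "X1 <= L" and x: "\<bar>x\<bar> < X1" and C: "C >= 0" and delta: "delta > 0"
  and F: "\<And>w w'. w \<in> strip (- X1) X1 eta ==> w' \<in> strip (- X1) X1 eta ==> cmod (w - w') <= delta ==> cmod (F w - F w') <= C * cmod (w - w') powr beta"
 shows "locally_holder beta D F (top x)"
proof -
 have "\<forall>\<^sub>F w in at (top x) within D. w \<in> strip (- X1) X1 eta" by (rule eventually_strip) (use eta X1 x in auto)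
 then obtain r where r: "r > 0" "\<forall>w\<in>D. w \<noteq> top x & dist w (top x) < r --> w \<in> strip (- X1) X1 eta" by (auto simp: eventually_at)
 have r': "w \<in> strip (- X1) X1 eta" if "w \<in> D" "dist (top x) w < r" for w
  using r(2) that in_D(3)[OF that(1)] by (auto simp: dist_commute)
 show ?thesis
 proof (rule locally_holderI[of "min r (delta / 2)" C])
  fix a b assume ab: "a \<in> D" "b \<in> D" "dist (top x) a < min r (delta / 2)" "dist (top x) b < min r (delta / 2)"
  have "dist a b <= dist (top x) a + dist (top x) b" by (simp add: dist_triangle3)
  then have "cmod (a - b) <= delta" using ab by (simp add: dist_norm)
  then show "norm (F a - F b) <= C * dist a b powr beta" using F[OF r' r'] ab by (simp add: dist_norm)
 qed (use r C delta in auto)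
qed

lemma cellD_swap: "cnj w - \<i> \<in> cellD L W U \<longleftrightarrow> w \<in> cellD L U W"
 by (auto simp: cellD_def)

text \<open>The reflection is an isometry. The constant c allows one statement for h, where it is 1,
  and for its derivatives, where it is 0.\<close>

lemma locally_holder_swap:
 assumes lh: "locally_holder beta (cellD L W U) F (Complex x (W x))"
  and G: "\<And>w. w \<in> cellD L U W ==> G w = c - cnj (F (cnj w - \<i>))"
 shows "locally_holder beta (cellD L U W) G (Complex x (- 1 - W x))"
proof -
 obtain r C where rC: "r > 0" "C >= 0" "\<And>a b. a \<in> cellD L W U ==> b \<in> cellD L W U ==> dist (Complex x (W x)) a < r ==> dist (Complex x (W x)) b < r ==> norm (F a - F b) <= C * dist a b powr beta"
  using lh by (rule locally_holderE, blast)
 have iso: "dist (cnj a - \<i>) (cnj b - \<i>) = dist a b" for a b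
  by (simp add: dist_norm flip: complex_cnj_diff)
 have pt: "Complex x (W x) = cnj (Complex x (- 1 - W x)) - \<i>" by (simp add: complex_eq_iff)
 show ?thesis
 proof (rule locally_holderI[OF rC(1,2)])
  fix a b assume ab: "a \<in> cellD L U W" "b \<in> cellD L U W" "dist (Complex x (- 1 - W x)) a < r" "dist (Complex x (- 1 - W x)) b < r"
  have "norm (F (cnj a - \<i>) - F (cnj b - \<i>)) <= C * dist (cnj a - \<i>) (cnj b - \<i>) powr beta"
   by (rule rC(3)) (use ab in \<open>simp_all only: cellD_swap pt iso\<close>)
  moreover have "norm (G a - G b) = norm (F (cnj a - \<i>) - F (cnj b - \<i>))"
   using complex_mod_cnj[of "F (cnj b - \<i>) - F (cnj a - \<i>)"] by (simp add: G ab norm_minus_commute)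
  ultimately show "norm (G a - G b) <= C * dist a b powr beta" by (simp only: iso)
 qed
qed

lemma (in potential) swp_derivs:
 assumes w: "w \<in> D"
 shows "h w = 1 - cnj (swp h (cnj w - \<i>))" "deriv h w = 0 - cnj (deriv (swp h) (cnj w - \<i>))"
  "deriv (deriv h) w = 0 - cnj (deriv (deriv (swp h)) (cnj w - \<i>))"
proof -
 have c: "cell L K U p W q" by unfold_locales
 have w': "cnj w - \<i> \<in> cellD L W U" using w by (simp add: cellD_swap)
 note s = is_potential_swap[OF c pot, folded swp_def]
 show "h w = 1 - cnj (swp h (cnj w - \<i>))" by (simp add: swp_def)
 show "deriv h w = 0 - cnj (deriv (swp h) (cnj w - \<i>))" using s(3)[OF w'] by simp
 show "deriv (deriv h) w = 0 - cnj (deriv (deriv (swp h)) (cnj w - \<i>))" using s(4)[OF w'] by simp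
qed

lemma le_2_cases: "n <= (2::nat) ==> n = 0 \<or> n = 1 \<or> n = 2" by auto

text \<open>Order 0 is the case of exponent 1 with the global bound 432 for h'. Order 1 uses the
  estimate valid up to the corners. Order 2 uses the one on [-X1, X1], with X1 chosen between |x|
  and L.\<close>

lemma (in smooth_potential) locally_holder_top:
 assumes x: "\<bar>x\<bar> < L" and n: "n <= 2" and beta: "0 < beta" "beta < 1"
 shows "locally_holder beta D ((deriv ^^ n) h) (top x)"
proof -
 have 0: "locally_holder beta D h (top x)"
 proof (rule locally_holder_mono)
  show "locally_holder 1 D h (top x)"
  proof (rule locally_holder_strip[where eta = "1/6" and ?X1.0 = L and C = "432 * (4 / 1 + 3)" and delta = "1/24"])
   fix w w' assume w: "w \<in> strip (- L) L (1/6)" "w' \<in> strip (- L) L (1/6)" "cmod (w - w') <= 1/24"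
   show "cmod (h w - h w') <= 432 * (4 / 1 + 3) * cmod (w - w') powr 1"
   proof (rule holder_near_top[where a = "- L" and b = L and eta = "1/3"])
    fix v assume v: "v \<in> strip (- L) L (1/3)"
    then have "v \<in> D" "0 < U (Re v) - Im v" using in_D(3)[of v] by (auto simp: strip_def)
    then show "cmod (deriv h v) <= 432 * (U (Re v) - Im v) powr (1 - 1)" using deriv_h_bound[of v] by simp
   qed (use w H(1) in auto)
  qed (use x in auto)
 qed (use beta in simp)
 have 1: "locally_holder beta D (deriv h) (top x)"
  by (rule locally_holder_strip[where eta = "1/12" and ?X1.0 = L and C = "trace_const L K beta" and delta = "1/48"])
   (use x trace_const_nonneg[OF beta] deriv_h_holder[OF beta] in auto)
 define X1 where "X1 = (\<bar>x\<bar> + L) / 2"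
 have X1: "0 <= X1" "X1 < L" "\<bar>x\<bar> < X1" using x by (auto simp: X1_def)
 obtain C eta where C: "C >= 0" "eta > 0" "eta <= 1/12" "\<forall>w\<in>strip (- X1) X1 eta. \<forall>w'\<in>strip (- X1) X1 eta. cmod (w - w') <= eta / 4 -->
  cmod (deriv (deriv h) w - deriv (deriv h) w') <= C * cmod (w - w') powr beta"
  using deriv2_h_holder[OF X1(1,2) beta] by blast
 have 2: "locally_holder beta D (deriv (deriv h)) (top x)"
  by (rule locally_holder_strip[where eta = eta and ?X1.0 = X1 and C = C and delta = "eta / 4"]) (use X1 C in auto)
 show ?thesis using le_2_cases[OF n] 0 1 2 by (auto simp: numeral_2_eq_2)
qed

lemma (in potential) locally_holder_bottom:
 assumes S: "smooth_potential L K W q U p (swp h) S2" and x: "\<bar>x\<bar> < L" and n: "n <= 2" and beta: "0 < beta" "beta < 1"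
 shows "locally_holder beta D ((deriv ^^ n) h) (Complex x (- 1 - W x))"
proof -
 note lt = smooth_potential.locally_holder_top[OF S x _ beta]
 show ?thesis using le_2_cases[OF n]
 proof (elim disjE)
  assume n: "n = 0"
  show ?thesis unfolding n by (rule locally_holder_swap[where F = "swp h" and c = 1]) (use lt[of 0] swp_derivs(1) in auto)
 next
  assume n: "n = 1"
  show ?thesis unfolding n by (rule locally_holder_swap[where F = "deriv (swp h)" and c = 0]) (use lt[of 1] swp_derivs(2) in auto)
 next
  assume n: "n = 2"
  show ?thesis unfolding n by (rule locally_holder_swap[where F = "deriv (deriv (swp h))" and c = 0]) (use lt[of 2] swp_derivs(3) in \<open>auto simp: numeral_2_eq_2\<close>)
 qed
qed

text \<open>The nearer graph supplies its own summand, the lower one by way of the reflected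
  potential; the other summand is nonnegative.\<close>

lemma (in potential) deriv2_h_bound:
 assumes beta: "0 < beta" "beta < 1" and w: "w \<in> D"
 shows "cmod (deriv (deriv h) w) <= hess_const L K beta * ((U (Re w) - Im w) powr (beta - 1) + (Im w + 1 + W (Re w)) powr (beta - 1))"
proof -
 interpret s: potential L K W q U p "swp h" by (rule potential_swap) unfold_locales
 have hc: "0 <= hess_const L K beta" using hess_const_nonneg[OF beta] .
 have "cmod (deriv (deriv h) w) <= hess_const L K beta * (U (Re w) - Im w) powr (beta - 1)
  \<or> cmod (deriv (deriv h) w) <= hess_const L K beta * (Im w + 1 + W (Re w)) powr (beta - 1)"
 proof (cases "U (Re w) - Im w <= Im w + 1 + W (Re w)")
  case True then show ?thesis using deriv2_h_upper_half[OF beta w] by simp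
 next
  case False
  have w': "cnj w - \<i> \<in> cellD L W U" using w by (simp add: cellD_swap)
  have "cmod (deriv (deriv (swp h)) (cnj w - \<i>)) <= hess_const L K beta * (W (Re (cnj w - \<i>)) - Im (cnj w - \<i>)) powr (beta - 1)"
   by (rule s.deriv2_h_upper_half[OF beta w']) (use False in simp)
  moreover have "W (Re (cnj w - \<i>)) - Im (cnj w - \<i>) = Im w + 1 + W (Re w)" by simp
  moreover have "cmod (deriv (deriv h) w) = cmod (deriv (deriv (swp h)) (cnj w - \<i>))" using swp_derivs(3)[OF w] by simp
  ultimately show ?thesis by metis
 qed
 then show ?thesis using hc by (auto simp: distrib_left intro: order_trans add_increasing add_increasing2)
qed

section \<open>The free boundary problem\<close>

text \<open>Two derivatives of x / eps produce eps^(-2), which cancels the factor in K = eps^2 r0.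
  The shift a and the sign b let one statement serve both graphs.\<close>

lemma rescaled_profile_regularity:
 fixes U p S :: "real => real" and a b :: real
 assumes eps: "0 < eps" and U: "\<And>x. (U has_real_derivative p x) (at x)"
  and p: "\<And>X. \<bar>X\<bar> <= 1/eps ==> (p has_real_derivative S X) (at X within {-(1/eps)..1/eps})"
  and S: "\<And>X. \<bar>X\<bar> <= 1/eps ==> \<bar>S X\<bar> <= eps\<^sup>2 * r0"
  and hol: "\<And>beta. 0 < beta ==> beta < 1 ==> \<exists>C\<ge>0. \<forall>x y. \<bar>x\<bar> <= 1/eps --> \<bar>y\<bar> <= 1/eps --> \<bar>S x - S y\<bar> <= C * \<bar>x - y\<bar> powr beta"
  and b: "\<bar>b\<bar> = 1" and alpha: "0 <= alpha" "alpha < 1"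
 defines "f \<equiv> (\<lambda>x. a + b * U (x / eps))"
 shows "x \<in> {-1..1} ==> D1 f x = b * p (x / eps) / eps" "x \<in> {-1..1} ==> D2 f x = b * S (x / eps) / eps\<^sup>2"
  "C2alpha_I alpha f" "x \<in> {-1..1} ==> \<bar>D2 f x\<bar> <= r0"
proof -
 have xe: "\<bar>x / eps\<bar> <= 1/eps" if "x \<in> {-1..1}" for x using that eps by (auto simp: divide_right_mono)
 have f1: "(f has_vector_derivative b * p (x / eps) / eps) (at x within {-1..1})" for x
 proof -
  have "((\<lambda>x. x / eps) has_real_derivative 1 / eps) (at x)" using eps by (auto intro!: derivative_eq_intros)
  from DERIV_chain2[OF U this] have "(f has_real_derivative b * p (x / eps) / eps) (at x)" unfolding f_def by (auto intro!: derivative_eq_intros)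
  then show ?thesis by (simp add: has_real_derivative_iff_has_vector_derivative has_vector_derivative_at_within)
 qed
 show d1: "D1 f x = b * p (x / eps) / eps" if "x \<in> {-1..1}" for x
  unfolding D1_def by (rule vector_derivative_within_closed_interval[OF _ that f1]) simp
 have f2: "(D1 f has_vector_derivative b * S (x / eps) / eps\<^sup>2) (at x within {-1..1})" if x: "x \<in> {-1..1}" for x
 proof (rule has_vector_derivative_transform[OF x d1])
  have g: "((\<lambda>x. x / eps) has_real_derivative 1 / eps) (at x within {-1..1})" using eps by (auto intro!: derivative_eq_intros)
  have im: "(\<lambda>x. x / eps) ` {-1..1} \<subseteq> {-(1/eps)..1/eps}"
  proof (rule image_subsetI)
   fix y :: real assume "y \<in> {-1..1}"
   from xe[OF this] show "y / eps \<in> {-(1/eps)..1/eps}" unfolding abs_le_iff atLeastAtMost_iff by linarith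
  qed
  have "(p has_real_derivative S (x / eps)) (at (x / eps) within (\<lambda>x. x / eps) ` {-1..1})" using p[OF xe[OF x]] im by (rule DERIV_subset)
  from DERIV_image_chain[OF this g] have "((\<lambda>x. p (x / eps)) has_real_derivative S (x / eps) * (1 / eps)) (at x within {-1..1})" by (simp add: o_def)
  then have "((\<lambda>x. b * p (x / eps) / eps) has_real_derivative b * S (x / eps) / eps\<^sup>2) (at x within {-1..1})"
   using eps by (auto intro!: derivative_eq_intros simp: power2_eq_square)
  then show "((\<lambda>x. b * p (x / eps) / eps) has_vector_derivative b * S (x / eps) / eps\<^sup>2) (at x within {-1..1})"
   by (simp add: has_real_derivative_iff_has_vector_derivative)
 qed
 show d2: "D2 f x = b * S (x / eps) / eps\<^sup>2" if "x \<in> {-1..1}" for x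
  unfolding D2_def by (subst D1_def) (rule vector_derivative_within_closed_interval[OF _ that f2[OF that]], simp)
 show d2b: "\<bar>D2 f x\<bar> <= r0" if "x \<in> {-1..1}" for x
  using S[OF xe[OF that]] eps b unfolding d2[OF that] abs_divide abs_mult b by (simp add: divide_le_eq mult.commute)
 have hold: "\<exists>C. \<forall>x\<in>{-1..1}. \<forall>y\<in>{-1..1}. \<bar>D2 f x - D2 f y\<bar> <= C * \<bar>x - y\<bar> powr beta" if beta: "0 < beta" "beta < 1" for beta
 proof -
  obtain C where C: "C >= 0" "\<And>x y. \<bar>x\<bar> <= 1/eps ==> \<bar>y\<bar> <= 1/eps ==> \<bar>S x - S y\<bar> <= C * \<bar>x - y\<bar> powr beta" using hol[OF beta] by blast
  show ?thesis
  proof (intro exI[of _ "C * (1/eps) powr beta / eps\<^sup>2"] ballI)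
   fix x y :: real assume xy: "x \<in> {-1..1}" "y \<in> {-1..1}"
   have "D2 f x - D2 f y = b * (S (x / eps) - S (y / eps)) / eps\<^sup>2" using d2[OF xy(1)] d2[OF xy(2)] by (simp add: diff_divide_distrib right_diff_distrib)
   then have "\<bar>D2 f x - D2 f y\<bar> = \<bar>S (x / eps) - S (y / eps)\<bar> / eps\<^sup>2" by (simp add: abs_mult b)
   also have "\<dots> <= C * \<bar>x / eps - y / eps\<bar> powr beta / eps\<^sup>2" using C(2)[OF xe[OF xy(1)] xe[OF xy(2)]] by (intro divide_right_mono) auto
   also have "\<bar>x / eps - y / eps\<bar> = 1/eps * \<bar>x - y\<bar>" using eps by (simp add: diff_divide_distrib[symmetric])
   also have "(1/eps * \<bar>x - y\<bar>) powr beta = (1/eps) powr beta * \<bar>x - y\<bar> powr beta" using eps by (intro powr_mult)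
   finally show "\<bar>D2 f x - D2 f y\<bar> <= C * (1/eps) powr beta / eps\<^sup>2 * \<bar>x - y\<bar> powr beta" by simp
  qed
 qed
 show "C2alpha_I alpha f" unfolding C2alpha_I_def
 proof (intro conjI ballI)
  fix x :: real assume x: "x \<in> {-1..1}"
  show "f differentiable (at x within {-1..1})" "D1 f differentiable (at x within {-1..1})"
   using f1 f2[OF x] unfolding has_vector_derivative_def differentiable_def by blast+
 next
  obtain C where C: "\<forall>x\<in>{-1..1}. \<forall>y\<in>{-1..1}. \<bar>D2 f x - D2 f y\<bar> <= C * \<bar>x - y\<bar> powr (1/2)" using hold[of "1/2"] by auto
  show "continuous_on {-1..1} (D2 f)" unfolding continuous_on_def
   by (intro ballI tendsto_of_holder_bound[where beta = "1/2" and r = 1 and C = C]) (use C in \<open>auto simp: dist_real_def\<close>)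
  show "\<exists>C. \<forall>x\<in>{-1..1}. \<forall>y\<in>{-1..1}. \<bar>D2 f x - D2 f y\<bar> <= C * \<bar>x - y\<bar> powr alpha"
  proof (cases "alpha = 0")
   \<comment> \<open>Exponent 0 is outside the range of \<open>hold\<close> and amounts to
     boundedness. The case x = y is separate because \<open>0 powr 0\<close> is 0.\<close>
   case True
   show ?thesis
   proof (intro exI[of _ "2 * r0"] ballI)
    fix x y :: real assume xy: "x \<in> {-1..1}" "y \<in> {-1..1}"
    show "\<bar>D2 f x - D2 f y\<bar> <= 2 * r0 * \<bar>x - y\<bar> powr alpha"
     using d2b[OF xy(1)] d2b[OF xy(2)] True by (cases "x = y") auto
   qed
  qed (use hold alpha in auto)
 qed
qed

text \<open>The equations for the slopes are still truncated here; the bound r0 / 270 on lam and mu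
  is what later removes the minimum.\<close>

locale solution = potential "1/eps" "eps\<^sup>2 * r0" U p W q h for eps r0 U p W q h +
 fixes lam mu :: real
 assumes eps: "0 < eps" "eps < 1" and r0: "0 < r0" "r0 < 2/3"
  and lam: "0 < lam" "lam <= r0 / 270" and mu: "0 < mu" "mu <= r0 / 270"
  and p_deriv: "\<bar>X\<bar> <= 1/eps ==> (p has_real_derivative min (eps\<^sup>2 * r0) (eps\<^sup>2 * lam * (cmod (top_trace (1/eps) U W (deriv h) \<bar>X\<bar>))\<^sup>2)) (at X within {-(1/eps)..1/eps})"
  and q_deriv: "\<bar>X\<bar> <= 1/eps ==> (q has_real_derivative min (eps\<^sup>2 * r0) (eps\<^sup>2 * mu * (cmod (top_trace (1/eps) W U (deriv (swp h)) \<bar>X\<bar>))\<^sup>2)) (at X within {-(1/eps)..1/eps})"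
begin

abbreviation "S1 \<equiv> \<lambda>X. min (eps\<^sup>2 * r0) (eps\<^sup>2 * lam * (cmod (top_trace (1/eps) U W (deriv h) \<bar>X\<bar>))\<^sup>2)"
abbreviation "S2 \<equiv> \<lambda>X. min (eps\<^sup>2 * r0) (eps\<^sup>2 * mu * (cmod (top_trace (1/eps) W U (deriv (swp h)) \<bar>X\<bar>))\<^sup>2)"

sublocale swapped: potential "1/eps" "eps\<^sup>2 * r0" W q U p "swp h"
 by (rule potential_swap) unfold_locales

lemma smooth_top: "smooth_potential (1/eps) (eps\<^sup>2 * r0) U p W q h S1"
 by (rule smooth_potentialI) (use lam p_deriv in auto)

lemma smooth_bottom: "smooth_potential (1/eps) (eps\<^sup>2 * r0) W q U p (swp h) S2"
 by (rule swapped.smooth_potentialI) (use mu q_deriv in auto)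

text \<open>The redundant \<open>0 + 1 *\<close> gives u the form a + b * U (x / eps) that is shared
  with the lower graph.\<close>

definition u where "u x = 0 + 1 * U (x / eps)"
definition v where "v x = - 1 + (- 1) * W (x / eps)"

abbreviation "\<Omega> \<equiv> Omega u v"

text \<open>Off the open set the datum itself is used, so the boundary condition holds by definition
  and the work lies in continuity up to the closure.\<close>

definition phi where
 "phi P = (if P \<in> \<Omega> then Re (h (emb eps P)) else (snd P - v (fst P)) / (u (fst P) - v (fst P)))"

lemma abs_scaled: "\<bar>x / eps\<bar> < 1/eps \<longleftrightarrow> \<bar>x\<bar> < 1" "\<bar>x / eps\<bar> <= 1/eps \<longleftrightarrow> \<bar>x\<bar> <= 1"
 using eps by (auto simp: abs_divide divide_less_cancel divide_le_cancel)

lemma Omega_iff: "P \<in> \<Omega> \<longleftrightarrow> emb eps P \<in> D"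
proof -
 have "- 1 < fst P & fst P < 1 \<longleftrightarrow> \<bar>fst P / eps\<bar> < 1/eps" unfolding abs_scaled by auto
 then show ?thesis by (cases P) (auto simp: Omega_def cellD_def u_def v_def simp del: abs_divide)
qed

lemma emb_cont: "isCont (emb eps) P"
 using bounded_linear_emb by (rule linear_continuous_at)

lemma open_Omega: "open \<Omega>"
proof -
 have "\<Omega> = emb eps -` D" using Omega_iff by auto
 then show ?thesis using open_vimage[OF open_D, of "emb eps"] emb_cont by (simp add: continuous_at_imp_continuous_on)
qed

lemma u_cont: "isCont u x" and v_cont: "isCont v x"
proof -
 have "isCont (\<lambda>x. U (x / eps)) x" by (rule isCont_o2[OF _ U_cont]) (use eps in \<open>auto intro!: continuous_intros\<close>)
 moreover have "isCont (\<lambda>x. W (x / eps)) x" by (rule isCont_o2[OF _ bot.U_cont]) (use eps in \<open>auto intro!: continuous_intros\<close>)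
 ultimately show "isCont u x" "isCont v x" unfolding u_def v_def by (auto intro!: continuous_intros)
qed

lemma uv_gap: "\<bar>x\<bar> <= 1 ==> u x - v x >= 1/3"
 using gap[of "x / eps"] unfolding abs_scaled by (simp add: u_def v_def)

lemma closure_Omega: assumes "P \<in> closure \<Omega>" shows "\<bar>fst P\<bar> <= 1" "v (fst P) <= snd P" "snd P <= u (fst P)"
proof -
 have "emb eps ` closure \<Omega> \<subseteq> closure D"
  by (rule image_closure_subset) (auto simp: Omega_iff continuous_at_imp_continuous_on emb_cont intro: subsetD[OF closure_subset])
 then have "emb eps P \<in> closure D" using assms by auto
 then have "\<bar>fst P / eps\<bar> <= 1/eps" "- 1 - W (fst P / eps) <= snd P" "snd P <= U (fst P / eps)" using closure_D by auto
 then show "\<bar>fst P\<bar> <= 1" "v (fst P) <= snd P" "snd P <= u (fst P)" unfolding abs_scaled by (auto simp: u_def v_def)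
qed

lemma boundary_limit_point: assumes x: "\<bar>x\<bar> < 1" shows "(x, u x) islimpt \<Omega>" "(x, v x) islimpt \<Omega>"
proof -
 have g: "u x - v x >= 1/3" using uv_gap[of x] x by simp
 show "(x, u x) islimpt \<Omega>" unfolding islimpt_approachable
 proof (intro allI impI)
  fix e :: real assume e: "e > 0"
  show "\<exists>P\<in>\<Omega>. P \<noteq> (x, u x) & dist P (x, u x) < e"
   using e x g by (intro bexI[of _ "(x, u x - min (e/2) (1/6))"]) (auto simp: Omega_def dist_Pair_Pair dist_real_def min_def)
 qed
 show "(x, v x) islimpt \<Omega>" unfolding islimpt_approachable
 proof (intro allI impI)
  fix e :: real assume e: "e > 0"
  show "\<exists>P\<in>\<Omega>. P \<noteq> (x, v x) & dist P (x, v x) < e"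
   using e x g by (intro bexI[of _ "(x, v x + min (e/2) (1/6))"]) (auto simp: Omega_def dist_Pair_Pair dist_real_def min_def)
 qed
qed

lemma filterlim_emb: assumes "P \<notin> \<Omega>" shows "filterlim (emb eps) (at (emb eps P) within D) (at P within \<Omega>)"
 unfolding filterlim_at
proof (intro conjI)
 show "\<forall>\<^sub>F x in at P within \<Omega>. emb eps x \<in> D & emb eps x \<noteq> emb eps P"
  unfolding eventually_at_filter by (rule always_eventually) (use assms Omega_iff in metis)
 show "(emb eps \<longlongrightarrow> emb eps P) (at P within \<Omega>)" using emb_cont isContD tendsto_within_subset by blast
qed

lemma pd_phi:
 assumes "P \<in> \<Omega>"
 shows "pd ds phi P = Re (prod_list (map (dirn eps) ds) * (deriv ^^ length ds) h (emb eps P))" "pd ds phi differentiable (at P)"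
 using pd_Re_holomorphic[OF open_Omega open_D H(1) _ _ assms, of eps phi ds] by (auto simp: Omega_iff phi_def)

lemma bpdir_phi:
 assumes P: "P \<notin> \<Omega>" "P islimpt \<Omega>" and lim: "(deriv h \<longlongrightarrow> l) (at (emb eps P) within D)"
 shows "bpdir d \<Omega> phi P = Re (dirn eps d * l)"
proof -
 have "((\<lambda>p. Re (dirn eps d * deriv h (emb eps p))) \<longlongrightarrow> Re (dirn eps d * l)) (at P within \<Omega>)"
  by (intro tendsto_intros filterlim_compose[OF lim filterlim_emb[OF P(1)]])
 then have "(pdir d phi \<longlongrightarrow> Re (dirn eps d * l)) (at P within \<Omega>)"
  by (rule Lim_transform_eventually) (use pd_phi(1)[of _ "[d]"] in \<open>auto simp: eventually_at_filter intro!: always_eventually\<close>)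
 then show ?thesis unfolding bpdir_def using P(2) by (intro tendsto_Lim) (auto simp: trivial_limit_within)
qed

lemma gradient_norm: "(eps * Re (dirn eps True * l))\<^sup>2 + (Re (dirn eps False * l))\<^sup>2 = (cmod l)\<^sup>2"
 using eps by (simp add: dirn_def cmod_power2)

text \<open>The minimum in \<open>S1\<close> is attained by its second argument, since lam * |T|^2
  <= r0 / 270 * 270. After division by eps^2 the rescaled gradient is |T|.\<close>

lemma top_gradient:
 assumes x: "\<bar>x\<bar> < 1"
 shows "S1 (x / eps) / eps\<^sup>2 = lam * ((eps * bpdir True \<Omega> phi (x, u x))\<^sup>2 + (bpdir False \<Omega> phi (x, u x))\<^sup>2)"
proof -
 define X where "X = x / eps"
 have X: "\<bar>X\<bar> < 1/eps" using x unfolding X_def abs_scaled .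
 have nin: "(x, u x) \<notin> \<Omega>" by (simp add: Omega_def)
 have "(deriv h \<longlongrightarrow> T X) (at (emb eps (x, u x)) within D)" using T_tendsto[of X] X by (simp add: emb_def u_def X_def)
 note b = bpdir_phi[OF nin boundary_limit_point(1)[OF x] this]
 have "cmod (T \<bar>X\<bar>) = cmod (T X)" using T_even[of X] X by (cases "X >= 0") auto
 moreover have "eps\<^sup>2 * lam * (cmod (T X))\<^sup>2 <= eps\<^sup>2 * r0"
 proof -
  have "lam * (cmod (T X))\<^sup>2 <= r0 / 270 * 270" using lam r0 T_norm[OF X] by (intro mult_mono) auto
  then show ?thesis using eps by simp
 qed
 ultimately have "S1 X = eps\<^sup>2 * lam * (cmod (T X))\<^sup>2" by simp
 then show ?thesis unfolding b gradient_norm X_def[symmetric] using eps by simp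
qed

lemma bottom_limit:
 assumes X: "\<bar>X\<bar> <= 1/eps"
 shows "(deriv h \<longlongrightarrow> 0 - cnj (swapped.T X)) (at (Complex X (- 1 - W X)) within D)"
proof -
 have fl: "filterlim (\<lambda>w. cnj w - \<i>) (at (Complex X (W X)) within cellD (1/eps) W U) (at (Complex X (- 1 - W X)) within D)"
  unfolding filterlim_at
 proof (intro conjI)
  have "cnj w - \<i> \<in> cellD (1/eps) W U & cnj w - \<i> \<noteq> Complex X (W X)" if "w \<in> D" for w
   using that cellD_swap[of w "1/eps" W U] by (auto simp: cellD_def complex_eq_iff)
  then show "\<forall>\<^sub>F w in at (Complex X (- 1 - W X)) within D. cnj w - \<i> \<in> cellD (1/eps) W U & cnj w - \<i> \<noteq> Complex X (W X)"
   unfolding eventually_at_filter by (auto intro: always_eventually)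
  have "((\<lambda>w. cnj w - \<i>) \<longlongrightarrow> cnj (Complex X (- 1 - W X)) - \<i>) (at (Complex X (- 1 - W X)) within D)" by (intro tendsto_intros)
  also have "cnj (Complex X (- 1 - W X)) - \<i> = Complex X (W X)" by (simp add: complex_eq_iff)
  finally show "((\<lambda>w. cnj w - \<i>) \<longlongrightarrow> Complex X (W X)) (at (Complex X (- 1 - W X)) within D)" .
 qed
 have "((\<lambda>w. 0 - cnj (deriv (swp h) (cnj w - \<i>))) \<longlongrightarrow> 0 - cnj (swapped.T X)) (at (Complex X (- 1 - W X)) within D)"
  by (intro tendsto_intros filterlim_compose[OF swapped.T_tendsto[OF X] fl])
 then show ?thesis
  by (rule Lim_transform_eventually) (use swp_derivs(2) in \<open>auto simp: eventually_at_filter intro!: always_eventually\<close>)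
qed

lemma bottom_gradient:
 assumes x: "\<bar>x\<bar> < 1"
 shows "S2 (x / eps) / eps\<^sup>2 = mu * ((eps * bpdir True \<Omega> phi (x, v x))\<^sup>2 + (bpdir False \<Omega> phi (x, v x))\<^sup>2)"
proof -
 define X where "X = x / eps"
 have X: "\<bar>X\<bar> < 1/eps" using x unfolding X_def abs_scaled .
 have nin: "(x, v x) \<notin> \<Omega>" by (simp add: Omega_def)
 have "(deriv h \<longlongrightarrow> 0 - cnj (swapped.T X)) (at (emb eps (x, v x)) within D)" using bottom_limit[of X] X by (simp add: emb_def v_def X_def)
 note b = bpdir_phi[OF nin boundary_limit_point(2)[OF x] this]
 have "cmod (swapped.T \<bar>X\<bar>) = cmod (swapped.T X)" using swapped.T_even[of X] X by (cases "X >= 0") auto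
 moreover have "eps\<^sup>2 * mu * (cmod (swapped.T X))\<^sup>2 <= eps\<^sup>2 * r0"
 proof -
  have "mu * (cmod (swapped.T X))\<^sup>2 <= r0 / 270 * 270" using mu r0 swapped.T_norm[OF X] by (intro mult_mono) auto
  then show ?thesis using eps by simp
 qed
 ultimately have "S2 X = eps\<^sup>2 * mu * (cmod (swapped.T X))\<^sup>2" by simp
 then show ?thesis unfolding b gradient_norm X_def[symmetric] using eps by simp
qed

lemma u_eq: "u = (\<lambda>x. 0 + 1 * U (x / eps))" and v_eq: "v = (\<lambda>x. - 1 + (- 1) * W (x / eps))"
 by (auto simp: u_def v_def)

lemma S_hyps:
 "\<bar>X\<bar> <= 1/eps ==> \<bar>S1 X\<bar> <= eps\<^sup>2 * r0" "\<bar>X\<bar> <= 1/eps ==> \<bar>S2 X\<bar> <= eps\<^sup>2 * r0"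
 "0 < beta ==> beta < 1 ==> \<exists>C\<ge>0. \<forall>x y. \<bar>x\<bar> <= 1/eps --> \<bar>y\<bar> <= 1/eps --> \<bar>S1 x - S1 y\<bar> <= C * \<bar>x - y\<bar> powr beta"
 "0 < beta ==> beta < 1 ==> \<exists>C\<ge>0. \<forall>x y. \<bar>x\<bar> <= 1/eps --> \<bar>y\<bar> <= 1/eps --> \<bar>S2 x - S2 y\<bar> <= C * \<bar>x - y\<bar> powr beta"
proof -
 have c: "0 <= eps\<^sup>2 * lam" "0 <= eps\<^sup>2 * mu" using lam mu by auto
 show "\<bar>X\<bar> <= 1/eps ==> \<bar>S1 X\<bar> <= eps\<^sup>2 * r0" "\<bar>X\<bar> <= 1/eps ==> \<bar>S2 X\<bar> <= eps\<^sup>2 * r0"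
  using smooth_potential.S_bound[OF smooth_top] smooth_potential.S_bound[OF smooth_bottom] by auto
 show "0 < beta ==> beta < 1 ==> \<exists>C\<ge>0. \<forall>x y. \<bar>x\<bar> <= 1/eps --> \<bar>y\<bar> <= 1/eps --> \<bar>S1 x - S1 y\<bar> <= C * \<bar>x - y\<bar> powr beta"
  by (rule boundary_gradient_holder[OF _ _ c(1)])
 show "0 < beta ==> beta < 1 ==> \<exists>C\<ge>0. \<forall>x y. \<bar>x\<bar> <= 1/eps --> \<bar>y\<bar> <= 1/eps --> \<bar>S2 x - S2 y\<bar> <= C * \<bar>x - y\<bar> powr beta"
  by (rule swapped.boundary_gradient_holder[OF _ _ c(2)])
qed

lemma u_regularity:
 assumes "0 <= alpha" "alpha < 1"
 shows "x \<in> {-1..1} ==> D1 u x = p (x / eps) / eps" "x \<in> {-1..1} ==> D2 u x = S1 (x / eps) / eps\<^sup>2"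
  "C2alpha_I alpha u" "x \<in> {-1..1} ==> \<bar>D2 u x\<bar> <= r0"
 using rescaled_profile_regularity[OF eps(1) U_deriv p_deriv S_hyps(1) S_hyps(3) abs_one assms, where a = 0] unfolding u_eq by auto

lemma v_regularity:
 assumes "0 <= alpha" "alpha < 1"
 shows "x \<in> {-1..1} ==> D1 v x = - q (x / eps) / eps" "x \<in> {-1..1} ==> D2 v x = - (S2 (x / eps) / eps\<^sup>2)"
  "C2alpha_I alpha v" "x \<in> {-1..1} ==> \<bar>D2 v x\<bar> <= r0"
proof -
 have b: "\<bar>- 1\<bar> = (1::real)" by simp
 note R = rescaled_profile_regularity[OF eps(1) bot.U_deriv q_deriv S_hyps(2) S_hyps(4) b assms, where a = "- 1", folded v_eq]
 show "x \<in> {-1..1} ==> D1 v x = - q (x / eps) / eps" "x \<in> {-1..1} ==> D2 v x = - (S2 (x / eps) / eps\<^sup>2)"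
  "C2alpha_I alpha v" "x \<in> {-1..1} ==> \<bar>D2 v x\<bar> <= r0"
  using R by auto
qed

text \<open>In the original variable the parabola K / 2 * (L^2 - X^2) becomes r0 / 2 * (1 - x^2),
  which is free of eps.\<close>

lemma profile_bounds: assumes x: "\<bar>x\<bar> <= 1" shows "u x <= 0" "u x >= - r0 / 2" "v x >= - 1" "v x <= - 1 + r0 / 2"
 "\<bar>p (x / eps) / eps\<bar> <= r0" "\<bar>q (x / eps) / eps\<bar> <= r0"
proof -
 have X: "\<bar>x / eps\<bar> <= 1/eps" using x unfolding abs_scaled .
 show "u x <= 0" "v x >= - 1" using U_nonpos[OF X] bot.U_nonpos[OF X] by (auto simp: u_def v_def)
 have e: "(eps\<^sup>2 * r0) / 2 * ((1/eps)\<^sup>2 - (x/eps)\<^sup>2) = r0 / 2 * (1 - x\<^sup>2)" using eps by (simp add: power_divide field_simps)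
 have "r0 / 2 * (1 - x\<^sup>2) <= r0 / 2 * 1" using r0 by (intro mult_left_mono) auto
 then show "u x >= - r0 / 2" "v x <= - 1 + r0 / 2" using U_lower[OF X] bot.U_lower[OF X] unfolding minus_mult_left[symmetric] e by (auto simp: u_def v_def)
 have "eps\<^sup>2 * r0 * \<bar>x / eps\<bar> <= eps\<^sup>2 * r0 * (1 / eps)" using X r0 by (intro mult_left_mono) auto
 also have "\<dots> = r0 * eps" using eps by (simp add: power2_eq_square)
 finally have "\<bar>p (x / eps)\<bar> <= r0 * eps" "\<bar>q (x / eps)\<bar> <= r0 * eps"
  using p_bound[of "x / eps"] bot.p_bound[of "x / eps"] by linarith+
 then show "\<bar>p (x / eps) / eps\<bar> <= r0" "\<bar>q (x / eps) / eps\<bar> <= r0"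
  using eps by (auto simp: pos_divide_le_eq)
qed

end

section \<open>Continuity and regularity of the potential in the original variables\<close>

context solution
begin

text \<open>At a graph both functions approach the same value, at the rates 27/2 and 3, whose sum is
  below 17. At a vertical side both approach Im w + 1.\<close>

lemma phi_minus_ramp:
 assumes P: "P \<in> \<Omega>"
 defines "f \<equiv> (snd P - v (fst P)) / (u (fst P) - v (fst P))"
 shows "\<bar>phi P - f\<bar> <= 17 * \<bar>u (fst P) - snd P\<bar>" "\<bar>phi P - f\<bar> <= 17 * \<bar>snd P - v (fst P)\<bar>"
  "\<bar>phi P - f\<bar> <= 2 * (1/eps - \<bar>fst P / eps\<bar>) + 1 / (1/eps)\<^sup>2 * ((1/eps)\<^sup>2 - (fst P / eps)\<^sup>2)"
proof -
 define w where "w = emb eps P"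
 have w: "w \<in> D" using P by (simp add: w_def Omega_iff)
 have wr: "Re w = fst P / eps" "Im w = snd P" by (auto simp: w_def)
 have f: "f = ramp w" by (simp add: f_def ramp_def u_def v_def wr algebra_simps)
 have phi: "phi P = Re (h w)" using P by (simp add: phi_def w_def)
 have a: "u (fst P) - snd P = U (Re w) - Im w" "snd P - v (fst P) = Im w + 1 + W (Re w)" by (auto simp: u_def v_def wr)
 have g: "U (Re w) + 1 + W (Re w) >= 1/3" using gap[of "Re w"] in_D(1)[OF w] by simp
 have pos: "0 < U (Re w) - Im w" "0 < Im w + 1 + W (Re w)" using in_D[OF w] by auto
 have r0': "0 <= ramp w" "ramp w <= 1" using g pos by (auto simp: ramp_def divide_le_eq)
 have "ramp w <= (Im w + 1 + W (Re w)) / (1/3)" unfolding ramp_def using g pos by (intro divide_left_mono) auto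
 then have r3: "ramp w <= 3 * (Im w + 1 + W (Re w))" by simp
 show "\<bar>phi P - f\<bar> <= 17 * \<bar>u (fst P) - snd P\<bar>" unfolding f phi a
  using H(3,4)[OF w] ramp_top[OF w] r0' pos by argo
 show "\<bar>phi P - f\<bar> <= 17 * \<bar>snd P - v (fst P)\<bar>" unfolding f phi a
  using H(2,5)[OF w] r3 r0' pos by argo
 show "\<bar>phi P - f\<bar> <= 2 * (1/eps - \<bar>fst P / eps\<bar>) + 1 / (1/eps)\<^sup>2 * ((1/eps)\<^sup>2 - (fst P / eps)\<^sup>2)"
  using H(6)[OF w] ramp_side[OF w] unfolding f phi wr by linarith
qed

text \<open>The datum is continuous on the closure. Its difference from phi is dominated by a
  continuous function that vanishes at the frontier point in question.\<close>

lemma phi_continuous: "continuous_on (closure \<Omega>) phi"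
 unfolding continuous_on_def
proof
 fix P assume P: "P \<in> closure \<Omega>"
 define f where "f P = (snd P - v (fst P)) / (u (fst P) - v (fst P))" for P
 show "(phi \<longlongrightarrow> phi P) (at P within closure \<Omega>)"
 proof (cases "P \<in> \<Omega>")
  case True
  then have "phi differentiable (at P)" using pd_phi(2)[of P "[]"] by simp
  then have "isCont phi P" by (rule differentiable_imp_continuous_within)
  then show ?thesis using isContD tendsto_within_subset by blast
 next
  case False
  have c: "isCont (\<lambda>P. u (fst P)) P" "isCont (\<lambda>P. v (fst P)) P"
   by (rule isCont_o2[OF _ u_cont] isCont_o2[OF _ v_cont], intro continuous_intros)+
  have "u (fst P) - v (fst P) \<noteq> 0" using uv_gap[OF closure_Omega(1)[OF P]] by simp
  then have fc: "isCont f P" unfolding f_def by (auto intro!: continuous_intros c)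
  have null: "((\<lambda>Q. phi Q - f Q) \<longlongrightarrow> 0) (at P within closure \<Omega>)" if e: "isCont e P" "e P = 0" "\<And>Q. Q \<in> \<Omega> ==> \<bar>phi Q - f Q\<bar> <= \<bar>e Q\<bar>" for e :: "real \<times> real => real"
  proof (rule Lim_null_comparison)
   have "\<bar>phi Q - f Q\<bar> <= \<bar>e Q\<bar>" for Q using e(3)[of Q] by (cases "Q \<in> \<Omega>") (auto simp: phi_def f_def)
   then show "\<forall>\<^sub>F Q in at P within closure \<Omega>. norm (phi Q - f Q) <= \<bar>e Q\<bar>" by simp
   have "((\<lambda>Q. \<bar>e Q\<bar>) \<longlongrightarrow> \<bar>e P\<bar>) (at P)" using e(1) by (intro tendsto_rabs) (simp add: isContD)
   then show "((\<lambda>Q. \<bar>e Q\<bar>) \<longlongrightarrow> 0) (at P within closure \<Omega>)" using e(2) tendsto_within_subset by fastforce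
  qed
  have "snd P = u (fst P) \<or> snd P = v (fst P) \<or> \<bar>fst P\<bar> = 1"
   using False closure_Omega[OF P] by (cases P) (auto simp: Omega_def abs_le_iff abs_if)
  then have "((\<lambda>Q. phi Q - f Q) \<longlongrightarrow> 0) (at P within closure \<Omega>)"
  proof (elim disjE)
   assume "snd P = u (fst P)"
   then show ?thesis
   proof (intro null[where e = "\<lambda>Q. 17 * (u (fst Q) - snd Q)"])
    show "\<bar>phi Q - f Q\<bar> <= \<bar>17 * (u (fst Q) - snd Q)\<bar>" if "Q \<in> \<Omega>" for Q using phi_minus_ramp(1)[OF that] unfolding f_def abs_mult by simp
   qed (auto intro!: continuous_intros c)
  next
   assume "snd P = v (fst P)"
   then show ?thesis
   proof (intro null[where e = "\<lambda>Q. 17 * (snd Q - v (fst Q))"])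
    show "\<bar>phi Q - f Q\<bar> <= \<bar>17 * (snd Q - v (fst Q))\<bar>" if "Q \<in> \<Omega>" for Q using phi_minus_ramp(2)[OF that] unfolding f_def abs_mult by simp
   qed (auto intro!: continuous_intros c)
  next
   assume x1: "\<bar>fst P\<bar> = 1"
   define e where "e Q = 2 * (1/eps - \<bar>fst Q / eps\<bar>) + 1 / (1/eps)\<^sup>2 * ((1/eps)\<^sup>2 - (fst Q / eps)\<^sup>2)" for Q :: "real \<times> real"
   show ?thesis
   proof (rule null[where e = e])
    show "isCont e P" unfolding e_def using eps by (auto intro!: continuous_intros)
    have "\<bar>fst P / eps\<bar> = 1/eps" using x1 eps by (simp add: abs_divide)
    moreover have "(fst P / eps)\<^sup>2 = (1/eps)\<^sup>2" using x1 by (simp add: power_divide) (metis one_power2 power2_abs)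
    ultimately show "e P = 0" unfolding e_def by simp
    show "\<bar>phi Q - f Q\<bar> <= \<bar>e Q\<bar>" if "Q \<in> \<Omega>" for Q
     using order_trans[OF phi_minus_ramp(3)[OF that] abs_ge_self] unfolding f_def e_def .
   qed
  qed
  from tendsto_add[OF this isContD[OF fc, THEN tendsto_within_subset[OF _ subset_UNIV]]]
  have "(phi \<longlongrightarrow> f P) (at P within closure \<Omega>)" by simp
  moreover have "phi P = f P" using False by (simp add: phi_def f_def)
  ultimately show ?thesis by simp
 qed
qed

lemma pd_phi_continuous: "continuous_on \<Omega> (pd ds phi)"
 using pd_phi(2) by (intro continuous_at_imp_continuous_on) (auto intro: differentiable_imp_continuous_within)

text \<open>With beta = 3/4 the square of d^(beta - 1) is d^(-1/2), which is integrable across the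
  graphs. Derivatives of order 0 and 1 are bounded and covered by the summand 1.\<close>

lemma pd_phi_square_bound:
 assumes "length ds <= 2"
 shows "\<exists>M\<ge>0. \<forall>P\<in>\<Omega>. (pd ds phi P)\<^sup>2 <= M * (1 + (1 * (u (fst P) - snd P)) powr (-1/2) + (- 1 * (v (fst P) - snd P)) powr (-1/2))"
proof -
 define c where "c = cmod (prod_list (map (dirn eps) ds))"
 define Hc where "Hc = hess_const (1/eps) (eps\<^sup>2 * r0) (3/4)"
 have Hc: "Hc >= 0" unfolding Hc_def by (rule hess_const_nonneg) auto
 define M where "M = 1 + (c * 432)\<^sup>2 + 2 * (c * Hc)\<^sup>2"
 have M: "1 <= M" "(c * 432)\<^sup>2 <= M" "2 * (c * Hc)\<^sup>2 <= M" by (auto simp: M_def)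
 show ?thesis
 proof (intro exI[of _ M] conjI ballI)
  show "0 <= M" using M by simp
  fix P assume P: "P \<in> \<Omega>"
  define a where "a = u (fst P) - snd P"
  define b where "b = snd P - v (fst P)"
  have w: "emb eps P \<in> D" using P by (simp add: Omega_iff)
  have ab: "a > 0" "b > 0" using P by (cases P; auto simp: Omega_def a_def b_def)+
  have ge: "M * 1 <= M * (1 + a powr (-1/2) + b powr (-1/2))" using M by (intro mult_left_mono) auto
  have "(pd ds phi P)\<^sup>2 <= M * (1 + a powr (-1/2) + b powr (-1/2))"
   using le_2_cases[OF assms]
  proof (elim disjE)
   assume "length ds = 0"
   then have "pd ds phi P = Re (h (emb eps P))" using P by (simp add: phi_def)
   then have "(pd ds phi P)\<^sup>2 <= 1" using H(2,3)[OF w] by (simp add: abs_square_le_1)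
   then show ?thesis using ge M by linarith
  next
   assume n: "length ds = 1"
   have "\<bar>pd ds phi P\<bar> <= c * cmod (deriv h (emb eps P))"
    using pd_phi(1)[OF P, of ds] abs_Re_le_cmod[of "prod_list (map (dirn eps) ds) * deriv h (emb eps P)"] n by (simp add: norm_mult c_def)
   also have "\<dots> <= c * 432" using deriv_h_bound[OF w] by (intro mult_left_mono) (auto simp: c_def)
   finally have "\<bar>pd ds phi P\<bar>\<^sup>2 <= (c * 432)\<^sup>2" by (intro power_mono) auto
   then show ?thesis using ge M(2) unfolding power2_abs by linarith
  next
   assume n: "length ds = 2"
   have "\<bar>pd ds phi P\<bar> <= c * cmod (deriv (deriv h) (emb eps P))"
    using pd_phi(1)[OF P, of ds] abs_Re_le_cmod[of "prod_list (map (dirn eps) ds) * deriv (deriv h) (emb eps P)"] n by (simp add: norm_mult c_def numeral_2_eq_2)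
   also have "\<dots> <= c * (Hc * (a powr (3/4 - 1) + b powr (3/4 - 1)))"
   proof (rule mult_left_mono)
    have e: "U (Re (emb eps P)) - Im (emb eps P) = a" "Im (emb eps P) + 1 + W (Re (emb eps P)) = b" by (auto simp: a_def b_def u_def v_def)
    have 34: "0 < (3/4::real)" "(3/4::real) < 1" by auto
    show "cmod (deriv (deriv h) (emb eps P)) <= Hc * (a powr (3/4 - 1) + b powr (3/4 - 1))"
     using deriv2_h_bound[OF 34 w] unfolding e Hc_def .
   qed (simp add: c_def)
   finally have "\<bar>pd ds phi P\<bar>\<^sup>2 <= (c * (Hc * (a powr (3/4 - 1) + b powr (3/4 - 1))))\<^sup>2" by (intro power_mono) auto
   also have "\<dots> = (c * Hc)\<^sup>2 * (a powr (3/4 - 1) + b powr (3/4 - 1))\<^sup>2" by (simp add: power_mult_distrib)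
   also have "\<dots> <= (c * Hc)\<^sup>2 * (2 * (a powr (-1/2) + b powr (-1/2)))"
   proof (rule mult_left_mono)
    have sq: "(x powr (3/4 - 1))\<^sup>2 = x powr (-1/2)" if "x > 0" for x :: real using that by (simp add: power2_eq_square powr_add[symmetric])
    have "(a powr (3/4 - 1) + b powr (3/4 - 1))\<^sup>2 <= 2 * ((a powr (3/4 - 1))\<^sup>2 + (b powr (3/4 - 1))\<^sup>2)"
     using sum_squares_bound[of "a powr (3/4 - 1)" "b powr (3/4 - 1)"] by (simp add: power2_sum)
    then show "(a powr (3/4 - 1) + b powr (3/4 - 1))\<^sup>2 <= 2 * (a powr (-1/2) + b powr (-1/2))" unfolding sq[OF ab(1)] sq[OF ab(2)] .
   qed simp
   also have "\<dots> = 2 * (c * Hc)\<^sup>2 * (a powr (-1/2) + b powr (-1/2))" by simp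
   also have "\<dots> <= M * (1 + a powr (-1/2) + b powr (-1/2))" using M by (intro mult_mono) auto
   finally show ?thesis by simp
  qed
  then show "(pd ds phi P)\<^sup>2 <= M * (1 + (1 * (u (fst P) - snd P)) powr (-1/2) + (- 1 * (v (fst P) - snd P)) powr (-1/2))"
   by (simp add: a_def b_def)
 qed
qed

lemma bounded_Omega: "bounded \<Omega>"
proof -
 have "\<Omega> \<subseteq> cbox (-1, -1) (1, 0)"
 proof
  fix P assume P: "P \<in> \<Omega>"
  then have w: "emb eps P \<in> D" by (simp add: Omega_iff)
  show "P \<in> cbox (-1, -1) (1, 0)" using P in_D(4,5)[OF w] by (cases P) (auto simp: Omega_def)
 qed
 then show ?thesis using bounded_cbox bounded_subset by blast
qed

lemma pd_phi_L2: assumes "length ds <= 2" shows "L2_on \<Omega> (pd ds phi)"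
proof -
 have Om[measurable]: "\<Omega> \<in> sets borel" using open_Omega by simp
 have m1: "(\<lambda>P. indicator \<Omega> P *\<^sub>R pd ds phi P) \<in> borel_measurable lborel"
  using borel_measurable_continuous_on_indicator[OF Om pd_phi_continuous] by simp
 have m2: "(\<lambda>P. indicator \<Omega> P *\<^sub>R (pd ds phi P)\<^sup>2) \<in> borel_measurable lborel"
  using borel_measurable_continuous_on_indicator[OF Om continuous_on_power[OF pd_phi_continuous]] by simp
 obtain M where M: "M >= 0" "\<And>P. P \<in> \<Omega> ==> (pd ds phi P)\<^sup>2 <= M * (1 + (1 * (u (fst P) - snd P)) powr (-1/2) + (- 1 * (v (fst P) - snd P)) powr (-1/2))"
  using pd_phi_square_bound[OF assms] by blast
 define G where "G w0 s P = indicator {P. \<bar>fst P\<bar> <= 1 & 0 <= s * (w0 (fst P) - snd P) & s * (w0 (fst P) - snd P) <= 1} P * (s * (w0 (fst P) - snd P)) powr (-1/2)"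
  for w0 :: "real => real" and s :: real and P :: "real \<times> real"
 have uc: "continuous_on UNIV u" "continuous_on UNIV v" using u_cont v_cont by (auto intro: continuous_at_imp_continuous_on)
 have Gi: "integrable lborel (G u 1)" "integrable lborel (G v (- 1))"
  using inverse_sqrt_integrable[OF uc(1), of 1] inverse_sqrt_integrable[OF uc(2), of "- 1"] unfolding G_def by auto
 have "integrable lborel (indicator \<Omega> :: real \<times> real => real)"
  by (rule integrable_real_indicator) (use emeasure_bounded_finite[OF bounded_Omega] in auto)
 then have I: "integrable lborel (\<lambda>P. M * (indicator \<Omega> P + G u 1 P + G v (- 1) P))" using Gi by (intro integrable_mult_right Bochner_Integration.integrable_add) auto
 have "set_integrable lborel \<Omega> (\<lambda>P. (pd ds phi P)\<^sup>2)" unfolding set_integrable_def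
 proof (rule Bochner_Integration.integrable_bound[OF I m2], rule AE_I2)
  fix P :: "real \<times> real"
  have G0: "0 <= G w0 s P" for w0 s by (simp add: G_def)
  show "norm (indicator \<Omega> P *\<^sub>R (pd ds phi P)\<^sup>2) <= norm (M * (indicator \<Omega> P + G u 1 P + G v (- 1) P))"
  proof (cases "P \<in> \<Omega>")
   case True
   have w: "emb eps P \<in> D" using True by (simp add: Omega_iff)
   have x: "\<bar>fst P\<bar> <= 1" "v (fst P) < snd P" "snd P < u (fst P)" using True by (cases P; auto simp: Omega_def)+
   have "u (fst P) - snd P <= 1" "snd P - v (fst P) <= 1" using in_D(4,5)[OF w] profile_bounds[OF x(1)] by auto
   then have "G u 1 P = (1 * (u (fst P) - snd P)) powr (-1/2)" "G v (- 1) P = (- 1 * (v (fst P) - snd P)) powr (-1/2)" using x by (auto simp: G_def)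
   then have "(pd ds phi P)\<^sup>2 <= M * (indicator \<Omega> P + G u 1 P + G v (- 1) P)" using M(2)[OF True] True by simp
   also have "\<dots> <= norm (M * (indicator \<Omega> P + G u 1 P + G v (- 1) P))" by simp
   finally show ?thesis using True by simp
  qed simp
 qed
 then show ?thesis unfolding L2_on_def set_borel_measurable_def using m1 by simp
qed

lemma phi_W22: "W22 \<Omega> phi"
 unfolding W22_def
proof (intro conjI allI impI)
 show "L2_on \<Omega> phi" using pd_phi_L2[of "[]"] by simp
 fix ds :: "bool list" assume "length ds <= 2"
 then show "\<exists>g. L2_on \<Omega> g & weak_pd \<Omega> ds phi g"
  using pd_phi_L2[of "rev ds"] weak_pd_classical[OF open_Omega pd_phi(2), of ds] by auto
qed

text \<open>The exponent beta = (1 + alpha) / 2 exceeds alpha and is positive also for alpha = 0.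
  Bounds with exponent beta give continuous extensions, and on compact sets they imply those with
  exponent alpha.\<close>

lemma phi_C2alpha:
 assumes alpha: "0 <= alpha" "alpha < 1"
 shows "C2alpha_upto alpha \<Omega> (\<Omega> \<union> Gamma u \<union> Gamma v) phi"
proof -
 define S where "S = \<Omega> \<union> Gamma u \<union> Gamma v"
 define beta where "beta = (1 + alpha) / 2"
 have beta: "0 < beta" "beta < 1" "alpha <= beta" using alpha by (auto simp: beta_def)
 have S: "\<Omega> \<subseteq> S" "S \<subseteq> closure \<Omega>"
 proof -
  show "\<Omega> \<subseteq> S" by (auto simp: S_def)
  have "Gamma u \<subseteq> closure \<Omega>" "Gamma v \<subseteq> closure \<Omega>"
   using boundary_limit_point by (auto simp: Gamma_def closure_def abs_less_iff)
  then show "S \<subseteq> closure \<Omega>" using closure_subset by (auto simp: S_def)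
 qed
 have lh: "locally_holder beta \<Omega> (pd ds phi) P" if ds: "length ds <= 2" and P: "P \<in> S" for ds P
 proof (rule locally_holder_emb[where D = D and F = "(deriv ^^ length ds) h" and c = "prod_list (map (dirn eps) ds)" and eps = eps])
  have hol: "(deriv ^^ n) h holomorphic_on D" for n using H(1) open_D by (rule holomorphic_higher_deriv)
  consider "P \<in> \<Omega>" | x where "P = (x, u x)" "\<bar>x\<bar> < 1" | x where "P = (x, v x)" "\<bar>x\<bar> < 1"
   using P by (auto simp: S_def Gamma_def abs_less_iff)
  then show "locally_holder beta D ((deriv ^^ length ds) h) (emb eps P)"
  proof cases
   case 1
   then show ?thesis using locally_holder_holomorphic[OF hol open_D, of "emb eps P" beta] beta by (simp add: Omega_iff)
  next
   case 2
   have "\<bar>x / eps\<bar> < 1/eps" using 2 unfolding abs_scaled by simp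
   from smooth_potential.locally_holder_top[OF smooth_top this ds beta(1,2)] show ?thesis by (simp add: 2 emb_def u_def)
  next
   case 3
   have "\<bar>x / eps\<bar> < 1/eps" using 3 unfolding abs_scaled by simp
   from locally_holder_bottom[OF smooth_bottom this ds beta(1,2)] show ?thesis by (simp add: 3 emb_def v_def)
  qed
 qed (use eps beta pd_phi(1) Omega_iff in auto)
 show ?thesis unfolding C2alpha_upto_def C2_on_def S_def[symmetric]
 proof (intro conjI allI impI ballI)
  show "pd ds phi differentiable (at P)" if "P \<in> \<Omega>" for ds P by (rule pd_phi(2)[OF that])
  show "continuous_on \<Omega> (pd ds phi)" for ds by (rule pd_phi_continuous)
  show "\<exists>g. continuous_on S g & (\<forall>P\<in>\<Omega>. g P = pd ds phi P)" if "length ds <= 2" for ds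
   by (rule locally_holder_extension[OF beta(1) S lh[OF that]])
 next
  fix Kc assume Kc: "compact Kc & Kc \<subseteq> S"
  have "\<forall>ds. \<exists>C. length ds = 2 --> (0 <= C & (\<forall>P\<in>Kc \<inter> \<Omega>. \<forall>Q\<in>Kc \<inter> \<Omega>. norm (pd ds phi P - pd ds phi Q) <= C * dist P Q powr alpha))"
   using locally_holder_compact[OF beta(1) alpha(1) beta(3) S lh] Kc by (metis order_refl)
  then obtain Cf where Cf: "\<And>ds. length ds = 2 ==> 0 <= Cf ds & (\<forall>P\<in>Kc \<inter> \<Omega>. \<forall>Q\<in>Kc \<inter> \<Omega>. norm (pd ds phi P - pd ds phi Q) <= Cf ds * dist P Q powr alpha)"
   unfolding choice_iff by blast
  \<comment> \<open>The definition asks for one constant for all second derivatives; there are four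
    lists, so the sum of their constants serves.\<close>
  define F where "F = {ds :: bool list. length ds = 2}"
  have F: "finite F" using finite_lists_length_eq[of "UNIV :: bool set" 2] by (simp add: F_def)
  show "\<exists>C. \<forall>ds. length ds = 2 --> (\<forall>P\<in>Kc \<inter> \<Omega>. \<forall>Q\<in>Kc \<inter> \<Omega>. \<bar>pd ds phi P - pd ds phi Q\<bar> <= C * dist P Q powr alpha)"
  proof (intro exI[of _ "sum Cf F"] allI impI ballI)
   fix ds :: "bool list" and P Q assume ds: "length ds = 2" and PQ: "P \<in> Kc \<inter> \<Omega>" "Q \<in> Kc \<inter> \<Omega>"
   have "Cf ds <= sum Cf F" using F Cf ds by (intro member_le_sum) (auto simp: F_def)
   then have "Cf ds * dist P Q powr alpha <= sum Cf F * dist P Q powr alpha" by (rule mult_right_mono) simp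
   moreover have "norm (pd ds phi P - pd ds phi Q) <= Cf ds * dist P Q powr alpha" using Cf[OF ds] PQ by blast
   ultimately show "\<bar>pd ds phi P - pd ds phi Q\<bar> <= sum Cf F * dist P Q powr alpha" by simp
  qed
 qed
qed

lemma solves: "solves_P eps lam mu u v phi"
 unfolding solves_P_def
proof (intro conjI ballI)
 show "v x < u x" if "x \<in> {-1..1}" for x 
 proof -
  have "\<bar>x\<bar> <= 1" using that by auto
  from uv_gap[OF this] show ?thesis by simp
 qed
 show "eps\<^sup>2 * pd [True, True] phi P + pd [False, False] phi P = 0" if "P \<in> \<Omega>" for P
  unfolding pd_phi(1)[OF that] using eps by (simp add: dirn_def power2_eq_square)
 show "phi P = (snd P - v (fst P)) / (u (fst P) - v (fst P))" if "P \<in> frontier \<Omega>" for P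
  using that open_Omega by (auto simp: frontier_def interior_open phi_def)
 fix x :: real assume x: "x \<in> {-1<..<1}"
 then have x': "\<bar>x\<bar> < 1" "x \<in> {-1..1}" by auto
 show "D2 u x = lam * ((eps * bpdir True \<Omega> phi (x, u x))\<^sup>2 + (bpdir False \<Omega> phi (x, u x))\<^sup>2)"
  unfolding top_gradient[OF x'(1), symmetric] using u_regularity(2)[of 0] x' by simp
 show "D2 v x = - mu * ((eps * bpdir True \<Omega> phi (x, v x))\<^sup>2 + (bpdir False \<Omega> phi (x, v x))\<^sup>2)"
  unfolding minus_mult_left[symmetric] bottom_gradient[OF x'(1), symmetric] using v_regularity(2)[of 0] x' by simp
next
 have "- 1 / eps = - (1 / eps)" by simp
 then show "u (- 1) = 0" "u 1 = 0" "v (- 1) = - 1" "v 1 = - 1"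
  using U_L bot.U_L U_even[of "1/eps"] bot.U_even[of "1/eps"] by (simp_all add: u_def v_def)
qed

lemma phi_even: "phi (- x, z) = phi (x, z)"
proof -
 have e: "emb eps (- x, z) = - cnj (emb eps (x, z))" by (simp add: complex_eq_iff)
 have uv: "u (- x) = u x" "v (- x) = v x" using U_even[of "x / eps"] bot.U_even[of "x / eps"] by (auto simp: u_def v_def)
 have "(- x, z) \<in> \<Omega> \<longleftrightarrow> (x, z) \<in> \<Omega>" by (auto simp: Omega_def uv)
 then show ?thesis using Re_h_even[of "emb eps (x, z)"] by (auto simp: phi_def e uv Omega_iff)
qed

lemma convexity: "convex_on {-1..1} u" "convex_on {-1..1} (\<lambda>x. - v x)"
proof -
 have d: "((\<lambda>x. x / eps) has_real_derivative 1 / eps) (at x)" for x using eps by (auto intro!: derivative_eq_intros)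
 show "convex_on {-1..1} u"
 proof (rule convex_on_realI[where f' = "\<lambda>x. p (x / eps) / eps"])
  show "(u has_real_derivative p (x / eps) / eps) (at x)" for x using DERIV_chain2[OF U_deriv d] unfolding u_eq by simp
  show "p (x / eps) / eps <= p (y / eps) / eps" if "x <= y" for x y by (intro divide_right_mono p_mono) (use that eps in auto)
 qed simp
 show "convex_on {-1..1} (\<lambda>x. - v x)"
 proof (rule convex_on_realI[where f' = "\<lambda>x. q (x / eps) / eps"])
  show "((\<lambda>x. - v x) has_real_derivative q (x / eps) / eps) (at x)" for x
   using DERIV_add[OF DERIV_chain2[OF bot.U_deriv d] DERIV_const[of 1]] unfolding v_eq by simp
  show "q (x / eps) / eps <= q (y / eps) / eps" if "x <= y" for x y by (intro divide_right_mono bot.p_mono) (use that eps in auto)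
 qed simp
qed

lemma norm_bounds: "W2inf_norm u <= 3" "W2inf_norm v <= 3"
proof -
 have ne: "{-1<..<1::real} \<noteq> {}" by auto
 have b: "\<bar>u x\<bar> <= 1" "\<bar>D1 u x\<bar> <= r0" "\<bar>D2 u x\<bar> <= r0" "\<bar>v x\<bar> <= 1" "\<bar>D1 v x\<bar> <= r0" "\<bar>D2 v x\<bar> <= r0" if "x \<in> {-1<..<1}" for x
 proof -
  have x: "x \<in> {-1..1}" "\<bar>x\<bar> <= 1" using that by auto
  show "\<bar>u x\<bar> <= 1" "\<bar>D1 u x\<bar> <= r0" "\<bar>D2 u x\<bar> <= r0" "\<bar>v x\<bar> <= 1" "\<bar>D1 v x\<bar> <= r0" "\<bar>D2 v x\<bar> <= r0"
   using profile_bounds[OF x(2)] r0 u_regularity(1,4)[of 0 x] v_regularity(1,4)[of 0 x] x(1) by auto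
 qed
 have "(SUP x\<in>{-1<..<1}. \<bar>u x\<bar>) <= 1" "(SUP x\<in>{-1<..<1}. \<bar>D1 u x\<bar>) <= r0" "(SUP x\<in>{-1<..<1}. \<bar>D2 u x\<bar>) <= r0"
  "(SUP x\<in>{-1<..<1}. \<bar>v x\<bar>) <= 1" "(SUP x\<in>{-1<..<1}. \<bar>D1 v x\<bar>) <= r0" "(SUP x\<in>{-1<..<1}. \<bar>D2 v x\<bar>) <= r0"
  by (rule cSUP_least[OF ne], rule b, assumption)+
 then show "W2inf_norm u <= 3" "W2inf_norm v <= 3" unfolding W2inf_norm_def using r0 by linarith+
qed

end

theorem theorem1:
  fixes r0 :: real
  assumes "0 < r0" and "r0 < 2/3"
  shows "\<exists>a0 > 0. \<exists>\<kappa>0. 0 < \<kappa>0 \<and> \<kappa>0 < 1/3 \<and>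
    (\<forall>\<epsilon> \<alpha> lam mu. 0 < \<epsilon> \<longrightarrow> \<epsilon> < 1 \<longrightarrow> 0 \<le> \<alpha> \<longrightarrow> \<alpha> < 1 \<longrightarrow>
       0 < lam \<longrightarrow> lam \<le> a0 \<longrightarrow> 0 < mu \<longrightarrow> mu \<le> a0 \<longrightarrow>
       (\<exists>u v \<phi>.
          solves_P \<epsilon> lam mu u v \<phi>
        \<and> C2alpha_I \<alpha> u \<and> C2alpha_I \<alpha> v
        \<and> W22 (Omega u v) \<phi>
        \<and> continuous_on (closure (Omega u v)) \<phi>
        \<and> C2alpha_upto \<alpha> (Omega u v) (Omega u v \<union> Gamma u \<union> Gamma v) \<phi>
        \<and> (\<forall>x\<in>{-1..1}. u (-x) = u x \<and> v (-x) = v x)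
        \<and> (\<forall>x z. (x, z) \<in> closure (Omega u v) \<longrightarrow> \<phi> (-x, z) = \<phi> (x, z))
        \<and> convex_on {-1..1} u \<and> convex_on {-1..1} (\<lambda>x. - v x)
        \<and> (\<forall>x\<in>{-1..1}. \<bar>D2 u x\<bar> \<le> r0 \<and> \<bar>D2 v x\<bar> \<le> r0)
        \<and> (\<forall>x\<in>{-1..1}. 0 \<ge> u x \<and> u x \<ge> -1/3 + \<kappa>0 \<and> -1/3 - 2*\<kappa>0 \<ge> v x \<and> v x \<ge> -1)
        \<and> W2inf_norm u \<le> 3 \<and> W2inf_norm v \<le> 3))"
proof (rule exI[of _ "r0 / 270"], rule conjI[rotated], rule exI[of _ "1/3 - r0 / 2"], intro conjI allI impI)
 \<comment> \<open>With kappa0 = 1/3 - r0 / 2 the required bounds read u >= - r0 / 2 and v <= -1 +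
   r0, and the profiles even satisfy v <= -1 + r0 / 2.\<close>
 show "0 < r0 / 270" "0 < 1/3 - r0 / 2" "1/3 - r0 / 2 < 1/3" using assms by auto
 fix eps alpha lam mu :: real
 assume eps: "0 < eps" "eps < 1" and alpha: "0 <= alpha" "alpha < 1" and lm: "0 < lam" "lam <= r0 / 270" "0 < mu" "mu <= r0 / 270"
 have L: "1 <= 1/eps" and K: "0 < eps\<^sup>2 * r0" and KL: "eps\<^sup>2 * r0 * (1/eps)\<^sup>2 <= 2/3" and c: "0 <= eps\<^sup>2 * lam" "0 <= eps\<^sup>2 * mu"
  using eps assms lm by (auto simp: power_divide)
 obtain U p W q h where sol: "potential (1/eps) (eps\<^sup>2 * r0) U p W q h"
  "\<And>X. \<bar>X\<bar> <= 1/eps ==> (p has_real_derivative min (eps\<^sup>2 * r0) (eps\<^sup>2 * lam * (cmod (top_trace (1/eps) U W (deriv h) \<bar>X\<bar>))\<^sup>2)) (at X within {-(1/eps)..1/eps})"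
  "\<And>X. \<bar>X\<bar> <= 1/eps ==> (q has_real_derivative min (eps\<^sup>2 * r0) (eps\<^sup>2 * mu * (cmod (top_trace (1/eps) W U (deriv (swp h)) \<bar>X\<bar>))\<^sup>2)) (at X within {-(1/eps)..1/eps})"
  by (rule coupled_solution[OF L K KL c]) blast
 interpret solution eps r0 U p W q h lam mu
  by (intro solution.intro solution_axioms.intro) (use sol eps assms lm in auto)
 show "\<exists>u v phi.
     solves_P eps lam mu u v phi
    & C2alpha_I alpha u & C2alpha_I alpha v
    & W22 (Omega u v) phi
    & continuous_on (closure (Omega u v)) phi
    & C2alpha_upto alpha (Omega u v) (Omega u v \<union> Gamma u \<union> Gamma v) phi
    & (\<forall>x\<in>{-1..1}. u (-x) = u x & v (-x) = v x)
    & (\<forall>x z. (x, z) \<in> closure (Omega u v) --> phi (-x, z) = phi (x, z))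
    & convex_on {-1..1} u & convex_on {-1..1} (\<lambda>x. - v x)
    & (\<forall>x\<in>{-1..1}. \<bar>D2 u x\<bar> <= r0 & \<bar>D2 v x\<bar> <= r0)
    & (\<forall>x\<in>{-1..1}. 0 >= u x & u x >= -1/3 + (1/3 - r0 / 2) & -1/3 - 2*(1/3 - r0 / 2) >= v x & v x >= -1)
    & W2inf_norm u <= 3 & W2inf_norm v <= 3"
 proof (rule exI[of _ u], rule exI[of _ v], rule exI[of _ phi], intro conjI ballI allI impI)
  fix x :: real assume x: "x \<in> {-1..1}"
  then have x': "\<bar>x\<bar> <= 1" by auto
  show "u (- x) = u x" "v (- x) = v x" using U_even[of "x / eps"] bot.U_even[of "x / eps"] by (auto simp: u_def v_def)
  show "\<bar>D2 u x\<bar> <= r0" "\<bar>D2 v x\<bar> <= r0" using u_regularity(4)[OF alpha x] v_regularity(4)[OF alpha x] by auto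
  show "u x <= 0" "u x >= -1/3 + (1/3 - r0 / 2)" "-1/3 - 2*(1/3 - r0 / 2) >= v x" "v x >= -1"
   using profile_bounds[OF x'] assms by auto
 qed (use solves u_regularity(3)[OF alpha] v_regularity(3)[OF alpha] phi_W22 phi_continuous phi_C2alpha[OF alpha] phi_even convexity norm_bounds in auto)
qed

end
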